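(* Let $T\in\mathcal{BC}(X)$ be such that $T=T_0+T_1e_1+T_2e_2$, and assume that the operators $T_\ell$, $\ell=0,1,2$, have real spectrum. (i) If $\breve f^\circ=\overline{\mathcal D}f$ and $\breve g^\circ=\overline{\mathcal D}g$ with $f,g\in SH_L(\sigma_S(T))$ and $a\in\mathbb H$, then $(\breve f^\circ a+\breve g^\circ)(T)=\breve f^\circ(T)a+\breve g^\circ(T)$. (ii) If $\breve f^\circ=f\overline{\mathcal D}$ and $\breve g^\circ=g\overline{\mathcal D}$ with $f,g\in SH_R(\sigma_S(T))$ and $a\in\mathbb H$, then $(a\breve f^\circ+\breve g^\circ)(T)=a\breve f^\circ(T)+\breve g^\circ(T)$.
   Context: $\mathbb H$: quaternions with units $e_1,e_2,e_3$. $\mathbb S$: imaginary units ($J^2=-1$). $\mathbb C_J=\mathbb R+J\mathbb R$. $\overline{\mathcal D}=\partial_{q_0}-\sum_{i=1}^3e_i\partial_{q_i}$ (acting from the left as $\overline{\mathcal D}f$, from the right as $f\overline{\mathcal D}$). A set $U\subseteq\mathbb H$ is axially symmetric if $u+Iv\in U$ implies $u+Jv\in U$ for all $J\in\mathbb S$. A slice Cauchy domain is an axially symmetric open $U$ such that for every $J\in\mathbb S$ the boundary of $U\cap\mathbb C_J$ is a finite union of nonintersecting piecewise $C^1$ Jordan curves. On an axially symmetric open $U$, $f$ is left (right) slice hyperholomorphic if $f(u+Jv)=\alpha(u,v)+J\beta(u,v)$ (resp. $\alpha(u,v)+\beta(u,v)J$) with $\mathbb H$-valued differentiable $\alpha$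 even in $v$, $\beta$ odd in $v$, and $\partial_u\alpha=\partial_v\beta$, $\partial_v\alpha=-\partial_u\beta$. $X=X_{\mathbb R}\otimes\mathbb H$ is a two-sided quaternionic Banach module, $X_{\mathbb R}$ a real Banach space; $\mathcal B(X)$ is the space of bounded right linear operators; $(aT)(x)=aT(x)$, $(Ta)(x)=T(ax)$ for $a\in\mathbb H$. $\mathcal{BC}(X)$: operators $T=T_0+T_1e_1+T_2e_2+T_3e_3$ with pairwise commuting $T_i\in\mathcal B(X_{\mathbb R})$; $\overline T=T_0-T_1e_1-T_2e_2-T_3e_3$. $\rho_S(T)=\{s\in\mathbb H:(T^2-2\mathrm{Re}(s)T+|s|^2\mathcal I)^{-1}\in\mathcal B(X)\}$, $\sigma_S(T)=\mathbb H\setminus\rho_S(T)$; for $T\in\mathcal{BC}(X)$, $\rho_S(T)$ is also the set of $s$ with $\mathcal Q_{c,s}(T):=s^2-s(T+\overline T)+T\overline T$ invertible in $\mathcal B(X)$. $SH_L(\sigma_S(T))$, $SH_R(\sigma_S(T))$: left, right slice hyperholomorphic functions whose (axially symmetric open) domain contains $\sigma_S(T)$. For $s\in\rho_S(T)$: $F_L(s,T)=-4(s\mathcal I-\overline T)\mathcal Q_{c,s}(T)^{-2}$, $F_R(s,T)=-4\mathcal Q_{c,s}(T)^{-2}(s\mathcal I-\overline T)$, $\mathcal P^L_2(s,T)=-F_L(s,T)s+T_0F_L(s,T)$, $\mathcal P^R_2(s,T)=-sF_R(s,T)+T_0F_R(s,T)$. $P_2$-functional calculus: for $J\in\mathbb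 S$, $ds_J=ds(-J)$ and $U$ a bounded slice Cauchy domain with $\sigma_S(T)\subset U$, $\overline U\subset\mathrm{dom}(f)$ (no dependence on $U,J$): if $\breve f^\circ=\overline{\mathcal D}f$, $f\in SH_L(\sigma_S(T))$, then $\breve f^\circ(T):=\frac1{2\pi}\int_{\partial(U\cap\mathbb C_J)}\mathcal P^L_2(s,T)ds_Jf(s)$; if $\breve f^\circ=f\overline{\mathcal D}$, $f\in SH_R(\sigma_S(T))$, then $\breve f^\circ(T):=\frac1{2\pi}\int_{\partial(U\cap\mathbb C_J)}f(s)ds_J\mathcal P^R_2(s,T)$. *)

theory Defs
  imports "HOL-Complex_Analysis.Complex_Analysis"
begin

section \<open>Quaternions\<close>

datatype quat = Quat (qRe: real) (qIm1: real) (qIm2: real) (qIm3: real)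

lemma quat_eq_iff:
  "x = y \<longleftrightarrow> qRe x = qRe y \<and> qIm1 x = qIm1 y \<and> qIm2 x = qIm2 y \<and> qIm3 x = qIm3 y"
  by (cases x; cases y) simp

instantiation quat :: real_vector
begin

definition "0 = Quat 0 0 0 0"
definition "x + y = Quat (qRe x + qRe y) (qIm1 x + qIm1 y) (qIm2 x + qIm2 y) (qIm3 x + qIm3 y)"
definition "- x = Quat (- qRe x) (- qIm1 x) (- qIm2 x) (- qIm3 x)"
definition "(x :: quat) - y = x + - y"
definition "scaleR r x = Quat (r * qRe x) (r * qIm1 x) (r * qIm2 x) (r * qIm3 x)"

instance
  by standard (simp_all add: quat_eq_iff zero_quat_def plus_quat_def uminus_quat_def
    minus_quat_def scaleR_quat_def algebra_simps)

end

instantiation quat :: real_inner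
begin

definition "inner x y = qRe x * qRe y + qIm1 x * qIm1 y + qIm2 x * qIm2 y + qIm3 x * qIm3 y"
definition norm_quat_def: "norm (x :: quat) = sqrt (inner x x)"
definition sgn_quat_def: "sgn (x :: quat) = x /\<^sub>R norm x"
definition dist_quat_def: "dist (x :: quat) y = norm (x - y)"
definition uniformity_quat_def:
  "(uniformity :: (quat \<times> quat) filter) = (INF e\<in>{0 <..}. principal {(x, y). dist x y < e})"
definition open_quat_def:
  "open (U :: quat set) \<longleftrightarrow> (\<forall>x\<in>U. eventually (\<lambda>(x', y). x' = x \<longrightarrow> y \<in> U) uniformity)"

instance
proof
  fix x :: quat
  show "(inner x x = 0) = (x = 0)"
  proof
    assume "inner x x = 0"
    then have "qRe x * qRe x + qIm1 x * qIm1 x + qIm2 x * qIm2 x + qIm3 x * qIm3 x = 0"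
      by (simp add: inner_quat_def)
    moreover have "qRe x * qRe x \<ge> 0" "qIm1 x * qIm1 x \<ge> 0" "qIm2 x * qIm2 x \<ge> 0"
      "qIm3 x * qIm3 x \<ge> 0" by simp_all
    ultimately have "qRe x * qRe x = 0" "qIm1 x * qIm1 x = 0" "qIm2 x * qIm2 x = 0"
      "qIm3 x * qIm3 x = 0" by linarith+
    then show "x = 0" by (simp add: quat_eq_iff zero_quat_def)
  qed (simp add: inner_quat_def zero_quat_def)
qed (auto simp: quat_eq_iff zero_quat_def plus_quat_def uminus_quat_def minus_quat_def
    scaleR_quat_def inner_quat_def norm_quat_def sgn_quat_def dist_quat_def
    uniformity_quat_def open_quat_def algebra_simps)

end

instantiation quat :: real_normed_algebra_1
begin

definition "1 = Quat 1 0 0 0"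
definition "x * y = Quat
  (qRe x * qRe y - qIm1 x * qIm1 y - qIm2 x * qIm2 y - qIm3 x * qIm3 y)
  (qRe x * qIm1 y + qIm1 x * qRe y + qIm2 x * qIm3 y - qIm3 x * qIm2 y)
  (qRe x * qIm2 y - qIm1 x * qIm3 y + qIm2 x * qRe y + qIm3 x * qIm1 y)
  (qRe x * qIm3 y + qIm1 x * qIm2 y - qIm2 x * qIm1 y + qIm3 x * qRe y)"

instance
proof
  fix x y :: quat
  have "inner (x * y) (x * y) = inner x x * inner y y"
    by (simp add: inner_quat_def times_quat_def algebra_simps)
  then show "norm (x * y) \<le> norm x * norm y"
    by (simp add: norm_quat_def real_sqrt_mult)
  show "norm (1 :: quat) = 1"
    by (simp add: norm_quat_def inner_quat_def one_quat_def)
qed (simp_all add: quat_eq_iff zero_quat_def plus_quat_def scaleR_quat_def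
    one_quat_def times_quat_def algebra_simps)

end

definition e1 :: quat where "e1 = Quat 0 1 0 0"
definition e2 :: quat where "e2 = Quat 0 0 1 0"
definition e3 :: quat where "e3 = Quat 0 0 0 1"

lemma quat_units:
  "e1 * e1 = -1" "e2 * e2 = -1" "e3 * e3 = -1"
  "e1 * e2 = e3" "e2 * e3 = e1" "e3 * e1 = e2"
  "e2 * e1 = - e3" "e3 * e2 = - e1" "e1 * e3 = - e2"
  by (simp_all add: e1_def e2_def e3_def times_quat_def one_quat_def uminus_quat_def)

definition imag_units :: "quat set" where
  "imag_units = {J. J * J = -1}"

text \<open>The point \<open>u + J v\<close> of the slice \<open>\<complex>\<^sub>J\<close>, with \<open>(u, v)\<close> encoded as the
  complex number \<open>z = u + \<i> v\<close>. For a fixed unit \<open>J\<close> this identifies \<open>\<complex>\<close> with \<open>\<complex>\<^sub>J\<close>.\<close>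

definition slice_pt :: "quat \<Rightarrow> complex \<Rightarrow> quat" where
  "slice_pt J z = of_real (Re z) + Im z *\<^sub>R J"

definition slice :: "quat \<Rightarrow> quat set \<Rightarrow> complex set" where
  "slice J U = {z. slice_pt J z \<in> U}"

definition axially_symmetric :: "quat set \<Rightarrow> bool" where
  "axially_symmetric U \<longleftrightarrow>
     (\<forall>z. \<forall>I\<in>imag_units. slice_pt I z \<in> U \<longrightarrow> (\<forall>J\<in>imag_units. slice_pt J z \<in> U))"


section \<open>Slice hyperholomorphic functions and the conjugate Cauchy-Fueter operator\<close>

text \<open>The stem functions \<open>\<alpha>(u,v)\<close>, \<open>\<beta>(u,v)\<close> are functions of \<open>z = u + \<i> v\<close>;
  thus \<open>\<partial>\<^sub>u\<close> and \<open>\<partial>\<^sub>v\<close> are the real directional derivatives along \<open>1\<close> and \<open>\<i>\<close>.\<close>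

definition stem_pair :: "complex set \<Rightarrow> (complex \<Rightarrow> quat) \<Rightarrow> (complex \<Rightarrow> quat) \<Rightarrow> bool" where
  "stem_pair A \<alpha> \<beta> \<longleftrightarrow> (\<forall>z\<in>A.
     \<alpha> (cnj z) = \<alpha> z \<and> \<beta> (cnj z) = - \<beta> z \<and>
     \<alpha> differentiable (at z) \<and> \<beta> differentiable (at z) \<and>
     frechet_derivative \<alpha> (at z) 1 = frechet_derivative \<beta> (at z) \<i> \<and>
     frechet_derivative \<alpha> (at z) \<i> = - frechet_derivative \<beta> (at z) 1)"

definition left_slice_hyperholomorphic :: "(quat \<Rightarrow> quat) \<Rightarrow> quat set \<Rightarrow> bool" where
  "left_slice_hyperholomorphic f W \<longleftrightarrow> (\<exists>\<alpha> \<beta>. \<forall>J\<in>imag_units. stem_pair (slice J W) \<alpha> \<beta> \<and>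
     (\<forall>z\<in>slice J W. f (slice_pt J z) = \<alpha> z + J * \<beta> z))"

definition right_slice_hyperholomorphic :: "(quat \<Rightarrow> quat) \<Rightarrow> quat set \<Rightarrow> bool" where
  "right_slice_hyperholomorphic f W \<longleftrightarrow> (\<exists>\<alpha> \<beta>. \<forall>J\<in>imag_units. stem_pair (slice J W) \<alpha> \<beta> \<and>
     (\<forall>z\<in>slice J W. f (slice_pt J z) = \<alpha> z + \<beta> z * J))"

text \<open>Functions are total in HOL, so a partially defined function is a pair \<open>(f, W)\<close> with \<open>W\<close> its
  domain: \<open>(f, W) \<in> SH_L S\<close> means that \<open>f\<close> is left slice hyperholomorphic on the axially
  symmetric open set \<open>W\<close> and \<open>S \<subseteq> W\<close>.\<close>

definition SH_L :: "quat set \<Rightarrow> ((quat \<Rightarrow> quat) \<times> quat set) set" where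
  "SH_L S = {(f, W). open W \<and> axially_symmetric W \<and> S \<subseteq> W \<and> left_slice_hyperholomorphic f W}"

definition SH_R :: "quat set \<Rightarrow> ((quat \<Rightarrow> quat) \<times> quat set) set" where
  "SH_R S = {(f, W). open W \<and> axially_symmetric W \<and> S \<subseteq> W \<and> right_slice_hyperholomorphic f W}"

definition partial_deriv :: "quat \<Rightarrow> (quat \<Rightarrow> quat) \<Rightarrow> quat \<Rightarrow> quat" where
  "partial_deriv e f q = vector_derivative (\<lambda>t. f (q + t *\<^sub>R e)) (at 0)"

definition Dbar_left :: "(quat \<Rightarrow> quat) \<Rightarrow> quat \<Rightarrow> quat" where
  "Dbar_left f q = partial_deriv 1 f q
     - (e1 * partial_deriv e1 f q + e2 * partial_deriv e2 f q + e3 * partial_deriv e3 f q)"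

definition Dbar_right :: "(quat \<Rightarrow> quat) \<Rightarrow> quat \<Rightarrow> quat" where
  "Dbar_right f q = partial_deriv 1 f q
     - (partial_deriv e1 f q * e1 + partial_deriv e2 f q * e2 + partial_deriv e3 f q * e3)"


section \<open>The two-sided module \<open>X = X\<^sub>\<real> \<otimes> \<H>\<close> and its operators\<close>

text \<open>\<open>(x0, x1, x2, x3)\<close> stands for \<open>x0 + x1 e1 + x2 e2 + x3 e3\<close>. The product norm
  makes this space complete; only the equivalence class of the norm matters below.
  A bounded real linear operator on \<open>X\<close> has type \<open>'a qmod \<Rightarrow>\<^sub>L 'a qmod\<close>.\<close>

type_synonym 'a qmod = "'a \<times> 'a \<times> 'a \<times> 'a"

fun lmul :: "quat \<Rightarrow> 'a::real_vector qmod \<Rightarrow> 'a qmod" where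
  "lmul (Quat a b c d) (x0, x1, x2, x3) =
    (a *\<^sub>R x0 - b *\<^sub>R x1 - c *\<^sub>R x2 - d *\<^sub>R x3,
     a *\<^sub>R x1 + b *\<^sub>R x0 + c *\<^sub>R x3 - d *\<^sub>R x2,
     a *\<^sub>R x2 - b *\<^sub>R x3 + c *\<^sub>R x0 + d *\<^sub>R x1,
     a *\<^sub>R x3 + b *\<^sub>R x2 - c *\<^sub>R x1 + d *\<^sub>R x0)"

fun rmul :: "'a::real_vector qmod \<Rightarrow> quat \<Rightarrow> 'a qmod" where
  "rmul (x0, x1, x2, x3) (Quat a b c d) =
    (a *\<^sub>R x0 - b *\<^sub>R x1 - c *\<^sub>R x2 - d *\<^sub>R x3,
     b *\<^sub>R x0 + a *\<^sub>R x1 + d *\<^sub>R x2 - c *\<^sub>R x3,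
     c *\<^sub>R x0 - d *\<^sub>R x1 + a *\<^sub>R x2 + b *\<^sub>R x3,
     d *\<^sub>R x0 + c *\<^sub>R x1 - b *\<^sub>R x2 + a *\<^sub>R x3)"

lemma lmul_mult: "lmul (p * q) x = lmul p (lmul q x)"
  by (cases p; cases q; cases x) (simp add: times_quat_def algebra_simps)

lemma rmul_mult: "rmul x (p * q) = rmul (rmul x p) q"
  by (cases p; cases q; cases x) (simp add: times_quat_def algebra_simps)

lemma lmul_rmul: "lmul p (rmul x q) = rmul (lmul p x) q"
  by (cases p; cases q; cases x) (simp add: algebra_simps)

lemma lmul_rmul_one: "lmul 1 x = x" "rmul x 1 = x"
  by (cases x; simp add: one_quat_def)+

text \<open>Left multiplication by \<open>a\<close> as an operator. It is also \<open>a \<I>\<close>, and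
  \<open>a T = Lm a o\<^sub>L T\<close>, \<open>T a = T o\<^sub>L Lm a\<close>.\<close>

definition Lm :: "quat \<Rightarrow> 'a::real_normed_vector qmod \<Rightarrow>\<^sub>L 'a qmod" where
  "Lm a = Blinfun (lmul a)"

lemma bounded_linear_lmul: "bounded_linear (lmul a :: 'a::real_normed_vector qmod \<Rightarrow> 'a qmod)"
proof -
  obtain r b c d where a: "a = Quat r b c d" by (cases a)
  have eq: "lmul a = (\<lambda>x :: 'a qmod.
    (r *\<^sub>R fst x - b *\<^sub>R fst (snd x) - c *\<^sub>R fst (snd (snd x)) - d *\<^sub>R snd (snd (snd x)),
     r *\<^sub>R fst (snd x) + b *\<^sub>R fst x + c *\<^sub>R snd (snd (snd x)) - d *\<^sub>R fst (snd (snd x)),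
     r *\<^sub>R fst (snd (snd x)) - b *\<^sub>R snd (snd (snd x)) + c *\<^sub>R fst x + d *\<^sub>R fst (snd x),
     r *\<^sub>R snd (snd (snd x)) + b *\<^sub>R fst (snd (snd x)) - c *\<^sub>R fst (snd x) + d *\<^sub>R fst x))"
    by (rule ext) (auto simp: a)
  show ?thesis
    unfolding eq by (intro bounded_linear_intros)
qed

lemma Lm_apply: "blinfun_apply (Lm a) = lmul a"
  by (simp add: Lm_def bounded_linear_Blinfun_apply bounded_linear_lmul)

text \<open>The componentwise action of an operator on \<open>X\<^sub>\<real>\<close>.\<close>

definition lift_op :: "('a::real_normed_vector \<Rightarrow>\<^sub>L 'a) \<Rightarrow> 'a qmod \<Rightarrow>\<^sub>L 'a qmod" where
  "lift_op A = Blinfun (\<lambda>(x0, x1, x2, x3). (A x0, A x1, A x2, A x3))"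

lemma lift_op_apply: "lift_op A (x0, x1, x2, x3) = (A x0, A x1, A x2, A x3)"
proof -
  have eq: "(\<lambda>(x0, x1, x2, x3). (A x0, A x1, A x2, A x3)) =
    (\<lambda>x. (A (fst x), A (fst (snd x)), A (fst (snd (snd x))), A (snd (snd (snd x)))))"
    by auto
  have "bounded_linear (\<lambda>(x0, x1, x2, x3). (A x0, A x1, A x2, A x3))"
    unfolding eq by (intro bounded_linear_intros)
  then show ?thesis
    by (simp add: lift_op_def bounded_linear_Blinfun_apply)
qed

definition right_linear_ops :: "('a::real_normed_vector qmod \<Rightarrow>\<^sub>L 'a qmod) set" where
  "right_linear_ops = {A. \<forall>x a. blinfun_apply A (rmul x a) = rmul (blinfun_apply A x) a}"

definition quat_op :: "('a::real_normed_vector \<Rightarrow>\<^sub>L 'a) \<Rightarrow> ('a \<Rightarrow>\<^sub>L 'a) \<Rightarrow> ('a \<Rightarrow>\<^sub>L 'a) \<Rightarrow> ('a \<Rightarrow>\<^sub>L 'a)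
    \<Rightarrow> 'a qmod \<Rightarrow>\<^sub>L 'a qmod" where
  "quat_op T0 T1 T2 T3 = lift_op T0 + (lift_op T1 o\<^sub>L Lm e1) + (lift_op T2 o\<^sub>L Lm e2)
     + (lift_op T3 o\<^sub>L Lm e3)"

definition commute_op :: "('a::real_normed_vector \<Rightarrow>\<^sub>L 'a) \<Rightarrow> ('a \<Rightarrow>\<^sub>L 'a) \<Rightarrow> bool" where
  "commute_op A B \<longleftrightarrow> A o\<^sub>L B = B o\<^sub>L A"

definition BC :: "('a::real_normed_vector qmod \<Rightarrow>\<^sub>L 'a qmod) set" where
  "BC = {quat_op T0 T1 T2 T3 | T0 T1 T2 T3.
     commute_op T0 T1 \<and> commute_op T0 T2 \<and> commute_op T0 T3 \<and>
     commute_op T1 T2 \<and> commute_op T1 T3 \<and> commute_op T2 T3}"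

text \<open>The components of \<open>T\<close> are read off from
  \<open>T (x \<otimes> 1) = T\<^sub>0 x + T\<^sub>1 x e1 + T\<^sub>2 x e2 + T\<^sub>3 x e3\<close>.\<close>

definition comp0 :: "('a::real_normed_vector qmod \<Rightarrow>\<^sub>L 'a qmod) \<Rightarrow> 'a \<Rightarrow>\<^sub>L 'a" where
  "comp0 T = Blinfun (\<lambda>x. fst (T (x, 0, 0, 0)))"
definition comp1 :: "('a::real_normed_vector qmod \<Rightarrow>\<^sub>L 'a qmod) \<Rightarrow> 'a \<Rightarrow>\<^sub>L 'a" where
  "comp1 T = Blinfun (\<lambda>x. fst (snd (T (x, 0, 0, 0))))"
definition comp2 :: "('a::real_normed_vector qmod \<Rightarrow>\<^sub>L 'a qmod) \<Rightarrow> 'a \<Rightarrow>\<^sub>L 'a" where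
  "comp2 T = Blinfun (\<lambda>x. fst (snd (snd (T (x, 0, 0, 0)))))"
definition comp3 :: "('a::real_normed_vector qmod \<Rightarrow>\<^sub>L 'a qmod) \<Rightarrow> 'a \<Rightarrow>\<^sub>L 'a" where
  "comp3 T = Blinfun (\<lambda>x. snd (snd (snd (T (x, 0, 0, 0)))))"

lemma comp_quat_op:
  "comp0 (quat_op T0 T1 T2 T3) = T0" "comp1 (quat_op T0 T1 T2 T3) = T1"
  "comp2 (quat_op T0 T1 T2 T3) = T2" "comp3 (quat_op T0 T1 T2 T3) = T3"
proof -
  have "quat_op T0 T1 T2 T3 (x, 0, 0, 0) = (T0 x, T1 x, T2 x, T3 x)" for x
    by (simp add: quat_op_def blinfun.add_left Lm_apply lift_op_apply e1_def e2_def e3_def)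
  then show "comp0 (quat_op T0 T1 T2 T3) = T0" "comp1 (quat_op T0 T1 T2 T3) = T1"
    "comp2 (quat_op T0 T1 T2 T3) = T2" "comp3 (quat_op T0 T1 T2 T3) = T3"
    by (simp_all add: comp0_def comp1_def comp2_def comp3_def blinfun_apply_inverse)
qed

definition conj_op :: "('a::real_normed_vector qmod \<Rightarrow>\<^sub>L 'a qmod) \<Rightarrow> 'a qmod \<Rightarrow>\<^sub>L 'a qmod" where
  "conj_op T = quat_op (comp0 T) (- comp1 T) (- comp2 T) (- comp3 T)"

definition is_inverse_op ::
  "('a::real_normed_vector qmod \<Rightarrow>\<^sub>L 'a qmod) \<Rightarrow> ('a qmod \<Rightarrow>\<^sub>L 'a qmod) \<Rightarrow> bool" where
  "is_inverse_op A B \<longleftrightarrow>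
     B \<in> right_linear_ops \<and> A o\<^sub>L B = id_blinfun \<and> B o\<^sub>L A = id_blinfun"

definition inv_op :: "('a::real_normed_vector qmod \<Rightarrow>\<^sub>L 'a qmod) \<Rightarrow> 'a qmod \<Rightarrow>\<^sub>L 'a qmod" where
  "inv_op A = (THE B. is_inverse_op A B)"

definition S_resolvent_set :: "('a::real_normed_vector qmod \<Rightarrow>\<^sub>L 'a qmod) \<Rightarrow> quat set" where
  "S_resolvent_set T = {s. \<exists>B. is_inverse_op
     ((T o\<^sub>L T) - (2 * qRe s) *\<^sub>R T + (norm s)\<^sup>2 *\<^sub>R id_blinfun) B}"

definition S_spectrum :: "('a::real_normed_vector qmod \<Rightarrow>\<^sub>L 'a qmod) \<Rightarrow> quat set" where
  "S_spectrum T = - S_resolvent_set T"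

text \<open>The spectrum of an operator on the real Banach space \<open>X\<^sub>\<real>\<close> is that of its complexification:
  \<open>complex_shift A \<mu>\<close> is \<open>\<mu> - A\<close> acting on \<open>x + \<i> y\<close>, written as the pair \<open>(x, y)\<close>.\<close>

definition complex_shift :: "('a::real_normed_vector \<Rightarrow>\<^sub>L 'a) \<Rightarrow> complex \<Rightarrow> ('a \<times> 'a) \<Rightarrow>\<^sub>L ('a \<times> 'a)" where
  "complex_shift A \<mu> = Blinfun (\<lambda>(x, y).
     (Re \<mu> *\<^sub>R x - Im \<mu> *\<^sub>R y - A x, Re \<mu> *\<^sub>R y + Im \<mu> *\<^sub>R x - A y))"

lemma complex_shift_apply: "complex_shift A \<mu> (x, y) =
  (Re \<mu> *\<^sub>R x - Im \<mu> *\<^sub>R y - A x, Re \<mu> *\<^sub>R y + Im \<mu> *\<^sub>R x - A y)"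
proof -
  have eq: "(\<lambda>(x, y). (Re \<mu> *\<^sub>R x - Im \<mu> *\<^sub>R y - A x, Re \<mu> *\<^sub>R y + Im \<mu> *\<^sub>R x - A y)) =
    (\<lambda>x. (Re \<mu> *\<^sub>R fst x - Im \<mu> *\<^sub>R snd x - A (fst x), Re \<mu> *\<^sub>R snd x + Im \<mu> *\<^sub>R fst x - A (snd x)))"
    by auto
  have "bounded_linear
    (\<lambda>(x, y). (Re \<mu> *\<^sub>R x - Im \<mu> *\<^sub>R y - A x, Re \<mu> *\<^sub>R y + Im \<mu> *\<^sub>R x - A y))"
    unfolding eq by (intro bounded_linear_intros)
  then show ?thesis
    by (simp add: complex_shift_def bounded_linear_Blinfun_apply)
qed

definition complex_spectrum :: "('a::real_normed_vector \<Rightarrow>\<^sub>L 'a) \<Rightarrow> complex set" where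
  "complex_spectrum A = {\<mu>. \<not> (\<exists>B. complex_shift A \<mu> o\<^sub>L B = id_blinfun \<and>
     B o\<^sub>L complex_shift A \<mu> = id_blinfun)}"

definition real_spectrum :: "('a::real_normed_vector \<Rightarrow>\<^sub>L 'a) \<Rightarrow> bool" where
  "real_spectrum A \<longleftrightarrow> complex_spectrum A \<subseteq> \<real>"


section \<open>Kernels\<close>

definition Qc :: "quat \<Rightarrow> ('a::real_normed_vector qmod \<Rightarrow>\<^sub>L 'a qmod) \<Rightarrow> 'a qmod \<Rightarrow>\<^sub>L 'a qmod" where
  "Qc s T = Lm (s * s) - (Lm s o\<^sub>L (T + conj_op T)) + (T o\<^sub>L conj_op T)"

definition F_L :: "quat \<Rightarrow> ('a::real_normed_vector qmod \<Rightarrow>\<^sub>L 'a qmod) \<Rightarrow> 'a qmod \<Rightarrow>\<^sub>L 'a qmod" where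
  "F_L s T = (-4) *\<^sub>R ((Lm s - conj_op T) o\<^sub>L (inv_op (Qc s T) o\<^sub>L inv_op (Qc s T)))"

definition F_R :: "quat \<Rightarrow> ('a::real_normed_vector qmod \<Rightarrow>\<^sub>L 'a qmod) \<Rightarrow> 'a qmod \<Rightarrow>\<^sub>L 'a qmod" where
  "F_R s T = (-4) *\<^sub>R ((inv_op (Qc s T) o\<^sub>L inv_op (Qc s T)) o\<^sub>L (Lm s - conj_op T))"

definition P2_kernel_L ::
  "quat \<Rightarrow> ('a::real_normed_vector qmod \<Rightarrow>\<^sub>L 'a qmod) \<Rightarrow> 'a qmod \<Rightarrow>\<^sub>L 'a qmod" where
  "P2_kernel_L s T = - (F_L s T o\<^sub>L Lm s) + (lift_op (comp0 T) o\<^sub>L F_L s T)"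

definition P2_kernel_R ::
  "quat \<Rightarrow> ('a::real_normed_vector qmod \<Rightarrow>\<^sub>L 'a qmod) \<Rightarrow> 'a qmod \<Rightarrow>\<^sub>L 'a qmod" where
  "P2_kernel_R s T = - (Lm s o\<^sub>L F_R s T) + (lift_op (comp0 T) o\<^sub>L F_R s T)"


section \<open>Slice Cauchy domains and the functional calculus\<close>

definition jordan_boundary :: "complex set \<Rightarrow> (real \<Rightarrow> complex) set \<Rightarrow> bool" where
  "jordan_boundary A \<Gamma> \<longleftrightarrow> finite \<Gamma> \<and>
     (\<forall>\<gamma>\<in>\<Gamma>. valid_path \<gamma> \<and> simple_path \<gamma> \<and> pathfinish \<gamma> = pathstart \<gamma>) \<and>
     pairwise (\<lambda>\<gamma> \<delta>. path_image \<gamma> \<inter> path_image \<delta> = {}) \<Gamma> \<and>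
     (\<Union>\<gamma>\<in>\<Gamma>. path_image \<gamma>) = frontier A"

definition slice_cauchy_domain :: "quat set \<Rightarrow> bool" where
  "slice_cauchy_domain U \<longleftrightarrow> open U \<and> axially_symmetric U \<and>
     (\<forall>J\<in>imag_units. \<exists>\<Gamma>. jordan_boundary (slice J U) \<Gamma>)"

text \<open>The boundary curves are oriented so that \<open>A\<close> lies to their left; the winding numbers
  say this for outer and inner boundary components alike.\<close>

definition oriented_boundary :: "complex set \<Rightarrow> (real \<Rightarrow> complex) set \<Rightarrow> bool" where
  "oriented_boundary A \<Gamma> \<longleftrightarrow> jordan_boundary A \<Gamma> \<and>
     (\<forall>z\<in>A. (\<Sum>\<gamma>\<in>\<Gamma>. winding_number \<gamma> z) = 1) \<and>
     (\<forall>z. z \<notin> closure A \<longrightarrow> (\<Sum>\<gamma>\<in>\<Gamma>. winding_number \<gamma> z) = 0)"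

text \<open>\<open>ds\<^sub>J = ds (-J)\<close> along \<open>s = slice_pt J (\<gamma> t)\<close>; the derivative is taken within
  \<open>{0..1}\<close>, as for the library's contour integrals.\<close>

definition ds_J :: "quat \<Rightarrow> (real \<Rightarrow> complex) \<Rightarrow> real \<Rightarrow> quat" where
  "ds_J J \<gamma> t = slice_pt J (vector_derivative \<gamma> (at t within {0..1})) * (- J)"

definition P2_integral_L :: "('a::real_normed_vector qmod \<Rightarrow>\<^sub>L 'a qmod) \<Rightarrow> (quat \<Rightarrow> quat) \<Rightarrow> quat
    \<Rightarrow> (real \<Rightarrow> complex) set \<Rightarrow> 'a qmod \<Rightarrow>\<^sub>L 'a qmod" where
  "P2_integral_L T f J \<Gamma> = (1 / (2 * pi)) *\<^sub>R (\<Sum>\<gamma>\<in>\<Gamma>. integral {0..1} (\<lambda>t.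
     P2_kernel_L (slice_pt J (\<gamma> t)) T o\<^sub>L Lm (ds_J J \<gamma> t) o\<^sub>L Lm (f (slice_pt J (\<gamma> t)))))"

definition P2_integral_R :: "('a::real_normed_vector qmod \<Rightarrow>\<^sub>L 'a qmod) \<Rightarrow> (quat \<Rightarrow> quat) \<Rightarrow> quat
    \<Rightarrow> (real \<Rightarrow> complex) set \<Rightarrow> 'a qmod \<Rightarrow>\<^sub>L 'a qmod" where
  "P2_integral_R T f J \<Gamma> = (1 / (2 * pi)) *\<^sub>R (\<Sum>\<gamma>\<in>\<Gamma>. integral {0..1} (\<lambda>t.
     Lm (f (slice_pt J (\<gamma> t))) o\<^sub>L Lm (ds_J J \<gamma> t) o\<^sub>L P2_kernel_R (slice_pt J (\<gamma> t)) T))"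

definition admissible :: "('a::real_normed_vector qmod \<Rightarrow>\<^sub>L 'a qmod) \<Rightarrow> quat set \<Rightarrow> quat set \<Rightarrow> bool" where
  "admissible T W U \<longleftrightarrow>
     slice_cauchy_domain U \<and> bounded U \<and> S_spectrum T \<subseteq> U \<and> closure U \<subseteq> W"

text \<open>\<open>P2_calc_L T W h\<close> is \<open>h(T)\<close> for the function \<open>h\<close> with domain \<open>W\<close>. It depends on \<open>h\<close> only:
  the primitive \<open>f\<close> with \<open>h = Dbar_left f\<close>, the domain \<open>U\<close>, the unit \<open>J\<close> and the parametrisation
  of the boundary may be chosen freely, and the description operator expresses that the
  value does not depend on the choice.\<close>

definition P2_calc_L :: "('a::real_normed_vector qmod \<Rightarrow>\<^sub>L 'a qmod) \<Rightarrow> quat set \<Rightarrow> (quat \<Rightarrow> quat)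
    \<Rightarrow> 'a qmod \<Rightarrow>\<^sub>L 'a qmod" where
  "P2_calc_L T W h = (THE A. \<exists>f U J \<Gamma>. (f, W) \<in> SH_L (S_spectrum T) \<and> (\<forall>q\<in>W. h q = Dbar_left f q) \<and>
     admissible T W U \<and> J \<in> imag_units \<and> oriented_boundary (slice J U) \<Gamma> \<and>
     A = P2_integral_L T f J \<Gamma>)"

definition P2_calc_R :: "('a::real_normed_vector qmod \<Rightarrow>\<^sub>L 'a qmod) \<Rightarrow> quat set \<Rightarrow> (quat \<Rightarrow> quat)
    \<Rightarrow> 'a qmod \<Rightarrow>\<^sub>L 'a qmod" where
  "P2_calc_R T W h = (THE A. \<exists>f U J \<Gamma>. (f, W) \<in> SH_R (S_spectrum T) \<and> (\<forall>q\<in>W. h q = Dbar_right f q) \<and>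
     admissible T W U \<and> J \<in> imag_units \<and> oriented_boundary (slice J U) \<Gamma> \<and>
     A = P2_integral_R T f J \<Gamma>)"

end

(* Put V = T_1 e_1 + T_2 e_2. On every slice the kernel P_2 is 4 (h2 + V h1) with the intrinsic kernels
   h1 = (s - T_0) Q^(-2) and h2 = (s - T_0)^2 Q^(-2), where Q = (s - T_0)^2 + T_1^2 + T_2^2. Expanding f into
   its four intrinsic components reduces the calculus to slice integrals of intrinsic functions, which
   depend neither on the contour (Cauchy) nor on the unit J. Since the integrals are linear in f, it remains
   to see that they vanish when f lies in the kernel of the conjugate Cauchy-Fueter operator.
   In that case the components F are locally constant and even. Integration by parts removes h1 and turns h2
   into Q^(-1) / 2. If the integral of F Q^(-1) were nonzero, one could pass to a proper ideal of the commutative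
   algebra generated by the T_i modulo which the T_i become real numbers t_i; there Q has the conjugate
   zeros t_0 +- i sqrt (t_1^2 + t_2^2), and the residues of F / Q at these two points cancel. *)

theory Submission
  imports Defs
begin

section \<open>Plane grids whose unions of cells are bounded by disjoint Jordan curves\<close>

section \<open>Brick-wall grids\<close>

text \<open>For a fixed primitive and contour linearity is immediate; the content is that the value
  is well defined. The domains are arbitrary open sets, so contours to be compared may bound
  multiply connected regions. This calls for the homology form of Cauchy's theorem and for polygonal
  domains, which also supply one contour inside the common domain of two functions. At the end the
  obstacle is a possible radical: vanishing of P, the integral of F Q^(-1), modulo all such ideals
  would only make P quasinilpotent. So F is split into indicators \<eta> of its level sets, and P is
  paired with A, the integral of \<eta> (s - T_0) Q^(-1). Then A P = pi i P, so modulo an ideal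
  containing the annihilator of P the value of A is pi i, whereas residues give 2 pi i times a value
  0 or 1 of \<eta>. Real spectra make the two zeros of Q conjugate, so that \<eta> agrees on them.
  The absence of T_3 lets conjugation by e_3 turn V into - V, which carries invertibility from the
  operator defining the S-spectrum over to Q.\<close>

definition lattice_pt :: "real \<Rightarrow> int \<times> int \<Rightarrow> complex" where
  "lattice_pt d p = Complex (d * of_int (fst p)) (d * (of_int (snd p) - 1/2))"

text \<open>Bricks have width 2 and height 1 in grid units, and neighbouring rows are offset by 1.
  Every grid vertex then lies on exactly three bricks, as in a honeycomb, so the boundary of a union
  of bricks never touches itself; in a square grid two squares could meet in a corner only. The
  shift by 1/2 in \<open>lattice_pt\<close> centres the row with index 0 on the real axis, so that
  conjugation maps the brick (x, k) to (x, - k), whose index has the same parity.\<close>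

definition brick :: "real \<Rightarrow> int \<times> int \<Rightarrow> complex set" where
  "brick d c = cbox (lattice_pt d c) (lattice_pt d (fst c + 2, snd c + 1))"

definition brick_indices :: "(int \<times> int) set" where
  "brick_indices = {c. even (fst c + snd c)}"

text \<open>Each long side is cut at its midpoint, which is a corner of a brick in the adjacent row.
  Edges then contain no grid vertex in their interior, and the two bricks along an edge list it with
  opposite orientations, both counterclockwise.\<close>

fun brick_edges :: "int \<times> int \<Rightarrow> ((int \<times> int) \<times> (int \<times> int)) set" where
  "brick_edges (x, k) =
    {((x, k), (x + 1, k)), ((x + 1, k), (x + 2, k)), ((x + 2, k), (x + 2, k + 1)),
     ((x + 2, k + 1), (x + 1, k + 1)), ((x + 1, k + 1), (x, k + 1)), ((x, k + 1), (x, k))}"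

text \<open>An edge that occurs in both orientations separates two bricks of \<open>C\<close> and
  cancels in every boundary integral. The remaining edges keep \<open>C\<close> on their
  left.\<close>

definition boundary_edges :: "(int \<times> int) set \<Rightarrow> ((int \<times> int) \<times> (int \<times> int)) set" where
  "boundary_edges C = (\<Union>c\<in>C. brick_edges c) - prod.swap ` (\<Union>c\<in>C. brick_edges c)"

definition edge_segment :: "real \<Rightarrow> (int \<times> int) \<times> (int \<times> int) \<Rightarrow> complex set" where
  "edge_segment d e = closed_segment (lattice_pt d (fst e)) (lattice_pt d (snd e))"

definition edge_integral :: "real \<Rightarrow> (complex \<Rightarrow> complex) \<Rightarrow> (int \<times> int) \<times> (int \<times> int) \<Rightarrow> complex" where
  "edge_integral d f e = contour_integral (linepath (lattice_pt d (fst e)) (lattice_pt d (snd e))) f"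

lemma finite_brick_edges: "finite (brick_edges c)"
  by (cases c) simp

lemma brick_edges_disjoint:
  assumes "c \<in> brick_indices" "c' \<in> brick_indices" "e \<in> brick_edges c" "e \<in> brick_edges c'"
  shows "c = c'"
proof -
  obtain x k x' k' where c: "c = (x, k)" "c' = (x', k')" by (cases c; cases c')
  have "even (x + k)" "even (x' + k')" using assms(1,2) c by (auto simp: brick_indices_def)
  then have "even (x - x' + (k - k'))" by simp
  then show ?thesis using assms(3,4) unfolding c by auto
qed

text \<open>Three bricks surround the vertex (m, k): (m, k), (m - 2, k), (m - 1, k - 1) if the
  coordinate sum is even, and (m - 1, k), (m, k - 1), (m - 2, k - 1) if it is odd. The alternatives
  name the brick that contributes each outgoing edge.\<close>

lemma Union_brick_edges_iff:
  assumes "C \<subseteq> brick_indices"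
  shows "((m, k), v) \<in> (\<Union>c\<in>C. brick_edges c) \<longleftrightarrow>
    (v = (m + 1, k) \<and> (if even (m + k) then (m, k) else (m - 1, k)) \<in> C) \<or>
    (v = (m - 1, k) \<and> (if even (m + k) then (m - 1, k - 1) else (m - 2, k - 1)) \<in> C) \<or>
    (v = (m, k + 1) \<and> (m - 2, k) \<in> C) \<or>
    (v = (m, k - 1) \<and> (m, k - 1) \<in> C)" (is "?L \<longleftrightarrow> ?R")
proof
  assume ?L
  then obtain x j where xj: "(x, j) \<in> C" "((m, k), v) \<in> brick_edges (x, j)" by fast
  have ev: "even (x + j)" using assms xj(1) by (auto simp: brick_indices_def)
  consider "m = x" "k = j" "v = (x + 1, j)" | "m = x + 1" "k = j" "v = (x + 2, j)" |
    "m = x + 2" "k = j" "v = (x + 2, j + 1)" | "m = x + 2" "k = j + 1" "v = (x + 1, j + 1)" |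
    "m = x + 1" "k = j + 1" "v = (x, j + 1)" | "m = x" "k = j + 1" "v = (x, j)"
    using xj(2) by auto
  then show ?R using xj(1) ev by cases simp_all
next
  assume R: ?R
  have W: "?L" if "(x, j) \<in> C" "((m, k), v) \<in> brick_edges (x, j)" for x j
    using that by blast
  from R show ?L
  proof (elim disjE conjE)
    assume "v = (m + 1, k)" "(if even (m + k) then (m, k) else (m - 1, k)) \<in> C"
    then show ?L by (cases "even (m + k)") (rule W, simp, simp)+
  next
    assume "v = (m - 1, k)" "(if even (m + k) then (m - 1, k - 1) else (m - 2, k - 1)) \<in> C"
    then show ?L by (cases "even (m + k)") (rule W, simp, simp)+
  next
    assume "v = (m, k + 1)" "(m - 2, k) \<in> C"
    then show ?L by - (rule W, assumption, simp)
  next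
    assume "v = (m, k - 1)" "(m, k - 1) \<in> C"
    then show ?L by - (rule W, assumption, simp)
  qed
qed

text \<open>Each alternative says that one brick at the vertex belongs to \<open>C\<close> and the
  next one clockwise does not. Around three bricks such a change occurs at most once, which makes
  the outgoing boundary edge unique.\<close>

lemma boundary_edges_iff:
  assumes "C \<subseteq> brick_indices"
  shows "((m, k), v) \<in> boundary_edges C \<longleftrightarrow>
    (if even (m + k) then
      (v = (m + 1, k) \<and> (m, k) \<in> C \<and> (m - 1, k - 1) \<notin> C) \<or>
      (v = (m, k + 1) \<and> (m - 2, k) \<in> C \<and> (m, k) \<notin> C) \<or>
      (v = (m - 1, k) \<and> (m - 1, k - 1) \<in> C \<and> (m - 2, k) \<notin> C)
     else
      (v = (m + 1, k) \<and> (m - 1, k) \<in> C \<and> (m, k - 1) \<notin> C) \<or>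
      (v = (m - 1, k) \<and> (m - 2, k - 1) \<in> C \<and> (m - 1, k) \<notin> C) \<or>
      (v = (m, k - 1) \<and> (m, k - 1) \<in> C \<and> (m - 2, k - 1) \<notin> C))"
proof -
  obtain m' k' where v: "v = (m', k')" by (cases v)
  have ev: "even (x + y)" if "(x, y) \<in> C" for x y
    using assms that by (auto simp: brick_indices_def)
  have "((m, k), v) \<in> boundary_edges C \<longleftrightarrow>
    ((m, k), v) \<in> (\<Union>c\<in>C. brick_edges c) \<and> (v, (m, k)) \<notin> (\<Union>c\<in>C. brick_edges c)"
    unfolding boundary_edges_def by (auto simp: image_iff)
  also have "\<dots> \<longleftrightarrow> (if even (m + k) then
      (v = (m + 1, k) \<and> (m, k) \<in> C \<and> (m - 1, k - 1) \<notin> C) \<or>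
      (v = (m, k + 1) \<and> (m - 2, k) \<in> C \<and> (m, k) \<notin> C) \<or>
      (v = (m - 1, k) \<and> (m - 1, k - 1) \<in> C \<and> (m - 2, k) \<notin> C)
     else
      (v = (m + 1, k) \<and> (m - 1, k) \<in> C \<and> (m, k - 1) \<notin> C) \<or>
      (v = (m - 1, k) \<and> (m - 2, k - 1) \<in> C \<and> (m - 1, k) \<notin> C) \<or>
      (v = (m, k - 1) \<and> (m, k - 1) \<in> C \<and> (m - 2, k - 1) \<notin> C))"
  proof -
    note U = Union_brick_edges_iff[OF assms]
    consider "v = (m + 1, k)" | "v = (m - 1, k)" | "v = (m, k + 1)" | "v = (m, k - 1)" |
      "v \<notin> {(m + 1, k), (m - 1, k), (m, k + 1), (m, k - 1)}" by blast
    then show ?thesis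
    proof cases
      case 1
      then show ?thesis by (simp only: U) (cases "even (m + k)"; simp)
    next
      case 2
      then show ?thesis by (simp only: U) (cases "even (m + k)"; simp)
    next
      case 3
      then show ?thesis using ev[of "m - 2" k] ev[of m k] by (simp only: U) (cases "even (m + k)"; auto)
    next
      case 4
      then show ?thesis using ev[of "m - 2" "k - 1"] ev[of m "k - 1"]
        by (simp only: U) (cases "even (m + k)"; auto)
    next
      case 5
      then show ?thesis by (simp only: U) auto
    qed
  qed
  finally show ?thesis .
qed

lemma boundary_edges_in_iff:
  assumes "C \<subseteq> brick_indices"
  shows "(v, (m, k)) \<in> boundary_edges C \<longleftrightarrow>
    (if even (m + k) then
      (v = (m + 1, k) \<and> (m - 1, k - 1) \<in> C \<and> (m, k) \<notin> C) \<or>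
      (v = (m, k + 1) \<and> (m, k) \<in> C \<and> (m - 2, k) \<notin> C) \<or>
      (v = (m - 1, k) \<and> (m - 2, k) \<in> C \<and> (m - 1, k - 1) \<notin> C)
     else
      (v = (m + 1, k) \<and> (m, k - 1) \<in> C \<and> (m - 1, k) \<notin> C) \<or>
      (v = (m - 1, k) \<and> (m - 1, k) \<in> C \<and> (m - 2, k - 1) \<notin> C) \<or>
      (v = (m, k - 1) \<and> (m - 2, k - 1) \<in> C \<and> (m, k - 1) \<notin> C))"
proof -
  obtain m' k' where v: "v = (m', k')" by (cases v)
  have ev: "even (x + y)" if "(x, y) \<in> C" for x y
    using assms that by (auto simp: brick_indices_def)
  have mem: "(v, (m, k)) \<in> boundary_edges C \<longleftrightarrow>
    (v, (m, k)) \<in> (\<Union>c\<in>C. brick_edges c) \<and> ((m, k), v) \<notin> (\<Union>c\<in>C. brick_edges c)"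
    unfolding boundary_edges_def by (auto simp: image_iff)
  note U = Union_brick_edges_iff[OF assms]
  consider "v = (m + 1, k)" | "v = (m - 1, k)" | "v = (m, k + 1)" | "v = (m, k - 1)" |
    "v \<notin> {(m + 1, k), (m - 1, k), (m, k + 1), (m, k - 1)}" by blast
  then show ?thesis
  proof cases
    case 1
    then show ?thesis unfolding mem by (simp only: U) (cases "even (m + k)"; simp)
  next
    case 2
    then show ?thesis unfolding mem by (simp only: U) (cases "even (m + k)"; simp)
  next
    case 3
    then show ?thesis unfolding mem using ev[of "m - 2" k] ev[of m k]
      by (simp only: U) (cases "even (m + k)"; auto)
  next
    case 4
    then show ?thesis unfolding mem using ev[of "m - 2" "k - 1"] ev[of m "k - 1"]
      by (simp only: U) (cases "even (m + k)"; auto)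
  next
    case 5
    have "(v, (m, k)) \<notin> (\<Union>c\<in>C. brick_edges c)"
      using 5 unfolding v by (simp only: U) auto
    with 5 show ?thesis unfolding mem by (cases "even (m + k)"; simp)
  qed
qed

lemma boundary_edges_out_unique:
  assumes "C \<subseteq> brick_indices" "(u, v) \<in> boundary_edges C" "(u, w) \<in> boundary_edges C"
  shows "v = w"
  using assms(2,3) by (cases u) (auto simp: boundary_edges_iff[OF assms(1)] split: if_splits)

lemma boundary_edges_in_unique:
  assumes "C \<subseteq> brick_indices" "(v, u) \<in> boundary_edges C" "(w, u) \<in> boundary_edges C"
  shows "v = w"
  using assms(2,3) by (cases u) (auto simp: boundary_edges_in_iff[OF assms(1)] split: if_splits)

text \<open>Around a vertex, changes from \<open>C\<close> to its complement and back alternate, so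
  an outgoing edge exists if and only if an incoming one does.\<close>

lemma boundary_edges_fst_eq_snd:
  assumes "C \<subseteq> brick_indices"
  shows "fst ` boundary_edges C = snd ` boundary_edges C"
proof -
  have "(\<exists>v. ((m, k), v) \<in> boundary_edges C) \<longleftrightarrow> (\<exists>v. (v, (m, k)) \<in> boundary_edges C)" for m k
    unfolding boundary_edges_iff[OF assms] boundary_edges_in_iff[OF assms]
    by (cases "even (m + k)") (simp_all only: if_True if_False ex_disj_distrib ex_simps simp_thms, blast+)
  then have "(\<exists>v. (u, v) \<in> boundary_edges C) \<longleftrightarrow> (\<exists>v. (v, u) \<in> boundary_edges C)" for u
    by (cases u) blast
  moreover have "u \<in> fst ` boundary_edges C \<longleftrightarrow> (\<exists>v. (u, v) \<in> boundary_edges C)"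
    "u \<in> snd ` boundary_edges C \<longleftrightarrow> (\<exists>v. (v, u) \<in> boundary_edges C)" for u
    by force+
  ultimately show ?thesis by blast
qed

lemma finite_boundary_edges: "finite C \<Longrightarrow> finite (boundary_edges C)"
  unfolding boundary_edges_def using finite_brick_edges by blast

lemma boundary_edges_asym: "(u, v) \<in> boundary_edges C \<Longrightarrow> (v, u) \<notin> boundary_edges C"
  unfolding boundary_edges_def by (auto simp: image_iff)

lemma sum_boundary_edges:
  fixes I :: "(int \<times> int) \<times> (int \<times> int) \<Rightarrow> complex"
  assumes C: "C \<subseteq> brick_indices" "finite C" and I: "\<And>e. I (prod.swap e) = - I e"
  shows "(\<Sum>c\<in>C. \<Sum>e\<in>brick_edges c. I e) = (\<Sum>e\<in>boundary_edges C. I e)"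
proof -
  define E where "E = (\<Union>c\<in>C. brick_edges c)"
  have fin: "finite E" unfolding E_def using C finite_brick_edges by blast
  have "(\<Sum>c\<in>C. \<Sum>e\<in>brick_edges c. I e) = sum I E"
    unfolding E_def
  proof (rule sum.UNION_disjoint[symmetric])
    show "\<forall>i\<in>C. \<forall>j\<in>C. i \<noteq> j \<longrightarrow> brick_edges i \<inter> brick_edges j = {}"
      using brick_edges_disjoint C(1) by (meson disjoint_iff subsetD)
  qed (use C(2) finite_brick_edges in auto)
  also have "\<dots> = sum I (E - prod.swap ` E) + sum I (E \<inter> prod.swap ` E)"
    by (subst add.commute, rule sum.Int_Diff[OF fin])
  \<comment> \<open>Reversal is an involution of this set that changes the sign of \<open>I\<close>,
    so the sum equals its own negative.\<close>
  also have "sum I (E \<inter> prod.swap ` E) = 0"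
  proof -
    have "sum I (E \<inter> prod.swap ` E) = (\<Sum>e\<in>E \<inter> prod.swap ` E. I (prod.swap e))"
      by (rule sum.reindex_bij_witness[of _ prod.swap prod.swap]) auto
    also have "\<dots> = - sum I (E \<inter> prod.swap ` E)" by (simp only: I sum_negf)
    finally show ?thesis by simp
  qed
  finally show ?thesis unfolding boundary_edges_def E_def by simp
qed

lemma edge_integral_swap: "edge_integral d f (prod.swap e) = - edge_integral d f e"
  using contour_integral_reversepath[of "linepath (lattice_pt d (fst e)) (lattice_pt d (snd e))" f]
  unfolding edge_integral_def by simp

lemma Re_lattice_pt [simp]: "Re (lattice_pt d p) = d * of_int (fst p)"
  and Im_lattice_pt [simp]: "Im (lattice_pt d p) = d * (of_int (snd p) - 1/2)"
  by (simp_all add: lattice_pt_def)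

lemma in_brick_iff:
  assumes "d > 0"
  shows "z \<in> brick d (x, k) \<longleftrightarrow> of_int x \<le> Re z / d \<and> Re z / d \<le> of_int x + 2 \<and>
     of_int k - 1/2 \<le> Im z / d \<and> Im z / d \<le> of_int k + 1/2"
  using assms unfolding brick_def in_cbox_complex_iff by (simp add: field_simps)

lemma in_brick_interior_iff:
  assumes "d > 0"
  shows "z \<in> interior (brick d (x, k)) \<longleftrightarrow> of_int x < Re z / d \<and> Re z / d < of_int x + 2 \<and>
     of_int k - 1/2 < Im z / d \<and> Im z / d < of_int k + 1/2"
  using assms unfolding brick_def interior_cbox in_box_complex_iff by (simp add: field_simps)

lemma closed_segment_horizontal:
  assumes "Im a = Im b"
  shows "z \<in> closed_segment a b \<longleftrightarrow> Im z = Im a \<and> Re z \<in> closed_segment (Re a) (Re b)"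
  using assms closed_segment_same_Im[of a b] by auto

lemma closed_segment_vertical:
  assumes "Re a = Re b"
  shows "z \<in> closed_segment a b \<longleftrightarrow> Re z = Re a \<and> Im z \<in> closed_segment (Im a) (Im b)"
  using assms closed_segment_same_Re[of a b] by auto

lemma in_horizontal_edge_iff:
  assumes "d > 0"
  shows "z \<in> edge_segment d ((m, k), (m + 1, k)) \<longleftrightarrow>
    Im z / d = of_int k - 1/2 \<and> of_int m \<le> Re z / d \<and> Re z / d \<le> of_int m + 1"
    "z \<in> edge_segment d ((m + 1, k), (m, k)) \<longleftrightarrow>
    Im z / d = of_int k - 1/2 \<and> of_int m \<le> Re z / d \<and> Re z / d \<le> of_int m + 1"
  using assms unfolding edge_segment_def
  by (auto simp: closed_segment_horizontal closed_segment_eq_real_ivl field_simps)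

lemma in_vertical_edge_iff:
  assumes "d > 0"
  shows "z \<in> edge_segment d ((m, k), (m, k + 1)) \<longleftrightarrow>
    Re z / d = of_int m \<and> of_int k - 1/2 \<le> Im z / d \<and> Im z / d \<le> of_int k + 1/2"
    "z \<in> edge_segment d ((m, k + 1), (m, k)) \<longleftrightarrow>
    Re z / d = of_int m \<and> of_int k - 1/2 \<le> Im z / d \<and> Im z / d \<le> of_int k + 1/2"
  using assms unfolding edge_segment_def
  by (auto simp: closed_segment_vertical closed_segment_eq_real_ivl field_simps)

section \<open>Closed polygons from edge sets with one outgoing and one incoming edge per
  vertex\<close>

section \<open>Decomposing an edge set into Jordan curves\<close>

text \<open>Follow successors from any edge until a vertex repeats. Since end points determine
  edges, a repetition can be moved back by one step; the first one therefore occurs at the starting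
  vertex, and the chain has no tail.\<close>

lemma closed_chain_obtain:
  fixes E :: "(complex \<times> complex) set"
  assumes fin: "finite E" and ne: "E \<noteq> {}" and vert: "snd ` E \<subseteq> fst ` E"
    and inj: "inj_on fst E" "inj_on snd E"
  obtains u :: "nat \<Rightarrow> complex" and n where "n > 0" "u n = u 0" "inj_on u {..<n}"
    "\<And>i. (u i, u (Suc i)) \<in> E"
proof -
  obtain e0 where e0: "e0 \<in> E" using ne by blast
  define nx where "nx v = (SOME w. (v, w) \<in> E)" for v
  have nx: "(v, nx v) \<in> E" if "v \<in> fst ` E" for v
    using that unfolding nx_def by (metis (mono_tags, lifting) imageE prod.collapse someI_ex)
  define u where "u i = (nx ^^ i) (fst e0)" for i
  have u_in: "u i \<in> fst ` E" for i
  proof (induction i)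
    case 0
    then show ?case using e0 by (simp add: u_def)
  next
    case (Suc i)
    then show ?case using nx[OF Suc] vert by (force simp: u_def)
  qed
  have uE: "(u i, u (Suc i)) \<in> E" for i
    using nx[OF u_in[of i]] by (simp add: u_def)
  have bwd: "u i = u j" if "u (Suc i) = u (Suc j)" for i j
    using inj_onD[OF inj(2), of "(u i, u (Suc i))" "(u j, u (Suc j))"] uE[of i] uE[of j] that by simp
  have "\<exists>j. \<exists>i<j. u i = u j"
  proof (rule ccontr)
    assume "\<not> ?thesis"
    then have "inj u" by (metis injI linorder_neqE_nat)
    moreover have "finite (range u)" by (rule finite_subset[of _ "fst ` E"]) (use u_in fin in auto)
    ultimately show False using finite_imageD by blast
  qed
  define n where "n = (LEAST j. \<exists>i<j. u i = u j)"
  have n: "\<exists>i<n. u i = u n" unfolding n_def by (rule LeastI_ex) fact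
  have least: "\<not> (\<exists>i<j. u i = u j)" if "j < n" for j
    using not_less_Least that unfolding n_def by blast
  obtain i where i: "i < n" "u i = u n" using n by blast
  have "i = 0"
  proof (rule ccontr)
    assume "i \<noteq> 0"
    then obtain i' n' where "i = Suc i'" "n = Suc n'" using i(1) by (metis not0_implies_Suc not_less0)
    then show False using bwd[of i' n'] i least[of n'] by auto
  qed
  show ?thesis
  proof
    show "n > 0" "u n = u 0" using i \<open>i = 0\<close> by auto
    show "inj_on u {..<n}" using least by (metis inj_onI lessThan_iff linorder_neqE_nat)
  qed (rule uE)
qed

text \<open>The first \<open>n - 1\<close> segments are joined to an arc by induction and the last
  one closes it to a loop. Segments meet only in common end points, which is what the criteria for
  joining arcs and closing loops ask for.\<close>

lemma closed_chain_path:
  fixes u :: "nat \<Rightarrow> complex"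
  defines "S \<equiv> (\<lambda>i. closed_segment (u i) (u (Suc i)))"
  assumes n: "n \<ge> 3" "u n = u 0" and inj: "inj_on u {..<n}"
    and meet: "\<And>i j. i < j \<Longrightarrow> j < n \<Longrightarrow> S i \<inter> S j \<subseteq> {u i, u (Suc i)} \<inter> {u j, u (Suc j)}"
  obtains \<gamma> where "valid_path \<gamma>" "simple_path \<gamma>" "pathfinish \<gamma> = pathstart \<gamma>"
    "path_image \<gamma> = (\<Union>i<n. S i)"
    "\<And>f. continuous_on (\<Union>i<n. S i) f \<Longrightarrow>
       contour_integral \<gamma> f = (\<Sum>i<n. contour_integral (linepath (u i) (u (Suc i))) f)"
proof -
  have neq: "u i \<noteq> u j" if "i < j" "j < n" for i j
    using inj_onD[OF inj, of i j] that by auto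
  have neqS: "u i \<noteq> u (Suc i)" if "i < n" for i
    using neq[of i "Suc i"] neq[of 0 i] n that by (cases "Suc i = n") auto
  have ci: "f contour_integrable_on linepath (u i) (u (Suc i))"
    if "continuous_on (\<Union>i<n. S i) f" "i < n" for f i
    by (rule contour_integrable_continuous_linepath, rule continuous_on_subset[OF that(1)])
      (use that(2) in \<open>auto simp: S_def\<close>)
  have "\<exists>g. valid_path g \<and> arc g \<and> pathstart g = u 0 \<and> pathfinish g = u k \<and>
      path_image g = (\<Union>i<k. S i) \<and> (\<forall>f. continuous_on (\<Union>i<n. S i) f \<longrightarrow>
        f contour_integrable_on g \<and>
        contour_integral g f = (\<Sum>i<k. contour_integral (linepath (u i) (u (Suc i))) f))"
    if "1 \<le> k" "k < n" for k
    using that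
  proof (induction k rule: nat_induct_at_least)
    case base
    show ?case using neqS[of 0] n ci[of _ 0]
      by (intro exI[of _ "linepath (u 0) (u 1)"]) (auto simp: S_def lessThan_Suc)
  next
    case (Suc k)
    then obtain g where g: "valid_path g" "arc g" "pathstart g = u 0" "pathfinish g = u k"
      "path_image g = (\<Union>i<k. S i)" "\<And>f. continuous_on (\<Union>i<n. S i) f \<Longrightarrow>
        f contour_integrable_on g \<and>
        contour_integral g f = (\<Sum>i<k. contour_integral (linepath (u i) (u (Suc i))) f)"
      by auto
    let ?l = "linepath (u k) (u (Suc k))"
    have sub: "path_image g \<inter> path_image ?l \<subseteq> {pathstart ?l}"
    proof
      fix z assume "z \<in> path_image g \<inter> path_image ?l"
      then obtain i where i: "i < k" "z \<in> S i" "z \<in> S k" unfolding g(5) by (auto simp: S_def)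
      then have "z \<in> {u i, u (Suc i)} \<inter> {u k, u (Suc k)}" using meet[of i k] Suc by auto
      then show "z \<in> {pathstart ?l}" using neq[of i k] neq[of i "Suc k"] neq[of "Suc i" "Suc k"] i Suc by auto
    qed
    show ?case
    proof (intro exI[of _ "g +++ ?l"] conjI allI impI)
      show "arc (g +++ ?l)" using g sub neqS[of k] Suc by (intro arc_join) auto
      show "path_image (g +++ ?l) = (\<Union>i<Suc k. S i)"
        using g by (simp add: path_image_join lessThan_Suc S_def Un_commute)
      fix f :: "complex \<Rightarrow> complex" assume f: "continuous_on (\<Union>i<n. S i) f"
      show "f contour_integrable_on (g +++ ?l)" "contour_integral (g +++ ?l) f =
        (\<Sum>i<Suc k. contour_integral (linepath (u i) (u (Suc i))) f)"
        using g(1,4) g(6)[OF f] ci[OF f, of k] Suc by (simp_all add: contour_integrable_joinI)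
    qed (use g in \<open>simp_all\<close>)
  qed
  from this[of "n - 1"] have "\<exists>g. valid_path g \<and> arc g \<and> pathstart g = u 0 \<and> pathfinish g = u (n - 1) \<and>
      path_image g = (\<Union>i<n - 1. S i) \<and> (\<forall>f. continuous_on (\<Union>i<n. S i) f \<longrightarrow>
        f contour_integrable_on g \<and>
        contour_integral g f = (\<Sum>i<n - 1. contour_integral (linepath (u i) (u (Suc i))) f))"
    using n(1) by (simp del: One_nat_def)
  then obtain g where g: "valid_path g" "arc g" "pathstart g = u 0" "pathfinish g = u (n - 1)"
      "path_image g = (\<Union>i<n - 1. S i)" "\<And>f. continuous_on (\<Union>i<n. S i) f \<Longrightarrow>
        f contour_integrable_on g \<and>
        contour_integral g f = (\<Sum>i<n - 1. contour_integral (linepath (u i) (u (Suc i))) f)"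
    by blast
  let ?l = "linepath (u (n - 1)) (u 0)"
  have Sn: "Suc (n - 1) = n" "{..<n} = insert (n - 1) {..<n - 1}" using n by auto
  have "path_image g \<inter> path_image ?l \<subseteq> {pathstart g, pathstart ?l}"
  proof
    fix z assume "z \<in> path_image g \<inter> path_image ?l"
    then obtain i where i: "i < n - 1" "z \<in> S i" "z \<in> S (n - 1)"
      unfolding g(5) using n Sn by (auto simp: S_def)
    then show "z \<in> {pathstart g, pathstart ?l}" using meet[of i "n - 1"] n Sn g by auto
  qed
  then have "simple_path (g +++ ?l)"
    using g neqS[of "n - 1"] n Sn by (intro simple_path_join_loop) auto
  show ?thesis
  proof
    show "valid_path (g +++ ?l)" "pathfinish (g +++ ?l) = pathstart (g +++ ?l)" using g by auto
    show "simple_path (g +++ ?l)" by fact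
    show "path_image (g +++ ?l) = (\<Union>i<n. S i)"
      using g n Sn(1) unfolding Sn(2) by (simp add: path_image_join S_def Un_commute)
    fix f :: "complex \<Rightarrow> complex" assume f: "continuous_on (\<Union>i<n. S i) f"
    show "contour_integral (g +++ ?l) f = (\<Sum>i<n. contour_integral (linepath (u i) (u (Suc i))) f)"
      using g(1,4) g(6)[OF f] ci[OF f, of "n - 1"] n Sn(1) unfolding Sn(2) by simp
  qed
qed

text \<open>Induction on the edge set: one closed chain is stripped off. Every vertex of the chain
  has its only outgoing and its only incoming edge there, so the remaining edges are disjoint from
  the chain and again satisfy the hypotheses.\<close>

lemma edges_decompose_into_Jordan_curves:
  fixes E :: "(complex \<times> complex) set"
  defines "S \<equiv> (\<lambda>e. closed_segment (fst e) (snd e))"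
  assumes "finite E" "fst ` E = snd ` E" "inj_on fst E" "inj_on snd E"
    and "\<And>u v. (u, v) \<in> E \<Longrightarrow> u \<noteq> v" "\<And>u v. (u, v) \<in> E \<Longrightarrow> (v, u) \<notin> E"
    and "\<And>e e'. e \<in> E \<Longrightarrow> e' \<in> E \<Longrightarrow> e \<noteq> e' \<Longrightarrow>
      S e \<inter> S e' \<subseteq> {fst e, snd e} \<inter> {fst e', snd e'}"
  shows "\<exists>\<Gamma>. finite \<Gamma> \<and> (\<forall>\<gamma>\<in>\<Gamma>. valid_path \<gamma> \<and> simple_path \<gamma> \<and> pathfinish \<gamma> = pathstart \<gamma>) \<and>
     pairwise (\<lambda>\<gamma> \<delta>. path_image \<gamma> \<inter> path_image \<delta> = {}) \<Gamma> \<and>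
     (\<Union>\<gamma>\<in>\<Gamma>. path_image \<gamma>) = (\<Union>e\<in>E. S e) \<and>
     (\<forall>f. continuous_on (\<Union>e\<in>E. S e) f \<longrightarrow>
       (\<Sum>\<gamma>\<in>\<Gamma>. contour_integral \<gamma> f) = (\<Sum>e\<in>E. contour_integral (linepath (fst e) (snd e)) f))"
  using assms(2-)
proof (induction E rule: finite_psubset_induct)
  case (psubset E)
  note vert = psubset.prems(1) and inj = psubset.prems(2,3) and loopfree = psubset.prems(4)
    and asym = psubset.prems(5) and meet = psubset.prems(6)
  show ?case
  proof (cases "E = {}")
    case True
    show ?thesis unfolding True by (rule exI[of _ "{}"]) (simp add: pairwise_empty)
  next
    case False
    obtain u n where u: "n > 0" "u n = u 0" "inj_on u {..<n}" "\<And>i. (u i, u (Suc i)) \<in> E"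
      by (rule closed_chain_obtain[OF psubset.hyps(1) False eq_refl[OF vert[symmetric]] inj])
        (rule that, simp_all)
    \<comment> \<open>Length 1 would be a loop, and length 2 an edge followed by its
      reversal.\<close>
    have "n \<noteq> 1" using u(2) loopfree[OF u(4)[of 0]] by auto
    moreover have "n \<noteq> 2" using u(2) asym[OF u(4)[of 0]] u(4)[of 1] by (auto simp: numeral_2_eq_2)
    ultimately have n3: "n \<ge> 3" using u(1) by auto
    define ed where "ed i = (u i, u (Suc i))" for i
    define E0 where "E0 = ed ` {..<n}"
    have edinj: "inj_on ed {..<n}" using u(3) unfolding ed_def inj_on_def by blast
    have meetu: "closed_segment (u i) (u (Suc i)) \<inter> closed_segment (u j) (u (Suc j))
       \<subseteq> {u i, u (Suc i)} \<inter> {u j, u (Suc j)}" if "i < j" "j < n" for i j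
    proof -
      have "ed i \<noteq> ed j" using inj_onD[OF edinj, of i j] that by auto
      then show ?thesis using meet[OF u(4)[of i] u(4)[of j]] by (simp add: ed_def S_def)
    qed
    obtain \<gamma> where \<gamma>: "valid_path \<gamma>" "simple_path \<gamma>" "pathfinish \<gamma> = pathstart \<gamma>"
      "path_image \<gamma> = (\<Union>i<n. closed_segment (u i) (u (Suc i)))"
      "\<And>f. continuous_on (\<Union>i<n. closed_segment (u i) (u (Suc i))) f \<Longrightarrow>
       contour_integral \<gamma> f = (\<Sum>i<n. contour_integral (linepath (u i) (u (Suc i))) f)"
      by (rule closed_chain_path[OF n3 u(2,3)]) (use meetu in \<open>simp_all\<close>)
    have E0: "E0 \<subseteq> E" "E0 \<noteq> {}" using u(1,4) unfolding E0_def ed_def by auto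
    have verts0: "fst ` E0 = snd ` E0"
    proof -
      have "fst ` E0 = u ` {..<n}" unfolding E0_def ed_def by (simp add: image_image)
      moreover have "snd ` E0 = u ` Suc ` {..<n}" unfolding E0_def ed_def by (simp add: image_image)
      moreover have "{..<n} = insert 0 {1..<n}" "Suc ` {..<n} = insert n {1..<n}"
        using u(1) by (auto simp: image_Suc_lessThan)
      ultimately show ?thesis by (metis image_insert u(2))
    qed
    define E' where "E' = E - E0"
    have img: "fst ` E' = fst ` E - fst ` E0" "snd ` E' = snd ` E - snd ` E0"
      unfolding E'_def using inj E0(1) by (simp_all add: inj_on_image_set_diff[of _ E])
    have disj: "S e \<inter> S e' = {}" if "e \<in> E0" "e' \<in> E'" for e e'
    proof -
      have "S e \<inter> S e' \<subseteq> {fst e, snd e} \<inter> {fst e', snd e'}"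
        using meet[of e e'] that E0(1) unfolding E'_def by blast
      moreover have "{fst e, snd e} \<subseteq> fst ` E0" using that(1) verts0 by auto
      moreover have "fst e' \<notin> fst ` E0" "snd e' \<notin> fst ` E0"
        using img that(2) verts0 by (metis DiffD2 imageI)+
      ultimately have "\<And>z. z \<in> S e \<inter> S e' \<Longrightarrow> z \<in> fst ` E0 \<and> z \<notin> fst ` E0"
        by (metis IntD1 IntD2 insertE singletonD subsetD)
      then show ?thesis by blast
    qed
    have "\<exists>\<Gamma>. finite \<Gamma> \<and> (\<forall>\<gamma>\<in>\<Gamma>. valid_path \<gamma> \<and> simple_path \<gamma> \<and> pathfinish \<gamma> = pathstart \<gamma>) \<and>
     pairwise (\<lambda>\<gamma> \<delta>. path_image \<gamma> \<inter> path_image \<delta> = {}) \<Gamma> \<and>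
     (\<Union>\<gamma>\<in>\<Gamma>. path_image \<gamma>) = (\<Union>e\<in>E'. S e) \<and>
     (\<forall>f. continuous_on (\<Union>e\<in>E'. S e) f \<longrightarrow>
       (\<Sum>\<gamma>\<in>\<Gamma>. contour_integral \<gamma> f) = (\<Sum>e\<in>E'. contour_integral (linepath (fst e) (snd e)) f))"
    proof (rule psubset.IH)
      show "E' \<subset> E" unfolding E'_def using E0 by blast
      show "fst ` E' = snd ` E'" using img vert verts0 by simp
      show "inj_on fst E'" "inj_on snd E'" unfolding E'_def using inj inj_on_diff by blast+
    qed (use loopfree asym meet in \<open>auto simp: E'_def\<close>)
    then obtain \<Gamma> where \<Gamma>: "finite \<Gamma>" "\<forall>\<gamma>\<in>\<Gamma>. valid_path \<gamma> \<and> simple_path \<gamma> \<and> pathfinish \<gamma> = pathstart \<gamma>"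
     "pairwise (\<lambda>\<gamma> \<delta>. path_image \<gamma> \<inter> path_image \<delta> = {}) \<Gamma>"
     "(\<Union>\<gamma>\<in>\<Gamma>. path_image \<gamma>) = (\<Union>e\<in>E'. S e)"
     "\<And>f. continuous_on (\<Union>e\<in>E'. S e) f \<Longrightarrow>
       (\<Sum>\<gamma>\<in>\<Gamma>. contour_integral \<gamma> f) = (\<Sum>e\<in>E'. contour_integral (linepath (fst e) (snd e)) f)"
      by blast
    have im: "path_image \<gamma> = (\<Union>e\<in>E0. S e)" unfolding \<gamma>(4) E0_def S_def ed_def by simp
    have sep: "path_image \<gamma> \<inter> path_image \<delta> = {}" if "\<delta> \<in> \<Gamma>" for \<delta>
    proof -
      have "path_image \<delta> \<subseteq> (\<Union>e\<in>E'. S e)" using \<Gamma>(4) that by blast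
      then show ?thesis unfolding im using disj by blast
    qed
    have "\<gamma> \<notin> \<Gamma>" using sep[of \<gamma>] path_image_nonempty[of \<gamma>] by auto
    have EE: "E = E0 \<union> E'" "E0 \<inter> E' = {}" "finite E0" "finite E'"
      using E0(1) psubset.hyps(1) unfolding E'_def by (auto intro: finite_subset)
    show ?thesis
    proof (intro exI[of _ "insert \<gamma> \<Gamma>"] conjI allI impI)
      show "pairwise (\<lambda>\<gamma> \<delta>. path_image \<gamma> \<inter> path_image \<delta> = {}) (insert \<gamma> \<Gamma>)"
        using \<Gamma>(3) sep by (auto simp: pairwise_insert Int_commute)
      show "\<Union> (path_image ` insert \<gamma> \<Gamma>) = \<Union> (S ` E)" unfolding EE(1) using im \<Gamma>(4) by auto
      fix f :: "complex \<Rightarrow> complex" assume f: "continuous_on (\<Union> (S ` E)) f"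
      have f0: "continuous_on (\<Union>i<n. closed_segment (u i) (u (Suc i))) f"
        using im unfolding \<gamma>(4) by (intro continuous_on_subset[OF f]) (simp add: EE(1))
      have f': "continuous_on (\<Union>e\<in>E'. S e) f"
        by (intro continuous_on_subset[OF f]) (auto simp: EE(1))
      have "(\<Sum>e\<in>E0. contour_integral (linepath (fst e) (snd e)) f) = contour_integral \<gamma> f"
        unfolding \<gamma>(5)[OF f0] E0_def sum.reindex[OF edinj] by (simp add: ed_def)
      then show "(\<Sum>\<gamma>\<in>insert \<gamma> \<Gamma>. contour_integral \<gamma> f) = (\<Sum>e\<in>E. contour_integral (linepath (fst e) (snd e)) f)"
        using \<Gamma>(1) \<open>\<gamma> \<notin> \<Gamma>\<close> \<Gamma>(5)[OF f'] by (simp add: EE(1) sum.union_disjoint[OF EE(3,4,2)])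
    qed (use \<Gamma>(1,2) \<gamma>(1-3) in auto)
  qed
qed

lemma brick_cover:
  assumes "d > 0"
  shows "\<exists>c\<in>brick_indices. z \<in> brick d c"
proof -
  define k where "k = \<lfloor>Im z / d + 1/2\<rfloor>"
  define m where "m = \<lfloor>Re z / d\<rfloor>"
  define x where "x = (if even (m + k) then m else m - 1)"
  have "even (x + k)" unfolding x_def by auto
  moreover have "z \<in> brick d (x, k)"
  proof -
    have "of_int k \<le> Im z / d + 1/2" "Im z / d + 1/2 < of_int k + 1"
      "of_int m \<le> Re z / d" "Re z / d < of_int m + 1"
      unfolding k_def m_def by linarith+
    moreover have "of_int x \<le> (of_int m :: real)" "of_int m \<le> of_int x + (1 :: real)"
      unfolding x_def by auto
    ultimately show ?thesis unfolding in_brick_iff[OF assms] by linarith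
  qed
  ultimately show ?thesis by (auto simp: brick_indices_def intro!: bexI[of _ "(x, k)"])
qed

lemma finite_bricks_meeting:
  assumes "d > 0" "bounded M"
  shows "finite {c. brick d c \<inter> M \<noteq> {}}"
proof -
  obtain r where r: "\<And>z. z \<in> M \<Longrightarrow> cmod z \<le> r" using assms(2) by (auto simp: bounded_iff)
  define n where "n = \<lceil>r / d\<rceil> + 3"
  have "{c. brick d c \<inter> M \<noteq> {}} \<subseteq> {-n..n} \<times> {-n..n}"
  proof safe
    fix x k z assume z: "z \<in> brick d (x, k)" "z \<in> M"
    have "\<bar>Re z\<bar> \<le> r" "\<bar>Im z\<bar> \<le> r"
      using r[OF z(2)] abs_Re_le_cmod[of z] abs_Im_le_cmod[of z] by linarith+
    then have *: "\<bar>Re z / d\<bar> \<le> r / d" "\<bar>Im z / d\<bar> \<le> r / d"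
      using assms(1) by (simp_all add: abs_divide divide_right_mono)
    have "of_int n \<ge> r / d + 3" unfolding n_def by linarith
    then have "of_int (-n) \<le> (of_int x :: real)" "of_int x \<le> (of_int n :: real)"
      "of_int (-n) \<le> (of_int k :: real)" "of_int k \<le> (of_int n :: real)"
      using z(1) * unfolding in_brick_iff[OF assms(1)] of_int_minus by linarith+
    then show "x \<in> {-n..n}" "k \<in> {-n..n}" by (simp_all only: of_int_le_iff atLeastAtMost_iff)
  qed
  then show ?thesis by (rule finite_subset) simp
qed

lemma brick_diameter:
  assumes "d > 0" "z \<in> brick d c" "w \<in> brick d c"
  shows "dist z w \<le> 3 * d"
proof -
  obtain x k where c: "c = (x, k)" by (cases c)
  have "\<bar>Re z / d - Re w / d\<bar> \<le> 2" "\<bar>Im z / d - Im w / d\<bar> \<le> 1"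
    using assms(2,3) unfolding c in_brick_iff[OF assms(1)] by auto
  moreover have "Re z / d - Re w / d = Re (z - w) / d" "Im z / d - Im w / d = Im (z - w) / d"
    by (simp_all add: diff_divide_distrib)
  ultimately have "\<bar>Re (z - w)\<bar> \<le> 2 * d" "\<bar>Im (z - w)\<bar> \<le> d"
    using assms(1) by (simp_all add: abs_divide divide_le_eq)
  then show ?thesis using cmod_le[of "z - w"] by (simp add: dist_norm)
qed

lemma closed_brick: "closed (brick d c)" and convex_brick: "convex (brick d c)"
  unfolding brick_def by (rule closed_cbox, rule convex_box(1))

lemma closure_interior_brick:
  assumes "d > 0"
  shows "closure (interior (brick d c)) = brick d c"
proof -
  obtain x k where c: "c = (x, k)" by (cases c)
  have "Complex (d * (of_int x + 1)) (d * of_int k) \<in> interior (brick d c)"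
    using assms unfolding c in_brick_interior_iff[OF assms] by simp
  then show ?thesis
    using convex_closure_interior[OF convex_brick, of d c] closed_brick[of d c] by (metis closure_closed emptyE)
qed

lemma edge_segment_swap: "edge_segment d (prod.swap e) = edge_segment d e"
  by (simp add: edge_segment_def closed_segment_commute)

text \<open>The honeycomb property: touching bricks never meet in a corner alone. Up to exchanging
  the two bricks, parity leaves only the offsets (2, 0), (1, 1) and (- 1, 1), each with a common
  edge that fills the whole intersection.\<close>

lemma bricks_share_edge:
  assumes d: "d > 0" and c: "c \<in> brick_indices" "c' \<in> brick_indices" "c \<noteq> c'"
    and z: "z \<in> brick d c" "z \<in> brick d c'"
  shows "\<exists>e\<in>brick_edges c. prod.swap e \<in> brick_edges c' \<and> z \<in> edge_segment d e"
proof -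
  have A: "\<exists>e\<in>brick_edges (x, k). prod.swap e \<in> brick_edges (x', k') \<and> z \<in> edge_segment d e"
    if par: "even (x + k)" "even (x' + k')" and ne: "(x, k) \<noteq> (x', k')"
      and zz: "z \<in> brick d (x, k)" "z \<in> brick d (x', k')" and le: "k < k' \<or> k = k' \<and> x < x'"
    for x k x' k'
  proof -
    note iff = in_brick_iff[OF d]
    have b: "of_int k - 1/2 \<le> Im z / d" "Im z / d \<le> of_int k + 1/2"
      "of_int k' - 1/2 \<le> Im z / d" "Im z / d \<le> of_int k' + 1/2"
      "of_int x \<le> Re z / d" "Re z / d \<le> of_int x + 2"
      "of_int x' \<le> Re z / d" "Re z / d \<le> of_int x' + 2"
      using zz unfolding iff by auto
    have "(of_int k' :: real) \<le> of_int (k + 1)" "(of_int x' :: real) \<le> of_int (x + 2)"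
      "(of_int x :: real) \<le> of_int (x' + 2)"
      using b by simp_all
    then have int: "k' \<le> k + 1" "x' \<le> x + 2" "x \<le> x' + 2" by (simp_all only: of_int_le_iff)
    from le show ?thesis
    proof
      assume "k = k' \<and> x < x'"
      then have k: "k' = k" and "x' = x + 1 \<or> x' = x + 2" using int by auto
      then have x': "x' = x + 2" using par by auto
      have "z \<in> edge_segment d ((x + 2, k), (x + 2, k + 1))"
        unfolding in_vertical_edge_iff[OF d] using b unfolding x' k by auto
      then show ?thesis unfolding x' k by (intro bexI[of _ "((x + 2, k), (x + 2, k + 1))"]) auto
    next
      assume "k < k'"
      then have k': "k' = k + 1" using int by auto
      have "x' = x + 1 \<or> x' = x - 1" using par int(2,3) unfolding k' by presburger
      then show ?thesis
      proof
        assume x': "x' = x + 1"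
        have "z \<in> edge_segment d ((x + 1 + 1, k + 1), (x + 1, k + 1))"
          unfolding in_horizontal_edge_iff[OF d] using b unfolding x' k' by auto
        then show ?thesis unfolding x' k' by (intro bexI[of _ "((x + 2, k + 1), (x + 1, k + 1))"]) (simp_all add: add.commute)
      next
        assume x': "x' = x - 1"
        have "z \<in> edge_segment d ((x + 1, k + 1), (x, k + 1))"
          unfolding in_horizontal_edge_iff[OF d] using b unfolding x' k' by auto
        then show ?thesis unfolding x' k' by (intro bexI[of _ "((x + 1, k + 1), (x, k + 1))"]) auto
      qed
    qed
  qed
  obtain x k x' k' where cc: "c = (x, k)" "c' = (x', k')" by (cases c; cases c')
  have par: "even (x + k)" "even (x' + k')" using c(1,2) cc by (auto simp: brick_indices_def)
  consider "k < k' \<or> k = k' \<and> x < x'" | "k' < k \<or> k' = k \<and> x' < x" using c(3) cc by force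
  then show ?thesis
  proof cases
    case 1
    then show ?thesis unfolding cc by (intro A[OF par]) (use c(3) z cc in auto)
  next
    case 2
    then have "\<exists>e\<in>brick_edges c'. prod.swap e \<in> brick_edges c \<and> z \<in> edge_segment d e"
      unfolding cc by (intro A[OF par(2,1)]) (use c(3) z cc in auto)
    then obtain e where "e \<in> brick_edges c'" "prod.swap e \<in> brick_edges c" "z \<in> edge_segment d e"
      by blast
    then show ?thesis by (intro bexI[of _ "prod.swap e"]) (auto simp: edge_segment_swap)
  qed
qed

lemma lattice_pt_in_brick:
  assumes "d > 0" "x \<le> fst p" "fst p \<le> x + 2" "k \<le> snd p" "snd p \<le> k + 1"
  shows "lattice_pt d p \<in> brick d (x, k)"
proof -
  have "(of_int x :: real) \<le> of_int (fst p)" "(of_int (fst p) :: real) \<le> of_int (x + 2)"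
    "(of_int k :: real) \<le> of_int (snd p)" "(of_int (snd p) :: real) \<le> of_int (k + 1)"
    using assms(2-) by (simp_all only: of_int_le_iff)
  then show ?thesis unfolding in_brick_iff[OF assms(1)] using assms(1) by simp
qed

lemma edge_segment_subset_brick:
  assumes "d > 0" "e \<in> brick_edges c"
  shows "edge_segment d e \<subseteq> brick d c"
proof -
  obtain x k where c: "c = (x, k)" by (cases c)
  have "lattice_pt d (fst e) \<in> brick d c" "lattice_pt d (snd e) \<in> brick d c"
    using assms(2) unfolding c by (auto intro!: lattice_pt_in_brick[OF assms(1)])
  then show ?thesis unfolding edge_segment_def by (rule closed_segment_subset) (rule convex_brick)
qed

lemma edge_segment_interior_disjoint:
  assumes d: "d > 0" and e: "e \<in> brick_edges c"
  shows "edge_segment d e \<inter> interior (brick d c) = {}"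
proof -
  obtain x k where c: "c = (x, k)" by (cases c)
  have "z \<notin> interior (brick d c)" if z: "z \<in> edge_segment d e" for z
  proof -
    note h = in_horizontal_edge_iff[OF d, of z] and v = in_vertical_edge_iff[OF d, of z]
    have two: "x + 1 + 1 = x + 2" by simp
    from e consider "e = ((x, k), (x + 1, k))" | "e = ((x + 1, k), (x + 2, k))"
      | "e = ((x + 2, k), (x + 2, k + 1))" | "e = ((x + 2, k + 1), (x + 1, k + 1))"
      | "e = ((x + 1, k + 1), (x, k + 1))" | "e = ((x, k + 1), (x, k))" unfolding c by auto
    then show ?thesis
      using z unfolding c in_brick_interior_iff[OF d]
      by cases (use h(1)[of x k] h(1)[of "x + 1" k] v(1)[of "x + 2" k] h(2)[of "x + 1" "k + 1"]
        h(2)[of x "k + 1"] v(2)[of x k] in \<open>auto simp: two\<close>)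
  qed
  then show ?thesis by blast
qed

lemma brick_interior_disjoint:
  assumes d: "d > 0" and c: "c \<in> brick_indices" "c' \<in> brick_indices" "c \<noteq> c'"
  shows "interior (brick d c) \<inter> brick d c' = {}"
proof -
  have "z \<notin> brick d c'" if z: "z \<in> interior (brick d c)" for z
  proof
    assume z': "z \<in> brick d c'"
    obtain e where e: "e \<in> brick_edges c" "z \<in> edge_segment d e"
      using bricks_share_edge[OF d c _ z'] z interior_subset by blast
    then show False using edge_segment_interior_disjoint[OF d e(1)] z by blast
  qed
  then show ?thesis by blast
qed

lemma swapped_edge_brick:
  assumes "c \<in> brick_indices" "e \<in> brick_edges c"
  shows "\<exists>c'\<in>brick_indices. prod.swap e \<in> brick_edges c'"
proof -
  obtain x k where c: "c = (x, k)" by (cases c)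
  have "even (x + k)" using assms c by (auto simp: brick_indices_def)
  then have I: "(x - 1, k - 1) \<in> brick_indices" "(x + 1, k - 1) \<in> brick_indices"
    "(x + 2, k) \<in> brick_indices" "(x + 1, k + 1) \<in> brick_indices"
    "(x - 1, k + 1) \<in> brick_indices" "(x - 2, k) \<in> brick_indices"
    by (auto simp: brick_indices_def)
  from assms(2) consider "e = ((x, k), (x + 1, k))" | "e = ((x + 1, k), (x + 2, k))"
      | "e = ((x + 2, k), (x + 2, k + 1))" | "e = ((x + 2, k + 1), (x + 1, k + 1))"
      | "e = ((x + 1, k + 1), (x, k + 1))" | "e = ((x, k + 1), (x, k))" unfolding c by auto
  then show ?thesis
  proof cases
    case 1 then show ?thesis by (intro bexI[OF _ I(1)]) auto next
    case 2 then show ?thesis by (intro bexI[OF _ I(2)]) auto next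
    case 3 then show ?thesis by (intro bexI[OF _ I(3)]) auto next
    case 4 then show ?thesis by (intro bexI[OF _ I(4)]) auto next
    case 5 then show ?thesis by (intro bexI[OF _ I(5)]) auto next
    case 6 then show ?thesis by (intro bexI[OF _ I(6)]) auto
  qed
qed

text \<open>A point of the union \<open>S\<close> on a boundary edge also lies on a brick outside
  \<open>C\<close>, whose interior is disjoint from \<open>S\<close> and accumulates at the point.
  Off the boundary edges all bricks through the point belong to \<open>C\<close>, so the point is
  interior. This identifies the topological frontier with the boundary edges.\<close>

lemma grid_domain:
  assumes d: "d > 0" and C: "C \<subseteq> brick_indices" "finite C"
  defines "S \<equiv> \<Union>(brick d ` C)" and "B \<equiv> \<Union>(edge_segment d ` boundary_edges C)"
  shows "interior S = S - B" "closure (interior S) = S" "frontier (interior S) = B" "B \<subseteq> S"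
    "\<And>z. z \<in> B \<Longrightarrow> \<exists>c'\<in>brick_indices - C. z \<in> brick d c'"
proof -
  have S: "closed S" unfolding S_def by (intro closed_UN C(2) ballI closed_brick)
  have B1: "\<exists>c\<in>C. \<exists>c'\<in>brick_indices - C. z \<in> brick d c \<and> z \<in> brick d c'" if zB: "z \<in> B" for z
  proof -
    obtain e where e': "e \<in> boundary_edges C" "z \<in> edge_segment d e" using zB unfolding B_def by blast
    moreover from e'(1) obtain c where "c \<in> C" "e \<in> brick_edges c"
      unfolding boundary_edges_def by (elim DiffE UN_E)
    ultimately have e: "e \<in> boundary_edges C" "z \<in> edge_segment d e" "c \<in> C" "e \<in> brick_edges c"
      by blast+
    obtain c' where c': "c' \<in> brick_indices" "prod.swap e \<in> brick_edges c'"
      using swapped_edge_brick[OF _ e(4)] e(3) C(1) by blast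
    have "c' \<notin> C" 
    proof
      assume "c' \<in> C"
      then have "prod.swap (prod.swap e) \<in> prod.swap ` (\<Union>c\<in>C. brick_edges c)" using c'(2) by blast
      then show False using e(1) unfolding boundary_edges_def by simp
    qed
    moreover have "z \<in> brick d c" using e edge_segment_subset_brick[OF d e(4)] by blast
    moreover have "z \<in> brick d c'"
      using e(2) edge_segment_subset_brick[OF d c'(2)] edge_segment_swap by blast
    ultimately show ?thesis using e(3) c'(1) by blast
  qed
  show "\<exists>c'\<in>brick_indices - C. z \<in> brick d c'" if "z \<in> B" for z
    using B1[OF that] by blast
  from B1 show "B \<subseteq> S" unfolding S_def by blast
  have B2: "z \<in> B" if "c \<in> C" "c' \<in> brick_indices - C" "z \<in> brick d c" "z \<in> brick d c'" for z c c'
  proof -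
    have "c \<noteq> c'" "c \<in> brick_indices" "c' \<in> brick_indices" using that C(1) by auto
    from bricks_share_edge[OF d this(2,3,1) that(3,4)]
    obtain e where e: "e \<in> brick_edges c" "prod.swap e \<in> brick_edges c'" "z \<in> edge_segment d e"
      by blast
    have "e \<notin> prod.swap ` (\<Union>c\<in>C. brick_edges c)"
    proof
      assume "e \<in> prod.swap ` (\<Union>c\<in>C. brick_edges c)"
      then obtain c2 where "c2 \<in> C" "prod.swap e \<in> brick_edges c2"
        by (elim imageE UN_E) (simp add: swap_swap)
      then show False using brick_edges_disjoint[of c2 c' "prod.swap e"] that(2) e(2) C(1) by blast
    qed
    moreover have "e \<in> (\<Union>c\<in>C. brick_edges c)" by (rule UN_I) (rule that(1), rule e(1))
    ultimately have "e \<in> boundary_edges C" unfolding boundary_edges_def by (rule DiffI[rotated])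
    then show ?thesis using e(3) unfolding B_def by blast
  qed
  have int: "interior S \<inter> B = {}"
  proof -
    have "z \<notin> interior S" if zB: "z \<in> B" for z
    proof
      assume z: "z \<in> interior S"
      obtain c' where c': "c' \<in> brick_indices - C" "z \<in> brick d c'" using B1[OF zB] by blast
      have "z \<in> closure (interior (brick d c'))" using c'(2) closure_interior_brick[OF d] by blast
      then have "interior S \<inter> interior (brick d c') \<noteq> {}"
        using z open_Int_closure_eq_empty[OF open_interior] by blast
      then obtain w c where "w \<in> interior (brick d c')" "c \<in> C" "w \<in> brick d c"
        using interior_subset unfolding S_def by blast
      then show False using brick_interior_disjoint[OF d, of c' c] c' C(1) by blast
    qed
    then show ?thesis by blast
  qed
  have sub: "S - B \<subseteq> interior S"
  proof
    fix z assume z: "z \<in> S - B"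
    \<comment> \<open>The bricks near \<open>z\<close> that avoid \<open>z\<close>. They are
      finitely many closed sets, so removing them leaves a neighbourhood of \<open>z\<close> covered
      by bricks through \<open>z\<close> only, all of which belong to \<open>C\<close>.\<close>
    define N where "N = {c \<in> brick_indices. brick d c \<inter> ball z 1 \<noteq> {} \<and> z \<notin> brick d c}"
    have "finite N"
      by (rule finite_subset[OF _ finite_bricks_meeting[OF d bounded_ball]]) (auto simp: N_def)
    then have "closed (\<Union>(brick d ` N))" by (intro closed_UN ballI closed_brick)
    then have "open (ball z 1 - \<Union>(brick d ` N))" by (intro open_Diff open_ball)
    moreover have "z \<in> ball z 1 - \<Union>(brick d ` N)" unfolding N_def by auto
    moreover have "ball z 1 - \<Union>(brick d ` N) \<subseteq> S"
    proof
      fix w assume w: "w \<in> ball z 1 - \<Union>(brick d ` N)"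
      obtain c where c: "c \<in> brick_indices" "w \<in> brick d c" using brick_cover[OF d] by blast
      have zc: "z \<in> brick d c" using c w unfolding N_def by blast
      obtain c0 where "c0 \<in> C" "z \<in> brick d c0" using z unfolding S_def by blast
      then have "c \<in> C" using B2[of c0 c z] c(1) zc z by blast
      then show "w \<in> S" using c(2) unfolding S_def by blast
    qed
    ultimately show "z \<in> interior S" by (rule interiorI)
  qed
  show iS: "interior S = S - B" using int sub interior_subset by blast
  have "brick d c \<subseteq> closure (interior S)" if "c \<in> C" for c
  proof -
    have "interior (brick d c) \<subseteq> interior S" by (rule interior_mono) (use that in \<open>auto simp: S_def\<close>)
    then show ?thesis using closure_mono closure_interior_brick[OF d] by blast
  qed
  then have "S \<subseteq> closure (interior S)" unfolding S_def by blast
  then show cl: "closure (interior S) = S" using S closure_minimal interior_subset by blast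
  show "frontier (interior S) = B" unfolding frontier_def cl interior_interior using iS \<open>B \<subseteq> S\<close> by blast
qed

definition segment_pair :: "real \<Rightarrow> (int \<times> int) \<times> (int \<times> int) \<Rightarrow> complex \<times> complex" where
  "segment_pair d e = (lattice_pt d (fst e), lattice_pt d (snd e))"

lemma inj_lattice_pt: "d > 0 \<Longrightarrow> lattice_pt d p = lattice_pt d q \<longleftrightarrow> p = q"
  by (auto simp: lattice_pt_def prod_eq_iff)

lemma lattice_pt_in_edge:
  assumes d: "d > 0" and "e \<in> brick_edges c" "lattice_pt d p \<in> edge_segment d e"
  shows "p \<in> {fst e, snd e}"
proof -
  obtain x k a b where c: "c = (x, k)" "p = (a, b)" by (cases c; cases p)
  have H: "(a, b) = (m, j) \<or> (a, b) = (m + 1, j)" if "lattice_pt d (a, b) \<in> edge_segment d ((m, j), (m + 1, j)) \<or>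
      lattice_pt d (a, b) \<in> edge_segment d ((m + 1, j), (m, j))" for m j
  proof -
    from that have "of_int b - 1/2 = (of_int j - 1/2 :: real)" "(of_int m :: real) \<le> of_int a" "(of_int a :: real) \<le> of_int (m + 1)"
      unfolding in_horizontal_edge_iff[OF d] using d by simp_all
    then have "b = j" "m \<le> a" "a \<le> m + 1" by (simp_all only: of_int_le_iff)
    then show ?thesis by auto
  qed
  have V: "(a, b) = (m, j) \<or> (a, b) = (m, j + 1)" if "lattice_pt d (a, b) \<in> edge_segment d ((m, j), (m, j + 1)) \<or>
      lattice_pt d (a, b) \<in> edge_segment d ((m, j + 1), (m, j))" for m j
  proof -
    from that have "(of_int a :: real) = of_int m" "(of_int j :: real) \<le> of_int b" "(of_int b :: real) \<le> of_int (j + 1)"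
      unfolding in_vertical_edge_iff[OF d] using d by simp_all
    then have "a = m" "j \<le> b" "b \<le> j + 1" by (simp_all only: of_int_le_iff of_int_eq_iff)
    then show ?thesis by auto
  qed
  from assms(2) consider "e = ((x, k), (x + 1, k))" | "e = ((x + 1, k), (x + 1 + 1, k))"
      | "e = ((x + 2, k), (x + 2, k + 1))" | "e = ((x + 1 + 1, k + 1), (x + 1, k + 1))"
      | "e = ((x + 1, k + 1), (x, k + 1))" | "e = ((x, k + 1), (x, k))" unfolding c by auto
  then show ?thesis
  proof cases
    case 1 then show ?thesis using H[of x k] assms(3) unfolding c by simp next
    case 2 then show ?thesis using H[of "x + 1" k] assms(3) unfolding c by simp next
    case 3 then show ?thesis using V[of "x + 2" k] assms(3) unfolding c by simp next
    case 4 then show ?thesis using H[of "x + 1" "k + 1"] assms(3) unfolding c by auto next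
    case 5 then show ?thesis using H[of x "k + 1"] assms(3) unfolding c by auto next
    case 6 then show ?thesis using V[of x k] assms(3) unfolding c by auto
  qed
qed

lemma brick_edge_cases:
  assumes "e \<in> brick_edges c"
  obtains (horizontal) m k where "e = ((m, k), (m + 1, k)) \<or> e = prod.swap ((m, k), (m + 1, k))"
  | (vertical) m k where "e = ((m, k), (m, k + 1)) \<or> e = prod.swap ((m, k), (m, k + 1))"
proof -
  obtain x k where c: "c = (x, k)" by (cases c)
  from assms consider "e = ((x, k), (x + 1, k))" | "e = ((x + 1, k), (x + 1 + 1, k))"
      | "e = ((x + 2, k), (x + 2, k + 1))" | "e = ((x + 1 + 1, k + 1), (x + 1, k + 1))"
      | "e = ((x + 1, k + 1), (x, k + 1))" | "e = ((x, k + 1), (x, k))" unfolding c by auto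
  then show ?thesis
  proof cases
    case 1 then show ?thesis using horizontal[of x k] by simp next
    case 2 then show ?thesis using horizontal[of "x + 1" k] by simp next
    case 3 then show ?thesis using vertical[of "x + 2" k] by simp next
    case 4 then show ?thesis using horizontal[of "x + 1" "k + 1"] by simp next
    case 5 then show ?thesis using horizontal[of x "k + 1"] by simp next
    case 6 then show ?thesis using vertical[of x k] by simp
  qed
qed

lemma edge_segments_meet:
  assumes d: "d > 0" and e: "e \<in> brick_edges c" "e' \<in> brick_edges c'" "e' \<noteq> e" "e' \<noteq> prod.swap e"
    and z: "z \<in> edge_segment d e" "z \<in> edge_segment d e'"
  shows "\<exists>p. z = lattice_pt d p"
proof -
  have L: "\<exists>p. z = lattice_pt d p" if "Re z / d = of_int a" "Im z / d = of_int b - 1/2" for a b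
    using that d by (intro exI[of _ "(a, b)"]) (simp add: complex_eq_iff field_simps)
  note h = in_horizontal_edge_iff[OF d] and v = in_vertical_edge_iff[OF d] and sw = edge_segment_swap[of d]
  from e(1) show ?thesis
  proof (cases rule: brick_edge_cases)
    case e: (horizontal m k)
    then have zm: "Im z / d = of_int k - 1/2" "of_int m \<le> Re z / d" "Re z / d \<le> of_int m + 1"
      using z(1) sw[of "((m, k), (m + 1, k))"] h(1)[of z m k] by auto
    from assms(3) show ?thesis
    proof (cases rule: brick_edge_cases)
      case e': (horizontal m' k')
      then have zm': "Im z / d = of_int k' - 1/2" "of_int m' \<le> Re z / d" "Re z / d \<le> of_int m' + 1"
        using z(2) sw[of "((m', k'), (m' + 1, k'))"] h(1)[of z m' k'] by auto
      have k: "k' = k" using zm(1) zm'(1) by simp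
      then have "m' \<noteq> m" using e e' assms(4,5) by auto
      moreover have "(of_int m' :: real) \<le> of_int (m + 1)" "(of_int m :: real) \<le> of_int (m' + 1)"
        using zm zm' by simp_all
      then have "m' \<le> m + 1" "m \<le> m' + 1" by (simp_all only: of_int_le_iff)
      ultimately have "m' = m + 1 \<or> m' = m - 1" by auto
      then have "Re z / d = of_int (m + 1) \<or> Re z / d = of_int m" using zm zm' by auto
      then show ?thesis using L[OF _ zm(1)] by blast
    next
      case e': (vertical m' k')
      then have "Re z / d = of_int m'"
        using z(2) sw[of "((m', k'), (m', k' + 1))"] v(1)[of z m' k'] by auto
      then show ?thesis using L[OF _ zm(1)] by blast
    qed
  next
    case e: (vertical m k)
    then have zm: "Re z / d = of_int m" "of_int k - 1/2 \<le> Im z / d" "Im z / d \<le> of_int k + 1/2"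
      using z(1) sw[of "((m, k), (m, k + 1))"] v(1)[of z m k] by auto
    from assms(3) show ?thesis
    proof (cases rule: brick_edge_cases)
      case e': (horizontal m' k')
      then have "Im z / d = of_int k' - 1/2"
        using z(2) sw[of "((m', k'), (m' + 1, k'))"] h(1)[of z m' k'] by auto
      then show ?thesis using L[OF zm(1)] by blast
    next
      case e': (vertical m' k')
      then have zm': "Re z / d = of_int m'" "of_int k' - 1/2 \<le> Im z / d" "Im z / d \<le> of_int k' + 1/2"
        using z(2) sw[of "((m', k'), (m', k' + 1))"] v(1)[of z m' k'] by auto
      have m: "m' = m" using zm(1) zm'(1) by simp
      then have "k' \<noteq> k" using e e' assms(4,5) by auto
      moreover have "(of_int k' :: real) \<le> of_int (k + 1)" "(of_int k :: real) \<le> of_int (k' + 1)"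
        using zm zm' by simp_all
      then have "k' \<le> k + 1" "k \<le> k' + 1" by (simp_all only: of_int_le_iff)
      ultimately have "k' = k + 1 \<or> k' = k - 1" by auto
      then have "Im z / d = of_int (k + 1) - 1/2 \<or> Im z / d = of_int k - 1/2" using zm zm' by auto
      then show ?thesis using L[OF zm(1)] by blast
    qed
  qed
qed

text \<open>Sums over edges are kept alongside sums over Jordan curves: Cauchy's formula and
  interchanges of integrals are checked segment by segment, while the calculus is defined with
  closed curves.\<close>

definition chain_integral :: "(complex \<times> complex) set \<Rightarrow> (complex \<Rightarrow> complex) \<Rightarrow> complex" where
  "chain_integral E f = (\<Sum>e\<in>E. contour_integral (linepath (fst e) (snd e)) f)"

definition chain_support :: "(complex \<times> complex) set \<Rightarrow> complex set" where
  "chain_support E = (\<Union>e\<in>E. closed_segment (fst e) (snd e))"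

lemma holomorphic_on_linepath_Cauchy_integral:
  assumes "continuous_on (closed_segment a b) f"
  shows "(\<lambda>z. contour_integral (linepath a b) (\<lambda>w. f w / (w - z))) holomorphic_on - closed_segment a b"
proof (unfold holomorphic_on_open[OF open_Compl[OF closed_segment]], intro ballI exI)
  fix z assume z: "z \<in> - closed_segment a b"
  show "((\<lambda>z. contour_integral (linepath a b) (\<lambda>w. f w / (w - z))) has_field_derivative
     of_nat 1 * contour_integral (linepath a b) (\<lambda>u. f u / (u - z) ^ Suc 1)) (at z)"
  proof (rule Cauchy_next_derivative(2)[where S = UNIV and B = "norm (b - a)"])
    fix w assume w: "w \<in> UNIV - path_image (linepath a b)"
    have "continuous_on (closed_segment a b) (\<lambda>u. f u / (u - w) ^ 1)"
      using w by (intro continuous_intros assms) auto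
    from contour_integrable_continuous_linepath[OF this]
    show "((\<lambda>u. f u / (u - w) ^ 1) has_contour_integral contour_integral (linepath a b) (\<lambda>u. f u / (u - w))) (linepath a b)"
      using has_contour_integral_integral by fastforce
  qed (use assms z in auto)
qed

lemma sum_brick_edges_eq_rectpath:
  assumes d: "d > 0" and g: "continuous_on (path_image (rectpath (lattice_pt d (x, k)) (lattice_pt d (x + 2, k + 1)))) g"
  shows "(\<Sum>e\<in>brick_edges (x, k). edge_integral d g e) =
    contour_integral (rectpath (lattice_pt d (x, k)) (lattice_pt d (x + 2, k + 1))) g"
proof -
  let ?p = "lattice_pt d"
  have pts: "Complex (Re (?p (x + 2, k + 1))) (Im (?p (x, k))) = ?p (x + 2, k)"
    "Complex (Re (?p (x, k))) (Im (?p (x + 2, k + 1))) = ?p (x, k + 1)"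
    by (simp_all add: lattice_pt_def)
  note rp = rectpath_def[of "?p (x, k)" "?p (x + 2, k + 1)", unfolded Let_def pts]
  have im: "path_image (rectpath (?p (x, k)) (?p (x + 2, k + 1))) =
     closed_segment (?p (x, k)) (?p (x + 2, k)) \<union> closed_segment (?p (x + 2, k)) (?p (x + 2, k + 1)) \<union>
     closed_segment (?p (x + 2, k + 1)) (?p (x, k + 1)) \<union> closed_segment (?p (x, k + 1)) (?p (x, k))"
    unfolding rp by (simp add: path_image_join Un_assoc)
  have c: "continuous_on (closed_segment (?p (x, k)) (?p (x + 2, k))) g"
     "continuous_on (closed_segment (?p (x + 2, k)) (?p (x + 2, k + 1))) g"
     "continuous_on (closed_segment (?p (x + 2, k + 1)) (?p (x, k + 1))) g"
     "continuous_on (closed_segment (?p (x, k + 1)) (?p (x, k))) g"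
    using g unfolding im by (auto elim: continuous_on_subset)
  note i = c[THEN contour_integrable_continuous_linepath]
  have "contour_integral (rectpath (?p (x, k)) (?p (x + 2, k + 1))) g =
    contour_integral (linepath (?p (x, k)) (?p (x + 2, k))) g +
    (contour_integral (linepath (?p (x + 2, k)) (?p (x + 2, k + 1))) g +
    (contour_integral (linepath (?p (x + 2, k + 1)) (?p (x, k + 1))) g +
     contour_integral (linepath (?p (x, k + 1)) (?p (x, k))) g))"
    unfolding rp using i by (simp add: contour_integrable_joinI)
  also have "contour_integral (linepath (?p (x, k)) (?p (x + 2, k))) g =
    contour_integral (linepath (?p (x, k)) (?p (x + 1, k))) g +
    contour_integral (linepath (?p (x + 1, k)) (?p (x + 2, k))) g"
    using d by (intro contour_integral_split_linepath[OF c(1)])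
      (simp add: closed_segment_horizontal closed_segment_eq_real_ivl)
  also have "contour_integral (linepath (?p (x + 2, k + 1)) (?p (x, k + 1))) g =
    contour_integral (linepath (?p (x + 2, k + 1)) (?p (x + 1, k + 1))) g +
    contour_integral (linepath (?p (x + 1, k + 1)) (?p (x, k + 1))) g"
    using d by (intro contour_integral_split_linepath[OF c(3)])
      (simp add: closed_segment_horizontal closed_segment_eq_real_ivl)
  finally show ?thesis by (simp add: edge_integral_def add_ac)
qed

lemma brick_Cauchy:
  assumes d: "d > 0" and f: "f holomorphic_on brick d c"
  shows "z \<in> interior (brick d c) \<Longrightarrow>
      (\<Sum>e\<in>brick_edges c. edge_integral d (\<lambda>w. f w / (w - z)) e) = 2 * pi * \<i> * f z"
    and "z \<notin> brick d c \<Longrightarrow> (\<Sum>e\<in>brick_edges c. edge_integral d (\<lambda>w. f w / (w - z)) e) = 0"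
proof -
  obtain x k where c: "c = (x, k)" by (cases c)
  define a b where "a = lattice_pt d (x, k)" and "b = lattice_pt d (x + 2, k + 1)"
  have ab: "Re a \<le> Re b" "Im a \<le> Im b" and br: "brick d c = cbox a b"
    using d unfolding a_def b_def c brick_def by (simp_all add: algebra_simps)
  have sub: "path_image (rectpath a b) \<subseteq> cbox a b" by (rule path_image_rectpath_subset_cbox[OF ab])
  have cont: "continuous_on (path_image (rectpath a b)) (\<lambda>w. f w / (w - z))" if "z \<notin> path_image (rectpath a b)"
    using f sub that unfolding br
    by (intro continuous_intros holomorphic_on_imp_continuous_on) (auto elim: holomorphic_on_subset)
  have eq: "(\<Sum>e\<in>brick_edges c. edge_integral d (\<lambda>w. f w / (w - z)) e) =
    contour_integral (rectpath a b) (\<lambda>w. f w / (w - z))" if "z \<notin> path_image (rectpath a b)"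
    using sum_brick_edges_eq_rectpath[OF d] cont[OF that] unfolding a_def b_def c by blast
  show "(\<Sum>e\<in>brick_edges c. edge_integral d (\<lambda>w. f w / (w - z)) e) = 2 * pi * \<i> * f z"
    if "z \<in> interior (brick d c)"
  proof -
    have zb: "z \<in> box a b" using that unfolding br by simp
    then have z: "z \<notin> path_image (rectpath a b)" using path_image_rectpath_inter_box[OF ab] by blast
    have "((\<lambda>w. f w / (w - z)) has_contour_integral (2*pi * \<i> * winding_number (rectpath a b) z * f z)) (rectpath a b)"
      by (rule Cauchy_integral_formula_convex_simple[of "cbox a b"]) (use f br sub z that in \<open>auto simp: convex_box\<close>)
    then show ?thesis
      unfolding eq[OF z] winding_number_rectpath[OF zb] by (simp add: contour_integral_unique)
  qed
  show "(\<Sum>e\<in>brick_edges c. edge_integral d (\<lambda>w. f w / (w - z)) e) = 0" if "z \<notin> brick d c"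
  proof -
    have z: "z \<notin> path_image (rectpath a b)" using that sub unfolding br by blast
    have "((\<lambda>w. f w / (w - z)) has_contour_integral 0) (rectpath a b)"
      by (rule Cauchy_theorem_convex_simple[of _ "cbox a b"])
        (use f br sub that in \<open>auto simp: convex_box intro!: holomorphic_intros\<close>)
    then show ?thesis unfolding eq[OF z] by (rule contour_integral_unique)
  qed
qed

text \<open>Adding the formulas for the single bricks cancels the inner edges. This gives the value
  for \<open>z\<close> in the interior of a brick; at points on inner edges both sides are
  continuous in \<open>z\<close>, because only boundary edges remain in the integral.\<close>

lemma grid_Cauchy:
  assumes d: "d > 0" and C: "C \<subseteq> brick_indices" "finite C" and f: "f holomorphic_on \<Union>(brick d ` C)"
  shows "z \<in> interior (\<Union>(brick d ` C)) \<Longrightarrow>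
      (\<Sum>e\<in>boundary_edges C. edge_integral d (\<lambda>w. f w / (w - z)) e) = 2 * pi * \<i> * f z"
    and "z \<notin> \<Union>(brick d ` C) \<Longrightarrow> (\<Sum>e\<in>boundary_edges C. edge_integral d (\<lambda>w. f w / (w - z)) e) = 0"
proof -
  define S where "S = \<Union>(brick d ` C)"
  define g where "g z = (\<Sum>e\<in>boundary_edges C. edge_integral d (\<lambda>w. f w / (w - z)) e)" for z
  note gd = grid_domain[OF d C, folded S_def]
  have fc: "f holomorphic_on brick d c" if "c \<in> C" for c
    by (rule holomorphic_on_subset[OF f]) (use that in blast)
  have gsum: "g z = (\<Sum>c\<in>C. \<Sum>e\<in>brick_edges c. edge_integral d (\<lambda>w. f w / (w - z)) e)" for z
    unfolding g_def by (rule sum_boundary_edges[OF C, symmetric]) (rule edge_integral_swap)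
  show "(\<Sum>e\<in>boundary_edges C. edge_integral d (\<lambda>w. f w / (w - z)) e) = 0" if "z \<notin> \<Union>(brick d ` C)"
    using that brick_Cauchy(2)[OF d fc] unfolding g_def[symmetric] gsum by (intro sum.neutral) blast
  have g_in: "g z = 2 * pi * \<i> * f z" if c: "c \<in> C" and z: "z \<in> interior (brick d c)" for z c
  proof -
    have "z \<notin> brick d c'" if "c' \<in> C - {c}" for c'
      using brick_interior_disjoint[OF d, of c c'] C(1) c z that by blast
    then have "(\<Sum>e\<in>brick_edges c'. edge_integral d (\<lambda>w. f w / (w - z)) e) = 0" if "c' \<in> C - {c}" for c'
      using brick_Cauchy(2)[OF d fc] that by blast
    then show ?thesis unfolding gsum using brick_Cauchy(1)[OF d fc[OF c] z]
      by (simp add: sum.remove[OF C(2) c])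
  qed
  have fS: "continuous_on S f" using f unfolding S_def by (rule holomorphic_on_imp_continuous_on)
  have cont: "continuous_on (interior S) (\<lambda>z. g z - 2 * pi * \<i> * f z)"
  proof -
    have "continuous_on (interior S) (\<lambda>z. edge_integral d (\<lambda>w. f w / (w - z)) e)" if e: "e \<in> boundary_edges C" for e
    proof -
      have "edge_segment d e \<subseteq> S" "interior S \<subseteq> - edge_segment d e" using gd(1,4) e by blast+
      then show ?thesis unfolding edge_integral_def edge_segment_def
        by (intro continuous_on_subset[OF holomorphic_on_imp_continuous_on[OF holomorphic_on_linepath_Cauchy_integral]]
           continuous_on_subset[OF fS])
    qed
    then show ?thesis unfolding g_def
      by (intro continuous_intros continuous_on_subset[OF fS interior_subset])
  qed
  show "(\<Sum>e\<in>boundary_edges C. edge_integral d (\<lambda>w. f w / (w - z)) e) = 2 * pi * \<i> * f z"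
    if "z \<in> interior (\<Union>(brick d ` C))"
  proof -
    have z: "z \<in> interior S" using that unfolding S_def .
    then obtain c where c: "c \<in> C" "z \<in> brick d c" using interior_subset unfolding S_def by blast
    then have "z \<in> closure (interior (brick d c))" using closure_interior_brick[OF d] by blast
    then obtain x where x: "\<And>n. x n \<in> interior (brick d c)" "x \<longlonglongrightarrow> z"
      unfolding closure_sequential by blast
    have "interior (brick d c) \<subseteq> interior S" by (rule interior_mono) (use c in \<open>auto simp: S_def\<close>)
    then have "(\<lambda>n. g (x n) - 2 * pi * \<i> * f (x n)) \<longlonglongrightarrow> g z - 2 * pi * \<i> * f z"
      using x z by (intro continuous_on_tendsto_compose[OF cont]) (auto intro!: always_eventually)
    moreover have "(\<lambda>n. g (x n) - 2 * pi * \<i> * f (x n)) = (\<lambda>n. 0)"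
      using g_in[OF c(1) x(1)] by simp
    ultimately have "g z - 2 * pi * \<i> * f z = 0" by (simp add: LIMSEQ_const_iff)
    then show ?thesis unfolding g_def by simp
  qed
qed

text \<open>The domain is the interior of the union of all bricks that meet \<open>K\<close>, for a
  grid finer than the distance from \<open>K\<close> to the complement of \<open>V\<close>. Its
  symmetry under conjugation is recorded because the domain is later rotated into an axially
  symmetric one.\<close>

lemma exists_polygonal_domain:
  assumes K: "compact K" and V: "open V" "K \<subseteq> V"
  obtains D E \<Gamma> where "open D" "bounded D" "K \<subseteq> D" "closure D \<subseteq> V" "finite E"
    "chain_support E = frontier D" "cnj ` K \<subseteq> K \<Longrightarrow> cnj ` D \<subseteq> D"
    "\<And>f z. f holomorphic_on V \<Longrightarrow> z \<in> D \<Longrightarrow> chain_integral E (\<lambda>w. f w / (w - z)) = 2 * pi * \<i> * f z"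
    "\<And>f z. f holomorphic_on V \<Longrightarrow> z \<notin> closure D \<Longrightarrow> chain_integral E (\<lambda>w. f w / (w - z)) = 0"
    "oriented_boundary D \<Gamma>"
    "\<And>f. continuous_on (frontier D) f \<Longrightarrow> (\<Sum>\<gamma>\<in>\<Gamma>. contour_integral \<gamma> f) = chain_integral E f"
proof -
  obtain r where r: "r > 0" "(\<Union>x\<in>K. ball x r) \<subseteq> V"
    using compact_subset_open_imp_ball_epsilon_subset[OF K V] by blast
  \<comment> \<open>A brick has diameter at most \<open>3 * d\<close>, which is less than
    \<open>r\<close>.\<close>
  define d where "d = r / 4"
  have d: "d > 0" using r(1) by (simp add: d_def)
  define C where "C = {c \<in> brick_indices. brick d c \<inter> K \<noteq> {}}"
  have C: "C \<subseteq> brick_indices" "finite C"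
    unfolding C_def by (auto intro: finite_subset[OF _ finite_bricks_meeting[OF d compact_imp_bounded[OF K]]])
  define S where "S = \<Union>(brick d ` C)"
  define D where "D = interior S"
  define E where "E = segment_pair d ` boundary_edges C"
  note gd = grid_domain[OF d C, folded S_def, folded D_def]
  have S_O: "S \<subseteq> V"
  proof
    fix z assume "z \<in> S"
    then obtain c w where "z \<in> brick d c" "w \<in> brick d c" "w \<in> K" unfolding S_def C_def by blast
    moreover from this have "z \<in> ball w r" using brick_diameter[OF d, of w c z] d by (simp add: d_def)
    ultimately show "z \<in> V" using r(2) by blast
  qed
  have K_D: "K \<subseteq> D"
  proof
    fix z assume z: "z \<in> K"
    obtain c where "c \<in> brick_indices" "z \<in> brick d c" using brick_cover[OF d] by blast
    then have "z \<in> S" unfolding S_def C_def using z by blast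
    \<comment> \<open>A point on a boundary edge also lies on a brick outside \<open>C\<close>, but
      every brick through a point of \<open>K\<close> belongs to \<open>C\<close>.\<close>
    moreover have "z \<notin> \<Union> (edge_segment d ` boundary_edges C)"
      using gd(5)[of z] z unfolding C_def by blast
    ultimately show "z \<in> D" unfolding gd(1) by blast
  qed
  have supp: "chain_support E = frontier D"
    unfolding gd(3) chain_support_def E_def segment_pair_def edge_segment_def by auto
  have inj: "inj_on (segment_pair d) (boundary_edges C)"
    unfolding segment_pair_def inj_on_def using inj_lattice_pt[OF d] by (auto simp: prod_eq_iff)
  have chain: "chain_integral E f = (\<Sum>e\<in>boundary_edges C. edge_integral d f e)" for f
    unfolding chain_integral_def E_def sum.reindex[OF inj] by (simp add: segment_pair_def edge_integral_def)
  have finE: "finite E" unfolding E_def by (intro finite_imageI finite_boundary_edges C)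
  have bd_edge: "\<exists>c\<in>C. e \<in> brick_edges c" if "e \<in> boundary_edges C" for e
    using that unfolding boundary_edges_def by (elim DiffE UN_E) (rule bexI)
  have cauchy: "chain_integral E (\<lambda>w. f w / (w - z)) = 2 * pi * \<i> * f z" if "f holomorphic_on S" "z \<in> D" for f z
    using grid_Cauchy(1)[OF d C, of f z] that unfolding chain S_def D_def by simp
  have cauchy0: "chain_integral E (\<lambda>w. f w / (w - z)) = 0" if "f holomorphic_on S" "z \<notin> closure D" for f z
    using grid_Cauchy(2)[OF d C, of f z] that unfolding chain gd(2) unfolding S_def by simp
  have "\<exists>\<Gamma>. finite \<Gamma> \<and> (\<forall>\<gamma>\<in>\<Gamma>. valid_path \<gamma> \<and> simple_path \<gamma> \<and> pathfinish \<gamma> = pathstart \<gamma>) \<and>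
     pairwise (\<lambda>\<gamma> \<delta>. path_image \<gamma> \<inter> path_image \<delta> = {}) \<Gamma> \<and>
     (\<Union>\<gamma>\<in>\<Gamma>. path_image \<gamma>) = (\<Union>e\<in>E. closed_segment (fst e) (snd e)) \<and>
     (\<forall>f. continuous_on (\<Union>e\<in>E. closed_segment (fst e) (snd e)) f \<longrightarrow>
       (\<Sum>\<gamma>\<in>\<Gamma>. contour_integral \<gamma> f) = (\<Sum>e\<in>E. contour_integral (linepath (fst e) (snd e)) f))"
  proof (rule edges_decompose_into_Jordan_curves[OF finE])
    have "fst ` E = lattice_pt d ` fst ` boundary_edges C" "snd ` E = lattice_pt d ` snd ` boundary_edges C"
      unfolding E_def segment_pair_def by (simp_all add: image_image)
    then show "fst ` E = snd ` E" using boundary_edges_fst_eq_snd[OF C(1)] by simp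
    show "inj_on fst E" "inj_on snd E"
      unfolding E_def inj_on_def segment_pair_def using inj_lattice_pt[OF d]
        boundary_edges_out_unique[OF C(1)] boundary_edges_in_unique[OF C(1)] by auto
    fix u v assume uv: "(u, v) \<in> E"
    then obtain e where e: "e \<in> boundary_edges C" "u = lattice_pt d (fst e)" "v = lattice_pt d (snd e)"
      unfolding E_def segment_pair_def by blast
    obtain c where c: "c \<in> C" "e \<in> brick_edges c" using bd_edge[OF e(1)] by blast
    have "fst e \<noteq> snd e" using c(2) by (cases c) auto
    then show "u \<noteq> v" using e inj_lattice_pt[OF d] by simp
    show "(v, u) \<notin> E"
    proof
      assume "(v, u) \<in> E"
      then obtain e' where e': "e' \<in> boundary_edges C" "v = lattice_pt d (fst e')" "u = lattice_pt d (snd e')"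
        unfolding E_def segment_pair_def by blast
      then have "fst e' = snd e" "snd e' = fst e" using e inj_lattice_pt[OF d] by auto
      then show False using boundary_edges_asym[of "fst e" "snd e" C] e(1) e'(1) by (metis prod.collapse)
    qed
  next
    fix e e' assume e: "e \<in> E" "e' \<in> E" "e \<noteq> e'"
    then obtain a a' where a: "a \<in> boundary_edges C" "e = segment_pair d a"
      "a' \<in> boundary_edges C" "e' = segment_pair d a'" unfolding E_def by blast
    obtain c where c: "c \<in> C" "a \<in> brick_edges c" using bd_edge[OF a(1)] by blast
    obtain c' where c': "c' \<in> C" "a' \<in> brick_edges c'" using bd_edge[OF a(3)] by blast
    have "a' \<noteq> a" using e(3) a by auto
    moreover have "a' \<noteq> prod.swap a" using boundary_edges_asym[of "fst a" "snd a" C] a(1,3)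
      by (metis prod.collapse swap_simp)
    ultimately have L: "\<exists>p. z = lattice_pt d p" if "z \<in> edge_segment d a" "z \<in> edge_segment d a'" for z
      using edge_segments_meet[OF d c(2) c'(2)] that by blast
    show "closed_segment (fst e) (snd e) \<inter> closed_segment (fst e') (snd e') \<subseteq> {fst e, snd e} \<inter> {fst e', snd e'}"
    proof
      fix z assume "z \<in> closed_segment (fst e) (snd e) \<inter> closed_segment (fst e') (snd e')"
      then have z: "z \<in> edge_segment d a" "z \<in> edge_segment d a'"
        unfolding a segment_pair_def edge_segment_def by auto
      obtain p where p: "z = lattice_pt d p" using L[OF z] by blast
      have "p \<in> {fst a, snd a}" "p \<in> {fst a', snd a'}"
        using lattice_pt_in_edge[OF d c(2)] lattice_pt_in_edge[OF d c'(2)] z unfolding p by blast+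
      then show "z \<in> {fst e, snd e} \<inter> {fst e', snd e'}" unfolding p a segment_pair_def by auto
    qed
  qed
  then obtain \<Gamma> where \<Gamma>: "finite \<Gamma>" "\<And>\<gamma>. \<gamma> \<in> \<Gamma> \<Longrightarrow> valid_path \<gamma> \<and> simple_path \<gamma> \<and> pathfinish \<gamma> = pathstart \<gamma>"
     "pairwise (\<lambda>\<gamma> \<delta>. path_image \<gamma> \<inter> path_image \<delta> = {}) \<Gamma>" "(\<Union>\<gamma>\<in>\<Gamma>. path_image \<gamma>) = frontier D"
     "\<And>f. continuous_on (frontier D) f \<Longrightarrow> (\<Sum>\<gamma>\<in>\<Gamma>. contour_integral \<gamma> f) = chain_integral E f"
    unfolding chain_support_def[symmetric] supp chain_integral_def[symmetric] by blast
  \<comment> \<open>The total winding number is the Cauchy integral of the constant 1 over the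
    edges, so the orientation condition is again Cauchy's formula.\<close>
  have wn: "(\<Sum>\<gamma>\<in>\<Gamma>. winding_number \<gamma> z) = 1 / (2 * pi * \<i>) * chain_integral E (\<lambda>w. 1 / (w - z))"
    if z: "z \<notin> frontier D" for z
  proof -
    have "winding_number \<gamma> z = 1 / (2 * pi * \<i>) * contour_integral \<gamma> (\<lambda>w. 1 / (w - z))" if "\<gamma> \<in> \<Gamma>" for \<gamma>
      by (rule winding_number_valid_path) (use z \<Gamma>(2,4) that in auto)
    then have "(\<Sum>\<gamma>\<in>\<Gamma>. winding_number \<gamma> z) = 1 / (2 * pi * \<i>) * (\<Sum>\<gamma>\<in>\<Gamma>. contour_integral \<gamma> (\<lambda>w. 1 / (w - z)))"
      by (simp add: sum_distrib_left)
    also have "(\<Sum>\<gamma>\<in>\<Gamma>. contour_integral \<gamma> (\<lambda>w. 1 / (w - z))) = chain_integral E (\<lambda>w. 1 / (w - z))"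
      by (rule \<Gamma>(5)) (use z in \<open>auto intro!: continuous_intros\<close>)
    finally show ?thesis .
  qed
  have jb: "jordan_boundary D \<Gamma>" unfolding jordan_boundary_def using \<Gamma> by blast
  have ob: "oriented_boundary D \<Gamma>"
    unfolding oriented_boundary_def
  proof (intro conjI ballI allI impI jb)
    fix z assume z: "z \<in> D"
    then have "z \<notin> frontier D" unfolding frontier_def D_def by simp
    then show "(\<Sum>\<gamma>\<in>\<Gamma>. winding_number \<gamma> z) = 1"
      using cauchy[of "\<lambda>_. 1" z] z by (simp add: wn)
  next
    fix z assume z: "z \<notin> closure D"
    then have "z \<notin> frontier D" unfolding frontier_def by simp
    then show "(\<Sum>\<gamma>\<in>\<Gamma>. winding_number \<gamma> z) = 0"
      using cauchy0[of "\<lambda>_. 1" z] z by (simp add: wn)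
  qed
  have bS: "bounded S"
    unfolding S_def by (intro bounded_UN C(2) ballI) (simp add: brick_def)
  have conj: "cnj ` D \<subseteq> D" if "cnj ` K \<subseteq> K"
  proof -
    have *: "cnj z \<in> S" if "z \<in> S" for z
    proof -
      obtain x k where xk: "(x, k) \<in> C" "z \<in> brick d (x, k)" using \<open>z \<in> S\<close> unfolding S_def by auto
      have flip: "cnj w \<in> brick d (x, - k)" if "w \<in> brick d (x, k)" for w
        using that unfolding in_brick_iff[OF d] by auto
      obtain w where w: "w \<in> K" "w \<in> brick d (x, k)" using xk(1) unfolding C_def by blast
      have "(x, - k) \<in> C" using w flip[OF w(2)] xk(1) \<open>cnj ` K \<subseteq> K\<close> unfolding C_def brick_indices_def by auto
      then show ?thesis using flip[OF xk(2)] unfolding S_def by blast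
    qed
    have "cnj ` S = S"
    proof
      show "S \<subseteq> cnj ` S" using * by (metis complex_cnj_cnj image_eqI subsetI)
    qed (use * in blast)
    moreover have "bij cnj" by (rule bijI'[of cnj]) (auto intro: complex_cnj_cnj[symmetric])
    ultimately have "cnj ` interior S = interior S"
      using interior_bijective_linear_image[of cnj S] bounded_linear.linear[OF bounded_linear_cnj] by simp
    then show ?thesis unfolding D_def by simp
  qed
  show ?thesis
  proof (rule that[of D E \<Gamma>])
    show "open D" unfolding D_def by simp
    show "bounded D" unfolding D_def using bS bounded_subset interior_subset by blast
    show "closure D \<subseteq> V" unfolding gd(2) by (rule S_O)
    show "chain_integral E (\<lambda>w. f w / (w - z)) = 2 * pi * \<i> * f z" if "f holomorphic_on V" "z \<in> D" for f z
      using cauchy[OF holomorphic_on_subset[OF that(1) S_O] that(2)] .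
    show "chain_integral E (\<lambda>w. f w / (w - z)) = 0" if "f holomorphic_on V" "z \<notin> closure D" for f z
      using cauchy0[OF holomorphic_on_subset[OF that(1) S_O] that(2)] .
  qed (use K_D finE supp conj ob \<Gamma>(5) in auto)
qed

section \<open>Cauchy's theorem in homology form, with complex coefficients\<close>

section \<open>Cauchy's theorem for cycles\<close>

text \<open>On the paths, \<open>f\<close> is a Cauchy integral over the edges of a polygonal domain
  \<open>D\<close> that contains the paths and every point of nonzero total winding. After
  interchanging the integrals, the inner one is, up to a constant factor, the total winding number
  at a boundary point of \<open>D\<close>, hence 0.\<close>

theorem Cauchy_theorem_cycle:
  fixes p :: "'i \<Rightarrow> real \<Rightarrow> complex" and c :: "'i \<Rightarrow> complex"
  assumes V: "open V" and f: "f holomorphic_on V" and I: "finite I"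
    and p: "\<And>i. i \<in> I \<Longrightarrow> valid_path (p i)" "\<And>i. i \<in> I \<Longrightarrow> pathfinish (p i) = pathstart (p i)"
      "\<And>i. i \<in> I \<Longrightarrow> path_image (p i) \<subseteq> V"
    and wn: "\<And>w. w \<notin> V \<Longrightarrow> (\<Sum>i\<in>I. c i * winding_number (p i) w) = 0"
  shows "(\<Sum>i\<in>I. c i * contour_integral (p i) f) = 0"
proof -
  define P where "P = (\<Union>i\<in>I. path_image (p i))"
  define W where "W w = (\<Sum>i\<in>I. c i * winding_number (p i) w)" for w
  \<comment> \<open>The paths together with the points they wind around. The set is compact: winding
    numbers are locally constant off the paths and vanish far away.\<close>
  define M where "M = P \<union> {w. W w \<noteq> 0}"
  have path: "path (p i)" if "i \<in> I" for i using p(1)[OF that] valid_path_imp_path by blast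
  have "open {w. w \<notin> P \<and> W w = 0}"
  proof (subst open_subopen, safe)
    fix w assume w: "w \<notin> P" "W w = 0"
    let ?T = "(\<Inter>i\<in>I. {z. z \<notin> path_image (p i) \<and> winding_number (p i) z = winding_number (p i) w})"
    have "open ?T" by (intro open_INT I ballI open_winding_number_levelsets path p(2))
    moreover have "w \<in> ?T" using w(1) unfolding P_def by auto
    moreover have "?T \<subseteq> {w. w \<notin> P \<and> W w = 0}"
    proof
      fix z assume z: "z \<in> ?T"
      then have "W z = W w" unfolding W_def by (intro sum.cong) auto
      then show "z \<in> {w. w \<notin> P \<and> W w = 0}" using z w(2) unfolding P_def by auto
    qed
    ultimately show "\<exists>T. open T \<and> w \<in> T \<and> T \<subseteq> {w. w \<notin> P \<and> W w = 0}" by blast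
  qed
  moreover have "M = - {w. w \<notin> P \<and> W w = 0}" unfolding M_def by auto
  ultimately have "closed M" by (simp add: closed_Compl)
  moreover have "bounded M"
  proof -
    have "\<exists>B. \<forall>z. B \<le> norm z \<longrightarrow> winding_number (p i) z = 0" if "i \<in> I" for i
      using winding_number_zero_at_infinity[OF path p(2)] that by blast
    then obtain B where B: "\<And>i z. i \<in> I \<Longrightarrow> B i \<le> norm z \<Longrightarrow> winding_number (p i) z = 0" by metis
    have "{w. W w \<noteq> 0} \<subseteq> (\<Union>i\<in>I. cball 0 (B i))"
    proof
      fix w assume "w \<in> {w. W w \<noteq> 0}"
      then obtain i where "i \<in> I" "winding_number (p i) w \<noteq> 0"
        unfolding W_def using sum.not_neutral_contains_not_neutral by force
      then have "\<not> B i \<le> norm w" using B[of i w] by blast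
      then show "w \<in> (\<Union>i\<in>I. cball 0 (B i))" using \<open>i \<in> I\<close> by (intro UN_I[of i]) auto
    qed
    moreover have "bounded (\<Union>i\<in>I. cball (0::complex) (B i))" by (intro bounded_UN I ballI) simp
    moreover have "bounded P" unfolding P_def by (intro bounded_UN I ballI bounded_path_image path)
    ultimately show ?thesis unfolding M_def using bounded_subset by auto
  qed
  ultimately have "compact M" by (simp add: compact_eq_bounded_closed)
  have "M \<subseteq> V" unfolding M_def P_def W_def using p(3) wn by blast
  obtain D E where D: "open D" "M \<subseteq> D" "closure D \<subseteq> V" "finite E" "chain_support E = frontier D"
    "\<And>f z. f holomorphic_on V \<Longrightarrow> z \<in> D \<Longrightarrow> chain_integral E (\<lambda>w. f w / (w - z)) = 2 * pi * \<i> * f z"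
    by (rule exists_polygonal_domain[OF \<open>compact M\<close> V \<open>M \<subseteq> V\<close>]) blast
  have seg: "closed_segment (fst e) (snd e) \<subseteq> frontier D" if "e \<in> E" for e
    using that D(5) unfolding chain_support_def by blast
  have fr: "frontier D \<inter> D = {}" "frontier D \<subseteq> V"
    using D(1,3) unfolding frontier_def by (auto simp: interior_open)
  \<comment> \<open>The interchange of integrals asks for a continuous derivative along the whole
    loop, which a piecewise smooth path need not have. A nearby polynomial loop has the same
    integrals over functions holomorphic on \<open>D\<close>.\<close>
  have "\<exists>q. polynomial_function q \<and> pathfinish q = pathstart q \<and> path_image q \<subseteq> D \<and>
      (\<forall>g. g holomorphic_on D \<longrightarrow> contour_integral q g = contour_integral (p i) g)" if i: "i \<in> I" for i
  proof -
    have im: "path_image (p i) \<subseteq> D" using i D(2) unfolding M_def P_def by blast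
    obtain r where r: "r > 0" "\<And>g h. valid_path g \<Longrightarrow> valid_path h \<Longrightarrow>
        (\<forall>t \<in> {0..1}. norm (g t - p i t) < r \<and> norm (h t - p i t) < r) \<Longrightarrow>
        pathfinish g = pathstart g \<Longrightarrow> pathfinish h = pathstart h \<Longrightarrow>
        path_image h \<subseteq> D \<and> (\<forall>f. f holomorphic_on D \<longrightarrow> contour_integral h f = contour_integral g f)"
      using contour_integral_nearby_loops[OF D(1) path[OF i] im] by metis
    obtain q where q: "polynomial_function q" "pathstart q = pathstart (p i)" "pathfinish q = pathfinish (p i)"
      "\<And>t. t \<in> {0..1} \<Longrightarrow> norm (q t - p i t) < r"
      using path_approx_polynomial_function[OF path[OF i] r(1)] by blast
    show ?thesis
      using r(2)[of "p i" q] p(1,2)[OF i] q r(1) by (intro exI[of _ q]) (auto simp: valid_path_polynomial_function)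
  qed
  then obtain q where q: "\<And>i. i \<in> I \<Longrightarrow> polynomial_function (q i)" "\<And>i. i \<in> I \<Longrightarrow> pathfinish (q i) = pathstart (q i)"
    "\<And>i. i \<in> I \<Longrightarrow> path_image (q i) \<subseteq> D"
    "\<And>i g. i \<in> I \<Longrightarrow> g holomorphic_on D \<Longrightarrow> contour_integral (q i) g = contour_integral (p i) g" by metis
  have vq: "valid_path (q i)" if "i \<in> I" for i using q(1)[OF that] valid_path_polynomial_function by blast
  have wq: "contour_integral (q i) (\<lambda>z. 1 / (w - z)) = - (2 * pi * \<i>) * winding_number (p i) w"
    if "i \<in> I" "w \<in> frontier D" for i w
  proof -
    have w: "w \<notin> D" using that(2) fr by blast
    have "contour_integral (q i) (\<lambda>z. 1 / (w - z)) = contour_integral (p i) (\<lambda>z. 1 / (w - z))"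
      by (rule q(4)[OF that(1)]) (use w in \<open>auto intro!: holomorphic_intros\<close>)
    also have "\<dots> = contour_integral (p i) (\<lambda>z. - 1 * (1 / (z - w)))"
      by (rule contour_integral_cong) (auto simp: divide_simps)
    also have "\<dots> = - contour_integral (p i) (\<lambda>z. 1 / (z - w))" by (simp add: contour_integral_neg)
    also have "contour_integral (p i) (\<lambda>z. 1 / (z - w)) = 2 * pi * \<i> * winding_number (p i) w"
      using winding_number_valid_path[OF p(1)[OF that(1)], of w] that(1) w D(2) unfolding M_def P_def by fastforce
    finally show ?thesis by simp
  qed
  have cf: "continuous_on (closed_segment (fst e) (snd e)) f" if "e \<in> E" for e
    using seg[OF that] fr(2) by (intro holomorphic_on_imp_continuous_on holomorphic_on_subset[OF f]) blast
  have int: "(\<lambda>w. f w * winding_number (p i) w) contour_integrable_on linepath (fst e) (snd e)"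
    if "i \<in> I" "e \<in> E" for i e
  proof (intro contour_integrable_continuous_linepath continuous_intros cf[OF that(2)])
    have "closed_segment (fst e) (snd e) \<subseteq> - path_image (p i)"
      using seg[OF that(2)] fr(1) D(2) that(1) unfolding M_def P_def by blast
    then show "continuous_on (closed_segment (fst e) (snd e)) (winding_number (p i))"
      using continuous_on_winding_number[OF path[OF that(1)]] continuous_on_subset by blast
  qed
  have swap: "contour_integral (q i) f = - (\<Sum>e\<in>E. contour_integral (linepath (fst e) (snd e)) (\<lambda>w. f w * winding_number (p i) w))"
    if i: "i \<in> I" for i
  proof -
    have fz: "f z = 1 / (2 * pi * \<i>) * chain_integral E (\<lambda>w. f w / (w - z))" if "z \<in> path_image (q i)" for z
      using D(6)[OF f, of z] q(3)[OF i] that by auto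
    have hol: "(\<lambda>z. contour_integral (linepath (fst e) (snd e)) (\<lambda>w. f w / (w - z))) contour_integrable_on q i" if "e \<in> E" for e
      by (rule contour_integrable_holomorphic_simple[OF _ D(1) vq[OF i] q(3)[OF i]],
          rule holomorphic_on_subset[OF holomorphic_on_linepath_Cauchy_integral[OF cf[OF that]]])
        (use seg[OF that] fr in blast)
    have "contour_integral (q i) f = contour_integral (q i) (\<lambda>z. 1 / (2 * pi * \<i>) * chain_integral E (\<lambda>w. f w / (w - z)))"
      by (rule contour_integral_cong) (use fz in auto)
    also have "\<dots> = 1 / (2 * pi * \<i>) * (\<Sum>e\<in>E. contour_integral (q i)
         (\<lambda>z. contour_integral (linepath (fst e) (snd e)) (\<lambda>w. f w / (w - z))))"
      unfolding chain_integral_def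
      by (subst contour_integral_lmul) (auto simp: contour_integral_sum[OF D(4) hol] intro!: contour_integrable_sum D(4) hol)
    also have "\<dots> = 1 / (2 * pi * \<i>) * (\<Sum>e\<in>E. contour_integral (linepath (fst e) (snd e))
         (\<lambda>w. f w * (- (2 * pi * \<i>) * winding_number (p i) w)))"
    proof (intro arg_cong2[where f = "(*)"] refl sum.cong)
      fix e assume e: "e \<in> E"
      let ?l = "linepath (fst e) (snd e)"
      have "contour_integral (q i) (\<lambda>z. contour_integral ?l (\<lambda>w. f w / (w - z))) =
        contour_integral ?l (\<lambda>w. contour_integral (q i) (\<lambda>z. f w / (w - z)))"
      proof (rule contour_integral_swap[of "q i" ?l "\<lambda>z w. f w / (w - z)"])
        have "w \<noteq> z" if "z \<in> path_image (q i)" "w \<in> closed_segment (fst e) (snd e)" for z w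
          using that q(3)[OF i] seg[OF e] fr(1) by blast
        then show "continuous_on (path_image (q i) \<times> path_image ?l) (\<lambda>(y1, y2). f y2 / (y2 - y1))"
          unfolding split_def
          by (intro continuous_intros continuous_on_compose2[OF cf[OF e]]) auto
        show "valid_path (q i)" "valid_path ?l" using vq[OF i] by auto
        show "continuous_on {0..1} (\<lambda>t. vector_derivative (q i) (at t))"
        proof -
          obtain q' where q': "polynomial_function q'" "\<And>x. (q i has_vector_derivative q' x) (at x)"
            using has_vector_derivative_polynomial_function[OF q(1)[OF i]] by blast
          have "(\<lambda>t. vector_derivative (q i) (at t)) = q'"
            using q'(2) vector_derivative_at by blast
          then show ?thesis by (metis continuous_on_polymonial_function[OF q'(1)])
        qed
      qed simp
      also have "\<dots> = contour_integral ?l (\<lambda>w. f w * (- (2 * pi * \<i>) * winding_number (p i) w))"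
      proof (rule contour_integral_cong[OF refl])
        fix w assume "w \<in> path_image ?l"
        then have w: "w \<in> frontier D" using seg[OF e] by auto
        then have "w \<notin> D" using fr by blast
        have "contour_integral (q i) (\<lambda>z. f w / (w - z)) = contour_integral (q i) (\<lambda>z. f w * (1 / (w - z)))" by simp
        also have "\<dots> = f w * contour_integral (q i) (\<lambda>z. 1 / (w - z))"
          by (rule contour_integral_lmul, rule contour_integrable_holomorphic_simple[OF _ D(1) vq[OF i] q(3)[OF i]])
            (use \<open>w \<notin> D\<close> in \<open>auto intro!: holomorphic_intros\<close>)
        finally show "contour_integral (q i) (\<lambda>z. f w / (w - z)) = f w * (- (2 * pi * \<i>) * winding_number (p i) w)"
          unfolding wq[OF i w] .
      qed
      finally show "contour_integral (q i) (\<lambda>z. contour_integral ?l (\<lambda>w. f w / (w - z))) =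
         contour_integral ?l (\<lambda>w. f w * (- (2 * pi * \<i>) * winding_number (p i) w))" .
    qed
    also have "\<dots> = - (\<Sum>e\<in>E. contour_integral (linepath (fst e) (snd e)) (\<lambda>w. f w * winding_number (p i) w))"
    proof -
      have "contour_integral (linepath (fst e) (snd e)) (\<lambda>w. f w * (- (2 * pi * \<i>) * winding_number (p i) w)) =
        - (2 * pi * \<i>) * contour_integral (linepath (fst e) (snd e)) (\<lambda>w. f w * winding_number (p i) w)"
        if "e \<in> E" for e
        using contour_integral_lmul[OF int[OF i that], of "- (2 * pi * \<i>)"] by (simp add: mult_ac)
      then show ?thesis by (simp add: sum_distrib_left[symmetric] sum_negf)
    qed
    finally show ?thesis .
  qed
  have "D \<subseteq> V" using D(3) closure_subset by (rule subset_trans[rotated])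
  then have "f holomorphic_on D" by (rule holomorphic_on_subset[OF f])
  then have "(\<Sum>i\<in>I. c i * contour_integral (p i) f) = (\<Sum>i\<in>I. c i * contour_integral (q i) f)"
    using q(4)[of _ f] by (intro sum.cong) auto
  also have "\<dots> = - (\<Sum>e\<in>E. \<Sum>i\<in>I. c i * contour_integral (linepath (fst e) (snd e)) (\<lambda>w. f w * winding_number (p i) w))"
    by (subst sum.swap) (simp add: swap sum_distrib_left sum_negf)
  also have "(\<Sum>e\<in>E. \<Sum>i\<in>I. c i * contour_integral (linepath (fst e) (snd e)) (\<lambda>w. f w * winding_number (p i) w)) = 0"
  proof (rule sum.neutral, rule ballI)
    fix e assume e: "e \<in> E"
    have "(\<Sum>i\<in>I. c i * contour_integral (linepath (fst e) (snd e)) (\<lambda>w. f w * winding_number (p i) w)) =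
      contour_integral (linepath (fst e) (snd e)) (\<lambda>w. \<Sum>i\<in>I. c i * (f w * winding_number (p i) w))"
      using int e by (simp add: contour_integral_sum[OF I] contour_integrable_lmul contour_integral_lmul)
    also have "\<dots> = contour_integral (linepath (fst e) (snd e)) (\<lambda>w. 0)"
    proof (rule contour_integral_cong[OF refl])
      fix w assume "w \<in> path_image (linepath (fst e) (snd e))"
      then have "W w = 0" using seg[OF e] fr(1) D(2) unfolding M_def by auto
      moreover have "(\<Sum>i\<in>I. c i * (f w * winding_number (p i) w)) = f w * W w"
        unfolding W_def sum_distrib_left by (intro sum.cong) (auto simp: mult_ac)
      ultimately show "(\<Sum>i\<in>I. c i * (f w * winding_number (p i) w)) = 0" by simp
    qed
    finally show "(\<Sum>i\<in>I. c i * contour_integral (linepath (fst e) (snd e)) (\<lambda>w. f w * winding_number (p i) w)) = 0"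
      by simp
  qed
  finally show ?thesis by simp
qed

section \<open>Linear functionals separating a point from a subspace\<close>

section \<open>The Hahn-Banach theorem\<close>

definition sublinear :: "('b::real_vector \<Rightarrow> real) \<Rightarrow> bool" where
  "sublinear q \<longleftrightarrow> (\<forall>x y. q (x + y) \<le> q x + q y) \<and> (\<forall>c x. c \<ge> 0 \<longrightarrow> q (c *\<^sub>R x) = c * q x)"

lemma sublinearI:
  assumes "\<And>x y. q (x + y) \<le> q x + q y" "q 0 = 0" "\<And>c x. c > 0 \<Longrightarrow> q (c *\<^sub>R x) \<le> c * q x"
  shows "sublinear q"
  unfolding sublinear_def
proof (intro conjI allI impI assms(1))
  fix c :: real and x assume "c \<ge> 0"
  show "q (c *\<^sub>R x) = c * q x"
  proof (cases "c = 0")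
    case False
    then have c: "c > 0" using \<open>c \<ge> 0\<close> by simp
    have "q ((1 / c) *\<^sub>R (c *\<^sub>R x)) \<le> (1 / c) * q (c *\<^sub>R x)" by (rule assms(3)) (use c in simp)
    then have "c * q x \<le> q (c *\<^sub>R x)" using c by (simp add: field_simps)
    then show ?thesis using assms(3)[OF c] by (rule antisym[rotated])
  qed (simp add: assms(2))
qed

lemma sublinear_0: "sublinear q \<Longrightarrow> q 0 = 0"
  unfolding sublinear_def by (metis mult_zero_left order_refl scaleR_zero_left)

lemma sublinear_minus: "sublinear q \<Longrightarrow> - q (- x) \<le> q x"
  using sublinear_0[of q] unfolding sublinear_def by (metis add.right_inverse minus_le_iff neg_le_iff_le le_add_same_cancel1 add.commute diff_ge_0_iff_ge diff_minus_eq_add)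

text \<open>Replacing \<open>q\<close> by \<open>\<lambda>y. INF t\<ge>0. q (y + t x) - t q x\<close> decreases it to a sublinear functional
  that is additive in the direction \<open>x\<close>; hence minimal sublinear functionals are linear.\<close>

lemma sublinear_directional:
  fixes x :: "'b::real_vector"
  assumes q: "sublinear q"
  shows "\<exists>Q. sublinear Q \<and> (\<forall>y. Q y \<le> q y) \<and> (\<forall>y. Q y \<le> q (y + x) - q x)"
proof -
  define F where "F y t = q (y + t *\<^sub>R x) - t * q x" for y t
  define Q where "Q y = (INF t\<in>{0..}. F y t)" for y
  have add: "q (a + b) \<le> q a + q b" for a b using q unfolding sublinear_def by blast
  have hom: "q (c *\<^sub>R a) = c * q a" if "c \<ge> 0" for c a using q that unfolding sublinear_def by blast
  have bdd: "bdd_below (F y ` {0..})" for y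
  proof (rule bdd_belowI2)
    fix t :: real assume "t \<in> {0..}"
    then have "t * q x \<le> q (y + t *\<^sub>R x) + q (- y)"
      using add[of "y + t *\<^sub>R x" "- y"] hom[of t x] by simp
    then show "- q (- y) \<le> F y t" unfolding F_def by linarith
  qed
  have low: "Q y \<le> F y t" if "t \<ge> 0" for y t
    unfolding Q_def by (rule cINF_lower[OF bdd]) (use that in simp)
  have great: "m \<le> Q y" if "\<And>t. t \<ge> 0 \<Longrightarrow> m \<le> F y t" for m y
    unfolding Q_def by (rule cINF_greatest) (use that in auto)
  have "sublinear Q"
  proof (rule sublinearI)
    fix y z
    have "Q (y + z) - F z s \<le> F y t" if "t \<ge> 0" "s \<ge> 0" for s t
    proof -
      have "Q (y + z) \<le> F (y + z) (t + s)" using that by (intro low) simp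
      also have "\<dots> \<le> F y t + F z s"
        using add[of "y + t *\<^sub>R x" "z + s *\<^sub>R x"] unfolding F_def by (simp add: algebra_simps)
      finally show ?thesis by simp
    qed
    then have "Q (y + z) - F z s \<le> Q y" if "s \<ge> 0" for s using that by (intro great) auto
    then have "Q (y + z) - Q y \<le> Q z" by (intro great) (simp add: algebra_simps)
    then show "Q (y + z) \<le> Q y + Q z" by simp
  next
    have "F 0 t = 0" if "t \<ge> 0" for t using hom[OF that] unfolding F_def by simp
    then show "Q 0 = 0" using low[of 0 0] great[of 0 0] by (intro antisym) auto
  next
    fix c :: real and y :: 'b assume c: "c > 0"
    have "Q (c *\<^sub>R y) / c \<le> F y t" if "t \<ge> 0" for t
    proof -
      have "Q (c *\<^sub>R y) \<le> F (c *\<^sub>R y) (c * t)" using that c by (intro low) simp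
      also have "\<dots> = c * F y t"
        using hom[of c "y + t *\<^sub>R x"] c unfolding F_def by (simp add: algebra_simps)
      finally show ?thesis using c by (simp add: field_simps)
    qed
    then have "Q (c *\<^sub>R y) / c \<le> Q y" by (rule great)
    then show "Q (c *\<^sub>R y) \<le> c * Q y" using c by (simp add: field_simps)
  qed
  moreover have "Q y \<le> q y" for y using low[of 0 y] unfolding F_def by simp
  moreover have "Q y \<le> q (y + x) - q x" for y using low[of 1 y] unfolding F_def by simp
  ultimately show ?thesis by blast
qed

text \<open>Zorn's lemma for the reversed pointwise order. The infimum of a chain is finite, because
  every sublinear functional below \<open>p\<close> is at least - p (- y), and it is subadditive,
  because of any two members of the chain one lies below the other and can replace both.\<close>

lemma exists_minimal_sublinear:
  fixes p :: "'b::real_vector \<Rightarrow> real"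
  assumes p: "sublinear p"
  shows "\<exists>q. sublinear q \<and> (\<forall>y. q y \<le> p y) \<and> (\<forall>q'. sublinear q' \<and> (\<forall>y. q' y \<le> q y) \<longrightarrow> q' = q)"
proof -
  define A where "A = {q. sublinear q \<and> (\<forall>y. q y \<le> p y)}"
  define P where "P a b \<longleftrightarrow> (\<forall>y. b y \<le> (a y :: real))" for a b :: "'b \<Rightarrow> real"
  have "\<exists>m\<in>A. \<forall>a\<in>A. P m a \<longrightarrow> a = m"
  proof (rule predicate_Zorn)
    show "partial_order_on A (relation_of P A)"
      unfolding P_def by (rule partial_order_on_relation_ofI) (auto simp: fun_eq_iff intro: order_trans order.antisym)
  next
    fix C assume C: "C \<in> Chains (relation_of P A)"
    have CA: "C \<subseteq> A" using C unfolding Chains_def relation_of_def by auto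
    have tot: "P a b \<or> P b a" if "a \<in> C" "b \<in> C" for a b
      using C that unfolding Chains_def relation_of_def by auto
    show "\<exists>u\<in>A. \<forall>a\<in>C. P a u"
    proof (cases "C = {}")
      case True
      then show ?thesis using p by (auto simp: A_def)
    next
      case False
      define u where "u y = (INF a\<in>C. a y)" for y
      have sub: "sublinear a" "a y \<le> p y" if "a \<in> C" for a y using CA that by (auto simp: A_def)
      have bdd: "bdd_below ((\<lambda>a. a y) ` C)" for y
      proof (rule bdd_belowI2)
        fix a assume "a \<in> C"
        then show "- p (- y) \<le> a y" using sublinear_minus[OF sub(1), of a y] sub(2)[of a "- y"] by fastforce
      qed
      have low: "u y \<le> a y" if "a \<in> C" for y a unfolding u_def by (rule cINF_lower[OF bdd that])
      have great: "m \<le> u y" if "\<And>a. a \<in> C \<Longrightarrow> m \<le> a y" for m y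
        unfolding u_def by (rule cINF_greatest[OF False that])
      obtain a0 where a0: "a0 \<in> C" using False by blast
      have "sublinear u"
      proof (rule sublinearI)
        fix x y
        have "u (x + y) - b y \<le> a x" if ab: "a \<in> C" "b \<in> C" for a b
        proof -
          obtain c where c: "c \<in> C" "c x \<le> a x" "c y \<le> b y" using tot[OF ab] ab unfolding P_def by blast
          have "u (x + y) \<le> c x + c y"
            using low[OF c(1), of "x + y"] sub(1)[OF c(1)] unfolding sublinear_def by (meson order_trans)
          then show ?thesis using c by linarith
        qed
        then have "u (x + y) - b y \<le> u x" if "b \<in> C" for b using that by (intro great) auto
        then have "u (x + y) - u x \<le> u y" by (intro great) (simp add: algebra_simps)
        then show "u (x + y) \<le> u x + u y" by simp
      next
        show "u 0 = 0" 
        proof (rule antisym)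
          show "u 0 \<le> 0" using low[OF a0, of 0] sublinear_0[OF sub(1)[OF a0]] by simp
          show "0 \<le> u 0" by (rule great) (simp add: sublinear_0[OF sub(1)])
        qed
      next
        fix c :: real and x assume c: "c > 0"
        have "u (c *\<^sub>R x) / c \<le> a x" if "a \<in> C" for a
          using low[OF that, of "c *\<^sub>R x"] sub(1)[OF that] c unfolding sublinear_def by (simp add: field_simps)
        then have "u (c *\<^sub>R x) / c \<le> u x" by (rule great)
        then show "u (c *\<^sub>R x) \<le> c * u x" using c by (simp add: field_simps)
      qed
      moreover have "u y \<le> p y" for y using low[OF a0, of y] sub(2)[OF a0, of y] by linarith
      ultimately show ?thesis using low by (intro bexI[of _ u]) (auto simp: A_def P_def)
    qed
  qed
  then obtain q where q: "q \<in> A" and min: "\<forall>a\<in>A. P q a \<longrightarrow> a = q" by (rule bexE)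
  have qs: "sublinear q" "q y \<le> p y" for y using q by (simp_all add: A_def)
  have "q' = q" if q': "sublinear q'" "\<forall>y. q' y \<le> q y" for q'
  proof -
    have "q' y \<le> p y" for y using spec[OF q'(2), of y] qs(2)[of y] by (rule order_trans)
    then have "q' \<in> A" using q'(1) by (simp add: A_def)
    then show "q' = q" using min q'(2) by (simp add: P_def)
  qed
  then show ?thesis using qs by (intro exI[of _ q]) auto
qed

lemma sublinear_infdist:
  fixes S :: "'b::real_normed_vector set"
  assumes S: "subspace S"
  shows "sublinear (\<lambda>y. infdist y S)"
proof -
  have ne: "S \<noteq> {}" using S subspace_0 by blast
  have great: "m \<le> infdist y S" if "\<And>s. s \<in> S \<Longrightarrow> m \<le> dist y s" for m y
    unfolding infdist_notempty[OF ne] by (rule cINF_greatest[OF ne that])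
  show ?thesis
  proof (rule sublinearI)
    fix x y
    have "infdist (x + y) S - dist y t \<le> dist x s" if "s \<in> S" "t \<in> S" for s t
      using infdist_le[OF subspace_add[OF S that], of "x + y"] dist_triangle_add[of x y s t] by linarith
    then have "infdist (x + y) S - dist y t \<le> infdist x S" if "t \<in> S" for t using that by (intro great) auto
    then have "infdist (x + y) S - infdist x S \<le> infdist y S" by (intro great) (simp add: algebra_simps)
    then show "infdist (x + y) S \<le> infdist x S + infdist y S" by simp
  next
    show "infdist 0 S = 0" by (rule infdist_zero[OF subspace_0[OF S]])
  next
    fix c :: real and x assume c: "c > 0"
    have "infdist (c *\<^sub>R x) S / c \<le> dist x s" if "s \<in> S" for s
    proof -
      have "infdist (c *\<^sub>R x) S \<le> dist (c *\<^sub>R x) (c *\<^sub>R s)" using that S by (intro infdist_le subspace_scale)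
      also have "dist (c *\<^sub>R x) (c *\<^sub>R s) = dist x s * c"
        using c by (metis abs_of_pos dist_norm norm_scaleR scaleR_diff_right mult.commute)
      finally show ?thesis using c by (simp add: divide_le_eq)
    qed
    then have "infdist (c *\<^sub>R x) S / c \<le> infdist x S" by (rule great)
    then show "infdist (c *\<^sub>R x) S \<le> c * infdist x S" using c by (simp add: field_simps)
  qed
qed

text \<open>A minimal sublinear functional below the distance to \<open>S\<close> is linear and
  therefore vanishes on \<open>S\<close>. Decreasing the distance once in the direction
  \<open>x\<close> beforehand bounds the value at \<open>- x\<close> by minus the distance of
  \<open>x\<close> from \<open>S\<close>, so the value at \<open>x\<close> cannot vanish.\<close>

theorem Hahn_Banach_separation:
  fixes S :: "'b::real_normed_vector set"
  assumes S: "subspace S" and x: "x \<notin> closure S"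
  obtains \<psi> :: "'b \<Rightarrow> real" where "bounded_linear \<psi>" "\<And>s. s \<in> S \<Longrightarrow> \<psi> s = 0" "\<psi> x \<noteq> 0"
proof -
  let ?p = "\<lambda>y. infdist y S"
  have ne: "S \<noteq> {}" using S subspace_0 by blast
  obtain p0 where p0: "sublinear p0" "\<And>y. p0 y \<le> ?p y" "\<And>y. p0 y \<le> ?p (y + x) - ?p x"
    using sublinear_directional[OF sublinear_infdist[OF S], of x] by blast
  obtain q where q': "sublinear q \<and> (\<forall>y. q y \<le> p0 y) \<and> (\<forall>q'. sublinear q' \<and> (\<forall>y. q' y \<le> q y) \<longrightarrow> q' = q)"
    using exists_minimal_sublinear[OF p0(1)] by (rule exE)
  then have q: "sublinear q" "q y \<le> p0 y" for y by simp_all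
  have add: "q (y + z) = q y + q z" for y z
  proof (rule antisym)
    show "q (y + z) \<le> q y + q z" using q(1) unfolding sublinear_def by blast
    obtain Q where Q: "sublinear Q" "\<And>y. Q y \<le> q y" "\<And>y. Q y \<le> q (y + z) - q z"
      using sublinear_directional[OF q(1), of z] by blast
    have "Q = q" using q' Q(1,2) by simp
    then show "q y + q z \<le> q (y + z)" using Q(3)[of y] by simp
  qed
  have neg: "q (- y) = - q y" for y using add[of y "- y"] sublinear_0[OF q(1)] by simp
  have scale: "q (c *\<^sub>R y) = c * q y" for c y
  proof (cases "c \<ge> 0")
    case False
    then have "- c \<ge> 0" by simp
    then have "q ((- c) *\<^sub>R y) = - c * q y" using q(1) unfolding sublinear_def by blast
    then show ?thesis using neg[of "c *\<^sub>R y"] by simp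
  qed (use q(1) in \<open>simp add: sublinear_def\<close>)
  have le: "q y \<le> ?p y" for y using q(2)[of y] p0(2)[of y] by linarith
  have p_le: "?p y \<le> norm y" for y using infdist_le[OF subspace_0[OF S], of y] by (simp add: dist_norm)
  have bl: "bounded_linear q"
  proof (rule bounded_linear_intro[of _ 1])
    fix y
    have "q y \<le> norm y" "- q y \<le> norm y" using le[of y] le[of "- y"] p_le[of y] p_le[of "- y"] neg[of y] by auto
    then show "norm (q y) \<le> norm y * 1" by simp
  qed (simp_all add: add scale)
  have zero: "q s = 0" if "s \<in> S" for s
    using le[of s] le[of "- s"] neg[of s] that subspace_neg[OF S that] by simp
  have "q (- x) \<le> ?p (- x + x) - ?p x" using q(2)[of "- x"] p0(3)[of "- x"] by linarith
  then have "q (- x) \<le> - ?p x" using subspace_0[OF S] by simp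
  moreover have "?p x > 0" 
    using x in_closure_iff_infdist_zero[OF ne, of x] infdist_nonneg[of x S] by auto
  ultimately have "q x \<noteq> 0" using neg[of x] by linarith
  with bl zero show ?thesis by (rule that)
qed

section \<open>Integration of holomorphic functions with values in a complex Banach space\<close>

section \<open>Weakly holomorphic functions\<close>

text \<open>A complex Banach space is given as a real one with a bounded operator \<open>j\<close>, \<open>j\<^sup>2 = -1\<close>.\<close>

locale complex_structure =
  fixes j :: "'b::banach \<Rightarrow> 'b"
  assumes bounded_linear_j: "bounded_linear j" and jj: "j (j x) = - x"
begin

sublocale j: bounded_linear j by (rule bounded_linear_j)

definition cscale :: "complex \<Rightarrow> 'b \<Rightarrow> 'b" where
  "cscale z x = Re z *\<^sub>R x + Im z *\<^sub>R j x"

definition functional :: "('b \<Rightarrow> complex) \<Rightarrow> bool" where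
  "functional \<phi> \<longleftrightarrow> bounded_linear \<phi> \<and> (\<forall>x. \<phi> (j x) = \<i> * \<phi> x)"

text \<open>Weak holomorphy together with norm continuity. Continuity gives the integrals in norm;
  identities between them are then read off from scalar functions through
  \<open>eq_iff_functional\<close>.\<close>

definition cholo :: "(complex \<Rightarrow> 'b) \<Rightarrow> complex set \<Rightarrow> bool" where
  "cholo h V \<longleftrightarrow> continuous_on V h \<and> (\<forall>\<phi>. functional \<phi> \<longrightarrow> (\<lambda>z. \<phi> (h z)) holomorphic_on V)"

definition cint :: "(real \<Rightarrow> complex) \<Rightarrow> (complex \<Rightarrow> 'b) \<Rightarrow> 'b" where
  "cint \<gamma> h = integral {0..1} (\<lambda>t. cscale (vector_derivative \<gamma> (at t within {0..1})) (h (\<gamma> t)))"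

lemma functional_cscale:
  assumes "functional \<phi>"
  shows "\<phi> (cscale z x) = z * \<phi> x"
proof -
  interpret \<phi>: bounded_linear \<phi> using assms by (simp add: functional_def)
  have "\<phi> (cscale z x) = Re z *\<^sub>R \<phi> x + Im z *\<^sub>R (\<i> * \<phi> x)"
    using assms by (simp add: cscale_def \<phi>.add \<phi>.scaleR functional_def)
  also have "\<dots> = (of_real (Re z) + \<i> * of_real (Im z)) * \<phi> x"
    by (simp add: scaleR_conv_of_real algebra_simps)
  also have "of_real (Re z) + \<i> * of_real (Im z) = z" by (simp add: complex_eq_iff)
  finally show ?thesis .
qed

lemma bounded_bilinear_cscale: "bounded_bilinear cscale"
proof
  obtain K where K: "\<And>x. norm (j x) \<le> norm x * K" using j.bounded by blast
  have "norm (cscale z x) \<le> norm z * norm x * (1 + K)" for z x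
  proof -
    have "norm (cscale z x) \<le> \<bar>Re z\<bar> * norm x + \<bar>Im z\<bar> * norm (j x)"
      unfolding cscale_def by (rule order_trans[OF norm_triangle_ineq]) simp
    also have "\<dots> \<le> cmod z * norm x + cmod z * (norm x * K)"
      by (intro add_mono mult_mono abs_Re_le_cmod abs_Im_le_cmod K) auto
    finally show ?thesis by (simp add: algebra_simps)
  qed
  then show "\<exists>K. \<forall>a b. norm (cscale a b) \<le> norm a * norm b * K" by blast
qed (simp_all add: cscale_def j.add j.scaleR algebra_simps)

sublocale cscale: bounded_bilinear cscale by (rule bounded_bilinear_cscale)

lemma cscale_cscale: "cscale z (cscale w x) = cscale (z * w) x"
  by (simp add: cscale_def j.add j.scaleR jj algebra_simps)

lemma functional_compose:
  assumes "functional \<phi>" "bounded_linear L" "\<And>x. L (j x) = j (L x)"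
  shows "functional (\<lambda>x. \<phi> (L x))"
  using assms bounded_linear_compose[of \<phi> L] by (simp add: functional_def)

text \<open>The usual complexification of a real functional: \<psi> y - \<i> \<psi> (j y) is linear
  with respect to \<open>j\<close> and has real part \<psi>. It still vanishes on \<open>S\<close>
  because \<open>S\<close> is stable under \<open>j\<close>.\<close>

lemma exists_separating_functional:
  assumes S: "subspace S" "\<And>s. s \<in> S \<Longrightarrow> j s \<in> S" and x: "x \<notin> closure S"
  shows "\<exists>\<phi>. functional \<phi> \<and> (\<forall>s\<in>S. \<phi> s = 0) \<and> \<phi> x = 1"
proof -
  obtain \<psi> :: "'b \<Rightarrow> real" where \<psi>: "bounded_linear \<psi>" "\<And>s. s \<in> S \<Longrightarrow> \<psi> s = 0" "\<psi> x \<noteq> 0"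
    using Hahn_Banach_separation[OF S(1) x] by blast
  define \<phi> where "\<phi> y = complex_of_real (\<psi> y) - \<i> * of_real (\<psi> (j y))" for y
  interpret \<psi>: bounded_linear \<psi> by (rule \<psi>(1))
  have bl: "bounded_linear \<phi>" unfolding \<phi>_def
    by (intro bounded_linear_intros bounded_linear_compose[OF bounded_linear_of_real]
      bounded_linear_compose[OF bounded_linear_mult_right] \<psi>(1) bounded_linear_compose[OF \<psi>(1)] bounded_linear_j)
  have "\<psi> (- y) = - \<psi> y" for y using \<psi>.diff[of 0 y] by (simp add: \<psi>.zero)
  then have f: "functional \<phi>" unfolding functional_def
    by (simp add: bl) (simp add: \<phi>_def jj algebra_simps)
  have "Re (\<phi> x) = \<psi> x" by (simp add: \<phi>_def)
  then have nz: "\<phi> x \<noteq> 0" using \<psi>(3) by auto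
  have "functional (\<lambda>y. \<phi> y / \<phi> x)"
    using f bounded_linear_compose[OF bounded_linear_divide bl] by (simp add: functional_def)
  moreover have "\<phi> s = 0" if "s \<in> S" for s using \<psi>(2) S(2) that by (simp add: \<phi>_def)
  ultimately show ?thesis using nz by (intro exI[of _ "\<lambda>y. \<phi> y / \<phi> x"]) simp
qed

lemma eq_iff_functional: "x = y \<longleftrightarrow> (\<forall>\<phi>. functional \<phi> \<longrightarrow> \<phi> x = \<phi> y)"
proof
  assume R: "\<forall>\<phi>. functional \<phi> \<longrightarrow> \<phi> x = \<phi> y"
  show "x = y"
  proof (rule ccontr)
    assume "x \<noteq> y"
    then have "x - y \<notin> closure {0}" by simp
    then obtain \<phi> where \<phi>: "functional \<phi>" "\<phi> (x - y) = 1"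
      using exists_separating_functional[of "{0}" "x - y"] j.zero by (auto simp: subspace_0 subspace_def)
    interpret \<phi>: bounded_linear \<phi> using \<phi>(1) by (simp add: functional_def)
    have "\<phi> x = \<phi> y" using R \<phi>(1) by blast
    then show False using \<phi>(2) by (simp add: \<phi>.diff)
  qed
qed simp

lemma cholo_subset: "cholo h V \<Longrightarrow> W \<subseteq> V \<Longrightarrow> cholo h W"
  unfolding cholo_def using continuous_on_subset holomorphic_on_subset by blast

lemma cholo_cscale:
  assumes "F holomorphic_on V" "cholo h V"
  shows "cholo (\<lambda>z. cscale (F z) (h z)) V"
  using assms unfolding cholo_def
  by (auto simp: functional_cscale intro!: holomorphic_intros cscale.continuous_on holomorphic_on_imp_continuous_on)

lemma cholo_compose:
  assumes "bounded_linear L" "\<And>x. L (j x) = j (L x)" "cholo h V"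
  shows "cholo (\<lambda>z. L (h z)) V"
  using assms(3) functional_compose[OF _ assms(1,2)] unfolding cholo_def
  by (auto intro: bounded_linear.continuous_on[OF assms(1)])

text \<open>The primitive is the integral along segments from the centre of the disc. Path
  independence follows from the scalar theorem under each functional, and norm continuity of
  \<open>h\<close> then yields the derivative in norm, not only weakly.\<close>

lemma cholo_local_primitive:
  assumes h: "cholo h (ball a r)" and r: "r > 0"
  shows "\<exists>G. \<forall>z\<in>ball a r. (G has_derivative (\<lambda>v. cscale v (h z))) (at z)"
proof -
  define I where "I z w = integral {0..1} (\<lambda>t. cscale (w - z) (h (linepath z w t)))" for z w
  have seg: "closed_segment z w \<subseteq> ball a r" if "z \<in> ball a r" "w \<in> ball a r" for z w
    using that by (rule closed_segment_subset) (rule convex_ball)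
  have ch: "continuous_on (ball a r) h" using h by (simp add: cholo_def)
  have cl: "continuous_on {0..1} (\<lambda>t. h (linepath z w t))" if "z \<in> ball a r" "w \<in> ball a r" for z w
    by (rule continuous_on_compose2[OF ch continuous_on_linepath])
      (use seg[OF that] in \<open>auto simp: linepath_image_01[symmetric]\<close>)
  have int: "(\<lambda>t. cscale (w - z) (h (linepath z w t))) integrable_on {0..1}"
    if "z \<in> ball a r" "w \<in> ball a r" for z w
    by (intro integrable_continuous_real cscale.continuous_on continuous_intros cl that)
  have I: "I a w - I a z = I z w" if zw: "z \<in> ball a r" "w \<in> ball a r" for z w
    unfolding eq_iff_functional[of "I a w - I a z"]
  proof (intro allI impI)
    fix \<phi> assume \<phi>: "functional \<phi>"
    interpret \<phi>: bounded_linear \<phi> using \<phi> by (simp add: functional_def)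
    have "(\<lambda>z. \<phi> (h z)) holomorphic_on ball a r" using h \<phi> by (simp add: cholo_def)
    then obtain P where P: "\<And>z. z \<in> ball a r \<Longrightarrow> (P has_field_derivative \<phi> (h z)) (at z within ball a r)"
      using holomorphic_convex_primitive'[of "ball a r" "\<lambda>z. \<phi> (h z)"] by (metis convex_ball open_ball)
    have eq: "\<phi> (I z w) = P w - P z" if zw: "z \<in> ball a r" "w \<in> ball a r" for z w
    proof -
      have "((\<lambda>t. \<phi> (cscale (w - z) (h (linepath z w t)))) has_integral \<phi> (I z w)) {0..1}"
        unfolding I_def
        using has_integral_linear[OF integrable_integral[OF int[OF zw]] \<phi>.bounded_linear_axioms] by (simp add: o_def)
      then have "((\<lambda>z. \<phi> (h z)) has_contour_integral \<phi> (I z w)) (linepath z w)"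
        unfolding has_contour_integral_def
        by (rule has_integral_eq[rotated]) (simp add: functional_cscale[OF \<phi>] vector_derivative_linepath_within)
      moreover have "((\<lambda>z. \<phi> (h z)) has_contour_integral (P w - P z)) (linepath z w)"
        using contour_integral_primitive[OF P, of "linepath z w"] seg[OF zw] by simp
      ultimately show ?thesis by (rule has_contour_integral_unique)
    qed
    show "\<phi> (I a w - I a z) = \<phi> (I z w)" using zw r by (simp add: \<phi>.diff eq)
  qed
  obtain K where K: "K > 0" "\<And>v x. norm (cscale v x) \<le> norm v * norm x * K"
    using cscale.pos_bounded by blast
  have "(I a has_derivative (\<lambda>v. cscale v (h z))) (at z)" if z: "z \<in> ball a r" for z
    unfolding has_derivative_at_alt
  proof (intro conjI allI impI)
    show "bounded_linear (\<lambda>v. cscale v (h z))" by (rule cscale.bounded_linear_left)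
    fix e :: real assume e: "e > 0"
    have "isCont h z" using ch z by (simp add: continuous_on_eq_continuous_at)
    then obtain d1 where d1: "d1 > 0" "\<And>w. dist w z < d1 \<Longrightarrow> dist (h w) (h z) < e / K"
      unfolding continuous_at_eps_delta dist_norm using e K(1) by (metis divide_pos_pos)
    obtain d2 where d2: "d2 > 0" "ball z d2 \<subseteq> ball a r"
      using z open_ball open_contains_ball by blast
    show "\<exists>d>0. \<forall>y. norm (y - z) < d \<longrightarrow> norm (I a y - I a z - cscale (y - z) (h z)) \<le> e * norm (y - z)"
    proof (intro exI[of _ "min d1 d2"] conjI allI impI)
      fix y assume y: "norm (y - z) < min d1 d2"
      then have "y \<in> ball z d2" by (simp add: dist_norm norm_minus_commute)
      then have yb: "y \<in> ball a r" using d2(2) by blast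
      have "I a y - I a z - cscale (y - z) (h z) =
        integral {0..1} (\<lambda>t. cscale (y - z) (h (linepath z y t)) - cscale (y - z) (h z))"
        unfolding I[OF z yb] by (subst integral_diff[OF int[OF z yb]]) (auto simp: I_def)
      also have "norm \<dots> \<le> integral {0..1} (\<lambda>t::real. e * norm (y - z))"
      proof (rule integral_norm_bound_integral)
        fix t :: real assume t: "t \<in> {0..1}"
        have "linepath z y t - z = t *\<^sub>R (y - z)" by (simp add: linepath_def algebra_simps)
        then have "dist (linepath z y t) z \<le> norm (y - z)"
          using t mult_left_le_one_le[of "norm (y - z)" t] by (simp add: dist_norm)
        then have "norm (h (linepath z y t) - h z) \<le> e / K"
          using d1(2)[of "linepath z y t"] y by (simp add: dist_norm less_imp_le)
        then have "norm (y - z) * norm (h (linepath z y t) - h z) * K \<le> norm (y - z) * (e / K) * K"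
          using K(1) by (intro mult_right_mono mult_left_mono) auto
        then have "norm (cscale (y - z) (h (linepath z y t) - h z)) \<le> norm (y - z) * (e / K) * K"
          using K(2) order_trans by blast
        then show "norm (cscale (y - z) (h (linepath z y t)) - cscale (y - z) (h z)) \<le> e * norm (y - z)"
          using K(1) by (simp add: cscale.diff_right mult.commute)
      qed (auto intro: integrable_diff[OF int[OF z yb]])
      finally show "norm (I a y - I a z - cscale (y - z) (h z)) \<le> e * norm (y - z)" by simp
    qed (use d1 d2 in auto)
  qed
  then show ?thesis by blast
qed

text \<open>Locally the integrand is the derivative of a primitive composed with \<gamma>. The
  fundamental theorem of calculus with finitely many exceptional points gives integrability on short
  intervals, and these are pieced together.\<close>

theorem cint_integrable:
  assumes V: "open V" and h: "cholo h V" and \<gamma>: "valid_path \<gamma>" "path_image \<gamma> \<subseteq> V"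
  shows "(\<lambda>t. cscale (vector_derivative \<gamma> (at t within {0..1})) (h (\<gamma> t))) integrable_on {0..1}"
proof -
  obtain S where S: "finite S" "continuous_on {0..1} \<gamma>" "\<And>t. t \<in> {0..1} - S \<Longrightarrow> \<gamma> differentiable (at t within {0..1})"
    using piecewise_C1_imp_differentiable[OF \<gamma>(1)[unfolded valid_path_def]]
    unfolding piecewise_differentiable_on_def by blast
  have "\<exists>d>0. \<forall>u v. x \<in> cbox u v \<and> cbox u v \<subseteq> ball x d \<and> cbox u v \<subseteq> cbox 0 1 \<longrightarrow>
     (\<lambda>t. cscale (vector_derivative \<gamma> (at t within {0..1})) (h (\<gamma> t))) integrable_on cbox u v"
    if x: "x \<in> cbox 0 (1::real)" for x
  proof -
    have "\<gamma> x \<in> V" using \<gamma>(2) x unfolding path_image_def by auto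
    then obtain r where r: "r > 0" "ball (\<gamma> x) r \<subseteq> V" using V open_contains_ball by blast
    obtain G where G: "\<And>z. z \<in> ball (\<gamma> x) r \<Longrightarrow> (G has_derivative (\<lambda>v. cscale v (h z))) (at z)"
      using cholo_local_primitive[OF cholo_subset[OF h r(2)] r(1)] by blast
    obtain d where d: "d > 0" "\<And>t. t \<in> {0..1} \<Longrightarrow> dist t x < d \<Longrightarrow> dist (\<gamma> t) (\<gamma> x) < r"
      using S(2) x r(1) unfolding continuous_on_iff by (metis cbox_interval)
    show ?thesis
    proof (intro exI[of _ d] conjI d(1) allI impI)
      fix u v assume uv: "x \<in> cbox u v \<and> cbox u v \<subseteq> ball x d \<and> cbox u v \<subseteq> cbox 0 1"
      have in_ball: "\<gamma> t \<in> ball (\<gamma> x) r" "t \<in> {0..1}" if "t \<in> {u..v}" for t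
      proof -
        have "t \<in> cbox u v" using that by simp
        then have "t \<in> ball x d" "t \<in> cbox 0 1" using uv by blast+
        then show "\<gamma> t \<in> ball (\<gamma> x) r" "t \<in> {0..1}" using d(2)[of t] by (auto simp: dist_commute)
      qed
      have "((\<lambda>t. cscale (vector_derivative \<gamma> (at t within {0..1})) (h (\<gamma> t))) has_integral (G (\<gamma> v) - G (\<gamma> u))) {u..v}"
      proof (rule fundamental_theorem_of_calculus_interior_strong[OF S(1)])
        show "u \<le> v" using uv by auto
        fix t assume t: "t \<in> {u<..<v} - S"
        then have tt: "t \<in> {u..v}" by auto
        have "u \<in> {u..v}" "v \<in> {u..v}" using uv by auto
        then have t01: "0 < t" "t < 1" using in_ball(2)[of u] in_ball(2)[of v] t by auto
        have "\<gamma> differentiable (at t within {0..1})" using S(3) t in_ball(2)[OF tt] by auto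
        then have hv: "(\<gamma> has_vector_derivative vector_derivative \<gamma> (at t within {0..1})) (at t within {0..1})"
          by (rule vector_derivative_works[THEN iffD1])
        have eq: "at t within {0..1} = at t"
          by (rule at_within_interior) (use t01 in \<open>simp add: interior_atLeastAtMost_real\<close>)
        have "(\<gamma> has_vector_derivative vector_derivative \<gamma> (at t within {0..1})) (at t)"
          using hv unfolding eq .
        from vector_derivative_diff_chain_within[OF this, of G "\<lambda>v. cscale v (h (\<gamma> t))"]
        show "((\<lambda>t. G (\<gamma> t)) has_vector_derivative cscale (vector_derivative \<gamma> (at t within {0..1})) (h (\<gamma> t))) (at t)"
          using has_derivative_at_withinI[OF G[OF in_ball(1)[OF tt]]] by (simp add: o_def)
      next
        have "continuous_on (ball (\<gamma> x) r) G"
          using G has_derivative_continuous by (intro continuous_at_imp_continuous_on ballI) blast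
        moreover have "continuous_on {u..v} \<gamma>" using in_ball(2) by (intro continuous_on_subset[OF S(2)]) auto
        ultimately show "continuous_on {u..v} (\<lambda>t. G (\<gamma> t))"
          by (rule continuous_on_compose2) (use in_ball in auto)
      qed
      then show "(\<lambda>t. cscale (vector_derivative \<gamma> (at t within {0..1})) (h (\<gamma> t))) integrable_on cbox u v"
        by (auto simp: integrable_on_def)
    qed
  qed
  then have "(\<lambda>t. cscale (vector_derivative \<gamma> (at t within {0..1})) (h (\<gamma> t))) integrable_on cbox 0 1"
    by (intro integrable_on_little_subintervals ballI)
  then show ?thesis by (simp add: cbox_interval)
qed

lemma functional_cint:
  assumes "open V" "cholo h V" "valid_path \<gamma>" "path_image \<gamma> \<subseteq> V" and \<phi>: "functional \<phi>"
  shows "\<phi> (cint \<gamma> h) = contour_integral \<gamma> (\<lambda>z. \<phi> (h z))"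
proof -
  interpret \<phi>: bounded_linear \<phi> using \<phi> by (simp add: functional_def)
  have "((\<lambda>t. \<phi> (cscale (vector_derivative \<gamma> (at t within {0..1})) (h (\<gamma> t)))) has_integral \<phi> (cint \<gamma> h)) {0..1}"
    unfolding cint_def
    using has_integral_linear[OF integrable_integral[OF cint_integrable[OF assms(1-4)]] \<phi>.bounded_linear_axioms]
    by (simp add: o_def)
  then have "((\<lambda>z. \<phi> (h z)) has_contour_integral \<phi> (cint \<gamma> h)) \<gamma>"
    unfolding has_contour_integral_def
    by (rule has_integral_eq[rotated]) (simp only: functional_cscale[OF \<phi>] mult.commute)
  then show ?thesis by (rule contour_integral_unique[symmetric])
qed

end

section \<open>Bounded operators, inverses, and left multiplication by quaternions\<close>

section \<open>Operators on \<open>X\<close>\<close>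

interpretation oL: bounded_bilinear "(o\<^sub>L) :: ('y::real_normed_vector \<Rightarrow>\<^sub>L 'z::real_normed_vector) \<Rightarrow> ('x::real_normed_vector \<Rightarrow>\<^sub>L 'y) \<Rightarrow> 'x \<Rightarrow>\<^sub>L 'z"
  by (rule bounded_bilinear_blinfun_compose)

lemma id_oL [simp]: "id_blinfun o\<^sub>L A = A" "A o\<^sub>L id_blinfun = A"
  by (auto intro: blinfun_eqI)

lemma oL_assoc: "(A o\<^sub>L B) o\<^sub>L C = A o\<^sub>L (B o\<^sub>L C)"
  by (auto intro: blinfun_eqI)

lemmas oL_ring = oL_assoc oL.add_left oL.add_right oL.diff_left oL.diff_right oL.minus_left
  oL.minus_right oL.scaleR_left oL.scaleR_right oL.zero_left oL.zero_right

definition invertible_op :: "('x::real_normed_vector \<Rightarrow>\<^sub>L 'x) \<Rightarrow> bool" where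
  "invertible_op A \<longleftrightarrow> (\<exists>B. A o\<^sub>L B = id_blinfun \<and> B o\<^sub>L A = id_blinfun)"

lemma invertible_op_compose: "invertible_op A \<Longrightarrow> invertible_op B \<Longrightarrow> invertible_op (A o\<^sub>L B)"
  unfolding invertible_op_def by (metis id_oL(1) oL_assoc)

text \<open>If \<open>C\<close> inverts the product, then \<open>B o\<^sub>L C\<close> is a right
  inverse of \<open>A\<close> and, since the factors commute, \<open>C o\<^sub>L B\<close> is a left
  inverse.\<close>

lemma invertible_op_commuting_factor:
  assumes "A o\<^sub>L B = B o\<^sub>L A" "invertible_op (A o\<^sub>L B)"
  shows "invertible_op A"
proof -
  obtain C where C: "(A o\<^sub>L B) o\<^sub>L C = id_blinfun" "C o\<^sub>L (A o\<^sub>L B) = id_blinfun"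
    using assms(2) unfolding invertible_op_def by blast
  have r: "A o\<^sub>L (B o\<^sub>L C) = id_blinfun" using C(1) by (simp add: oL_assoc)
  have l: "(C o\<^sub>L B) o\<^sub>L A = id_blinfun" using C(2) assms(1) by (simp add: oL_assoc)
  have "C o\<^sub>L B = B o\<^sub>L C" using l r by (metis id_oL oL_assoc)
  then show ?thesis using l r unfolding invertible_op_def by metis
qed

lemma inverse_unique:
  "A o\<^sub>L B = id_blinfun \<Longrightarrow> C o\<^sub>L A = id_blinfun \<Longrightarrow> B = C"
  by (metis id_oL oL_assoc)

lemma Neumann_series:
  fixes A :: "'x::banach \<Rightarrow>\<^sub>L 'x"
  assumes "norm A < 1"
  obtains N where "(id_blinfun - A) o\<^sub>L N = id_blinfun" "N o\<^sub>L (id_blinfun - A) = id_blinfun"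
    "norm N * (1 - norm A) \<le> 1"
proof -
  define P where "P n = ((\<lambda>B. A o\<^sub>L B) ^^ n) id_blinfun" for n
  have PS: "P (Suc n) = A o\<^sub>L P n" for n by (simp add: P_def)
  have PS': "P (Suc n) = P n o\<^sub>L A" for n
  proof (induction n)
    case 0
    show ?case by (simp add: P_def)
  next
    case (Suc n)
    show ?case by (metis PS Suc oL_assoc)
  qed
  have nP: "norm (P n) \<le> norm A ^ n" for n
  proof (induction n)
    case 0
    then show ?case by (simp add: P_def norm_blinfun_id_le)
  next
    case (Suc n)
    then show ?case unfolding PS power_Suc
      by (meson mult_left_mono norm_blinfun_compose norm_ge_zero order_trans)
  qed
  have sg: "summable (\<lambda>n. norm A ^ n)" using assms by (simp add: summable_geometric)
  have sn: "summable (\<lambda>n. norm (P n))" by (rule summable_comparison_test'[OF sg, of 0]) (use nP in auto)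
  then have sP: "summable P" by (rule summable_norm_cancel)
  define N where "N = (\<Sum>n. P n)"
  have AN: "A o\<^sub>L N = (\<Sum>n. P (Suc n))" unfolding N_def PS by (rule bounded_linear.suminf[OF oL.bounded_linear_right sP])
  have NA: "N o\<^sub>L A = (\<Sum>n. P (Suc n))" unfolding N_def PS' by (rule bounded_linear.suminf[OF oL.bounded_linear_left sP])
  have "(\<Sum>n. P (Suc n)) = N - id_blinfun" using suminf_split_head[OF sP] unfolding N_def by (simp add: P_def)
  then have "(id_blinfun - A) o\<^sub>L N = id_blinfun" "N o\<^sub>L (id_blinfun - A) = id_blinfun"
    using AN NA by (simp_all add: oL.diff_left oL.diff_right)
  moreover have "norm N \<le> 1 / (1 - norm A)"
    using order_trans[OF summable_norm[OF sn] suminf_le[OF nP sn sg]] assms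
    unfolding N_def by (simp add: suminf_geometric)
  ultimately show ?thesis using that assms by (simp add: field_simps)
qed

lemma invertible_op_near:
  fixes A B :: "'x::banach \<Rightarrow>\<^sub>L 'x"
  assumes "invertible_op A"
  shows "\<exists>e>0. \<forall>B. norm (B - A) < e \<longrightarrow> invertible_op B"
proof -
  obtain C where C: "A o\<^sub>L C = id_blinfun" "C o\<^sub>L A = id_blinfun" using assms unfolding invertible_op_def by blast
  have "invertible_op B" if "norm (B - A) < 1 / (norm C + 1)" for B
  proof -
    have "norm ((A - B) o\<^sub>L C) \<le> norm (A - B) * norm C" by (rule norm_blinfun_compose)
    also have "\<dots> \<le> norm (A - B) * (norm C + 1)" by (intro mult_left_mono) auto
    also have "\<dots> < 1" using that by (simp add: norm_minus_commute pos_less_divide_eq add_nonneg_pos)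
    finally have "invertible_op (id_blinfun - ((A - B) o\<^sub>L C))"
      using Neumann_series unfolding invertible_op_def by metis
    moreover have "B = (id_blinfun - ((A - B) o\<^sub>L C)) o\<^sub>L A"
      by (simp add: oL.diff_left oL_assoc C)
    ultimately show ?thesis using invertible_op_compose assms by metis
  qed
  then show ?thesis by (intro exI[of _ "1 / (norm C + 1)"]) (auto simp: add_nonneg_pos)
qed

lemma lmul_add: "lmul (p + q) x = lmul p x + lmul q x"
  and lmul_scaleR: "lmul (r *\<^sub>R p) x = r *\<^sub>R lmul p x"
  by (cases p; cases q; cases x; simp add: plus_quat_def scaleR_quat_def algebra_simps)+

lemma Lm_mult: "Lm (p * q) = Lm p o\<^sub>L Lm q"
  by (rule blinfun_eqI) (simp add: Lm_apply lmul_mult)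

lemma Lm_add: "Lm (p + q) = Lm p + Lm q" and Lm_scaleR: "Lm (r *\<^sub>R p) = r *\<^sub>R Lm p"
  and Lm_one: "Lm 1 = id_blinfun"
  by (rule blinfun_eqI, simp add: Lm_apply lmul_add lmul_scaleR lmul_rmul_one blinfun.add_left blinfun.scaleR_left)+

lemma Lm_minus: "Lm (- p) = - Lm p" using Lm_scaleR[of "-1" p] by simp

lemma Lm_diff: "Lm (p - q) = Lm p - Lm q" using Lm_add[of p "- q"] by (simp add: Lm_minus)

lemma Lm_of_real: "Lm (of_real r) = r *\<^sub>R id_blinfun"
  by (simp add: of_real_def Lm_scaleR Lm_one)

lemma bounded_linear_Lm: "bounded_linear (Lm :: quat \<Rightarrow> 'a::real_normed_vector qmod \<Rightarrow>\<^sub>L 'a qmod)"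
proof -
  have "linear (Lm :: quat \<Rightarrow> 'a qmod \<Rightarrow>\<^sub>L 'a qmod)" by (intro linearI Lm_add Lm_scaleR)
  moreover have "q = qRe q *\<^sub>R 1 + qIm1 q *\<^sub>R e1 + qIm2 q *\<^sub>R e2 + qIm3 q *\<^sub>R e3" for q
    by (simp add: quat_eq_iff plus_quat_def scaleR_quat_def one_quat_def e1_def e2_def e3_def)
  then have L: "Lm q = qRe q *\<^sub>R Lm 1 + qIm1 q *\<^sub>R Lm e1 + qIm2 q *\<^sub>R Lm e2 + qIm3 q *\<^sub>R (Lm e3 :: 'a qmod \<Rightarrow>\<^sub>L 'a qmod)" for q
    by (metis Lm_add Lm_scaleR)
  have c: "\<bar>qRe q\<bar> \<le> norm q" "\<bar>qIm1 q\<bar> \<le> norm q" "\<bar>qIm2 q\<bar> \<le> norm q" "\<bar>qIm3 q\<bar> \<le> norm q" for q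
    unfolding norm_quat_def inner_quat_def by (rule real_le_rsqrt, simp add: power2_eq_square)+
  have "norm (Lm q :: 'a qmod \<Rightarrow>\<^sub>L 'a qmod) \<le> norm q * (norm (Lm 1 :: 'a qmod \<Rightarrow>\<^sub>L 'a qmod) + norm (Lm e1 :: 'a qmod \<Rightarrow>\<^sub>L 'a qmod)
     + norm (Lm e2 :: 'a qmod \<Rightarrow>\<^sub>L 'a qmod) + norm (Lm e3 :: 'a qmod \<Rightarrow>\<^sub>L 'a qmod))" for q
    unfolding distrib_left
    by (subst L, intro norm_triangle_mono) (simp_all add: mult_right_mono c)
  ultimately show ?thesis by (intro bounded_linear_intro) (auto simp: Lm_add Lm_scaleR)
qed

lemma lift_op_Lm: "lift_op A o\<^sub>L Lm q = Lm q o\<^sub>L lift_op A"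
proof (rule blinfun_eqI)
  fix x :: "'a qmod"
  obtain a b c d where "x = (a, b, c, d)" by (cases x)
  then show "(lift_op A o\<^sub>L Lm q) x = (Lm q o\<^sub>L lift_op A) x"
    by (cases q) (simp add: Lm_apply lift_op_apply blinfun.add_right blinfun.diff_right blinfun.scaleR_right)
qed

lemma lift_op_compose: "lift_op (A o\<^sub>L B) = lift_op A o\<^sub>L lift_op B"
  and lift_op_minus: "lift_op (- A) = - lift_op A"
  and lift_op_zero: "lift_op 0 = 0"
  by (rule blinfun_eqI, auto simp: lift_op_apply blinfun.add_left blinfun.minus_left zero_prod_def)+

lemma right_linear_ops_intros:
  fixes A :: "'a::real_normed_vector \<Rightarrow>\<^sub>L 'a" and B C :: "'a qmod \<Rightarrow>\<^sub>L 'a qmod"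
  shows "(Lm q :: 'a qmod \<Rightarrow>\<^sub>L 'a qmod) \<in> right_linear_ops" "lift_op A \<in> right_linear_ops"
  "B \<in> right_linear_ops \<Longrightarrow> C \<in> right_linear_ops \<Longrightarrow> B + C \<in> right_linear_ops"
  "B \<in> right_linear_ops \<Longrightarrow> C \<in> right_linear_ops \<Longrightarrow> B - C \<in> right_linear_ops"
  "B \<in> right_linear_ops \<Longrightarrow> C \<in> right_linear_ops \<Longrightarrow> B o\<^sub>L C \<in> right_linear_ops"
  "B \<in> right_linear_ops \<Longrightarrow> r *\<^sub>R B \<in> right_linear_ops"
  "(id_blinfun :: 'a qmod \<Rightarrow>\<^sub>L 'a qmod) \<in> right_linear_ops"
proof -
  have add: "rmul (x + y) q = rmul x q + rmul y q" and sc: "rmul (r *\<^sub>R x) q = r *\<^sub>R rmul x q"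
    for x y :: "'a qmod" and q r
    by (cases q; cases x; cases y; simp add: algebra_simps)+
  have diff: "rmul (x - y) q = rmul x q - rmul y q" for x y :: "'a qmod" and q
    using add[of x "(-1) *\<^sub>R y" q] sc[of "-1" y q] by simp
  show "(Lm q :: 'a qmod \<Rightarrow>\<^sub>L 'a qmod) \<in> right_linear_ops" by (simp add: right_linear_ops_def Lm_apply lmul_rmul)
  show "lift_op A \<in> right_linear_ops" unfolding right_linear_ops_def
  proof (safe)
    fix a b c d and q :: quat
    show "lift_op A (rmul (a, b, c, d) q) = rmul (lift_op A (a, b, c, d)) q"
      by (cases q) (simp add: lift_op_apply blinfun.add_right blinfun.diff_right blinfun.scaleR_right)
  qed
  show "B \<in> right_linear_ops \<Longrightarrow> C \<in> right_linear_ops \<Longrightarrow> B + C \<in> right_linear_ops"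
  "B \<in> right_linear_ops \<Longrightarrow> C \<in> right_linear_ops \<Longrightarrow> B - C \<in> right_linear_ops"
  "B \<in> right_linear_ops \<Longrightarrow> C \<in> right_linear_ops \<Longrightarrow> B o\<^sub>L C \<in> right_linear_ops"
  "B \<in> right_linear_ops \<Longrightarrow> r *\<^sub>R B \<in> right_linear_ops"
  "(id_blinfun :: 'a qmod \<Rightarrow>\<^sub>L 'a qmod) \<in> right_linear_ops"
    unfolding right_linear_ops_def
    by (simp_all add: blinfun.add_left blinfun.diff_left blinfun.scaleR_left add sc diff del: split_paired_All)
qed

text \<open>The two-sided inverse of a right linear operator is itself right linear, which reduces
  questions about \<open>is_inverse_op\<close> to \<open>invertible_op\<close>.\<close>

lemma is_inverse_op_iff:
  fixes A :: "'a::real_normed_vector qmod \<Rightarrow>\<^sub>L 'a qmod"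
  assumes A: "A \<in> right_linear_ops"
  shows "is_inverse_op A B \<longleftrightarrow> A o\<^sub>L B = id_blinfun \<and> B o\<^sub>L A = id_blinfun"
proof -
  have "B \<in> right_linear_ops" if "A o\<^sub>L B = id_blinfun" "B o\<^sub>L A = id_blinfun"
    unfolding right_linear_ops_def
  proof safe
    fix a b c d :: 'a and q
    let ?x = "(a, b, c, d)"
    have AB: "A (B y) = y" "B (A y) = y" for y :: "'a qmod"
      using arg_cong[OF that(1), of "\<lambda>F. blinfun_apply F y"] arg_cong[OF that(2), of "\<lambda>F. blinfun_apply F y"]
      by simp_all
    have "A (rmul (B ?x) q) = rmul ?x q" using A AB(1) unfolding right_linear_ops_def by (simp del: split_paired_All)
    then show "B (rmul ?x q) = rmul (B ?x) q" using AB(2) by metis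
  qed
  then show ?thesis unfolding is_inverse_op_def by blast
qed

lemma inv_op_inverse:
  assumes "A \<in> right_linear_ops" "invertible_op A"
  shows "A o\<^sub>L inv_op A = id_blinfun" "inv_op A o\<^sub>L A = id_blinfun"
proof -
  obtain B where B: "is_inverse_op A B" using assms unfolding invertible_op_def is_inverse_op_iff[OF assms(1)] by blast
  have "is_inverse_op A (inv_op A)"
    unfolding inv_op_def by (rule theI[of _ B]) (use B is_inverse_op_iff[OF assms(1)] inverse_unique in metis)+
  then show "A o\<^sub>L inv_op A = id_blinfun" "inv_op A o\<^sub>L A = id_blinfun"
    unfolding is_inverse_op_iff[OF assms(1)] by auto
qed

section \<open>Slices\<close>

lemma imag_units_iff: "J \<in> imag_units \<longleftrightarrow> qRe J = 0 \<and> qIm1 J ^ 2 + qIm2 J ^ 2 + qIm3 J ^ 2 = 1"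
proof (cases J)
  case (Quat a b c d)
  show ?thesis
  proof
    assume "J \<in> imag_units"
    then have *: "a * a - b * b - c * c - d * d = -1" "a * b = 0" "a * c = 0" "a * d = 0"
      unfolding imag_units_def Quat by (auto simp: times_quat_def one_quat_def uminus_quat_def)
    have "a = 0"
    proof (rule ccontr)
      assume "a \<noteq> 0"
      then have "b = 0" "c = 0" "d = 0" using * by auto
      then have "a * a = -1" using *(1) by simp
      then show False using zero_le_square[of a] by linarith
    qed
    then show "qRe J = 0 \<and> qIm1 J ^ 2 + qIm2 J ^ 2 + qIm3 J ^ 2 = 1"
      using *(1) Quat by (simp add: power2_eq_square)
  qed (simp add: Quat imag_units_def times_quat_def one_quat_def uminus_quat_def power2_eq_square algebra_simps)
qed

lemma e_imag_units [simp]: "e1 \<in> imag_units" "e2 \<in> imag_units" "e3 \<in> imag_units"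
  by (simp_all add: imag_units_def quat_units)

lemma imag_units_minus [simp]: "- J \<in> imag_units \<longleftrightarrow> J \<in> imag_units"
  by (simp add: imag_units_def)

lemma imag_unitsD: "J \<in> imag_units \<Longrightarrow> J * J = -1" by (simp add: imag_units_def)

lemma slice_pt_0 [simp]: "slice_pt J 0 = 0" and slice_pt_1 [simp]: "slice_pt J 1 = 1"
  and slice_pt_i [simp]: "slice_pt J \<i> = J"
  and slice_pt_add: "slice_pt J (z + w) = slice_pt J z + slice_pt J w"
  and slice_pt_minus: "slice_pt J (- z) = - slice_pt J z"
  and slice_pt_of_real: "slice_pt J (of_real r) = of_real r"
  and slice_pt_cnj: "slice_pt J (cnj z) = slice_pt (- J) z"
  by (simp_all add: slice_pt_def algebra_simps)

lemma slice_pt_mult: "J \<in> imag_units \<Longrightarrow> slice_pt J (z * w) = slice_pt J z * slice_pt J w"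
  using imag_unitsD[of J] by (simp add: slice_pt_def of_real_def algebra_simps)

lemma qRe_slice_pt: "J \<in> imag_units \<Longrightarrow> qRe (slice_pt J z) = Re z"
  by (simp add: imag_units_iff slice_pt_def of_real_def plus_quat_def scaleR_quat_def one_quat_def)

lemma norm_slice_pt: "J \<in> imag_units \<Longrightarrow> norm (slice_pt J z) = cmod z"
proof -
  assume J: "J \<in> imag_units"
  have "(Im z * qIm1 J)\<^sup>2 + (Im z * qIm2 J)\<^sup>2 + (Im z * qIm3 J)\<^sup>2 = (Im z)\<^sup>2 * (qIm1 J ^ 2 + qIm2 J ^ 2 + qIm3 J ^ 2)"
    by (simp add: power_mult_distrib algebra_simps)
  then have "(Im z * qIm1 J)\<^sup>2 + (Im z * qIm2 J)\<^sup>2 + (Im z * qIm3 J)\<^sup>2 = (Im z)\<^sup>2"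
    using J by (simp add: imag_units_iff)
  then show ?thesis
    using J by (simp add: imag_units_iff norm_quat_def inner_quat_def slice_pt_def of_real_def plus_quat_def
      scaleR_quat_def one_quat_def cmod_def power2_eq_square add.assoc)
qed

lemma quat_slice_cases:
  obtains J z where "J \<in> imag_units" "q = slice_pt J z"
proof (cases q)
  case (Quat a b c d)
  define v where "v = sqrt (b^2 + c^2 + d^2)"
  have v2: "v^2 = b^2 + c^2 + d^2" unfolding v_def by simp
  show ?thesis
  proof (cases "v = 0")
    case True
    then have "b^2 = 0" "c^2 = 0" "d^2 = 0" using v2 by (smt (verit) power_zero_numeral zero_le_power2)+
    then show ?thesis using that[of e1 "Complex a 0"] Quat
      by (simp add: slice_pt_def of_real_def scaleR_quat_def one_quat_def zero_quat_def plus_quat_def)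
  next
    case False
    then have "v^2 \<noteq> 0" by simp
    then have nz: "b^2 + c^2 + d^2 \<noteq> 0" unfolding v2 .
    have "Quat 0 (b / v) (c / v) (d / v) \<in> imag_units"
      using nz v2 by (simp add: imag_units_iff power_divide add_divide_distrib[symmetric])
    then show ?thesis using that[of "Quat 0 (b / v) (c / v) (d / v)" "Complex a v"] Quat False
      by (simp add: slice_pt_def of_real_def scaleR_quat_def one_quat_def zero_quat_def plus_quat_def)
  qed
qed

lemma axially_symmetric_slice:
  assumes "axially_symmetric U" "I \<in> imag_units" "J \<in> imag_units"
  shows "slice I U = slice J U"
  using assms unfolding axially_symmetric_def slice_def by blast

section \<open>Commuting components: invertibility and holomorphy of the inverse \<open>Y\<close> of
  \<open>Qc\<close>\<close>

section \<open>The resolvent of the modified operator\<close>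

text \<open>The identity g - B = g (A - f) B first bounds the left inverses by twice the norm of
  \<open>B\<close>, once the norm of \<open>f - A\<close> times that of \<open>B\<close> is below
  1/2, and then gives convergence.\<close>

lemma tendsto_inverse_op:
  fixes A :: "'x::real_normed_vector \<Rightarrow>\<^sub>L 'x"
  assumes f: "(f \<longlongrightarrow> A) F" and g: "eventually (\<lambda>w. g w o\<^sub>L f w = id_blinfun) F" and B: "A o\<^sub>L B = id_blinfun"
  shows "(g \<longlongrightarrow> B) F"
proof -
  have "((\<lambda>w. norm (f w - A) * norm B) \<longlongrightarrow> norm (A - A) * norm B) F" by (intro tendsto_intros f)
  then have "eventually (\<lambda>w. norm (f w - A) * norm B < 1/2) F" by (rule order_tendstoD(2)) simp
  with g have "eventually (\<lambda>w. norm (g w - B) \<le> 2 * norm B * norm (f w - A) * norm B) F"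
  proof eventually_elim
    case (elim w)
    have eq: "g w - B = g w o\<^sub>L ((A - f w) o\<^sub>L B)"
      using elim(1) by (simp add: oL_ring B flip: oL_assoc[of "g w" "f w"])
    have le: "norm (g w - B) \<le> norm (g w) * (norm (f w - A) * norm B)"
      unfolding eq norm_minus_commute[of "f w"]
      by (meson mult_left_mono norm_blinfun_compose norm_ge_zero order_trans)
    also have "\<dots> \<le> norm (g w) * (1/2)" using elim(2) by (intro mult_left_mono) auto
    finally have "norm (g w) \<le> 2 * norm B" using norm_triangle_ineq2[of "g w" B] by linarith
    then have "norm (g w) * (norm (f w - A) * norm B) \<le> 2 * norm B * (norm (f w - A) * norm B)"
      by (intro mult_right_mono) auto
    then show ?case using le by (simp add: mult.assoc)
  qed
  moreover have "((\<lambda>w. 2 * norm B * norm (f w - A) * norm B) \<longlongrightarrow> 2 * norm B * norm (A - A) * norm B) F"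
    by (intro tendsto_intros f)
  then have "((\<lambda>w. 2 * norm B * norm (f w - A) * norm B) \<longlongrightarrow> 0) F" by simp
  ultimately have "((\<lambda>w. g w - B) \<longlongrightarrow> 0) F" by (rule Lim_null_comparison)
  then show ?thesis by (rule LIM_zero_cancel)
qed

locale commuting_triple =
  fixes T0 T1 T2 :: "'a::banach \<Rightarrow>\<^sub>L 'a"
  assumes comm: "T0 o\<^sub>L T1 = T1 o\<^sub>L T0" "T0 o\<^sub>L T2 = T2 o\<^sub>L T0" "T1 o\<^sub>L T2 = T2 o\<^sub>L T1"
begin

definition t0 :: "'a qmod \<Rightarrow>\<^sub>L 'a qmod" where "t0 = lift_op T0"
definition t1 :: "'a qmod \<Rightarrow>\<^sub>L 'a qmod" where "t1 = lift_op T1"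
definition t2 :: "'a qmod \<Rightarrow>\<^sub>L 'a qmod" where "t2 = lift_op T2"
text \<open>This is - V V, the squared modulus of the vector part of \<open>T\<close>. Unlike
  \<open>V\<close> it commutes with all left multiplications, which is why \<open>Qc\<close> can be
  treated on every slice as a quadratic polynomial with commuting coefficients.\<close>

definition R :: "'a qmod \<Rightarrow>\<^sub>L 'a qmod" where "R = (t1 o\<^sub>L t1) + (t2 o\<^sub>L t2)"
definition V :: "'a qmod \<Rightarrow>\<^sub>L 'a qmod" where "V = (t1 o\<^sub>L Lm e1) + (t2 o\<^sub>L Lm e2)"
definition T :: "'a qmod \<Rightarrow>\<^sub>L 'a qmod" where "T = quat_op T0 T1 T2 0"
definition Y :: "quat \<Rightarrow> 'a qmod \<Rightarrow>\<^sub>L 'a qmod" where "Y s = inv_op (Qc s T)"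
definition K :: "complex set" where "K = slice e1 (S_spectrum T)"
text \<open>The operator from \<open>S_resolvent_set\<close> at a point with slice coordinate
  \<open>z\<close>. It involves only the real part and modulus of \<open>z\<close>, so the slices of
  the S-spectrum in all units coincide with \<open>K\<close>.\<close>

definition N :: "complex \<Rightarrow> 'a qmod \<Rightarrow>\<^sub>L 'a qmod" where
  "N z = (T o\<^sub>L T) - (2 * Re z) *\<^sub>R T + (cmod z)\<^sup>2 *\<^sub>R id_blinfun"

lemma t_comm: "t1 o\<^sub>L t0 = t0 o\<^sub>L t1" "t2 o\<^sub>L t0 = t0 o\<^sub>L t2" "t2 o\<^sub>L t1 = t1 o\<^sub>L t2"
  using comm by (simp_all add: t0_def t1_def t2_def flip: lift_op_compose)

lemma t_Lm: "t0 o\<^sub>L Lm q = Lm q o\<^sub>L t0" "t1 o\<^sub>L Lm q = Lm q o\<^sub>L t1" "t2 o\<^sub>L Lm q = Lm q o\<^sub>L t2"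
  by (simp_all add: t0_def t1_def t2_def lift_op_Lm)

lemma comm_left: "(A o\<^sub>L B) = (B o\<^sub>L A) \<Longrightarrow> A o\<^sub>L (B o\<^sub>L C) = B o\<^sub>L (A o\<^sub>L C)"
  by (metis oL_assoc)

lemmas t_rules = t_comm t_Lm t_comm[THEN comm_left] t_Lm[THEN comm_left]

lemma T_eq: "T = t0 + V"
  by (simp add: T_def quat_op_def t0_def V_def t1_def t2_def lift_op_zero oL_ring)

lemma conj_T: "conj_op T = t0 - V"
  unfolding conj_op_def T_def comp_quat_op
  by (simp add: quat_op_def t0_def V_def t1_def t2_def lift_op_zero lift_op_minus oL_ring)

lemma R_comm: "R o\<^sub>L t0 = t0 o\<^sub>L R" "R o\<^sub>L Lm q = Lm q o\<^sub>L R" "R o\<^sub>L t1 = t1 o\<^sub>L R" "R o\<^sub>L t2 = t2 o\<^sub>L R"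
  unfolding R_def by (simp_all add: oL_ring t_rules)

lemma V_t0: "V o\<^sub>L t0 = t0 o\<^sub>L V"
  unfolding V_def by (simp add: oL_ring t_rules)

lemma R_V: "R o\<^sub>L V = V o\<^sub>L R"
  unfolding V_def by (simp add: oL_ring R_comm R_comm[THEN comm_left])

lemma V_V: "V o\<^sub>L V = - R"
proof -
  have "Lm e1 o\<^sub>L Lm e1 = - (id_blinfun :: 'a qmod \<Rightarrow>\<^sub>L 'a qmod)" "Lm e2 o\<^sub>L Lm e2 = - (id_blinfun :: 'a qmod \<Rightarrow>\<^sub>L 'a qmod)"
    "Lm e2 o\<^sub>L Lm e1 = - (Lm e1 o\<^sub>L Lm e2 :: 'a qmod \<Rightarrow>\<^sub>L 'a qmod)"
    by (simp_all add: Lm_mult[symmetric] quat_units Lm_minus Lm_one)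
  then have L: "Lm e1 o\<^sub>L (Lm e1 o\<^sub>L A) = - A" "Lm e2 o\<^sub>L (Lm e2 o\<^sub>L A) = - A"
    "Lm e2 o\<^sub>L (Lm e1 o\<^sub>L A) = - (Lm e1 o\<^sub>L (Lm e2 o\<^sub>L A))" for A :: "'a qmod \<Rightarrow>\<^sub>L 'a qmod"
    by (simp_all add: oL_assoc[symmetric] oL.minus_left)
  show ?thesis
    unfolding V_def R_def by (simp add: oL_ring t_Lm t_rules(4-6) t_Lm[THEN comm_left] L t_comm)
qed

text \<open>The sum of \<open>T\<close> and its conjugate is 2 t0 and their product is t0 t0 + R, so
  the quadratic expression can be completed to a square.\<close>

lemma Qc_eq: "Qc s T = ((Lm s - t0) o\<^sub>L (Lm s - t0)) + R"
  unfolding Qc_def conj_T unfolding T_eq by (simp add: oL_ring V_t0 V_V t_Lm Lm_mult scaleR_2 algebra_simps)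

lemma right_linear: "t0 \<in> right_linear_ops" "V \<in> right_linear_ops" "R \<in> right_linear_ops" "T \<in> right_linear_ops"
  "Qc s T \<in> right_linear_ops" "N z \<in> right_linear_ops"
proof -
  show 1: "t0 \<in> right_linear_ops" "V \<in> right_linear_ops" "R \<in> right_linear_ops"
    unfolding t0_def V_def R_def t1_def t2_def by (intro right_linear_ops_intros)+
  then show 2: "T \<in> right_linear_ops" unfolding T_eq by (intro right_linear_ops_intros)
  show "Qc s T \<in> right_linear_ops" "N z \<in> right_linear_ops"
    unfolding Qc_eq N_def by (intro right_linear_ops_intros 1 2)+
qed

lemma slice_S_spectrum:
  assumes J: "J \<in> imag_units"
  shows "z \<in> slice J (S_spectrum T) \<longleftrightarrow> \<not> invertible_op (N z)"
proof -
  have "N z = (T o\<^sub>L T) - (2 * qRe (slice_pt J z)) *\<^sub>R T + (norm (slice_pt J z))\<^sup>2 *\<^sub>R id_blinfun"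
    unfolding N_def qRe_slice_pt[OF J] norm_slice_pt[OF J] ..
  then show ?thesis
    using is_inverse_op_iff[OF right_linear(6)[of z]]
    unfolding slice_def S_spectrum_def S_resolvent_set_def invertible_op_def by auto
qed

lemma K_iff: "z \<in> K \<longleftrightarrow> \<not> invertible_op (N z)"
  unfolding K_def by (rule slice_S_spectrum) simp

lemma slice_spectrum_eq_K: "J \<in> imag_units \<Longrightarrow> slice J (S_spectrum T) = K"
  using slice_S_spectrum K_iff by blast

lemma cnj_K: "cnj ` K \<subseteq> K"
  by (auto simp: K_iff N_def)

lemma compact_K: "compact K"
proof -
  have "open (- K)"
  proof (subst open_subopen, safe)
    fix z assume "z \<notin> K"
    then obtain e where e: "e > 0" "\<And>B. norm (B - N z) < e \<Longrightarrow> invertible_op B"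
      using invertible_op_near unfolding K_iff by blast
    have "continuous_on UNIV N" unfolding N_def by (intro continuous_intros)
    then have "open (N -` ball (N z) e)" by (intro open_vimage) auto
    moreover have "N -` ball (N z) e \<subseteq> - K"
      using e(2) by (auto simp: K_iff dist_norm norm_minus_commute)
    ultimately show "\<exists>S. open S \<and> z \<in> S \<and> S \<subseteq> - K" using e(1) by (intro exI[of _ "N -` ball (N z) e"]) auto
  qed
  \<comment> \<open>For |z| = r beyond this radius, 2 r |T| + r |T|^2 is smaller than r^2, so
    \<open>N z\<close> is r^2 times a Neumann perturbation of the identity.\<close>
  moreover have "K \<subseteq> cball 0 (2 * norm T + norm T ^ 2 + 1)"
  proof
    fix z assume zK: "z \<in> K"
    show "z \<in> cball 0 (2 * norm T + norm T ^ 2 + 1)"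
    proof (rule ccontr)
      define r where "r = cmod z"
      assume "z \<notin> cball 0 (2 * norm T + norm T ^ 2 + 1)"
      then have r: "r > 2 * norm T + norm T ^ 2 + 1" by (simp add: r_def)
      then have r1: "r > 1" by (smt (verit) norm_ge_zero zero_le_power2)
      define A where "A = (1 / r\<^sup>2) *\<^sub>R ((2 * Re z) *\<^sub>R T - (T o\<^sub>L T))"
      have "norm ((2 * Re z) *\<^sub>R T - (T o\<^sub>L T)) \<le> norm ((2 * Re z) *\<^sub>R T) + norm (T o\<^sub>L T)"
        by (rule norm_triangle_ineq4)
      also have "\<dots> \<le> 2 * r * norm T + r * norm T ^ 2"
      proof (rule add_mono)
        show "norm ((2 * Re z) *\<^sub>R T) \<le> 2 * r * norm T"
          using abs_Re_le_cmod[of z] by (simp add: r_def mult_right_mono)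
        have "norm (T o\<^sub>L T) \<le> 1 * norm T ^ 2" using norm_blinfun_compose[of T T] by (simp add: power2_eq_square)
        also have "\<dots> \<le> r * norm T ^ 2" using r1 by (intro mult_right_mono) auto
        finally show "norm (T o\<^sub>L T) \<le> r * norm T ^ 2" .
      qed
      also have "\<dots> = r * (2 * norm T + norm T ^ 2)" by (simp add: algebra_simps)
      also have "\<dots> < r\<^sup>2" using r r1 by (simp add: power2_eq_square)
      finally have "norm A < 1" unfolding A_def using r1 by (simp add: divide_less_eq)
      then have "invertible_op (id_blinfun - A)" using Neumann_series unfolding invertible_op_def by metis
      moreover have "invertible_op (r\<^sup>2 *\<^sub>R id_blinfun :: 'a qmod \<Rightarrow>\<^sub>L 'a qmod)"
        unfolding invertible_op_def using r1
        by (intro exI[of _ "(1 / r\<^sup>2) *\<^sub>R id_blinfun"]) (simp add: oL.scaleR_left oL.scaleR_right)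
      ultimately have "invertible_op ((r\<^sup>2 *\<^sub>R id_blinfun) o\<^sub>L (id_blinfun - A))" by (rule invertible_op_compose[rotated])
      also have "(r\<^sup>2 *\<^sub>R id_blinfun) o\<^sub>L (id_blinfun - A) = N z"
        using r1 by (simp add: A_def N_def oL_ring r_def[symmetric] algebra_simps)
      finally show False using zK K_iff by blast
    qed
  qed
  then have "bounded K" using bounded_cball bounded_subset by blast
  ultimately show ?thesis by (simp add: compact_eq_bounded_closed closed_def)
qed

text \<open>The S-spectrum is defined through \<open>N\<close>, the kernels through
  \<open>Qc\<close>. Let \<open>N'\<close> arise from \<open>N z\<close> by replacing
  \<open>V\<close> with \<open>- V\<close>. Then the product of \<open>N z\<close> and
  \<open>N'\<close> equals the product of \<open>Qc\<close> at the two conjugate points. Since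
  \<open>e3\<close> anticommutes with \<open>e1\<close> and \<open>e2\<close>, conjugation by it
  maps \<open>N z\<close> to \<open>N'\<close>, so \<open>N'\<close> is invertible as well; and a
  commuting factor of an invertible product is invertible.\<close>

lemma Qc_invertible:
  assumes J: "J \<in> imag_units" and z: "z \<notin> K"
  shows "invertible_op (Qc (slice_pt J z) T)"
proof -
  define u v m where "u = Re z" and "v = Im z" and "m = (Lm J :: 'a qmod \<Rightarrow>\<^sub>L 'a qmod)"
  define t where "t = t0 - u *\<^sub>R id_blinfun"
  have mm: "m o\<^sub>L m = - id_blinfun" using J by (simp add: m_def Lm_mult[symmetric] imag_unitsD Lm_minus Lm_one)
  have rules: "V o\<^sub>L t = t o\<^sub>L V" "R o\<^sub>L t = t o\<^sub>L R" "R o\<^sub>L V = V o\<^sub>L R" "V o\<^sub>L V = - R"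
    "t o\<^sub>L m = m o\<^sub>L t" "R o\<^sub>L m = m o\<^sub>L R" "m o\<^sub>L m = - id_blinfun"
    unfolding t_def m_def using mm V_t0 R_comm R_V V_V t_Lm by (simp_all add: oL_ring m_def)
  have left: "V o\<^sub>L (t o\<^sub>L A) = t o\<^sub>L (V o\<^sub>L A)" "R o\<^sub>L (t o\<^sub>L A) = t o\<^sub>L (R o\<^sub>L A)"
    "R o\<^sub>L (V o\<^sub>L A) = V o\<^sub>L (R o\<^sub>L A)" "V o\<^sub>L (V o\<^sub>L A) = - (R o\<^sub>L A)" "t o\<^sub>L (m o\<^sub>L A) = m o\<^sub>L (t o\<^sub>L A)"
    "R o\<^sub>L (m o\<^sub>L A) = m o\<^sub>L (R o\<^sub>L A)" "m o\<^sub>L (m o\<^sub>L A) = - A" for A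
    using rules by (simp_all add: oL_assoc[symmetric] oL.minus_left)
  have Ls: "Lm (slice_pt J z) = u *\<^sub>R id_blinfun + v *\<^sub>R m"
    by (simp add: slice_pt_def u_def v_def m_def Lm_add Lm_of_real Lm_scaleR)
  have Lsc: "Lm (slice_pt J (cnj z)) = u *\<^sub>R id_blinfun - v *\<^sub>R m"
    by (simp add: slice_pt_def u_def v_def m_def Lm_diff Lm_minus Lm_add Lm_of_real Lm_scaleR)
  have Q: "Qc (slice_pt J z) T = ((v *\<^sub>R m - t) o\<^sub>L (v *\<^sub>R m - t)) + R"
    "Qc (slice_pt J (cnj z)) T = ((v *\<^sub>R m + t) o\<^sub>L (v *\<^sub>R m + t)) + R"
    unfolding Qc_eq Ls Lsc t_def by (simp_all add: oL_ring algebra_simps)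
  have cm: "(cmod z)\<^sup>2 = u * u + v * v" using cmod_power2[of z] by (simp add: u_def v_def power2_eq_square)
  have Nz: "N z = ((t + V) o\<^sub>L (t + V)) + (v * v) *\<^sub>R id_blinfun"
    unfolding N_def cm T_eq t_def u_def[symmetric] mult_2 scaleR_add_left by (simp add: oL_ring algebra_simps)
  define N' where "N' = ((t - V) o\<^sub>L (t - V)) + (v * v) *\<^sub>R id_blinfun"
  have e3V: "Lm e3 o\<^sub>L (t + V) = (t - V) o\<^sub>L Lm e3"
  proof -
    have "Lm e3 o\<^sub>L Lm e1 = - (Lm e1 o\<^sub>L Lm e3 :: 'a qmod \<Rightarrow>\<^sub>L 'a qmod)" "Lm e3 o\<^sub>L Lm e2 = - (Lm e2 o\<^sub>L Lm e3 :: 'a qmod \<Rightarrow>\<^sub>L 'a qmod)"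
      by (simp_all add: Lm_mult[symmetric] quat_units Lm_minus)
    moreover from this have "Lm e3 o\<^sub>L (Lm e1 o\<^sub>L A) = - (Lm e1 o\<^sub>L (Lm e3 o\<^sub>L A))"
      "Lm e3 o\<^sub>L (Lm e2 o\<^sub>L A) = - (Lm e2 o\<^sub>L (Lm e3 o\<^sub>L A))" for A :: "'a qmod \<Rightarrow>\<^sub>L 'a qmod"
      by (simp_all add: oL_assoc[symmetric] oL.minus_left)
    ultimately show ?thesis unfolding V_def t_def
      by (simp add: oL_ring t_Lm t_Lm[THEN comm_left])
  qed
  have "((t - V) o\<^sub>L (t - V)) o\<^sub>L Lm e3 = Lm e3 o\<^sub>L ((t + V) o\<^sub>L (t + V))"
  proof -
    have "((t - V) o\<^sub>L (t - V)) o\<^sub>L Lm e3 = (t - V) o\<^sub>L ((t - V) o\<^sub>L Lm e3)" by (rule oL_assoc)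
    also have "\<dots> = (t - V) o\<^sub>L (Lm e3 o\<^sub>L (t + V))" by (simp only: e3V)
    also have "\<dots> = ((t - V) o\<^sub>L Lm e3) o\<^sub>L (t + V)" by (rule oL_assoc[symmetric])
    also have "\<dots> = Lm e3 o\<^sub>L ((t + V) o\<^sub>L (t + V))" by (simp only: e3V[symmetric] oL_assoc)
    finally show ?thesis .
  qed
  then have e3N: "N' o\<^sub>L Lm e3 = Lm e3 o\<^sub>L N z"
    by (simp only: N'_def Nz oL.add_left oL.add_right oL.scaleR_left oL.scaleR_right id_oL)
  have "Lm (- e3) o\<^sub>L Lm e3 = (id_blinfun :: 'a qmod \<Rightarrow>\<^sub>L 'a qmod)" "Lm e3 o\<^sub>L Lm (- e3) = (id_blinfun :: 'a qmod \<Rightarrow>\<^sub>L 'a qmod)"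
    by (simp_all add: Lm_mult[symmetric] quat_units Lm_one)
  then have inv3: "invertible_op (Lm e3 :: 'a qmod \<Rightarrow>\<^sub>L 'a qmod)" "invertible_op (Lm (- e3) :: 'a qmod \<Rightarrow>\<^sub>L 'a qmod)"
    and "N' = (Lm e3 o\<^sub>L N z) o\<^sub>L Lm (- e3)"
    unfolding invertible_op_def e3N[symmetric] by (auto simp: oL_assoc)
  then have "invertible_op N'" using z by (metis K_iff invertible_op_compose)
  then have "invertible_op (N z o\<^sub>L N')" using z by (intro invertible_op_compose) (simp add: K_iff)
  also have "N z o\<^sub>L N' = Qc (slice_pt J z) T o\<^sub>L Qc (slice_pt J (cnj z)) T"
    unfolding Nz N'_def Q by (simp add: oL_ring rules left algebra_simps)
  finally show ?thesis
    by (rule invertible_op_commuting_factor[rotated]) (simp add: Q oL_ring rules left algebra_simps)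
qed

lemma Y_inverse:
  assumes "J \<in> imag_units" "z \<notin> K"
  shows "Qc (slice_pt J z) T o\<^sub>L Y (slice_pt J z) = id_blinfun" "Y (slice_pt J z) o\<^sub>L Qc (slice_pt J z) T = id_blinfun"
  unfolding Y_def using inv_op_inverse[OF right_linear(5) Qc_invertible[OF assms]] by auto

lemma Y_intertwine:
  assumes J: "I \<in> imag_units" "J \<in> imag_units" "z \<notin> K" "w \<notin> K"
    and X: "X o\<^sub>L Qc (slice_pt I z) T = Qc (slice_pt J w) T o\<^sub>L X"
  shows "X o\<^sub>L Y (slice_pt I z) = Y (slice_pt J w) o\<^sub>L X"
proof -
  let ?Y = "Y (slice_pt I z)" and ?Y' = "Y (slice_pt J w)" and ?Q = "Qc (slice_pt I z) T" and ?Q' = "Qc (slice_pt J w) T"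
  have "X o\<^sub>L ?Y = (?Y' o\<^sub>L ?Q') o\<^sub>L (X o\<^sub>L ?Y)" by (simp only: Y_inverse(2)[OF J(2,4)] id_oL)
  also have "\<dots> = ?Y' o\<^sub>L ((?Q' o\<^sub>L X) o\<^sub>L ?Y)" by (simp only: oL_assoc)
  also have "\<dots> = ?Y' o\<^sub>L ((X o\<^sub>L ?Q) o\<^sub>L ?Y)" by (simp only: X)
  also have "\<dots> = ?Y' o\<^sub>L X" by (simp only: oL_assoc Y_inverse(1)[OF J(1,3)] id_oL)
  finally show ?thesis .
qed

lemma Y_comm:
  assumes J: "J \<in> imag_units" "z \<notin> K"
    and X: "X o\<^sub>L Lm (slice_pt J z) = Lm (slice_pt J z) o\<^sub>L X" "X o\<^sub>L t0 = t0 o\<^sub>L X" "X o\<^sub>L R = R o\<^sub>L X"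
  shows "X o\<^sub>L Y (slice_pt J z) = Y (slice_pt J z) o\<^sub>L X"
  by (rule Y_intertwine[OF J(1,1,2,2)]) (simp add: Qc_eq oL_ring X X[THEN comm_left])

end

locale slice_triple = commuting_triple +
  fixes J :: quat
  assumes J: "J \<in> imag_units"
begin

abbreviation sop :: "complex \<Rightarrow> 'a qmod \<Rightarrow>\<^sub>L 'a qmod" where "sop z \<equiv> Lm (slice_pt J z)"
abbreviation y :: "complex \<Rightarrow> 'a qmod \<Rightarrow>\<^sub>L 'a qmod" where "y z \<equiv> Y (slice_pt J z)"

lemma JJ: "Lm J o\<^sub>L Lm J = - (id_blinfun :: 'a qmod \<Rightarrow>\<^sub>L 'a qmod)"
  using J by (simp add: Lm_mult[symmetric] imag_unitsD Lm_minus Lm_one)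

text \<open>Left composition with \<open>Lm J\<close> turns the real Banach space of operators into
  a complex one. The scalar action of \<open>z\<close> is then left multiplication by the slice
  point, so that functions on the slice of \<open>J\<close> are functions of one complex
  variable.\<close>

sublocale complex_structure "\<lambda>A :: 'a qmod \<Rightarrow>\<^sub>L 'a qmod. Lm J o\<^sub>L A"
proof (rule complex_structure.intro)
  show "bounded_linear (\<lambda>A :: 'a qmod \<Rightarrow>\<^sub>L 'a qmod. Lm J o\<^sub>L A)" by (rule oL.bounded_linear_right)
  show "Lm J o\<^sub>L (Lm J o\<^sub>L A) = - A" for A :: "'a qmod \<Rightarrow>\<^sub>L 'a qmod"
    by (simp add: oL_assoc[symmetric] JJ oL.minus_left)
qed

lemma sop_eq: "sop z = Re z *\<^sub>R id_blinfun + Im z *\<^sub>R Lm J"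
  by (simp add: slice_pt_def Lm_add Lm_of_real Lm_scaleR)

lemma cscale_eq: "cscale z A = sop z o\<^sub>L A"
  by (simp add: cscale_def sop_eq oL_ring)

lemma sop_sop: "sop z o\<^sub>L sop w = sop w o\<^sub>L sop z"
  using J by (simp add: Lm_mult[symmetric] slice_pt_mult[symmetric] mult.commute)

lemma y_comm:
  assumes "z \<notin> K"
  shows "sop w o\<^sub>L y z = y z o\<^sub>L sop w" "Lm J o\<^sub>L y z = y z o\<^sub>L Lm J"
    "t0 o\<^sub>L y z = y z o\<^sub>L t0" "t1 o\<^sub>L y z = y z o\<^sub>L t1" "t2 o\<^sub>L y z = y z o\<^sub>L t2" "R o\<^sub>L y z = y z o\<^sub>L R"
proof -
  note c = Y_comm[OF J assms]
  show "sop w o\<^sub>L y z = y z o\<^sub>L sop w" for w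
    by (rule c) (simp_all add: sop_sop t_Lm R_comm)
  from this[of \<i>] show "Lm J o\<^sub>L y z = y z o\<^sub>L Lm J" by simp
  show "t0 o\<^sub>L y z = y z o\<^sub>L t0" "t1 o\<^sub>L y z = y z o\<^sub>L t1" "t2 o\<^sub>L y z = y z o\<^sub>L t2" "R o\<^sub>L y z = y z o\<^sub>L R"
    by (rule c; simp add: t_comm t_Lm R_comm)+
qed

lemma y_y:
  assumes "z \<notin> K" "w \<notin> K"
  shows "y z o\<^sub>L y w = y w o\<^sub>L y z"
  by (rule Y_comm[OF J assms(2)]) (simp_all add: y_comm[OF assms(1)])

lemma y_inverse:
  assumes "z \<notin> K"
  shows "Qc (slice_pt J z) T o\<^sub>L y z = id_blinfun" "y z o\<^sub>L Qc (slice_pt J z) T = id_blinfun"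
  using Y_inverse[OF J assms] by auto

lemma Qc_diff: "Qc (slice_pt J z) T - Qc (slice_pt J w) T = sop (z - w) o\<^sub>L (sop (z + w) - 2 *\<^sub>R t0)"
proof -
  have m: "slice_pt J (z - w) = slice_pt J z - slice_pt J w" using slice_pt_add[of J z "- w"] by (simp add: slice_pt_minus)
  show ?thesis
    unfolding Qc_eq m slice_pt_add Lm_add Lm_diff
    by (simp add: oL_ring t_Lm sop_sop[of w z] scaleR_2 algebra_simps)
qed

text \<open>The difference quotient of \<open>y\<close>; on the diagonal it becomes - 2 H1.\<close>

definition ry :: "complex \<Rightarrow> complex \<Rightarrow> 'a qmod \<Rightarrow>\<^sub>L 'a qmod" where
  "ry z w = - (y w o\<^sub>L ((sop (w + z) - 2 *\<^sub>R t0) o\<^sub>L y z))"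

lemma resolvent:
  assumes "z \<notin> K" "w \<notin> K"
  shows "y w - y z = cscale (w - z) (ry z w)"
proof -
  have "y w - y z = y w o\<^sub>L ((Qc (slice_pt J z) T - Qc (slice_pt J w) T) o\<^sub>L y z)"
    using y_inverse[OF assms(1)] y_inverse[OF assms(2)]
    by (simp add: oL.diff_left oL.diff_right flip: oL_assoc[of "y w" "Qc (slice_pt J w) T"])
  also have "\<dots> = sop (z - w) o\<^sub>L (y w o\<^sub>L ((sop (z + w) - 2 *\<^sub>R t0) o\<^sub>L y z))"
    unfolding Qc_diff by (simp add: oL_assoc comm_left[OF y_comm(1)[OF assms(2), symmetric]])
  also have "\<dots> = sop (w - z) o\<^sub>L ry z w"
    unfolding ry_def using slice_pt_minus[of J "w - z"]
    by (simp add: Lm_minus oL.minus_left oL.minus_right add.commute)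
  finally show ?thesis unfolding cscale_eq .
qed

text \<open>\<open>H1\<close> and \<open>H2\<close> are the intrinsic kernels restricted to the
  slice. Together with \<open>X\<close> they satisfy y' = - 2 H1 and X' = y - 2 H2, the two
  relations behind the integration by parts.\<close>

definition H1 :: "complex \<Rightarrow> 'a qmod \<Rightarrow>\<^sub>L 'a qmod" where "H1 z = (sop z - t0) o\<^sub>L (y z o\<^sub>L y z)"
definition H2 :: "complex \<Rightarrow> 'a qmod \<Rightarrow>\<^sub>L 'a qmod" where "H2 z = (sop z - t0) o\<^sub>L H1 z"
definition X :: "complex \<Rightarrow> 'a qmod \<Rightarrow>\<^sub>L 'a qmod" where "X z = (sop z - t0) o\<^sub>L y z"

lemma continuous_sop: "continuous_on A sop"
  unfolding sop_eq by (intro continuous_intros)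

lemma tendsto_y:
  assumes z: "z \<notin> K"
  shows "(y \<longlongrightarrow> y z) (at z)"
proof (rule tendsto_inverse_op[where f = "\<lambda>w. Qc (slice_pt J w) T" and A = "Qc (slice_pt J z) T"])
  have "continuous_on UNIV (\<lambda>w. Qc (slice_pt J w) T)"
    unfolding Qc_eq by (intro continuous_intros oL.continuous_on continuous_sop)
  then show "((\<lambda>w. Qc (slice_pt J w) T) \<longlongrightarrow> Qc (slice_pt J z) T) (at z)"
    by (simp add: continuous_on_def)
  have "eventually (\<lambda>w. w \<in> - K) (at z)"
    using z compact_imp_closed[OF compact_K] by (intro eventually_at_in_open') auto
  then show "eventually (\<lambda>w. y w o\<^sub>L Qc (slice_pt J w) T = id_blinfun) (at z)"
    by eventually_elim (simp add: y_inverse)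
  show "Qc (slice_pt J z) T o\<^sub>L y z = id_blinfun" by (rule y_inverse[OF z])
qed

lemma open_K: "open (- K)"
  using compact_imp_closed[OF compact_K] by (rule open_Compl)

lemma continuous_y: "continuous_on (- K) y"
  unfolding continuous_on_eq_continuous_at[OF open_K] continuous_at using tendsto_y by auto

lemma DERIV_functional:
  assumes \<phi>: "functional \<phi>" and z: "z \<notin> K"
    and h: "\<And>w. w \<notin> K \<Longrightarrow> h w - h z = cscale (w - z) (q w)" and q: "(q \<longlongrightarrow> L) (at z)"
  shows "((\<lambda>z. \<phi> (h z)) has_field_derivative \<phi> L) (at z)"
  unfolding has_field_derivative_iff
proof (rule Lim_transform_eventually)
  interpret \<phi>: bounded_linear \<phi> using \<phi> by (simp add: functional_def)
  show "((\<lambda>w. \<phi> (q w)) \<longlongrightarrow> \<phi> L) (at z)" by (rule \<phi>.tendsto[OF q])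
  have "eventually (\<lambda>w. w \<in> - K - {z}) (at z)"
    using z open_K by (intro eventually_at_in_open) auto
  then show "eventually (\<lambda>w. \<phi> (q w) = (\<phi> (h w) - \<phi> (h z)) / (w - z)) (at z)"
    by eventually_elim (simp add: \<phi>.diff[symmetric] h functional_cscale[OF \<phi>])
qed

lemma tendsto_ry:
  assumes z: "z \<notin> K"
  shows "((\<lambda>w. ry z w) \<longlongrightarrow> - 2 *\<^sub>R H1 z) (at z)"
proof -
  have "((\<lambda>w. sop (w + z)) \<longlongrightarrow> sop (z + z)) (at z)"
    unfolding sop_eq by (intro tendsto_intros)
  then have "((\<lambda>w. ry z w) \<longlongrightarrow> - (y z o\<^sub>L ((sop (z + z) - 2 *\<^sub>R t0) o\<^sub>L y z))) (at z)"
    unfolding ry_def by (intro tendsto_intros oL.tendsto tendsto_y z)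
  also have "- (y z o\<^sub>L ((sop (z + z) - 2 *\<^sub>R t0) o\<^sub>L y z)) = - 2 *\<^sub>R H1 z"
    unfolding H1_def slice_pt_add Lm_add
    by (simp add: oL_ring y_comm[OF z] y_comm(1,3)[OF z, THEN comm_left] scaleR_2 algebra_simps)
  finally show ?thesis .
qed

lemma DERIV_y:
  "functional \<phi> \<Longrightarrow> z \<notin> K \<Longrightarrow> ((\<lambda>z. \<phi> (y z)) has_field_derivative \<phi> (- 2 *\<^sub>R H1 z)) (at z)"
  by (rule DERIV_functional[OF _ _ resolvent tendsto_ry])

lemma DERIV_X:
  assumes \<phi>: "functional \<phi>" and z: "z \<notin> K"
  shows "((\<lambda>z. \<phi> (X z)) has_field_derivative \<phi> (y z - 2 *\<^sub>R H2 z)) (at z)"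
proof (rule DERIV_functional[OF \<phi> z])
  fix w assume w: "w \<notin> K"
  have m: "sop w = sop z + sop (w - z)" using slice_pt_add[of J z "w - z"] by (simp add: Lm_add)
  have "X w - X z = (sop (w - z) o\<^sub>L y w) + ((sop z - t0) o\<^sub>L (y w - y z))"
    unfolding X_def m by (simp add: oL_ring algebra_simps)
  also have "\<dots> = sop (w - z) o\<^sub>L (y w + ((sop z - t0) o\<^sub>L ry z w))"
    unfolding resolvent[OF z w] cscale_eq
    by (simp add: oL_ring t_Lm t_Lm[THEN comm_left] comm_left[OF sop_sop, of z "w - z"])
  finally show "X w - X z = cscale (w - z) (y w + ((sop z - t0) o\<^sub>L ry z w))" unfolding cscale_eq .
next
  have "((\<lambda>w. y w + ((sop z - t0) o\<^sub>L ry z w)) \<longlongrightarrow> y z + ((sop z - t0) o\<^sub>L (- 2 *\<^sub>R H1 z))) (at z)"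
    by (intro tendsto_intros oL.tendsto tendsto_y tendsto_ry z)
  then show "((\<lambda>w. y w + ((sop z - t0) o\<^sub>L ry z w)) \<longlongrightarrow> y z - 2 *\<^sub>R H2 z) (at z)"
    by (simp add: H2_def oL.scaleR_right oL.minus_right)
qed

text \<open>Under each functional, \<open>h\<close> is the derivative of a holomorphic function and
  hence holomorphic. Both \<open>H1\<close> and \<open>H2\<close> are linear combinations of
  \<open>y\<close> and the derivatives of \<open>y\<close> and \<open>X\<close>, so they need no
  difference quotients of their own.\<close>

lemma cholo_from_derivative:
  assumes g: "\<And>\<phi> z. functional \<phi> \<Longrightarrow> z \<notin> K \<Longrightarrow> ((\<lambda>z. \<phi> (g z)) has_field_derivative \<phi> (h z)) (at z)"
    and h: "continuous_on (- K) h"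
  shows "cholo h (- K)"
  unfolding cholo_def
proof (intro conjI h allI impI)
  fix \<phi> assume \<phi>: "functional \<phi>"
  have "(\<lambda>z. \<phi> (g z)) holomorphic_on - K"
    unfolding holomorphic_on_open[OF open_K] using g[OF \<phi>] by auto
  then have "deriv (\<lambda>z. \<phi> (g z)) holomorphic_on - K" by (rule holomorphic_deriv[OF _ open_K])
  moreover have "deriv (\<lambda>z. \<phi> (g z)) z = \<phi> (h z)" if "z \<in> - K" for z
    using DERIV_imp_deriv[OF g[OF \<phi>]] that by simp
  ultimately show "(\<lambda>z. \<phi> (h z)) holomorphic_on - K" by (rule holomorphic_transform)
qed

lemma cholo_y: "cholo y (- K)"
  unfolding cholo_def using continuous_y DERIV_y by (auto simp: holomorphic_on_open[OF open_K])

lemma cholo_sum: "cholo g S \<Longrightarrow> cholo h S \<Longrightarrow> cholo (\<lambda>z. g z + r *\<^sub>R h z) S"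
  unfolding cholo_def functional_def
  by (auto intro!: continuous_intros holomorphic_intros simp: linear_simps scaleR_conv_of_real)

lemma continuous_X: "continuous_on (- K) X"
  unfolding X_def by (intro continuous_intros oL.continuous_on continuous_sop continuous_y)

lemma continuous_H: "continuous_on (- K) H1" "continuous_on (- K) H2"
  unfolding H2_def H1_def by (intro continuous_intros oL.continuous_on continuous_sop continuous_y)+

lemma cholo_X: "cholo X (- K)"
  unfolding cholo_def using continuous_X DERIV_X by (auto simp: holomorphic_on_open[OF open_K])

lemma cholo_H: "cholo H1 (- K)" "cholo H2 (- K)"
proof -
  have "cholo (\<lambda>z. - 2 *\<^sub>R H1 z) (- K)"
    by (rule cholo_from_derivative, rule DERIV_y, assumption+, intro continuous_intros continuous_H)
  from cholo_compose[OF bounded_linear_scaleR_right _ this, of "-1/2"]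
  show "cholo H1 (- K)" by (simp add: oL.scaleR_right oL.minus_right)
  have "cholo (\<lambda>z. y z - 2 *\<^sub>R H2 z) (- K)"
    by (rule cholo_from_derivative, rule DERIV_X, assumption+, intro continuous_intros continuous_y continuous_H)
  from cholo_sum[OF cholo_y this, of "-1"] have "cholo (\<lambda>z. 2 *\<^sub>R H2 z) (- K)" by simp
  from cholo_compose[OF bounded_linear_scaleR_right _ this, of "1/2"]
  show "cholo H2 (- K)" by (simp add: oL.scaleR_right)
qed

end

section \<open>A commutative operator algebra and the Gelfand-Mazur argument in it\<close>

section \<open>Ideals in the bicommutant\<close>

lemma tendsto_Neumann:
  fixes A :: "'w \<Rightarrow> 'x::banach \<Rightarrow>\<^sub>L 'x"
  assumes "(A \<longlongrightarrow> 0) F"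
  shows "\<exists>N. (N \<longlongrightarrow> id_blinfun) F \<and>
    eventually (\<lambda>w. (id_blinfun - A w) o\<^sub>L N w = id_blinfun \<and> N w o\<^sub>L (id_blinfun - A w) = id_blinfun) F"
proof -
  define N where "N w = (SOME B. (id_blinfun - A w) o\<^sub>L B = id_blinfun \<and> B o\<^sub>L (id_blinfun - A w) = id_blinfun)" for w
  have "((\<lambda>w. norm (A w)) \<longlongrightarrow> 0) F" using assms by (rule tendsto_norm_zero)
  then have "eventually (\<lambda>w. norm (A w) < 1) F" by (rule order_tendstoD(2)) simp
  then have ev: "eventually (\<lambda>w. (id_blinfun - A w) o\<^sub>L N w = id_blinfun \<and> N w o\<^sub>L (id_blinfun - A w) = id_blinfun) F"
  proof eventually_elim
    case (elim w)
    then obtain B where "(id_blinfun - A w) o\<^sub>L B = id_blinfun \<and> B o\<^sub>L (id_blinfun - A w) = id_blinfun"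
      using Neumann_series by metis
    then show ?case unfolding N_def by (rule someI)
  qed
  have "((\<lambda>w. id_blinfun - A w) \<longlongrightarrow> id_blinfun - 0) F" by (intro tendsto_intros assms)
  then have "(N \<longlongrightarrow> id_blinfun) F"
    by (rule tendsto_inverse_op) (use ev in \<open>auto elim: eventually_mono\<close>)
  then show ?thesis using ev by (intro exI[of _ N] conjI)
qed

context slice_triple
begin

definition commutant :: "('a qmod \<Rightarrow>\<^sub>L 'a qmod) set" where
  "commutant = {B. \<forall>g\<in>{Lm J, t0, t1, t2}. B o\<^sub>L g = g o\<^sub>L B}"

text \<open>The bicommutant of the generators. It is commutative because the generators commute, and
  it contains the inverses of its invertible members and the contour integrals of functions with
  values in it. The generator \<open>Lm J\<close> makes it a complex algebra.\<close>

definition alg :: "('a qmod \<Rightarrow>\<^sub>L 'a qmod) set" where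
  "alg = {A. \<forall>B\<in>commutant. A o\<^sub>L B = B o\<^sub>L A}"

definition ideal :: "('a qmod \<Rightarrow>\<^sub>L 'a qmod) set \<Rightarrow> bool" where
  "ideal I \<longleftrightarrow> subspace I \<and> I \<subseteq> alg \<and> (\<forall>A\<in>alg. \<forall>B\<in>I. A o\<^sub>L B \<in> I) \<and> id_blinfun \<notin> I"

lemma commutantD: "B \<in> commutant \<Longrightarrow> B o\<^sub>L Lm J = Lm J o\<^sub>L B" "B \<in> commutant \<Longrightarrow> B o\<^sub>L t0 = t0 o\<^sub>L B"
  "B \<in> commutant \<Longrightarrow> B o\<^sub>L t1 = t1 o\<^sub>L B" "B \<in> commutant \<Longrightarrow> B o\<^sub>L t2 = t2 o\<^sub>L B"
  unfolding commutant_def by auto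

lemma alg_subset_commutant: "alg \<subseteq> commutant"
proof
  fix A assume A: "A \<in> alg"
  have "{Lm J, t0, t1, t2} \<subseteq> commutant" unfolding commutant_def by (auto simp: t_comm t_Lm)
  then show "A \<in> commutant" using A unfolding alg_def commutant_def[of] by blast
qed

lemma alg_commute: "A \<in> alg \<Longrightarrow> B \<in> alg \<Longrightarrow> A o\<^sub>L B = B o\<^sub>L A"
  using alg_subset_commutant unfolding alg_def by blast

lemma alg_gens: "Lm J \<in> alg" "t0 \<in> alg" "t1 \<in> alg" "t2 \<in> alg"
  unfolding alg_def commutant_def by auto

lemma alg_compose:
  assumes A: "A \<in> alg" "B \<in> alg"
  shows "A o\<^sub>L B \<in> alg"
  unfolding alg_def
proof safe
  fix C assume "C \<in> commutant"
  then have "A o\<^sub>L C = C o\<^sub>L A" "B o\<^sub>L C = C o\<^sub>L B" using A unfolding alg_def by auto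
  then show "(A o\<^sub>L B) o\<^sub>L C = C o\<^sub>L (A o\<^sub>L B)" by (simp add: oL_assoc comm_left)
qed

lemma alg_linear: "A \<in> alg \<Longrightarrow> B \<in> alg \<Longrightarrow> A + B \<in> alg" "A \<in> alg \<Longrightarrow> B \<in> alg \<Longrightarrow> A - B \<in> alg"
  "A \<in> alg \<Longrightarrow> r *\<^sub>R A \<in> alg" "id_blinfun \<in> alg" "0 \<in> alg"
  unfolding alg_def by (auto simp: oL_ring)

lemma alg_R: "R \<in> alg" unfolding R_def by (intro alg_linear alg_compose alg_gens)

lemma alg_sop: "sop z \<in> alg" unfolding sop_eq by (intro alg_linear alg_gens)

lemma alg_inverse:
  assumes "A \<in> alg" "A o\<^sub>L B = id_blinfun" "B o\<^sub>L A = id_blinfun"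
  shows "B \<in> alg"
  unfolding alg_def
proof (safe)
  fix C assume C: "C \<in> commutant"
  have "B o\<^sub>L C = B o\<^sub>L (C o\<^sub>L (A o\<^sub>L B))" by (simp add: assms)
  also have "\<dots> = (B o\<^sub>L (A o\<^sub>L C)) o\<^sub>L B" using assms(1) C unfolding alg_def by (simp add: oL_assoc)
  also have "\<dots> = C o\<^sub>L B" by (simp add: assms flip: oL_assoc)
  finally show "B o\<^sub>L C = C o\<^sub>L B" .
qed

lemma alg_y:
  assumes "z \<notin> K"
  shows "y z \<in> alg"
proof (rule alg_inverse[OF _ y_inverse[OF assms]])
  show "Qc (slice_pt J z) T \<in> alg"
    unfolding Qc_eq by (intro alg_linear alg_compose alg_sop alg_gens alg_R)
qed

lemma alg_X: "z \<notin> K \<Longrightarrow> X z \<in> alg"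
  unfolding X_def by (intro alg_compose alg_linear alg_sop alg_gens alg_y)

lemma functional_left: "functional \<phi> \<Longrightarrow> B o\<^sub>L Lm J = Lm J o\<^sub>L B \<Longrightarrow> functional (\<lambda>A. \<phi> (B o\<^sub>L A))"
  by (rule functional_compose) (auto intro: oL.bounded_linear_right comm_left)

lemma functional_right: "functional \<phi> \<Longrightarrow> functional (\<lambda>A. \<phi> (A o\<^sub>L B))"
  by (rule functional_compose) (auto intro: oL.bounded_linear_left simp: oL_assoc)

lemma cint_in_alg:
  assumes S: "open S" "cholo h S" "valid_path \<gamma>" "path_image \<gamma> \<subseteq> S" and h: "\<And>z. z \<in> S \<Longrightarrow> h z \<in> alg"
  shows "cint \<gamma> h \<in> alg"
  unfolding alg_def
proof safe
  fix B assume B: "B \<in> commutant"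
  show "cint \<gamma> h o\<^sub>L B = B o\<^sub>L cint \<gamma> h"
    unfolding eq_iff_functional
  proof (intro allI impI)
    fix \<phi> assume \<phi>: "functional \<phi>"
    have "\<phi> (cint \<gamma> h o\<^sub>L B) = contour_integral \<gamma> (\<lambda>z. \<phi> (h z o\<^sub>L B))"
      by (rule functional_cint[OF S functional_right[OF \<phi>]])
    also have "\<dots> = contour_integral \<gamma> (\<lambda>z. \<phi> (B o\<^sub>L h z))"
    proof (rule contour_integral_cong[OF refl])
      fix z assume "z \<in> path_image \<gamma>"
      then have "h z \<in> alg" using h S(4) by blast
      then show "\<phi> (h z o\<^sub>L B) = \<phi> (B o\<^sub>L h z)" using B unfolding alg_def by simp
    qed
    also have "\<dots> = \<phi> (B o\<^sub>L cint \<gamma> h)"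
      by (rule functional_cint[OF S functional_left[OF \<phi> commutantD(1)[OF B]], symmetric])
    finally show "\<phi> (cint \<gamma> h o\<^sub>L B) = \<phi> (B o\<^sub>L cint \<gamma> h)" .
  qed
qed

text \<open>Members of \<open>alg\<close> at distance less than 1 from the identity have their
  inverse in \<open>alg\<close>, so even the closure of a proper ideal misses the identity. The
  functional need not be multiplicative; it only tests congruences modulo \<open>I\<close>.\<close>

lemma ideal_functional:
  assumes "ideal I"
  shows "\<exists>\<phi>. functional \<phi> \<and> (\<forall>B\<in>I. \<phi> B = 0) \<and> \<phi> id_blinfun = 1"
proof (rule exists_separating_functional)
  have I: "subspace I" "I \<subseteq> alg" "\<And>A B. A \<in> alg \<Longrightarrow> B \<in> I \<Longrightarrow> A o\<^sub>L B \<in> I" "id_blinfun \<notin> I"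
    using assms unfolding ideal_def by auto
  show "subspace I" by (rule I(1))
  show "Lm J o\<^sub>L B \<in> I" if "B \<in> I" for B by (rule I(3)[OF alg_gens(1) that])
  show "id_blinfun \<notin> closure I"
  proof
    assume "id_blinfun \<in> closure I"
    then obtain x where x: "x \<in> I" "dist x id_blinfun < 1" unfolding closure_approachable by (metis zero_less_one)
    then have "norm (id_blinfun - x) < 1" by (simp add: dist_norm norm_minus_commute)
    then obtain B where "(id_blinfun - (id_blinfun - x)) o\<^sub>L B = id_blinfun" "B o\<^sub>L (id_blinfun - (id_blinfun - x)) = id_blinfun"
      using Neumann_series by metis
    then have B: "x o\<^sub>L B = id_blinfun" "B o\<^sub>L x = id_blinfun" by simp_all
    have "B \<in> alg" by (rule alg_inverse[OF _ B]) (use x(1) I(2) in blast)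
    then show False using I(3)[OF _ x(1)] B(2) I(4) by metis
  qed
qed

text \<open>Gelfand-Mazur without forming a quotient. If no \<mu> worked, each
  \<open>S - sop \<mu>\<close> would have an inverse modulo \<open>I\<close>. Under the functional
  from \<open>ideal_functional\<close> these inverses give an entire function that tends to 0 at
  infinity and so is 0 by Liouville, although - \<mu> times it tends to the value 1 at the
  identity.\<close>

lemma spectral_value_modulo_ideal:
  assumes I: "ideal I" and S: "S \<in> alg"
  shows "\<exists>\<mu>. ideal {B + ((S - sop \<mu>) o\<^sub>L A) | A B. A \<in> alg \<and> B \<in> I}"
proof (rule ccontr)
  assume no: "\<not> ?thesis"
  have sI: "subspace I" and IA: "I \<subseteq> alg" and mI: "\<And>A B. A \<in> alg \<Longrightarrow> B \<in> I \<Longrightarrow> A o\<^sub>L B \<in> I"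
    using I unfolding ideal_def by auto
  have Smu: "S - sop \<mu> \<in> alg" for \<mu> by (intro alg_linear S alg_sop)
  have "\<exists>A\<in>alg. id_blinfun - ((S - sop \<mu>) o\<^sub>L A) \<in> I" for \<mu>
  proof -
    let ?I = "{B + ((S - sop \<mu>) o\<^sub>L A) | A B. A \<in> alg \<and> B \<in> I}"
    have s1: "subspace ?I" unfolding subspace_def
    proof (intro conjI ballI allI)
      show "0 \<in> ?I" using alg_linear(5) subspace_0[OF sI] by force
      fix x assume x: "x \<in> ?I"
      then obtain A B where AB: "x = B + ((S - sop \<mu>) o\<^sub>L A)" "A \<in> alg" "B \<in> I" by blast
      show "c *\<^sub>R x \<in> ?I" for c
        using AB alg_linear(3)[of A c] subspace_scale[OF sI, of B c]
        by (intro CollectI exI[of _ "c *\<^sub>R A"] exI[of _ "c *\<^sub>R B"]) (simp add: oL.scaleR_right algebra_simps)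
      fix x' assume "x' \<in> ?I"
      then obtain A' B' where AB': "x' = B' + ((S - sop \<mu>) o\<^sub>L A')" "A' \<in> alg" "B' \<in> I" by blast
      show "x + x' \<in> ?I"
        using AB AB' alg_linear(1)[of A A'] subspace_add[OF sI, of B B']
        by (intro CollectI exI[of _ "A + A'"] exI[of _ "B + B'"]) (simp add: oL.add_right)
    qed
    have s2: "?I \<subseteq> alg" using IA Smu by (auto intro!: alg_linear alg_compose S alg_sop)
    have s3: "C o\<^sub>L x \<in> ?I" if C: "C \<in> alg" "x \<in> ?I" for C x
    proof -
      obtain A B where AB: "x = B + ((S - sop \<mu>) o\<^sub>L A)" "A \<in> alg" "B \<in> I"
        using C(2) by blast
      have "C o\<^sub>L x = (C o\<^sub>L B) + ((S - sop \<mu>) o\<^sub>L (C o\<^sub>L A))"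
        by (simp only: AB(1) oL.add_right comm_left[OF alg_commute[OF C(1) Smu]])
      then show ?thesis using mI[OF C(1) AB(3)] alg_compose[OF C(1) AB(2)]
        by (intro CollectI exI[of _ "C o\<^sub>L A"] exI[of _ "C o\<^sub>L B"]) simp
    qed
    have "id_blinfun \<in> ?I"
    proof (rule ccontr)
      assume "id_blinfun \<notin> ?I"
      with s1 s2 s3 have "ideal ?I" unfolding ideal_def by (intro conjI ballI)
      then have "\<exists>\<mu>. ideal {B + ((S - sop \<mu>) o\<^sub>L A) | A B. A \<in> alg \<and> B \<in> I}" by (rule exI)
      with no show False by (rule notE)
    qed
    then obtain A B where AB: "id_blinfun = B + ((S - sop \<mu>) o\<^sub>L A)" "A \<in> alg" "B \<in> I"
      by (elim CollectE exE conjE) (rule that)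
    have "id_blinfun - ((S - sop \<mu>) o\<^sub>L A) = B" using AB(1) by (simp add: algebra_simps)
    then show ?thesis using AB(2,3) by (intro bexI[of _ A]) simp_all
  qed
  then obtain G where G: "\<And>\<mu>. G \<mu> \<in> alg" "\<And>\<mu>. id_blinfun - ((S - sop \<mu>) o\<^sub>L G \<mu>) \<in> I" by metis
  obtain \<phi> where \<phi>: "functional \<phi>" "\<And>B. B \<in> I \<Longrightarrow> \<phi> B = 0" "\<phi> id_blinfun = 1"
    using ideal_functional[OF I] by blast
  interpret \<phi>: bounded_linear \<phi> using \<phi>(1) by (simp add: functional_def)
  have red: "\<phi> Z = \<phi> (Z o\<^sub>L ((S - sop \<mu>) o\<^sub>L W))"
    if "Z \<in> alg" "id_blinfun - ((S - sop \<mu>) o\<^sub>L W) \<in> I" for Z W \<mu>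
    using \<phi>(2)[OF mI[OF that]] by (simp add: oL.diff_right \<phi>.diff)
  \<comment> \<open>Inverses modulo \<open>I\<close> are unique modulo \<open>I\<close>, so \<phi>
    does not see the choice made in \<open>G\<close>. This allows \<open>G\<close> to be replaced by
    explicit Neumann inverses, near a given point and near infinity.\<close>
  have uniq: "\<phi> (Z o\<^sub>L G \<mu>) = \<phi> (Z o\<^sub>L W)"
    if "Z \<in> alg" "W \<in> alg" "id_blinfun - ((S - sop \<mu>) o\<^sub>L W) \<in> I" for Z W \<mu>
  proof -
    have "\<phi> (Z o\<^sub>L G \<mu>) = \<phi> ((Z o\<^sub>L G \<mu>) o\<^sub>L ((S - sop \<mu>) o\<^sub>L W))"
      by (rule red) (use that G alg_compose in auto)
    also have "(Z o\<^sub>L G \<mu>) o\<^sub>L ((S - sop \<mu>) o\<^sub>L W) = (Z o\<^sub>L W) o\<^sub>L ((S - sop \<mu>) o\<^sub>L G \<mu>)"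
    proof -
      have "G \<mu> o\<^sub>L ((S - sop \<mu>) o\<^sub>L W) = ((S - sop \<mu>) o\<^sub>L W) o\<^sub>L G \<mu>"
        by (intro alg_commute G alg_compose Smu that)
      also have "\<dots> = W o\<^sub>L ((S - sop \<mu>) o\<^sub>L G \<mu>)"
        by (simp add: alg_commute[OF Smu that(2)] oL_assoc)
      finally show ?thesis by (simp add: oL_assoc)
    qed
    also have "\<phi> \<dots> = \<phi> (Z o\<^sub>L W)" by (rule red[symmetric]) (use that G alg_compose in auto)
    finally show ?thesis .
  qed
  define g where "g \<mu> = \<phi> (G \<mu>)" for \<mu>
  have diff: "g \<nu> - g \<mu> = (\<nu> - \<mu>) * \<phi> (G \<mu> o\<^sub>L G \<nu>)" for \<mu> \<nu>
  proof -
    have "g \<nu> = \<phi> (G \<nu> o\<^sub>L ((S - sop \<mu>) o\<^sub>L G \<mu>))" "g \<mu> = \<phi> (G \<mu> o\<^sub>L ((S - sop \<nu>) o\<^sub>L G \<nu>))"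
      unfolding g_def by (intro red G)+
    moreover have "G \<nu> o\<^sub>L ((S - sop \<mu>) o\<^sub>L G \<mu>) = (S - sop \<mu>) o\<^sub>L (G \<nu> o\<^sub>L G \<mu>)"
      "G \<mu> o\<^sub>L ((S - sop \<nu>) o\<^sub>L G \<nu>) = (S - sop \<nu>) o\<^sub>L (G \<mu> o\<^sub>L G \<nu>)"
      by (rule comm_left[OF alg_commute[OF G(1) Smu]])+
    moreover have "G \<nu> o\<^sub>L G \<mu> = G \<mu> o\<^sub>L G \<nu>" by (rule alg_commute[OF G(1) G(1)])
    moreover have "((S - sop \<mu>) o\<^sub>L (G \<mu> o\<^sub>L G \<nu>)) - ((S - sop \<nu>) o\<^sub>L (G \<mu> o\<^sub>L G \<nu>)) = cscale (\<nu> - \<mu>) (G \<mu> o\<^sub>L G \<nu>)"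
      unfolding cscale_eq sop_eq by (simp add: oL_ring algebra_simps)
    ultimately show ?thesis by (simp add: \<phi>.diff[symmetric] functional_cscale[OF \<phi>(1)])
  qed
  have "(g has_field_derivative \<phi> (G \<mu> o\<^sub>L G \<mu>)) (at \<mu>)" for \<mu>
    unfolding has_field_derivative_iff
  proof (rule Lim_transform_eventually)
    have "((\<lambda>\<nu>. cscale (\<nu> - \<mu>) (G \<mu>)) \<longlongrightarrow> cscale (\<mu> - \<mu>) (G \<mu>)) (at \<mu>)" by (intro tendsto_intros cscale.tendsto)
    then have "((\<lambda>\<nu>. cscale (\<nu> - \<mu>) (G \<mu>)) \<longlongrightarrow> 0) (at \<mu>)" by (simp add: cscale.zero_left)
    then have ex: "\<exists>N. (N \<longlongrightarrow> id_blinfun) (at \<mu>) \<and> eventually (\<lambda>\<nu>. (id_blinfun - cscale (\<nu> - \<mu>) (G \<mu>)) o\<^sub>L N \<nu> = id_blinfun \<and>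
         N \<nu> o\<^sub>L (id_blinfun - cscale (\<nu> - \<mu>) (G \<mu>)) = id_blinfun) (at \<mu>)" by (rule tendsto_Neumann)
    define N where "N = (SOME N. (N \<longlongrightarrow> id_blinfun) (at \<mu>) \<and> eventually (\<lambda>\<nu>. (id_blinfun - cscale (\<nu> - \<mu>) (G \<mu>)) o\<^sub>L N \<nu> = id_blinfun \<and>
         N \<nu> o\<^sub>L (id_blinfun - cscale (\<nu> - \<mu>) (G \<mu>)) = id_blinfun) (at \<mu>))"
    have N': "(N \<longlongrightarrow> id_blinfun) (at \<mu>) \<and> eventually (\<lambda>\<nu>. (id_blinfun - cscale (\<nu> - \<mu>) (G \<mu>)) o\<^sub>L N \<nu> = id_blinfun \<and>
         N \<nu> o\<^sub>L (id_blinfun - cscale (\<nu> - \<mu>) (G \<mu>)) = id_blinfun) (at \<mu>)" unfolding N_def by (rule someI_ex[OF ex])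
    note N = conjunct1[OF N'] conjunct2[OF N']
    have "((\<lambda>\<nu>. \<phi> (G \<mu> o\<^sub>L (G \<mu> o\<^sub>L N \<nu>))) \<longlongrightarrow> \<phi> (G \<mu> o\<^sub>L (G \<mu> o\<^sub>L id_blinfun))) (at \<mu>)"
      by (intro \<phi>.tendsto oL.tendsto tendsto_intros N)
    then show "((\<lambda>\<nu>. \<phi> (G \<mu> o\<^sub>L (G \<mu> o\<^sub>L N \<nu>))) \<longlongrightarrow> \<phi> (G \<mu> o\<^sub>L G \<mu>)) (at \<mu>)" by simp
    have "eventually (\<lambda>\<nu>. \<nu> \<noteq> \<mu>) (at \<mu>)" by (simp add: eventually_at_filter)
    with N(2) show "eventually (\<lambda>\<nu>. \<phi> (G \<mu> o\<^sub>L (G \<mu> o\<^sub>L N \<nu>)) = (g \<nu> - g \<mu>) / (\<nu> - \<mu>)) (at \<mu>)"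
    proof eventually_elim
      case (elim \<nu>)
      have cA: "cscale (\<nu> - \<mu>) (G \<mu>) \<in> alg" unfolding cscale_eq by (intro alg_compose alg_sop G)
      have NA: "N \<nu> \<in> alg" by (rule alg_inverse[of "id_blinfun - cscale (\<nu> - \<mu>) (G \<mu>)"]) (use elim cA alg_linear in auto)
      have "(S - sop \<nu>) o\<^sub>L (G \<mu> o\<^sub>L N \<nu>) = ((S - sop \<mu>) o\<^sub>L (G \<mu> o\<^sub>L N \<nu>)) - (cscale (\<nu> - \<mu>) (G \<mu>) o\<^sub>L N \<nu>)"
        unfolding cscale_eq sop_eq by (simp add: oL_ring algebra_simps)
      also have "cscale (\<nu> - \<mu>) (G \<mu>) o\<^sub>L N \<nu> = N \<nu> - id_blinfun"
        using elim(1) by (simp add: oL.diff_left algebra_simps)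
      finally have "id_blinfun - ((S - sop \<nu>) o\<^sub>L (G \<mu> o\<^sub>L N \<nu>)) = (id_blinfun - ((S - sop \<mu>) o\<^sub>L G \<mu>)) o\<^sub>L N \<nu>"
        by (simp add: oL_ring)
      also have "\<dots> = N \<nu> o\<^sub>L (id_blinfun - ((S - sop \<mu>) o\<^sub>L G \<mu>))"
        by (rule alg_commute) (use NA IA G(2) in auto)
      finally have "id_blinfun - ((S - sop \<nu>) o\<^sub>L (G \<mu> o\<^sub>L N \<nu>)) \<in> I" using mI[OF NA G(2)] by simp
      from uniq[OF G(1) _ this, of \<mu>] have "\<phi> (G \<mu> o\<^sub>L G \<nu>) = \<phi> (G \<mu> o\<^sub>L (G \<mu> o\<^sub>L N \<nu>))"
        using alg_compose[OF G(1) NA] by blast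
      then show ?case using diff[of \<nu> \<mu>] elim(2) by (simp add: field_simps)
    qed
  qed
  then have hol: "g holomorphic_on UNIV" unfolding holomorphic_on_open[OF open_UNIV] by auto
  have inv: "((\<lambda>\<mu>. 1 / \<mu>) \<longlongrightarrow> (0::complex)) at_infinity"
  proof -
    have "(\<lambda>\<mu>. 1 / \<mu>) = (inverse :: complex \<Rightarrow> complex)" by (simp add: fun_eq_iff inverse_eq_divide)
    then show ?thesis using tendsto_inverse_0 by (simp only:)
  qed
  then have "((\<lambda>\<mu>. cscale (1 / \<mu>) S) \<longlongrightarrow> cscale 0 S) at_infinity" by (intro cscale.tendsto tendsto_intros)
  then have "((\<lambda>\<mu>. cscale (1 / \<mu>) S) \<longlongrightarrow> 0) at_infinity" by (simp add: cscale.zero_left)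
  then have ex: "\<exists>M. (M \<longlongrightarrow> id_blinfun) at_infinity \<and> eventually (\<lambda>\<mu>. (id_blinfun - cscale (1 / \<mu>) S) o\<^sub>L M \<mu> = id_blinfun \<and>
       M \<mu> o\<^sub>L (id_blinfun - cscale (1 / \<mu>) S) = id_blinfun) at_infinity" by (rule tendsto_Neumann)
    define M where "M = (SOME M. (M \<longlongrightarrow> id_blinfun) at_infinity \<and> eventually (\<lambda>\<mu>. (id_blinfun - cscale (1 / \<mu>) S) o\<^sub>L M \<mu> = id_blinfun \<and>
       M \<mu> o\<^sub>L (id_blinfun - cscale (1 / \<mu>) S) = id_blinfun) at_infinity)"
    have M': "(M \<longlongrightarrow> id_blinfun) at_infinity \<and> eventually (\<lambda>\<mu>. (id_blinfun - cscale (1 / \<mu>) S) o\<^sub>L M \<mu> = id_blinfun \<and>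
       M \<mu> o\<^sub>L (id_blinfun - cscale (1 / \<mu>) S) = id_blinfun) at_infinity" unfolding M_def by (rule someI_ex[OF ex])
    note M = conjunct1[OF M'] conjunct2[OF M']
  have "eventually (\<lambda>\<mu>::complex. \<mu> \<noteq> 0) at_infinity"
    unfolding eventually_at_infinity by (intro exI[of _ 1]) auto
  with M(2) have gM: "eventually (\<lambda>\<mu>. g \<mu> = - (1 / \<mu>) * \<phi> (M \<mu>) \<and> \<mu> \<noteq> 0) at_infinity"
  proof eventually_elim
    case (elim \<mu>)
    have cA: "cscale (1 / \<mu>) S \<in> alg" unfolding cscale_eq by (intro alg_compose alg_sop S)
    have MA: "M \<mu> \<in> alg" by (rule alg_inverse[of "id_blinfun - cscale (1 / \<mu>) S"]) (use elim cA alg_linear in auto)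
    \<comment> \<open>For large \<mu> a genuine inverse of \<open>S - sop \<mu>\<close>, from the
      Neumann series in S / \<mu>.\<close>
    define W where "W = - cscale (1 / \<mu>) (M \<mu>)"
    have WA: "W \<in> alg" using alg_linear(3)[OF alg_compose[OF alg_sop MA], of "-1"] unfolding W_def cscale_eq by simp
    have "sop \<mu> o\<^sub>L cscale (1 / \<mu>) (M \<mu>) = M \<mu>"
      unfolding cscale_eq[symmetric] cscale_cscale using elim(2) by (simp add: cscale_def)
    moreover have "S o\<^sub>L cscale (1 / \<mu>) (M \<mu>) = cscale (1 / \<mu>) S o\<^sub>L M \<mu>"
      unfolding cscale_eq using alg_commute[OF S alg_sop] by (simp add: oL_assoc[symmetric])
    moreover have "cscale (1 / \<mu>) S o\<^sub>L M \<mu> = M \<mu> - id_blinfun" using elim(1) by (simp add: oL.diff_left algebra_simps)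
    ultimately have "(S - sop \<mu>) o\<^sub>L W = id_blinfun" unfolding W_def by (simp add: oL.diff_left oL.minus_right)
    then have "id_blinfun - ((S - sop \<mu>) o\<^sub>L W) \<in> I" using subspace_0[OF sI] by simp
    from uniq[OF alg_linear(4) WA this] have "g \<mu> = \<phi> W" by (simp add: g_def)
    also have "\<dots> = - (1 / \<mu>) * \<phi> (M \<mu>)" unfolding W_def using functional_cscale[OF \<phi>(1)] by (simp add: linear_simps[OF \<phi>.bounded_linear_axioms])
    finally show ?case using elim(2) by simp
  qed
  have \<phi>M: "((\<lambda>\<mu>. \<phi> (M \<mu>)) \<longlongrightarrow> 1) at_infinity" using \<phi>.tendsto[OF M(1)] \<phi>(3) by simp
  have "((\<lambda>\<mu>. - (1 / \<mu>) * \<phi> (M \<mu>)) \<longlongrightarrow> - 0 * 1) at_infinity" by (intro tendsto_intros inv \<phi>M)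
  then have "((\<lambda>\<mu>. - (1 / \<mu>) * \<phi> (M \<mu>)) \<longlongrightarrow> 0) at_infinity" by simp
  then have "(g \<longlongrightarrow> 0) at_infinity"
    by (rule Lim_transform_eventually) (use gM in \<open>auto elim: eventually_mono\<close>)
  then have g0: "g \<mu> = 0" for \<mu> by (rule Liouville_weak[OF hol])
  have "eventually (\<lambda>\<mu>. \<phi> (M \<mu>) = 0) at_infinity"
    using gM by eventually_elim (auto simp: g0)
  then have "((\<lambda>\<mu>. \<phi> (M \<mu>)) \<longlongrightarrow> 0) at_infinity" by (rule tendsto_eventually)
  then show False using tendsto_unique[OF _ \<phi>M] trivial_limit_at_infinity by fastforce
qed

lemma ideal_not_invertible:
  assumes "ideal I" "A \<in> I"
  shows "\<not> invertible_op A"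
proof
  assume "invertible_op A"
  then obtain B where B: "A o\<^sub>L B = id_blinfun" "B o\<^sub>L A = id_blinfun" unfolding invertible_op_def by blast
  have "B \<in> alg" by (rule alg_inverse[OF _ B]) (use assms in \<open>auto simp: ideal_def\<close>)
  then show False using assms B(2) unfolding ideal_def by metis
qed

end

text \<open>Under left multiplication by \<open>e1\<close>, the module consists of two copies of the
  complexification of the real space, formed by the first two and the last two components. An
  inverse of \<open>complex_shift A \<mu>\<close> applied to both copies inverts the lifted
  operator, up to sign.\<close>

lemma real_spectrum_lift_op:
  fixes A :: "'a::banach \<Rightarrow>\<^sub>L 'a"
  assumes A: "real_spectrum A" and not: "\<not> invertible_op (lift_op A - Lm (slice_pt e1 \<mu>))"
  shows "Im \<mu> = 0"
proof (rule ccontr)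
  assume "Im \<mu> \<noteq> 0"
  then have "\<mu> \<notin> complex_spectrum A" using A unfolding real_spectrum_def by (auto simp: complex_is_Real_iff)
  then obtain B where B: "complex_shift A \<mu> o\<^sub>L B = id_blinfun" "B o\<^sub>L complex_shift A \<mu> = id_blinfun"
    unfolding complex_spectrum_def by blast
  define C :: "'a qmod \<Rightarrow>\<^sub>L 'a qmod" where "C = Blinfun (\<lambda>x. (fst (B (fst x, fst (snd x))), snd (B (fst x, fst (snd x))),
     fst (B (snd (snd x))), snd (B (snd (snd x)))))"
  have "bounded_linear (\<lambda>x :: 'a qmod. (fst (B (fst x, fst (snd x))), snd (B (fst x, fst (snd x))),
     fst (B (snd (snd x))), snd (B (snd (snd x)))))"
    by (intro bounded_linear_intros)
  then have C: "C x = (fst (B (fst x, fst (snd x))), snd (B (fst x, fst (snd x))),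
     fst (B (snd (snd x))), snd (B (snd (snd x))))" for x
    unfolding C_def by (simp add: bounded_linear_Blinfun_apply)
  let ?D = "Lm (slice_pt e1 \<mu>) - lift_op A"
  have D: "?D x = (fst (complex_shift A \<mu> (fst x, fst (snd x))), snd (complex_shift A \<mu> (fst x, fst (snd x))),
     fst (complex_shift A \<mu> (snd (snd x))), snd (complex_shift A \<mu> (snd (snd x))))" for x
    by (cases x) (simp add: blinfun.diff_left Lm_apply lift_op_apply complex_shift_apply slice_pt_def e1_def of_real_def
      one_quat_def scaleR_quat_def plus_quat_def)
  have BB: "complex_shift A \<mu> (B x) = x" "B (complex_shift A \<mu> x) = x" for x
    using arg_cong[OF B(1), of "\<lambda>F. blinfun_apply F x"] arg_cong[OF B(2), of "\<lambda>F. blinfun_apply F x"] by simp_all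
  have "?D o\<^sub>L C = id_blinfun" "C o\<^sub>L ?D = id_blinfun"
    by (rule blinfun_eqI, simp add: C D BB)+
  then have "(lift_op A - Lm (slice_pt e1 \<mu>)) o\<^sub>L (- C) = id_blinfun" "(- C) o\<^sub>L (lift_op A - Lm (slice_pt e1 \<mu>)) = id_blinfun"
    by (simp_all add: oL.minus_right oL.minus_left oL.diff_left oL.diff_right)
  then show False using not unfolding invertible_op_def by blast
qed

section \<open>Interchange and contour independence for integrals over chains\<close>

section \<open>Integrals over chains\<close>

lemma chain_integrable:
  assumes "continuous_on (chain_support E) f" "e \<in> E"
  shows "f contour_integrable_on linepath (fst e) (snd e)"
  using assms by (intro contour_integrable_continuous_linepath continuous_on_subset[OF assms(1)])
    (auto simp: chain_support_def)

lemma chain_integral_cong: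
  assumes "\<And>z. z \<in> chain_support E \<Longrightarrow> f z = g z"
  shows "chain_integral E f = chain_integral E g"
  unfolding chain_integral_def
  by (intro sum.cong contour_integral_cong refl assms) (auto simp: chain_support_def)

lemma chain_integral_diff:
  assumes "continuous_on (chain_support E) f" "continuous_on (chain_support E) g"
  shows "chain_integral E (\<lambda>z. f z - g z) = chain_integral E f - chain_integral E g"
  unfolding chain_integral_def sum_subtractf[symmetric]
  by (intro sum.cong refl contour_integral_diff chain_integrable[OF assms(1)] chain_integrable[OF assms(2)])

lemma chain_integral_add:
  assumes "continuous_on (chain_support E) f" "continuous_on (chain_support E) g"
  shows "chain_integral E (\<lambda>z. f z + g z) = chain_integral E f + chain_integral E g"
  unfolding chain_integral_def sum.distrib[symmetric]
  by (intro sum.cong refl contour_integral_add chain_integrable[OF assms(1)] chain_integrable[OF assms(2)])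

lemma chain_integral_lmul:
  assumes "continuous_on (chain_support E) f"
  shows "chain_integral E (\<lambda>z. c * f z) = c * chain_integral E f"
  unfolding chain_integral_def sum_distrib_left
  by (intro sum.cong refl contour_integral_lmul chain_integrable[OF assms])

lemma continuous_on_chain_Cauchy_integral:
  assumes E: "continuous_on (chain_support E) b" and S: "S \<inter> chain_support E = {}"
  shows "continuous_on S (\<lambda>z. chain_integral E (\<lambda>w. b w / (w - z)))"
  unfolding chain_integral_def
proof (intro continuous_on_sum)
  fix e assume e: "e \<in> E"
  then have sub: "closed_segment (fst e) (snd e) \<subseteq> chain_support E" unfolding chain_support_def by blast
  show "continuous_on S (\<lambda>z. contour_integral (linepath (fst e) (snd e)) (\<lambda>w. b w / (w - z)))"
    by (rule continuous_on_subset[OF holomorphic_on_imp_continuous_on[OF holomorphic_on_linepath_Cauchy_integral]])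
      (use continuous_on_subset[OF E sub] sub S in auto)
qed

text \<open>Fubini's theorem for disjoint chains; the sign comes from the antisymmetry of the kernel
  1 / (w - z).\<close>

lemma chain_integral_swap:
  assumes E: "finite E" "finite E'" and disj: "chain_support E \<inter> chain_support E' = {}"
    and a: "continuous_on (chain_support E) a" and b: "continuous_on (chain_support E') b"
  shows "chain_integral E (\<lambda>z. a z * chain_integral E' (\<lambda>w. b w / (w - z))) =
     - chain_integral E' (\<lambda>w. b w * chain_integral E (\<lambda>z. a z / (z - w)))"
proof -
  have sub: "closed_segment (fst e) (snd e) \<subseteq> chain_support E" if "e \<in> E" for e and E :: "(complex \<times> complex) set"
    using that unfolding chain_support_def by blast
  define I where "I e e' = contour_integral (linepath (fst e) (snd e)) (\<lambda>z. contour_integral (linepath (fst e') (snd e')) (\<lambda>w. a z * b w / (w - z)))" for e e'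
  have expand: "chain_integral E (\<lambda>z. a z * chain_integral E' (\<lambda>w. b w / (w - z))) = (\<Sum>e\<in>E. \<Sum>e'\<in>E'.
      contour_integral (linepath (fst e) (snd e)) (\<lambda>z. contour_integral (linepath (fst e') (snd e')) (\<lambda>w. a z * b w / (w - z))))"
    if E: "finite E" "finite E'" and disj: "chain_support E \<inter> chain_support E' = {}"
    and a: "continuous_on (chain_support E) a" and b: "continuous_on (chain_support E') b" for E E' a b
  proof -
    have cb: "continuous_on (chain_support E') (\<lambda>w. b w / (w - z))" if "z \<in> chain_support E" for z
      using disj that by (intro continuous_intros b) auto
    have ci: "(\<lambda>z. contour_integral (linepath (fst e') (snd e')) (\<lambda>w. a z * b w / (w - z))) contour_integrable_on linepath (fst e) (snd e)"
      if e: "e \<in> E" "e' \<in> E'" for e e'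
    proof (rule contour_integrable_continuous_linepath)
      have "continuous_on (chain_support E) (\<lambda>z. a z * contour_integral (linepath (fst e') (snd e')) (\<lambda>w. b w / (w - z)))"
        by (intro continuous_intros a continuous_on_subset[OF holomorphic_on_imp_continuous_on[OF holomorphic_on_linepath_Cauchy_integral]])
          (use continuous_on_subset[OF b sub[OF e(2)]] sub[OF e(2)] disj in auto)
      moreover have "a z * contour_integral (linepath (fst e') (snd e')) (\<lambda>w. b w / (w - z)) =
        contour_integral (linepath (fst e') (snd e')) (\<lambda>w. a z * b w / (w - z))" if "z \<in> chain_support E" for z
        using contour_integral_lmul[OF chain_integrable[OF cb[OF that] e(2)], of "a z"] by simp
      ultimately have "continuous_on (chain_support E) (\<lambda>z. contour_integral (linepath (fst e') (snd e')) (\<lambda>w. a z * b w / (w - z)))"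
        by (simp cong: continuous_on_cong)
      then show "continuous_on (closed_segment (fst e) (snd e)) (\<lambda>z. contour_integral (linepath (fst e') (snd e')) (\<lambda>w. a z * b w / (w - z)))"
        using sub[OF e(1)] continuous_on_subset by blast
    qed
    have "chain_integral E (\<lambda>z. a z * chain_integral E' (\<lambda>w. b w / (w - z))) =
      chain_integral E (\<lambda>z. \<Sum>e'\<in>E'. contour_integral (linepath (fst e') (snd e')) (\<lambda>w. a z * b w / (w - z)))"
    proof (rule chain_integral_cong)
      fix z assume z: "z \<in> chain_support E"
      show "a z * chain_integral E' (\<lambda>w. b w / (w - z)) =
         (\<Sum>e'\<in>E'. contour_integral (linepath (fst e') (snd e')) (\<lambda>w. a z * b w / (w - z)))"
        using chain_integral_lmul[OF cb[OF z], of "a z"] unfolding chain_integral_def by simp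
    qed
    also have "\<dots> = (\<Sum>e\<in>E. \<Sum>e'\<in>E'.
      contour_integral (linepath (fst e) (snd e)) (\<lambda>z. contour_integral (linepath (fst e') (snd e')) (\<lambda>w. a z * b w / (w - z))))"
      unfolding chain_integral_def by (intro sum.cong refl contour_integral_sum E ci)
    finally show ?thesis .
  qed
  have swap: "contour_integral (linepath (fst e) (snd e)) (\<lambda>z. contour_integral (linepath (fst e') (snd e')) (\<lambda>w. a z * b w / (w - z)))
     = - contour_integral (linepath (fst e') (snd e')) (\<lambda>w. contour_integral (linepath (fst e) (snd e)) (\<lambda>z. b w * a z / (z - w)))"
    if e: "e \<in> E" "e' \<in> E'" for e e'
  proof -
    have ne: "z \<noteq> w" if "z \<in> closed_segment (fst e) (snd e)" "w \<in> closed_segment (fst e') (snd e')" for z w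
      using sub[OF e(1)] sub[OF e(2)] disj that by blast
    have "contour_integral (linepath (fst e) (snd e)) (\<lambda>z. contour_integral (linepath (fst e') (snd e')) (\<lambda>w. a z * b w / (w - z)))
     = contour_integral (linepath (fst e') (snd e')) (\<lambda>w. contour_integral (linepath (fst e) (snd e)) (\<lambda>z. a z * b w / (w - z)))"
    proof (rule contour_integral_swap)
      show "continuous_on (path_image (linepath (fst e) (snd e)) \<times> path_image (linepath (fst e') (snd e'))) (\<lambda>(z, w). a z * b w / (w - z))"
        unfolding split_def path_image_linepath
        by (intro continuous_intros continuous_on_compose2[OF continuous_on_subset[OF a sub[OF e(1)]]]
           continuous_on_compose2[OF continuous_on_subset[OF b sub[OF e(2)]]]) (use ne in force)+
    qed auto
    also have "\<dots> = contour_integral (linepath (fst e') (snd e')) (\<lambda>w. - contour_integral (linepath (fst e) (snd e)) (\<lambda>z. b w * a z / (z - w)))"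
    proof (rule contour_integral_cong[OF refl])
      fix w
      have "contour_integral (linepath (fst e) (snd e)) (\<lambda>z. a z * b w / (w - z)) =
        contour_integral (linepath (fst e) (snd e)) (\<lambda>z. - (b w * a z / (z - w)))"
        by (rule contour_integral_cong[OF refl]) (metis minus_diff_eq minus_divide_right mult.commute)
      then show "contour_integral (linepath (fst e) (snd e)) (\<lambda>z. a z * b w / (w - z)) =
        - contour_integral (linepath (fst e) (snd e)) (\<lambda>z. b w * a z / (z - w))"
        by (simp only: contour_integral_neg)
    qed
    finally show ?thesis by (simp only: contour_integral_neg)
  qed
  show ?thesis
    unfolding expand[OF E disj a b] expand[OF E(2,1) _ b a] using disj
    by (subst expand[OF E(2,1) _ b a]) (auto simp: swap sum_negf Int_commute intro: sum.swap)
qed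

text \<open>The difference of the two boundaries has total winding number 1 - 1 on \<open>K\<close>
  and 0 outside \<open>U\<close>, so it is null-homologous in \<open>U - K\<close>.\<close>

lemma boundary_integral_unique:
  assumes U: "open U" "compact K" "K \<subseteq> U" and f: "f holomorphic_on U - K"
    and D: "open D" "K \<subseteq> D" "closure D \<subseteq> U" "oriented_boundary D \<Gamma>"
    and D': "open D'" "K \<subseteq> D'" "closure D' \<subseteq> U" "oriented_boundary D' \<Gamma>'"
  shows "(\<Sum>\<gamma>\<in>\<Gamma>. contour_integral \<gamma> f) = (\<Sum>\<gamma>\<in>\<Gamma>'. contour_integral \<gamma> f)"
proof -
  have ob: "finite \<Gamma>" "\<And>\<gamma>. \<gamma> \<in> \<Gamma> \<Longrightarrow> valid_path \<gamma>" "\<And>\<gamma>. \<gamma> \<in> \<Gamma> \<Longrightarrow> pathfinish \<gamma> = pathstart \<gamma>"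
    "\<And>\<gamma>. \<gamma> \<in> \<Gamma> \<Longrightarrow> path_image \<gamma> \<subseteq> U - K"
    "\<And>w. w \<notin> U - K \<Longrightarrow> (\<Sum>\<gamma>\<in>\<Gamma>. winding_number \<gamma> w) = (if w \<in> K then 1 else 0)"
    if "open D" "K \<subseteq> D" "closure D \<subseteq> U" "oriented_boundary D \<Gamma>" for D \<Gamma>
  proof -
    have im: "path_image \<gamma> \<subseteq> frontier D" if "\<gamma> \<in> \<Gamma>" for \<gamma>
      using \<open>oriented_boundary D \<Gamma>\<close> that unfolding oriented_boundary_def jordan_boundary_def by blast
    have "frontier D \<subseteq> U - K" using that unfolding frontier_def by (auto simp: interior_open)
    then show "\<And>\<gamma>. \<gamma> \<in> \<Gamma> \<Longrightarrow> path_image \<gamma> \<subseteq> U - K" using im by blast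
    show "\<And>w. w \<notin> U - K \<Longrightarrow> (\<Sum>\<gamma>\<in>\<Gamma>. winding_number \<gamma> w) = (if w \<in> K then 1 else 0)"
      using that unfolding oriented_boundary_def by auto
  qed (use that in \<open>auto simp: oriented_boundary_def jordan_boundary_def\<close>)
  note o1 = ob[OF D] and o2 = ob[OF D']
  have "(\<Sum>i\<in>\<Gamma> <+> \<Gamma>'. case_sum (\<lambda>_. 1) (\<lambda>_. -1) i * contour_integral (case_sum id id i) f) = 0"
  proof (rule Cauchy_theorem_cycle[where V = "U - K"])
    show "open (U - K)" using U compact_imp_closed by blast
    show "finite (\<Gamma> <+> \<Gamma>')" using o1(1) o2(1) by simp
    show "path_image (case_sum id id i) \<subseteq> U - K" if "i \<in> \<Gamma> <+> \<Gamma>'" for i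
      using that by (elim PlusE) (simp_all only: sum.case id_apply o1(4) o2(4))
    fix w assume "w \<notin> U - K"
    then show "(\<Sum>i\<in>\<Gamma> <+> \<Gamma>'. case_sum (\<lambda>_. 1) (\<lambda>_. -1) i * winding_number (case_sum id id i) w) = 0"
      using o1(5)[of w] o2(5)[of w] by (simp add: sum.Plus o1(1) o2(1) sum_negf)
  qed (use f o1 o2 in auto)
  then show ?thesis by (simp add: sum.Plus o1(1) o2(1) sum_negf)
qed

section \<open>Integrals of the resolvent against an even indicator function\<close>

section \<open>Vanishing of the integral of the resolvent\<close>

text \<open>The edges \<open>E\<close> carry Cauchy's formula and the double integrals; the curves
  \<Gamma> allow comparison with arbitrary oriented boundaries. The last clause passes from one to
  the other.\<close>

definition polygonal_domain ::
  "complex set \<Rightarrow> complex set \<Rightarrow> (complex \<times> complex) set \<Rightarrow> (real \<Rightarrow> complex) set \<Rightarrow> bool" where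
  "polygonal_domain U D E \<Gamma> \<longleftrightarrow> open D \<and> bounded D \<and> closure D \<subseteq> U \<and> finite E \<and>
     chain_support E = frontier D \<and> oriented_boundary D \<Gamma> \<and>
     (\<forall>f z. f holomorphic_on U \<longrightarrow> z \<in> D \<longrightarrow> chain_integral E (\<lambda>w. f w / (w - z)) = 2 * pi * \<i> * f z) \<and>
     (\<forall>f z. f holomorphic_on U \<longrightarrow> z \<notin> closure D \<longrightarrow> chain_integral E (\<lambda>w. f w / (w - z)) = 0) \<and>
     (\<forall>f. continuous_on (frontier D) f \<longrightarrow> (\<Sum>\<gamma>\<in>\<Gamma>. contour_integral \<gamma> f) = chain_integral E f)"

lemma exists_polygonal_domain':
  assumes "compact K" "open U" "K \<subseteq> U"
  shows "\<exists>D E \<Gamma>. polygonal_domain U D E \<Gamma> \<and> K \<subseteq> D \<and> (cnj ` K \<subseteq> K \<longrightarrow> cnj ` D \<subseteq> D)"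
proof (rule exists_polygonal_domain[OF assms])
  fix D E \<Gamma>
  assume a: "open D" "bounded D" "K \<subseteq> D" "closure D \<subseteq> U" "finite E"
    "chain_support E = frontier D" "cnj ` K \<subseteq> K \<Longrightarrow> cnj ` D \<subseteq> D"
    and b: "\<And>f z. f holomorphic_on U \<Longrightarrow> z \<in> D \<Longrightarrow> chain_integral E (\<lambda>w. f w / (w - z)) = 2 * pi * \<i> * f z"
    and c: "\<And>f z. f holomorphic_on U \<Longrightarrow> z \<notin> closure D \<Longrightarrow> chain_integral E (\<lambda>w. f w / (w - z)) = 0"
    and d: "oriented_boundary D \<Gamma>"
    and e: "\<And>f. continuous_on (frontier D) f \<Longrightarrow> (\<Sum>\<gamma>\<in>\<Gamma>. contour_integral \<gamma> f) = chain_integral E f"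
  have "polygonal_domain U D E \<Gamma>"
    unfolding polygonal_domain_def by (intro conjI allI impI a(1,2,4-6) b c d e)
  then show ?thesis using a(3,7) by (intro exI[of _ D] exI[of _ E] exI[of _ \<Gamma>] conjI impI)
qed

lemma polygonal_domain_frontier:
  assumes "polygonal_domain U D E \<Gamma>"
  shows "chain_support E \<subseteq> U" "chain_support E \<inter> D = {}"
  using assms unfolding polygonal_domain_def frontier_def by (auto simp: interior_open)

lemma polygonal_chain_unique:
  assumes P: "polygonal_domain U D E \<Gamma>" "K \<subseteq> D" "polygonal_domain U D' E' \<Gamma>'" "K \<subseteq> D'"
    and U: "open U" "compact K" and f: "f holomorphic_on U - K"
  shows "chain_integral E f = chain_integral E' f"
proof -
  have c: "continuous_on (frontier D) f" if "polygonal_domain U D E \<Gamma>" "K \<subseteq> D" for D E \<Gamma>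
    using polygonal_domain_frontier[OF that(1)] that unfolding polygonal_domain_def
    by (intro continuous_on_subset[OF holomorphic_on_imp_continuous_on[OF f]]) blast
  have "K \<subseteq> U" using P unfolding polygonal_domain_def using closure_subset by blast
  have "(\<Sum>\<gamma>\<in>\<Gamma>. contour_integral \<gamma> f) = (\<Sum>\<gamma>\<in>\<Gamma>'. contour_integral \<gamma> f)"
    by (rule boundary_integral_unique[where D = D and D' = D', OF U \<open>K \<subseteq> U\<close> f]) (use P in \<open>auto simp: polygonal_domain_def\<close>)
  then show ?thesis using c[OF P(1,2)] c[OF P(3,4)] P(1,3) unfolding polygonal_domain_def by simp
qed

context slice_triple
begin

definition eint :: "(complex \<times> complex) set \<Rightarrow> (complex \<Rightarrow> 'a qmod \<Rightarrow>\<^sub>L 'a qmod) \<Rightarrow> 'a qmod \<Rightarrow>\<^sub>L 'a qmod" where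
  "eint E h = (\<Sum>e\<in>E. cint (linepath (fst e) (snd e)) h)"

lemma functional_eint:
  assumes "open S" "cholo h S" "chain_support E \<subseteq> S" and \<phi>: "functional \<phi>"
  shows "\<phi> (eint E h) = chain_integral E (\<lambda>z. \<phi> (h z))"
proof -
  interpret \<phi>: bounded_linear \<phi> using \<phi> by (simp add: functional_def)
  have "\<phi> (cint (linepath (fst e) (snd e)) h) = contour_integral (linepath (fst e) (snd e)) (\<lambda>z. \<phi> (h z))" if "e \<in> E" for e
    by (rule functional_cint[OF assms(1,2)]) (use assms that in \<open>auto simp: chain_support_def\<close>)
  then show ?thesis unfolding eint_def chain_integral_def \<phi>.sum by simp
qed

lemma eint_in_alg:
  assumes S: "open S" "cholo h S" "chain_support E \<subseteq> S" and h: "\<And>z. z \<in> S \<Longrightarrow> h z \<in> alg"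
  shows "eint E h \<in> alg"
proof -
  have sub: "cint (linepath (fst e) (snd e)) h \<in> alg" if "e \<in> E" for e
    by (rule cint_in_alg[OF S(1,2) _ _ h]) (use S that in \<open>auto simp: chain_support_def\<close>)
  have gen: "(\<Sum>e\<in>F. g e) \<in> alg" if "\<And>e. e \<in> F \<Longrightarrow> g e \<in> alg" for F :: "(complex \<times> complex) set" and g
    using that by (induction F rule: infinite_finite_induct) (auto intro: alg_linear)
  show ?thesis unfolding eint_def by (rule gen) (rule sub)
qed

text \<open>With \<open>\<eta>\<close> the indicator of a part of the spectrum, \<open>A\<close> and \<open>P\<close> below are entries of the Riesz
  projection of the operator matrix with rows \<open>(T\<^sub>0, R)\<close> and \<open>(-1, T\<^sub>0)\<close>, whose resolvent has the
  entries \<open>X\<close> and \<open>- y\<close>.\<close>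

lemma idempotent_relation:
  assumes U: "open U" and \<eta>: "\<eta> holomorphic_on U" "\<And>z. z \<in> U \<Longrightarrow> \<eta> z * \<eta> z = \<eta> z"
    and D: "polygonal_domain U D E \<Gamma>" "K \<subseteq> D"
  defines "P \<equiv> eint E (\<lambda>z. cscale (\<eta> z) (y z))" and "A \<equiv> eint E (\<lambda>z. cscale (\<eta> z) (X z))"
  shows "2 *\<^sub>R (A o\<^sub>L P) = cscale (2 * pi * \<i>) P" "P \<in> alg" "A \<in> alg"
proof -
  define S where "S = U - K"
  have S: "open S" unfolding S_def using U compact_imp_closed[OF compact_K] by (rule open_Diff)
  have SK: "S \<subseteq> - K" "S \<subseteq> U" unfolding S_def by auto
  have \<eta>S: "\<eta> holomorphic_on S" using \<eta>(1) SK(2) by (rule holomorphic_on_subset)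
  define hy where "hy z = cscale (\<eta> z) (y z)" for z
  define hX where "hX z = cscale (\<eta> z) (X z)" for z
  have ch: "cholo hy S" "cholo hX S"
    unfolding hy_def hX_def by (intro cholo_cscale[OF \<eta>S] cholo_subset[OF cholo_y SK(1)] cholo_subset[OF cholo_X SK(1)])+
  have alg: "hy z \<in> alg" "hX z \<in> alg" if "z \<in> S" for z
    using that SK(1) unfolding hy_def hX_def cscale_eq by (auto intro: alg_compose alg_sop alg_y alg_X)
  have "compact (closure D)" "closure D \<subseteq> U" using D(1) unfolding polygonal_domain_def by (auto simp: compact_closure)
  \<comment> \<open>A second contour around the closure of \<open>D\<close>. It yields the same
    \<open>P\<close> and \<open>A\<close>, and in the products the two integration variables stay
    apart.\<close>
  from exists_polygonal_domain'[OF this(1) U this(2)] obtain D' E' \<Gamma>'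
    where D': "polygonal_domain U D' E' \<Gamma>'" "closure D \<subseteq> D'" by blast
  have KD': "K \<subseteq> D'" using D(2) D'(2) closure_subset by blast
  have supp: "chain_support E \<subseteq> S" "chain_support E' \<subseteq> S"
    using polygonal_domain_frontier[OF D(1)] polygonal_domain_frontier[OF D'(1)] D(2) KD' unfolding S_def by auto
  have suppD: "chain_support E \<subseteq> closure D" using D(1) unfolding polygonal_domain_def frontier_def by auto
  have disj: "chain_support E \<inter> chain_support E' = {}" "chain_support E' \<inter> closure D = {}"
    using polygonal_domain_frontier(2)[OF D'(1)] D'(2) suppD by auto
  have fin: "finite E" "finite E'" using D(1) D'(1) unfolding polygonal_domain_def by auto
  have eq: "eint E h = eint E' h" if h: "cholo h S" for h
    unfolding eq_iff_functional
  proof (intro allI impI)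
    fix \<phi> assume \<phi>: "functional \<phi>"
    then have "(\<lambda>z. \<phi> (h z)) holomorphic_on U - K" using h unfolding cholo_def S_def by blast
    then show "\<phi> (eint E h) = \<phi> (eint E' h)"
      unfolding functional_eint[OF S h supp(1) \<phi>] functional_eint[OF S h supp(2) \<phi>]
      by (rule polygonal_chain_unique[OF D D'(1) KD' U compact_K])
  qed
  have P: "P = eint E hy" "P = eint E' hy" and A: "A = eint E hX" "A = eint E' hX"
    unfolding P_def A_def hy_def[symmetric] hX_def[symmetric] using eq ch by auto
  show PA: "P \<in> alg" "A \<in> alg" unfolding P A using eint_in_alg[OF S ch(1) supp(1)] eint_in_alg[OF S ch(2) supp(1)] alg P A by simp_all
  have sum: "(A o\<^sub>L P) + (P o\<^sub>L A) = cscale (2 * pi * \<i>) P"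
    unfolding eq_iff_functional
  proof (intro allI impI)
    fix \<phi> assume \<phi>: "functional \<phi>"
    interpret \<phi>: bounded_linear \<phi> using \<phi> by (simp add: functional_def)
    define b where "b w = \<phi> (hy w)" for w
    have cb: "continuous_on S b" "continuous_on S \<eta>" "continuous_on S (\<lambda>z. \<phi> (y z))"
      using ch(1) cholo_subset[OF cholo_y SK(1)] \<phi> \<eta>S unfolding b_def cholo_def
      by (auto intro: holomorphic_on_imp_continuous_on)
    have comm: "A o\<^sub>L Lm J = Lm J o\<^sub>L A" "P o\<^sub>L Lm J = Lm J o\<^sub>L P" by (intro alg_commute PA alg_gens)+
    define F where "F z = chain_integral E' (\<lambda>w. \<phi> (hX w o\<^sub>L y z))" for z
    define G where "G z = chain_integral E' (\<lambda>w. \<phi> (hy w o\<^sub>L X z))" for z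
    have F: "\<phi> (A o\<^sub>L y z) = F z" and G: "\<phi> (P o\<^sub>L X z) = G z" for z
      unfolding F_def G_def A(2) P(2) by (rule functional_eint[OF S _ supp(2) functional_right[OF \<phi>]], rule ch)+
    have "cholo (\<lambda>z. y z) S" "cholo (\<lambda>z. X z) S" using cholo_subset[OF cholo_y SK(1)] cholo_subset[OF cholo_X SK(1)] by auto
    then have cFG: "continuous_on S F" "continuous_on S G"
      using functional_left[OF \<phi> comm(1)] functional_left[OF \<phi> comm(2)] unfolding F[symmetric] G[symmetric] cholo_def
      by (auto intro: holomorphic_on_imp_continuous_on)
    note cS = continuous_on_subset[OF _ supp(1)] continuous_on_subset[OF _ supp(2)]
    have "\<phi> (A o\<^sub>L P) = chain_integral E (\<lambda>z. \<phi> (A o\<^sub>L hy z))"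
      unfolding P(1) by (rule functional_eint[OF S ch(1) supp(1) functional_left[OF \<phi> comm(1)]])
    also have "\<dots> = chain_integral E (\<lambda>z. \<eta> z * F z)"
      unfolding hy_def F[symmetric] using functional_cscale[OF functional_left[OF \<phi> comm(1)]] by simp
    finally have 1: "\<phi> (A o\<^sub>L P) = chain_integral E (\<lambda>z. \<eta> z * F z)" .
    have "\<phi> (P o\<^sub>L A) = chain_integral E (\<lambda>z. \<phi> (P o\<^sub>L hX z))"
      unfolding A(1) by (rule functional_eint[OF S ch(2) supp(1) functional_left[OF \<phi> comm(2)]])
    also have "\<dots> = chain_integral E (\<lambda>z. \<eta> z * G z)"
      unfolding hX_def G[symmetric] using functional_cscale[OF functional_left[OF \<phi> comm(2)]] by simp
    finally have 2: "\<phi> (P o\<^sub>L A) = chain_integral E (\<lambda>z. \<eta> z * G z)" .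
    \<comment> \<open>The resolvent identity reads X(w) y(z) + y(w) X(z) = (y(z) - y(w)) / (w - z).
      As \<open>z\<close> lies inside the outer contour, the part with y(z) is evaluated by Cauchy's
      formula for \<eta>.\<close>
    have FG: "F z + G z = 2 * pi * \<i> * \<eta> z * \<phi> (y z) - chain_integral E' (\<lambda>w. b w / (w - z))"
      if z: "z \<in> chain_support E" for z
    proof -
      have zK: "z \<notin> K" and zD: "z \<in> D'" using z supp(1) SK suppD D'(2) by auto
      have c: "continuous_on (chain_support E') (\<lambda>w. \<phi> (hX w o\<^sub>L y z))" "continuous_on (chain_support E') (\<lambda>w. \<phi> (hy w o\<^sub>L X z))"
        using ch functional_right[OF \<phi>] unfolding cholo_def
        by (blast intro: cS(2) holomorphic_on_imp_continuous_on)+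
      have ne: "w \<noteq> z" if "w \<in> chain_support E'" for w using that z disj(1) by auto
      have "F z + G z = chain_integral E' (\<lambda>w. \<phi> (hX w o\<^sub>L y z) + \<phi> (hy w o\<^sub>L X z))"
        unfolding F_def G_def by (rule chain_integral_add[OF c, symmetric])
      also have "\<dots> = chain_integral E' (\<lambda>w. \<phi> (y z) * (\<eta> w / (w - z)) - b w / (w - z))"
      proof (rule chain_integral_cong)
        fix w assume w: "w \<in> chain_support E'"
        have wK: "w \<notin> K" using w supp(2) SK by auto
        have "y z - y w = cscale (z - w) (ry w z)" by (rule resolvent[OF wK zK])
        also have "ry w z = - ((X w o\<^sub>L y z) + (y w o\<^sub>L X z))"
          unfolding ry_def X_def slice_pt_add Lm_add
          by (simp add: oL_ring y_comm(1,3)[OF wK] y_comm(1,3)[OF zK] y_comm(1,3)[OF wK, THEN comm_left]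
            y_comm(1,3)[OF zK, THEN comm_left] y_y[OF zK wK] comm_left[OF y_y[OF zK wK]] scaleR_2 algebra_simps)
        finally have eqA: "y z - y w = cscale (z - w) (- ((X w o\<^sub>L y z) + (y w o\<^sub>L X z)))" .
        have neg: "\<phi> (- B) = - \<phi> B" for B using \<phi>.diff[of 0 B] by (simp add: \<phi>.zero)
        have "\<phi> (y z) - \<phi> (y w) = (z - w) * - (\<phi> (X w o\<^sub>L y z) + \<phi> (y w o\<^sub>L X z))"
          unfolding \<phi>.diff[symmetric] eqA functional_cscale[OF \<phi>] neg \<phi>.add ..
        then have "\<phi> (X w o\<^sub>L y z) + \<phi> (y w o\<^sub>L X z) = (\<phi> (y z) - \<phi> (y w)) / (w - z)"
          using ne[OF w] by (simp add: field_simps)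
        moreover have "\<phi> (hX w o\<^sub>L y z) + \<phi> (hy w o\<^sub>L X z) = \<eta> w * (\<phi> (X w o\<^sub>L y z) + \<phi> (y w o\<^sub>L X z))"
          unfolding hX_def hy_def using functional_cscale[OF functional_right[OF \<phi>]] by (simp add: distrib_left)
        ultimately have "\<phi> (hX w o\<^sub>L y z) + \<phi> (hy w o\<^sub>L X z) = \<eta> w * ((\<phi> (y z) - \<phi> (y w)) / (w - z))"
          by (simp only:)
        moreover have "b w = \<eta> w * \<phi> (y w)" unfolding b_def hy_def by (rule functional_cscale[OF \<phi>])
        ultimately show "\<phi> (hX w o\<^sub>L y z) + \<phi> (hy w o\<^sub>L X z) = \<phi> (y z) * (\<eta> w / (w - z)) - b w / (w - z)"
          by (simp add: diff_divide_distrib right_diff_distrib mult.commute)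
      qed
      also have "\<dots> = chain_integral E' (\<lambda>w. \<phi> (y z) * (\<eta> w / (w - z))) - chain_integral E' (\<lambda>w. b w / (w - z))"
        by (intro chain_integral_diff continuous_intros cS(2) cb) (use ne in auto)
      also have "chain_integral E' (\<lambda>w. \<phi> (y z) * (\<eta> w / (w - z))) = \<phi> (y z) * chain_integral E' (\<lambda>w. \<eta> w / (w - z))"
        by (intro chain_integral_lmul continuous_intros cS(2) cb) (use ne in auto)
      also have "chain_integral E' (\<lambda>w. \<eta> w / (w - z)) = 2 * pi * \<i> * \<eta> z"
        using D'(1) \<eta>(1) zD unfolding polygonal_domain_def by blast
      finally show ?thesis by (simp add: mult_ac)
    qed
    have cI: "continuous_on (chain_support E) (\<lambda>z. chain_integral E' (\<lambda>w. b w / (w - z)))"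
      by (rule continuous_on_chain_Cauchy_integral[OF cS(2)[OF cb(1)] disj(1)])
    have "\<phi> ((A o\<^sub>L P) + (P o\<^sub>L A)) = chain_integral E (\<lambda>z. \<eta> z * F z + \<eta> z * G z)"
      unfolding \<phi>.add 1 2 by (intro chain_integral_add[symmetric] continuous_intros cS(1) cb cFG)
    also have "\<dots> = chain_integral E (\<lambda>z. 2 * pi * \<i> * b z - \<eta> z * chain_integral E' (\<lambda>w. b w / (w - z)))"
    proof (rule chain_integral_cong)
      fix z assume z: "z \<in> chain_support E"
      have "\<eta> z * F z + \<eta> z * G z = 2 * pi * \<i> * (\<eta> z * \<eta> z) * \<phi> (y z) - \<eta> z * chain_integral E' (\<lambda>w. b w / (w - z))"
        unfolding distrib_left[symmetric] FG[OF z] by (simp add: algebra_simps)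
      also have "\<eta> z * \<eta> z = \<eta> z" using \<eta>(2) z supp(1) SK(2) by blast
      finally show "\<eta> z * F z + \<eta> z * G z = 2 * pi * \<i> * b z - \<eta> z * chain_integral E' (\<lambda>w. b w / (w - z))"
        unfolding b_def hy_def by (simp add: functional_cscale[OF \<phi>])
    qed
    also have "\<dots> = 2 * pi * \<i> * chain_integral E b - chain_integral E (\<lambda>z. \<eta> z * chain_integral E' (\<lambda>w. b w / (w - z)))"
    proof -
      have c1: "continuous_on (chain_support E) (\<lambda>z. 2 * pi * \<i> * b z)"
        by (intro continuous_intros cS(1) cb)
      have c2: "continuous_on (chain_support E) (\<lambda>z. \<eta> z * chain_integral E' (\<lambda>w. b w / (w - z)))"
        by (rule continuous_on_mult[OF cS(1)[OF cb(2)] cI])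
      show ?thesis
        unfolding chain_integral_diff[OF c1 c2] chain_integral_lmul[OF cS(1)[OF cb(1)]] ..
    qed
    \<comment> \<open>After the interchange, the integral over the inner contour is taken at points
      outside it, where Cauchy's formula gives 0.\<close>
    also have "chain_integral E (\<lambda>z. \<eta> z * chain_integral E' (\<lambda>w. b w / (w - z))) = 0"
    proof -
      have "chain_integral E (\<lambda>z. \<eta> z / (z - w)) = 0" if "w \<in> chain_support E'" for w
        using D(1) \<eta>(1) disj(2) that unfolding polygonal_domain_def by blast
      then have "chain_integral E' (\<lambda>w. b w * chain_integral E (\<lambda>z. \<eta> z / (z - w))) = chain_integral E' (\<lambda>w. 0)"
        by (intro chain_integral_cong) simp
      then show ?thesis
        unfolding chain_integral_swap[OF fin disj(1) cS(1)[OF cb(2)] cS(2)[OF cb(1)]] by (simp add: chain_integral_def)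
    qed
    also have "2 * pi * \<i> * chain_integral E b - 0 = \<phi> (cscale (2 * pi * \<i>) P)"
      unfolding functional_cscale[OF \<phi>] P(1) functional_eint[OF S ch(1) supp(1) \<phi>] b_def by simp
    finally show "\<phi> ((A o\<^sub>L P) + (P o\<^sub>L A)) = \<phi> (cscale (2 * pi * \<i>) P)" .
  qed
  then show "2 *\<^sub>R (A o\<^sub>L P) = cscale (2 * pi * \<i>) P" by (simp add: scaleR_2 alg_commute[OF PA])
qed

lemma ideal_extend:
  assumes I: "ideal I" and S: "S \<in> alg"
  shows "\<exists>\<mu> I'. ideal I' \<and> I \<subseteq> I' \<and> S - sop \<mu> \<in> I'"
proof -
  obtain \<mu> where \<mu>: "ideal {B + ((S - sop \<mu>) o\<^sub>L A) | A B. A \<in> alg \<and> B \<in> I}" (is "ideal ?I")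
    using spectral_value_modulo_ideal[OF I S] by (rule exE)
  have "B \<in> ?I" if "B \<in> I" for B
    by (intro CollectI exI[of _ 0] exI[of _ B]) (simp add: that alg_linear)
  moreover have "S - sop \<mu> \<in> ?I"
    using I subspace_0[of I] unfolding ideal_def
    by (intro CollectI exI[of _ id_blinfun] exI[of _ 0]) (simp add: alg_linear)
  ultimately show ?thesis using \<mu> by (intro exI[of _ \<mu>] exI[of _ ?I]) blast
qed

text \<open>The kernel 1 / q has opposite residues at the two zeros of \<open>q\<close>, whereas (z
  - a0) / q has residue 1/2 at each. With \<eta> even, the latter gives \<open>A\<close> the value 2
  pi i \<eta>(\<rho>), while \<open>idempotent_relation\<close> demands pi i if \<open>P\<close> is
  not 0; then \<eta>(\<rho>) = 1/2, which is not idempotent. The partial fractions remain valid when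
  the two zeros coincide.\<close>

theorem eint_resolvent_zero:
  assumes J1: "J = e1" and real: "real_spectrum T0" "real_spectrum T1" "real_spectrum T2"
    and U: "open U" and \<eta>: "\<eta> holomorphic_on U" "\<And>z. z \<in> U \<Longrightarrow> \<eta> z * \<eta> z = \<eta> z" "\<And>z. z \<in> U \<Longrightarrow> \<eta> (cnj z) = \<eta> z"
    and D: "polygonal_domain U D E \<Gamma>" "K \<subseteq> D"
  shows "eint E (\<lambda>z. cscale (\<eta> z) (y z)) = 0"
proof (rule ccontr)
  define P where "P = eint E (\<lambda>z. cscale (\<eta> z) (y z))"
  define A where "A = eint E (\<lambda>z. cscale (\<eta> z) (X z))"
  assume "eint E (\<lambda>z. cscale (\<eta> z) (y z)) \<noteq> 0"
  then have P0: "P \<noteq> 0" by (simp add: P_def)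
  note rel = idempotent_relation[OF U \<eta>(1,2) D, folded P_def A_def]
  \<comment> \<open>The annihilator of \<open>P\<close>, proper because \<open>P\<close> is not 0.
    Every ideal reached below contains it, so relations that hold after composition with
    \<open>P\<close> hold modulo these ideals.\<close>
  define I0 where "I0 = {B \<in> alg. B o\<^sub>L P = 0}"
  have "ideal I0" unfolding ideal_def
  proof (intro conjI ballI)
    show "subspace I0" unfolding subspace_def I0_def by (auto simp: alg_linear oL_ring)
    show "B o\<^sub>L C \<in> I0" if "B \<in> alg" "C \<in> I0" for B C using that by (auto simp: I0_def alg_compose oL_assoc)
  qed (use P0 in \<open>auto simp: I0_def\<close>)
  then obtain \<mu>0 I1 where I1: "ideal I1" "I0 \<subseteq> I1" "t0 - sop \<mu>0 \<in> I1" using ideal_extend[OF _ alg_gens(2)] by blast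
  obtain \<mu>1 I2 where I2: "ideal I2" "I1 \<subseteq> I2" "t1 - sop \<mu>1 \<in> I2" using ideal_extend[OF I1(1) alg_gens(3)] by blast
  obtain \<mu>2 I where I: "ideal I" "I2 \<subseteq> I" "t2 - sop \<mu>2 \<in> I" using ideal_extend[OF I2(1) alg_gens(4)] by blast
  have mem: "t0 - sop \<mu>0 \<in> I" "t1 - sop \<mu>1 \<in> I" "t2 - sop \<mu>2 \<in> I" "I0 \<subseteq> I"
    using I1 I2 I by auto
  \<comment> \<open>A proper ideal contains no invertible operator, so the three scalars are
    spectral values of the components, and those are real.\<close>
  have Im: "Im \<mu>0 = 0" "Im \<mu>1 = 0" "Im \<mu>2 = 0"
    using mem(1-3)[THEN ideal_not_invertible[OF I(1)]] real[THEN real_spectrum_lift_op]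
    unfolding J1 t0_def t1_def t2_def by blast+
  define a0 a1 a2 where "a0 = Re \<mu>0" and "a1 = Re \<mu>1" and "a2 = Re \<mu>2"
  have m0: "t0 - a0 *\<^sub>R id_blinfun \<in> I" and m1: "t1 - a1 *\<^sub>R id_blinfun \<in> I" and m2: "t2 - a2 *\<^sub>R id_blinfun \<in> I"
    using mem(1-3) Im unfolding sop_eq a0_def a1_def a2_def by simp_all
  obtain \<phi> where \<phi>: "functional \<phi>" "\<And>B. B \<in> I \<Longrightarrow> \<phi> B = 0" "\<phi> id_blinfun = 1"
    using ideal_functional[OF I(1)] by blast
  interpret \<phi>: bounded_linear \<phi> using \<phi>(1) by (simp add: functional_def)
  have sI: "subspace I" and mI: "\<And>B C. B \<in> alg \<Longrightarrow> C \<in> I \<Longrightarrow> B o\<^sub>L C \<in> I" and IA: "I \<subseteq> alg"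
    using I(1) unfolding ideal_def by auto
  have mI': "C o\<^sub>L B \<in> I" if "B \<in> alg" "C \<in> I" for B C
    using mI[OF that] alg_commute[OF that(1)] that(2) IA by auto
  define q :: "complex \<Rightarrow> complex" where "q z = (z - a0)\<^sup>2 + (of_real (a1\<^sup>2 + a2\<^sup>2) :: complex)" for z
  have Qq: "Qc (slice_pt J z) T - sop (q z) \<in> I" for z
  proof -
    have s2: "sop ((z - a0)\<^sup>2) = sop (z - a0) o\<^sub>L sop (z - a0)"
      using J by (simp add: power2_eq_square slice_pt_mult Lm_mult)
    have sa: "sop (z - a0) = sop z - a0 *\<^sub>R id_blinfun" unfolding sop_eq by (simp add: algebra_simps)
    have sq: "sop (q z) = (sop (z - a0) o\<^sub>L sop (z - a0)) + (a1\<^sup>2 + a2\<^sup>2) *\<^sub>R id_blinfun"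
      unfolding q_def slice_pt_add Lm_add s2[symmetric] by (simp add: slice_pt_of_real Lm_of_real del: of_real_add)
    have "Qc (slice_pt J z) T - sop (q z) = (- ((sop z - t0) + sop (z - a0)) o\<^sub>L (t0 - a0 *\<^sub>R id_blinfun)) +
       (((t1 + a1 *\<^sub>R id_blinfun) o\<^sub>L (t1 - a1 *\<^sub>R id_blinfun)) + ((t2 + a2 *\<^sub>R id_blinfun) o\<^sub>L (t2 - a2 *\<^sub>R id_blinfun)))"
      unfolding Qc_eq sq R_def sa by (simp add: oL_ring t_Lm power2_eq_square algebra_simps)
    also have "\<dots> \<in> I"
    proof (intro subspace_add[OF sI] mI m0 m1 m2)
      have "(-1) *\<^sub>R ((sop z - t0) + sop (z - a0)) \<in> alg" by (intro alg_linear alg_sop alg_gens)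
      then show "- ((sop z - t0) + sop (z - a0)) \<in> alg" by simp
    qed (intro alg_linear alg_gens)+
    finally show ?thesis .
  qed
  have qy: "q z * \<phi> (y z) = 1" if z: "z \<notin> K" for z
  proof -
    have "(Qc (slice_pt J z) T - sop (q z)) o\<^sub>L y z \<in> I" by (rule mI'[OF alg_y[OF z] Qq])
    then have "\<phi> (id_blinfun - cscale (q z) (y z)) = 0"
      using \<phi>(2) y_inverse[OF z] by (simp add: oL.diff_left cscale_eq)
    then show ?thesis using \<phi>(3) functional_cscale[OF \<phi>(1)] by (simp add: \<phi>.diff)
  qed
  have Xy: "\<phi> (X z) = (z - a0) * \<phi> (y z)" if z: "z \<notin> K" for z
  proof -
    have "X z = cscale (z - a0) (y z) - ((t0 - a0 *\<^sub>R id_blinfun) o\<^sub>L y z)"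
      unfolding X_def cscale_eq sop_eq by (simp add: oL_ring algebra_simps)
    moreover have "\<phi> ((t0 - a0 *\<^sub>R id_blinfun) o\<^sub>L y z) = 0" by (rule \<phi>(2)[OF mI'[OF alg_y[OF z] m0]])
    ultimately show ?thesis using functional_cscale[OF \<phi>(1)] by (simp add: \<phi>.diff)
  qed
  define r where "r = sqrt (a1\<^sup>2 + a2\<^sup>2)"
  define \<rho> where "\<rho> = Complex a0 r"
  have r2: "r\<^sup>2 = a1\<^sup>2 + a2\<^sup>2" unfolding r_def by simp
  have qf: "q z = (z - \<rho>) * (z - cnj \<rho>)" for z
    unfolding q_def r2[symmetric] \<rho>_def by (simp add: complex_eq_iff power2_eq_square algebra_simps)
  \<comment> \<open>Outside \<open>K\<close> the identity \<open>qy\<close> would read 0 = 1 at a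
    zero of \<open>q\<close>.\<close>
  have \<rho>K: "\<rho> \<in> K" using qy[of \<rho>] qf[of \<rho>] by auto
  then have \<rho>K': "cnj \<rho> \<in> K" using cnj_K by blast
  have KU: "K \<subseteq> U" using D unfolding polygonal_domain_def using closure_subset by blast
  have supp: "chain_support E \<subseteq> U - K" using polygonal_domain_frontier[OF D(1)] D(2) by auto
  have "open (U - K)" using U compact_imp_closed[OF compact_K] by (rule open_Diff)
  have "cholo (\<lambda>z. cscale (\<eta> z) (X z)) (U - K)"
    by (intro cholo_cscale holomorphic_on_subset[OF \<eta>(1)] cholo_subset[OF cholo_X]) auto
  then have "\<phi> A = chain_integral E (\<lambda>z. \<phi> (cscale (\<eta> z) (X z)))"
    unfolding A_def by (rule functional_eint[OF \<open>open (U - K)\<close> _ supp \<phi>(1)])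
  also have "\<dots> = chain_integral E (\<lambda>z. 1/2 * (\<eta> z / (z - \<rho>) + \<eta> z / (z - cnj \<rho>)))"
  proof (rule chain_integral_cong)
    fix z assume "z \<in> chain_support E"
    then have z: "z \<notin> K" using supp by auto
    then have ne: "z - \<rho> \<noteq> 0" "z - cnj \<rho> \<noteq> 0" using \<rho>K \<rho>K' by auto
    have f1: "\<phi> (y z) = 1 / ((z - \<rho>) * (z - cnj \<rho>))" 
    proof (rule eq_divide_imp)
      show "(z - \<rho>) * (z - cnj \<rho>) \<noteq> 0" using ne by simp
      show "\<phi> (y z) * ((z - \<rho>) * (z - cnj \<rho>)) = 1" using qy[OF z] unfolding qf by (simp only: mult.commute)
    qed
    have f2: "z - a0 = ((z - \<rho>) + (z - cnj \<rho>)) / 2" unfolding \<rho>_def by (simp add: complex_eq_iff)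
    have "\<phi> (cscale (\<eta> z) (X z)) = \<eta> z * ((((z - \<rho>) + (z - cnj \<rho>)) / 2) * (1 / ((z - \<rho>) * (z - cnj \<rho>))))"
      unfolding functional_cscale[OF \<phi>(1)] Xy[OF z] f1 unfolding f2 ..
    also have "\<dots> = 1/2 * (\<eta> z / (z - \<rho>) + \<eta> z / (z - cnj \<rho>))"
      using ne by (simp add: divide_simps) (simp add: algebra_simps)
    finally show "\<phi> (cscale (\<eta> z) (X z)) = 1/2 * (\<eta> z / (z - \<rho>) + \<eta> z / (z - cnj \<rho>))" .
  qed
  also have "\<dots> = 1/2 * (chain_integral E (\<lambda>z. \<eta> z / (z - \<rho>)) + chain_integral E (\<lambda>z. \<eta> z / (z - cnj \<rho>)))"
  proof -
    have c: "continuous_on (chain_support E) (\<lambda>z. \<eta> z / (z - p))" if "p \<in> K" for p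
      using supp that by (intro continuous_intros holomorphic_on_imp_continuous_on holomorphic_on_subset[OF \<eta>(1)]) auto
    show ?thesis
      using chain_integral_lmul[OF continuous_on_add[OF c[OF \<rho>K] c[OF \<rho>K']], of "1/2"] chain_integral_add[OF c[OF \<rho>K] c[OF \<rho>K']]
      by simp
  qed
  also have "chain_integral E (\<lambda>z. \<eta> z / (z - \<rho>)) = 2 * pi * \<i> * \<eta> \<rho>"
    using D \<rho>K \<eta>(1) unfolding polygonal_domain_def by blast
  also have "chain_integral E (\<lambda>z. \<eta> z / (z - cnj \<rho>)) = 2 * pi * \<i> * \<eta> (cnj \<rho>)"
    using D \<rho>K' \<eta>(1) unfolding polygonal_domain_def by blast
  also have "\<eta> (cnj \<rho>) = \<eta> \<rho>" using \<eta>(3) \<rho>K KU by blast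
  finally have \<phi>A: "\<phi> A = 2 * pi * \<i> * \<eta> \<rho>" by simp
  have "2 *\<^sub>R A - sop (2 * pi * \<i>) \<in> I0"
    unfolding I0_def using rel alg_linear alg_sop by (auto simp: oL_ring cscale_eq)
  then have "\<phi> (2 *\<^sub>R A - cscale (2 * pi * \<i>) id_blinfun) = 0" using \<phi>(2) mem(4) by (auto simp: cscale_eq)
  then have "2 * \<phi> A = 2 * pi * \<i>"
    using \<phi>(3) functional_cscale[OF \<phi>(1)] by (simp add: \<phi>.diff \<phi>.scaleR scaleR_conv_of_real)
  then have "\<eta> \<rho> = 1 / 2" unfolding \<phi>A by (simp add: eq_divide_eq mult.commute)
  moreover have "\<eta> \<rho> * \<eta> \<rho> = \<eta> \<rho>" using \<eta>(2) \<rho>K KU by blast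
  ultimately show False by auto
qed

end

section \<open>Slice integrals of intrinsic functions: independence of contour and unit\<close>

section \<open>Integrals over slices\<close>

text \<open>The factor - \<i> stands for the - J in \<open>ds_J\<close>. The complex function
  \<open>F\<close> is transported to the slice of \<open>J\<close> and stands to the left of the
  kernel.\<close>

definition slice_integral :: "quat \<Rightarrow> (complex \<Rightarrow> complex) \<Rightarrow> (quat \<Rightarrow> 'a::banach qmod \<Rightarrow>\<^sub>L 'a qmod)
    \<Rightarrow> (real \<Rightarrow> complex) set \<Rightarrow> 'a qmod \<Rightarrow>\<^sub>L 'a qmod" where
  "slice_integral J F h \<Gamma> = (\<Sum>\<gamma>\<in>\<Gamma>. integral {0..1} (\<lambda>t.
     Lm (slice_pt J (- \<i> * F (\<gamma> t) * vector_derivative \<gamma> (at t within {0..1}))) o\<^sub>L h (slice_pt J (\<gamma> t))))"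

lemma quat_inverse:
  assumes "c \<noteq> (0::quat)"
  shows "\<exists>d. c * d = 1"
proof -
  obtain a b c' d where c: "c = Quat a b c' d" by (cases c)
  have "a\<^sup>2 + b\<^sup>2 + c'\<^sup>2 + d\<^sup>2 \<noteq> 0"
  proof
    assume s: "a\<^sup>2 + b\<^sup>2 + c'\<^sup>2 + d\<^sup>2 = 0"
    have "a\<^sup>2 \<ge> 0" "b\<^sup>2 \<ge> 0" "c'\<^sup>2 \<ge> 0" "d\<^sup>2 \<ge> 0" by simp_all
    with s have "a\<^sup>2 = 0" "b\<^sup>2 = 0" "c'\<^sup>2 = 0" "d\<^sup>2 = 0" by linarith+
    then show False using assms unfolding c by (simp add: zero_quat_def)
  qed
  moreover have "c * Quat a (- b) (- c') (- d) = (a\<^sup>2 + b\<^sup>2 + c'\<^sup>2 + d\<^sup>2) *\<^sub>R 1"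
    unfolding c by (simp add: times_quat_def scaleR_quat_def one_quat_def power2_eq_square)
  ultimately have "c * ((1 / (a\<^sup>2 + b\<^sup>2 + c'\<^sup>2 + d\<^sup>2)) *\<^sub>R Quat a (- b) (- c') (- d)) = 1"
    by simp
  then show ?thesis by blast
qed

context commuting_triple
begin

definition h1 :: "quat \<Rightarrow> 'a qmod \<Rightarrow>\<^sub>L 'a qmod" where "h1 s = (Lm s - t0) o\<^sub>L (Y s o\<^sub>L Y s)"
definition h2 :: "quat \<Rightarrow> 'a qmod \<Rightarrow>\<^sub>L 'a qmod" where "h2 s = (Lm s - t0) o\<^sub>L h1 s"

text \<open>The second clause is equivariance under conjugation by \<open>c\<close>. It is used for
  \<open>c\<close> in the slice itself, for \<open>e2\<close>, which reflects the slice of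
  \<open>e1\<close>, and for a \<open>c\<close> that carries \<open>e1\<close> to
  \<open>J\<close>.\<close>

definition slice_kernel :: "(quat \<Rightarrow> 'a qmod \<Rightarrow>\<^sub>L 'a qmod) \<Rightarrow> bool" where
  "slice_kernel h \<longleftrightarrow>
     (\<forall>J\<in>imag_units. complex_structure.cholo (\<lambda>A. Lm J o\<^sub>L A) (\<lambda>z. h (slice_pt J z)) (- K)) \<and>
     (\<forall>I\<in>imag_units. \<forall>J\<in>imag_units. \<forall>z w c. z \<notin> K \<longrightarrow> w \<notin> K \<longrightarrow>
        c * slice_pt I z = slice_pt J w * c \<longrightarrow> Lm c o\<^sub>L h (slice_pt I z) = h (slice_pt J w) o\<^sub>L Lm c)"

lemma slice_kernel_h: "slice_kernel h1" "slice_kernel h2"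
proof -
  have ch: "complex_structure.cholo (\<lambda>A :: 'a qmod \<Rightarrow>\<^sub>L 'a qmod. Lm J o\<^sub>L A) (\<lambda>z. h1 (slice_pt J z)) (- K)"
    "complex_structure.cholo (\<lambda>A :: 'a qmod \<Rightarrow>\<^sub>L 'a qmod. Lm J o\<^sub>L A) (\<lambda>z. h2 (slice_pt J z)) (- K)" if "J \<in> imag_units" for J
  proof -
    interpret s: slice_triple T0 T1 T2 J by unfold_locales fact
    show "s.cholo (\<lambda>z. h1 (slice_pt J z)) (- K)" "s.cholo (\<lambda>z. h2 (slice_pt J z)) (- K)"
      using s.cholo_H unfolding s.H1_def[abs_def] s.H2_def[abs_def] h1_def h2_def .
  qed
  have tw: "Lm c o\<^sub>L h1 s = h1 s' o\<^sub>L Lm c" "Lm c o\<^sub>L h2 s = h2 s' o\<^sub>L Lm c"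
    if I: "I \<in> imag_units" "J \<in> imag_units" "z \<notin> K" "w \<notin> K" and s: "s = slice_pt I z" "s' = slice_pt J w"
      and c: "c * s = s' * c" for I J z w c s s'
  proof -
    have L: "Lm c o\<^sub>L (Lm s - t0) = (Lm s' - t0) o\<^sub>L (Lm c :: 'a qmod \<Rightarrow>\<^sub>L 'a qmod)"
      using arg_cong[OF c, of "Lm :: quat \<Rightarrow> 'a qmod \<Rightarrow>\<^sub>L 'a qmod"] by (simp add: Lm_mult oL_ring t_Lm)
    then have L': "Lm c o\<^sub>L ((Lm s - t0) o\<^sub>L B) = (Lm s' - t0) o\<^sub>L (Lm c o\<^sub>L B)" for B :: "'a qmod \<Rightarrow>\<^sub>L 'a qmod"
      by (simp only: oL_assoc[symmetric])
    have "Lm c o\<^sub>L Qc s T = Qc s' T o\<^sub>L Lm c"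
      unfolding Qc_eq oL.add_left oL.add_right oL_assoc L' L R_comm ..
    then have Y: "Lm c o\<^sub>L Y s = Y s' o\<^sub>L Lm c" unfolding s by (rule Y_intertwine[OF I])
    then have Y': "Lm c o\<^sub>L (Y s o\<^sub>L B) = Y s' o\<^sub>L (Lm c o\<^sub>L B)" for B by (simp only: oL_assoc[symmetric])
    show 1: "Lm c o\<^sub>L h1 s = h1 s' o\<^sub>L Lm c" unfolding h1_def by (simp only: oL_assoc L' Y' Y)
    show "Lm c o\<^sub>L h2 s = h2 s' o\<^sub>L Lm c" unfolding h2_def by (simp only: oL_assoc L' 1)
  qed
  show "slice_kernel h1" unfolding slice_kernel_def
    by (intro conjI ballI allI impI, erule ch(1), rule tw(1)[OF _ _ _ _ refl refl], assumption+)
  show "slice_kernel h2" unfolding slice_kernel_def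
    by (intro conjI ballI allI impI, erule ch(2), rule tw(2)[OF _ _ _ _ refl refl], assumption+)
qed

text \<open>The bounded domain is hidden behind the quantifier, so that boundaries taken in
  different slices and around different domains become objects of one kind and can be
  compared.\<close>

definition contour :: "complex set \<Rightarrow> (real \<Rightarrow> complex) set \<Rightarrow> bool" where
  "contour U \<Gamma> \<longleftrightarrow> (\<exists>D. open D \<and> K \<subseteq> D \<and> closure D \<subseteq> U \<and> oriented_boundary D \<Gamma>)"

lemma contourD:
  assumes "contour U \<Gamma>"
  shows "finite \<Gamma>" "\<And>\<gamma>. \<gamma> \<in> \<Gamma> \<Longrightarrow> valid_path \<gamma>" "\<And>\<gamma>. \<gamma> \<in> \<Gamma> \<Longrightarrow> pathfinish \<gamma> = pathstart \<gamma>"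
    "\<And>\<gamma>. \<gamma> \<in> \<Gamma> \<Longrightarrow> path_image \<gamma> \<subseteq> U - K"
    "\<And>w. w \<in> K \<Longrightarrow> (\<Sum>\<gamma>\<in>\<Gamma>. winding_number \<gamma> w) = 1" "\<And>w. w \<notin> U \<Longrightarrow> (\<Sum>\<gamma>\<in>\<Gamma>. winding_number \<gamma> w) = 0"
proof -
  obtain D where D: "open D" "K \<subseteq> D" "closure D \<subseteq> U" "oriented_boundary D \<Gamma>" using assms unfolding contour_def by blast
  have "frontier D \<subseteq> U - K" using D unfolding frontier_def by (auto simp: interior_open)
  then show "\<And>\<gamma>. \<gamma> \<in> \<Gamma> \<Longrightarrow> path_image \<gamma> \<subseteq> U - K"
    using D(4) unfolding oriented_boundary_def jordan_boundary_def by blast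
qed (use assms in \<open>auto simp: contour_def oriented_boundary_def jordan_boundary_def\<close>)

lemma contour_integral_unique_contour:
  assumes "open U" "K \<subseteq> U" "f holomorphic_on U - K" "contour U \<Gamma>" "contour U \<Gamma>'"
  shows "(\<Sum>\<gamma>\<in>\<Gamma>. contour_integral \<gamma> f) = (\<Sum>\<gamma>\<in>\<Gamma>'. contour_integral \<gamma> f)"
proof -
  obtain D D' where "open D" "K \<subseteq> D" "closure D \<subseteq> U" "oriented_boundary D \<Gamma>"
    "open D'" "K \<subseteq> D'" "closure D' \<subseteq> U" "oriented_boundary D' \<Gamma>'"
    using assms(4,5) unfolding contour_def by blast
  then show ?thesis by (rule boundary_integral_unique[OF assms(1) compact_K assms(2,3)])
qed

text \<open>Conjugation reverses orientation. The contour and its mirror image therefore have total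
  winding number 0 on \<open>K\<close> as well as outside \<open>U\<close>, and Cauchy's theorem
  applies to them jointly.\<close>

lemma contour_integral_cnj_symmetric:
  assumes U: "open U" "cnj ` U \<subseteq> U" and f: "f holomorphic_on U - K" and \<Gamma>: "contour U \<Gamma>"
  shows "(\<Sum>\<gamma>\<in>\<Gamma>. cnj (contour_integral \<gamma> (cnj \<circ> f \<circ> cnj))) = - (\<Sum>\<gamma>\<in>\<Gamma>. contour_integral \<gamma> f)"
proof -
  note c = contourD[OF \<Gamma>]
  have cU: "cnj z \<in> U - K" if "z \<in> U - K" for z
    using that U(2) cnj_K by (metis Diff_iff complex_cnj_cnj image_subset_iff)
  have "(\<Sum>i\<in>\<Gamma> <+> \<Gamma>. 1 * contour_integral (case_sum id ((\<circ>) cnj) i) f) = 0"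
  proof (rule Cauchy_theorem_cycle[where V = "U - K"])
    show "open (U - K)" using U(1) compact_imp_closed[OF compact_K] by (rule open_Diff)
    show "valid_path (case_sum id ((\<circ>) cnj) i)" if "i \<in> \<Gamma> <+> \<Gamma>" for i
      using that by (elim PlusE) (simp_all add: c(2) valid_path_cnj)
    show "pathfinish (case_sum id ((\<circ>) cnj) i) = pathstart (case_sum id ((\<circ>) cnj) i)" if "i \<in> \<Gamma> <+> \<Gamma>" for i
      using that by (elim PlusE) (simp_all add: c(3) pathfinish_compose pathstart_compose)
    show "path_image (case_sum id ((\<circ>) cnj) i) \<subseteq> U - K" if "i \<in> \<Gamma> <+> \<Gamma>" for i
      using that
    proof (elim PlusE)
      fix \<gamma> assume \<gamma>: "\<gamma> \<in> \<Gamma>" "i = Inr \<gamma>"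
      have "path_image (cnj \<circ> \<gamma>) = cnj ` path_image \<gamma>" by (rule path_image_compose)
      then show ?thesis using c(4)[OF \<gamma>(1)] cU \<gamma>(2) by auto
    qed (simp add: c(4))
    fix w assume w: "w \<notin> U - K"
    then have w': "cnj w \<notin> U - K" using cU[of "cnj w"] by auto
    have "winding_number (cnj \<circ> \<gamma>) w = - cnj (winding_number \<gamma> (cnj w))" if "\<gamma> \<in> \<Gamma>" for \<gamma>
      using winding_number_cnj[of \<gamma> "cnj w"] c(4)[OF that] w' valid_path_imp_path[OF c(2)[OF that]] by auto
    then have "(\<Sum>\<gamma>\<in>\<Gamma>. winding_number (cnj \<circ> \<gamma>) w) = - cnj (\<Sum>\<gamma>\<in>\<Gamma>. winding_number \<gamma> (cnj w))"
      by (simp add: sum_negf)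
    moreover have "w \<in> K \<longleftrightarrow> cnj w \<in> K" using cnj_K by (metis complex_cnj_cnj image_subset_iff)
    ultimately show "(\<Sum>i\<in>\<Gamma> <+> \<Gamma>. 1 * winding_number (case_sum id ((\<circ>) cnj) i) w) = 0"
      using c(5)[of w] c(6)[of w] c(5)[of "cnj w"] c(6)[of "cnj w"] w w' by (cases "w \<in> K") (auto simp: sum.Plus c(1) simp del: cnj_sum)
  qed (use c f in auto)
  then have "(\<Sum>\<gamma>\<in>\<Gamma>. contour_integral \<gamma> f) + (\<Sum>\<gamma>\<in>\<Gamma>. contour_integral (cnj \<circ> \<gamma>) f) = 0"
    by (simp add: sum.Plus c(1))
  moreover have "contour_integral (cnj \<circ> \<gamma>) f = cnj (contour_integral \<gamma> (cnj \<circ> f \<circ> cnj))" if "\<gamma> \<in> \<Gamma>" for \<gamma>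
    by (rule contour_integral_cnj) (use c(2) that in auto)
  ultimately show ?thesis by (simp add: add_eq_0_iff)
qed

end

context slice_triple
begin

lemma slice_integrand_eq:
  "Lm (slice_pt J (- \<i> * w * d)) o\<^sub>L B = cscale d (cscale (- \<i> * w) B)"
  unfolding cscale_cscale unfolding cscale_eq by (simp add: mult_ac)

lemma slice_integral_eq: "slice_integral J F h \<Gamma> = (\<Sum>\<gamma>\<in>\<Gamma>. cint \<gamma> (\<lambda>z. cscale (- \<i> * F z) (h (slice_pt J z))))"
  unfolding slice_integral_def cint_def slice_integrand_eq ..

lemma slice_kernel_cholo:
  assumes "slice_kernel h" "F holomorphic_on U"
  shows "cholo (\<lambda>z. cscale (c * F z) (h (slice_pt J z))) (U - K)"
proof -
  have "cholo (\<lambda>z. h (slice_pt J z)) (- K)" using assms(1) J unfolding slice_kernel_def by blast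
  then have "cholo (\<lambda>z. h (slice_pt J z)) (U - K)" by (rule cholo_subset) auto
  moreover have "(\<lambda>z. c * F z) holomorphic_on U - K"
    by (intro holomorphic_intros holomorphic_on_subset[OF assms(2)]) auto
  ultimately show ?thesis by (rule cholo_cscale[rotated])
qed

lemma functional_slice_integral:
  assumes h: "slice_kernel h" and F: "F holomorphic_on U" and U: "open U" and \<Gamma>: "contour U \<Gamma>" and \<phi>: "functional \<phi>"
  shows "\<phi> (slice_integral J F h \<Gamma>) = (\<Sum>\<gamma>\<in>\<Gamma>. contour_integral \<gamma> (\<lambda>z. - \<i> * F z * \<phi> (h (slice_pt J z))))"
proof -
  interpret \<phi>: bounded_linear \<phi> using \<phi> by (simp add: functional_def)
  have o: "open (U - K)" using U compact_imp_closed[OF compact_K] by (rule open_Diff)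
  show ?thesis
    unfolding slice_integral_eq \<phi>.sum
    using functional_cint[OF o slice_kernel_cholo[OF h F, of "- \<i>"] contourD(2,4)[OF \<Gamma>] \<phi>]
    by (simp add: functional_cscale[OF \<phi>])
qed

lemma slice_integrand_integrable:
  assumes h: "slice_kernel h" and F: "F holomorphic_on U" and U: "open U" and \<Gamma>: "contour U \<Gamma>" and \<gamma>: "\<gamma> \<in> \<Gamma>"
  shows "(\<lambda>t. Lm (slice_pt J (- \<i> * F (\<gamma> t) * vector_derivative \<gamma> (at t within {0..1}))) o\<^sub>L h (slice_pt J (\<gamma> t)))
     integrable_on {0..1}"
proof -
  have o: "open (U - K)" using U compact_imp_closed[OF compact_K] by (rule open_Diff)
  show ?thesis
    unfolding slice_integrand_eq
    by (rule cint_integrable[OF o slice_kernel_cholo[OF h F, of "- \<i>"] contourD(2,4)[OF \<Gamma> \<gamma>]])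
qed

lemma functional_kernel_holomorphic:
  assumes h: "slice_kernel h" and \<phi>: "functional \<phi>"
  shows "(\<lambda>z. \<phi> (h (slice_pt J z))) holomorphic_on - K"
proof -
  have "cholo (\<lambda>z. h (slice_pt J z)) (- K)" using h J unfolding slice_kernel_def by blast
  then show ?thesis using \<phi> unfolding cholo_def by simp
qed

lemma slice_integral_unique:
  assumes h: "slice_kernel h" and F: "F holomorphic_on U" and U: "open U" "K \<subseteq> U" and \<Gamma>: "contour U \<Gamma>" "contour U \<Gamma>'"
  shows "slice_integral J F h \<Gamma> = slice_integral J F h \<Gamma>'"
  unfolding eq_iff_functional
proof (intro allI impI)
  fix \<phi> assume \<phi>: "functional \<phi>"
  show "\<phi> (slice_integral J F h \<Gamma>) = \<phi> (slice_integral J F h \<Gamma>')"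
    unfolding functional_slice_integral[OF h F U(1) \<Gamma>(1) \<phi>] functional_slice_integral[OF h F U(1) \<Gamma>(2) \<phi>]
    by (rule contour_integral_unique_contour[OF U _ \<Gamma>])
      (intro holomorphic_intros holomorphic_on_subset[OF F] holomorphic_on_subset[OF functional_kernel_holomorphic[OF h \<phi>]]; auto)
qed

end

text \<open>On the slice of \<open>e1\<close> all factors commute with \<open>e1\<close>. As e2 s
  equals the conjugate of s times e2, conjugation by \<open>e2\<close> reflects the contour, and for
  intrinsic \<open>F\<close> the symmetry of contour integrals restores the original value. The unit
  \<open>e3\<close> is the product of the other two.\<close>

lemma (in commuting_triple) slice_integral_e1_commute:
  assumes h: "slice_kernel h" and F: "F holomorphic_on U" and cF: "\<And>z. z \<in> U \<Longrightarrow> F (cnj z) = cnj (F z)"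
    and U: "open U" "K \<subseteq> U" "cnj ` U \<subseteq> U" and \<Gamma>: "contour U \<Gamma>"
  shows "Lm q o\<^sub>L slice_integral e1 F h \<Gamma> = slice_integral e1 F h \<Gamma> o\<^sub>L Lm q"
proof -
  interpret s: slice_triple T0 T1 T2 e1 by unfold_locales simp
  let ?Z = "slice_integral e1 F h \<Gamma>"
  note fs = s.functional_slice_integral[OF h F U(1) \<Gamma>]
  have tw: "Lm c o\<^sub>L h (slice_pt e1 z) = h (slice_pt e1 w) o\<^sub>L Lm c"
    if "z \<notin> K" "w \<notin> K" "c * slice_pt e1 z = slice_pt e1 w * c" for z w c
    using h that unfolding slice_kernel_def by simp
  have K_off: "z \<notin> K" if "z \<in> path_image \<gamma>" "\<gamma> \<in> \<Gamma>" for z \<gamma>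
    using contourD(4)[OF \<Gamma> that(2)] that(1) by blast
  have 1: "Lm e1 o\<^sub>L ?Z = ?Z o\<^sub>L Lm e1"
    unfolding s.eq_iff_functional
  proof (intro allI impI)
    fix \<phi> :: "('a qmod \<Rightarrow>\<^sub>L 'a qmod) \<Rightarrow> complex" assume \<phi>: "s.functional \<phi>"
    have "e1 * slice_pt e1 z = slice_pt e1 z * e1" for z
      by (simp add: slice_pt_def of_real_def algebra_simps)
    then have "Lm e1 o\<^sub>L h (slice_pt e1 z) = h (slice_pt e1 z) o\<^sub>L Lm e1" if "z \<notin> K" for z using tw that by blast
    then have "contour_integral \<gamma> (\<lambda>z. - \<i> * F z * \<phi> (Lm e1 o\<^sub>L h (slice_pt e1 z))) =
        contour_integral \<gamma> (\<lambda>z. - \<i> * F z * \<phi> (h (slice_pt e1 z) o\<^sub>L Lm e1))" if "\<gamma> \<in> \<Gamma>" for \<gamma>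
      using K_off that by (intro contour_integral_cong refl) auto
    then show "\<phi> (Lm e1 o\<^sub>L ?Z) = \<phi> (?Z o\<^sub>L Lm e1)"
      unfolding fs[OF s.functional_left[OF \<phi> refl]] fs[OF s.functional_right[OF \<phi>]] by (intro sum.cong refl)
  qed
  have e2: "Lm (- e2) o\<^sub>L Lm e2 = (id_blinfun :: 'a qmod \<Rightarrow>\<^sub>L 'a qmod)" "Lm e2 o\<^sub>L Lm (- e2) = (id_blinfun :: 'a qmod \<Rightarrow>\<^sub>L 'a qmod)"
    by (simp_all add: Lm_mult[symmetric] quat_units Lm_one)
  have "(Lm e2 o\<^sub>L ?Z) o\<^sub>L Lm (- e2) = ?Z"
    unfolding s.eq_iff_functional
  proof (intro allI impI)
    fix \<phi> :: "('a qmod \<Rightarrow>\<^sub>L 'a qmod) \<Rightarrow> complex" assume \<phi>: "s.functional \<phi>"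
    interpret \<phi>: bounded_linear \<phi> using \<phi> by (simp add: s.functional_def)
    \<comment> \<open>Conjugation by \<open>e2\<close> is antilinear for the structure given by
      \<open>e1\<close>; the outer complex conjugate makes \<psi> linear again.\<close>
    define \<psi> where "\<psi> A = cnj (\<phi> ((Lm e2 o\<^sub>L A) o\<^sub>L Lm (- e2)))" for A
    have "bounded_linear \<psi>" unfolding \<psi>_def
      by (intro bounded_linear_compose[OF bounded_linear_cnj] bounded_linear_compose[OF \<phi>.bounded_linear_axioms]
        bounded_linear_compose[OF oL.bounded_linear_left] oL.bounded_linear_right)
    moreover have "\<psi> (Lm e1 o\<^sub>L A) = \<i> * \<psi> A" for A
    proof -
      have m: "Lm e2 o\<^sub>L Lm e1 = - (Lm e1 o\<^sub>L (Lm e2 :: 'a qmod \<Rightarrow>\<^sub>L 'a qmod))"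
        by (simp add: Lm_mult[symmetric] quat_units Lm_minus)
      have "(Lm e2 o\<^sub>L (Lm e1 o\<^sub>L A)) o\<^sub>L Lm (- e2) = - (Lm e1 o\<^sub>L ((Lm e2 o\<^sub>L A) o\<^sub>L Lm (- e2)))"
        by (simp add: oL_assoc[symmetric] m oL.minus_left)
      moreover have "\<phi> (- B) = - \<phi> B" for B using \<phi>.diff[of 0 B] by (simp add: \<phi>.zero)
      ultimately show ?thesis using \<phi> by (simp add: \<psi>_def s.functional_def)
    qed
    ultimately have \<psi>: "s.functional \<psi>" unfolding s.functional_def by blast
    define g where "g z = \<i> * F z * \<phi> (h (slice_pt e1 z))" for z
    have g: "g holomorphic_on U - K" unfolding g_def
      by (intro holomorphic_intros holomorphic_on_subset[OF F] holomorphic_on_subset[OF s.functional_kernel_holomorphic[OF h \<phi>]]; auto)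
    have "\<phi> ((Lm e2 o\<^sub>L ?Z) o\<^sub>L Lm (- e2)) = cnj (\<psi> ?Z)" by (simp add: \<psi>_def)
    also have "\<dots> = (\<Sum>\<gamma>\<in>\<Gamma>. cnj (contour_integral \<gamma> (\<lambda>z. - \<i> * F z * \<psi> (h (slice_pt e1 z)))))"
      unfolding fs[OF \<psi>] by simp
    also have "\<dots> = (\<Sum>\<gamma>\<in>\<Gamma>. cnj (contour_integral \<gamma> (cnj \<circ> g \<circ> cnj)))"
    proof (intro sum.cong refl arg_cong[where f = cnj] contour_integral_cong)
      fix \<gamma> z assume z: "\<gamma> \<in> \<Gamma>" "z \<in> path_image \<gamma>"
      have zU: "z \<in> U" "z \<notin> K" using contourD(4)[OF \<Gamma> z(1)] z(2) by auto
      then have cK: "cnj z \<notin> K" using cnj_K by (metis complex_cnj_cnj image_subset_iff)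
      have "e2 * slice_pt e1 z = slice_pt e1 (cnj z) * e2"
        by (simp add: slice_pt_def of_real_def algebra_simps quat_units)
      from tw[OF zU(2) cK this] have "\<psi> (h (slice_pt e1 z)) = cnj (\<phi> (h (slice_pt e1 (cnj z))))"
        unfolding \<psi>_def by (simp add: oL_assoc e2)
      then show "- \<i> * F z * \<psi> (h (slice_pt e1 z)) = (cnj \<circ> g \<circ> cnj) z"
        using cF[OF zU(1)] by (simp add: g_def)
    qed
    also have "\<dots> = - (\<Sum>\<gamma>\<in>\<Gamma>. contour_integral \<gamma> g)" by (rule contour_integral_cnj_symmetric[OF U(1,3) g \<Gamma>])
    also have "\<dots> = (\<Sum>\<gamma>\<in>\<Gamma>. contour_integral \<gamma> (\<lambda>z. - \<i> * F z * \<phi> (h (slice_pt e1 z))))"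
      unfolding g_def by (simp add: sum_negf[symmetric] contour_integral_neg[symmetric] del: sum_negf)
    also have "\<dots> = \<phi> ?Z" by (rule fs[OF \<phi>, symmetric])
    finally show "\<phi> ((Lm e2 o\<^sub>L ?Z) o\<^sub>L Lm (- e2)) = \<phi> ?Z" .
  qed
  then have "((Lm e2 o\<^sub>L ?Z) o\<^sub>L Lm (- e2)) o\<^sub>L Lm e2 = ?Z o\<^sub>L Lm e2" by simp
  then have 2: "Lm e2 o\<^sub>L ?Z = ?Z o\<^sub>L Lm e2" by (simp add: oL_assoc e2)
  have 3: "Lm e3 o\<^sub>L ?Z = ?Z o\<^sub>L Lm e3"
    unfolding quat_units(4)[symmetric] Lm_mult by (simp add: oL_assoc 1 2 comm_left[OF 1])
  have "q = qRe q *\<^sub>R 1 + qIm1 q *\<^sub>R e1 + qIm2 q *\<^sub>R e2 + qIm3 q *\<^sub>R e3"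
    by (simp add: quat_eq_iff plus_quat_def scaleR_quat_def one_quat_def e1_def e2_def e3_def)
  then have L: "Lm q = qRe q *\<^sub>R id_blinfun + qIm1 q *\<^sub>R Lm e1 + qIm2 q *\<^sub>R Lm e2 + qIm3 q *\<^sub>R (Lm e3 :: 'a qmod \<Rightarrow>\<^sub>L 'a qmod)"
    by (metis Lm_add Lm_scaleR Lm_one)
  show ?thesis unfolding L by (simp add: oL_ring 1 2 3)
qed

text \<open>Some \<open>c\<close> satisfies c e1 = J c, so equivariance of the kernel turns the
  integral over the slice of \<open>J\<close> into the one over the slice of \<open>e1\<close>
  conjugated by \<open>c\<close>. The latter commutes with every quaternion, and the conjugation
  drops out.\<close>

lemma (in commuting_triple) slice_integral_independent:
  assumes h: "slice_kernel h" and F: "F holomorphic_on U" and cF: "\<And>z. z \<in> U \<Longrightarrow> F (cnj z) = cnj (F z)"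
    and U: "open U" "K \<subseteq> U" "cnj ` U \<subseteq> U" and \<Gamma>: "contour U \<Gamma>" "contour U \<Gamma>'" and J: "J \<in> imag_units"
  shows "slice_integral J F h \<Gamma> = slice_integral e1 F h \<Gamma>'"
proof -
  interpret e: slice_triple T0 T1 T2 e1 by unfold_locales simp
  interpret s: slice_triple T0 T1 T2 J by unfold_locales fact
  \<comment> \<open>The choice 1 - J e1 intertwines \<open>e1\<close> and \<open>J\<close>. It
    vanishes only for J = - e1, where \<open>e2\<close> takes its place.\<close>
  have "\<exists>c. c \<noteq> 0 \<and> c * e1 = J * c"
  proof (cases "1 - J * e1 = 0")
    case True
    then have "J * e1 = 1" by simp
    then have "J * (e1 * e1) = e1" by (metis mult.assoc mult_1)
    then have "J = - e1" by (simp add: quat_units minus_equation_iff)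
    then show ?thesis by (intro exI[of _ e2]) (simp add: quat_units, simp add: e2_def zero_quat_def)
  next
    case False
    have "(1 - J * e1) * e1 = J * (1 - J * e1)"
      using imag_unitsD[OF J] by (simp add: left_diff_distrib right_diff_distrib mult.assoc quat_units flip: mult.assoc[of J J])
    then show ?thesis using False by blast
  qed
  then obtain c where c: "c \<noteq> 0" "c * e1 = J * c" by blast
  obtain d where d: "c * d = 1" using quat_inverse[OF c(1)] by blast
  let ?Z = "slice_integral e1 F h \<Gamma>"
  have cs: "c * slice_pt e1 z = slice_pt J z * c" for z
    using c(2) by (simp add: slice_pt_def of_real_def algebra_simps)
  have "slice_integral J F h \<Gamma> o\<^sub>L Lm c = Lm c o\<^sub>L ?Z"
    unfolding s.eq_iff_functional
  proof (intro allI impI)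
    fix \<phi> :: "('a qmod \<Rightarrow>\<^sub>L 'a qmod) \<Rightarrow> complex" assume \<phi>: "s.functional \<phi>"
    have \<psi>: "e.functional (\<lambda>A. \<phi> (Lm c o\<^sub>L A))"
      unfolding e.functional_def
    proof (intro conjI allI)
      show "bounded_linear (\<lambda>A. \<phi> (Lm c o\<^sub>L A))"
        using \<phi> by (intro bounded_linear_compose[OF _ oL.bounded_linear_right]) (simp add: s.functional_def)
      have "Lm c o\<^sub>L (Lm e1 o\<^sub>L A) = Lm J o\<^sub>L (Lm c o\<^sub>L A)" for A :: "'a qmod \<Rightarrow>\<^sub>L 'a qmod"
        by (simp add: oL_assoc[symmetric] Lm_mult[symmetric] c(2))
      then show "\<phi> (Lm c o\<^sub>L (Lm e1 o\<^sub>L A)) = \<i> * \<phi> (Lm c o\<^sub>L A)" for A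
        using \<phi> by (simp add: s.functional_def)
    qed
    have "contour_integral \<gamma> (\<lambda>z. - \<i> * F z * \<phi> (h (slice_pt J z) o\<^sub>L Lm c)) =
      contour_integral \<gamma> (\<lambda>z. - \<i> * F z * \<phi> (Lm c o\<^sub>L h (slice_pt e1 z)))" if "\<gamma> \<in> \<Gamma>" for \<gamma>
    proof (rule contour_integral_cong[OF refl])
      fix z assume "z \<in> path_image \<gamma>"
      then have "z \<notin> K" using contourD(4)[OF \<Gamma>(1) that] by blast
      then have "Lm c o\<^sub>L h (slice_pt e1 z) = h (slice_pt J z) o\<^sub>L Lm c"
        using h J cs unfolding slice_kernel_def by simp
      then show "- \<i> * F z * \<phi> (h (slice_pt J z) o\<^sub>L Lm c) = - \<i> * F z * \<phi> (Lm c o\<^sub>L h (slice_pt e1 z))" by simp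
    qed
    then show "\<phi> (slice_integral J F h \<Gamma> o\<^sub>L Lm c) = \<phi> (Lm c o\<^sub>L ?Z)"
      unfolding s.functional_slice_integral[OF h F U(1) \<Gamma>(1) s.functional_right[OF \<phi>]]
        e.functional_slice_integral[OF h F U(1) \<Gamma>(1) \<psi>] by (intro sum.cong refl)
  qed
  also have "\<dots> = ?Z o\<^sub>L Lm c" by (rule slice_integral_e1_commute[OF h F cF U \<Gamma>(1)])
  finally have "(slice_integral J F h \<Gamma> o\<^sub>L Lm c) o\<^sub>L Lm d = (?Z o\<^sub>L Lm c) o\<^sub>L Lm d" by simp
  then have "slice_integral J F h \<Gamma> = ?Z" by (simp add: oL_assoc Lm_mult[symmetric] d Lm_one)
  also have "\<dots> = slice_integral e1 F h \<Gamma>'" by (rule e.slice_integral_unique[OF h F U(1,2) \<Gamma>])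
  finally show ?thesis .
qed

section \<open>Vanishing of the slice integrals for locally constant even functions\<close>

section \<open>Locally constant functions\<close>

lemma (in commuting_triple) polygonal_domain_contour:
  "polygonal_domain U D E \<Gamma> \<Longrightarrow> K \<subseteq> D \<Longrightarrow> contour U \<Gamma>"
  unfolding polygonal_domain_def contour_def by blast

text \<open>A locally constant factor passes through derivatives, so y' = - 2 H1 makes the first
  integrand exact, and X' = y - 2 H2 reduces the second to an integral of F y. On \<open>U\<close>
  the function \<open>F\<close> may take infinitely many values, but it is constant on each of the
  finitely many edges of a polygonal chain; there it is a finite combination of indicators of its
  level sets.\<close>

lemma (in commuting_triple) slice_integral_locally_constant:
  assumes real: "real_spectrum T0" "real_spectrum T1" "real_spectrum T2"
    and U: "open U" "K \<subseteq> U" and \<Gamma>: "contour U \<Gamma>"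
    and F: "\<And>z. z \<in> U \<Longrightarrow> (F has_field_derivative 0) (at z)"
    and cF: "\<And>z. z \<in> U \<Longrightarrow> F (cnj z) = F z"
  shows "slice_integral e1 F h1 \<Gamma> = 0" "slice_integral e1 F h2 \<Gamma> = 0"
proof -
  interpret s: slice_triple T0 T1 T2 e1 by unfold_locales simp
  have hF: "F holomorphic_on U" using F by (auto simp: holomorphic_on_open[OF U(1)])
  define S where "S = U - K"
  have S: "open S" unfolding S_def using U(1) compact_imp_closed[OF compact_K] by (rule open_Diff)
  have SK: "z \<notin> K" "z \<in> U" if "z \<in> S" for z using that by (auto simp: S_def)
  note c = contourD[OF \<Gamma>, folded S_def]
  have prim: "contour_integral \<gamma> p' = 0" if "\<gamma> \<in> \<Gamma>" "\<And>z. z \<in> S \<Longrightarrow> (p has_field_derivative p' z) (at z)" for p p' \<gamma>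
    using contour_integral_primitive[of S p p' \<gamma>] that c(2-4)[OF that(1)] contour_integral_unique
    by (fastforce intro: has_field_derivative_at_within)
  have h1: "h1 (slice_pt e1 z) = s.H1 z" and h2: "h2 (slice_pt e1 z) = s.H2 z" for z
    by (simp_all add: h1_def h2_def s.H1_def s.H2_def)
  show "slice_integral e1 F h1 \<Gamma> = 0"
    unfolding s.eq_iff_functional
  proof (intro allI impI)
    fix \<phi> :: "('a qmod \<Rightarrow>\<^sub>L 'a qmod) \<Rightarrow> complex" assume \<phi>: "s.functional \<phi>"
    interpret \<phi>: bounded_linear \<phi> using \<phi> by (simp add: s.functional_def)
    \<comment> \<open>The factor \<i> / 2 turns the derivative - 2 H1 into the weight - \<i> of the
      slice integral.\<close>
    have d1: "((\<lambda>z. \<i> / 2 * (F z * \<phi> (s.y z))) has_field_derivative - \<i> * F z * \<phi> (s.H1 z)) (at z)" if "z \<in> S" for z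
      by (rule derivative_eq_intros F[OF SK(2)[OF that]] s.DERIV_y[OF \<phi> SK(1)[OF that]] refl)+
        (simp add: \<phi>.scaleR \<phi>.neg scaleR_conv_of_real)
    have "contour_integral \<gamma> (\<lambda>z. - \<i> * F z * \<phi> (s.H1 z)) = 0" if "\<gamma> \<in> \<Gamma>" for \<gamma> by (rule prim[OF that d1])
    then show "\<phi> (slice_integral e1 F h1 \<Gamma>) = \<phi> 0"
      unfolding s.functional_slice_integral[OF slice_kernel_h(1) hF U(1) \<Gamma> \<phi>] h1 by (simp add: \<phi>.zero)
  qed
  obtain D E \<Gamma>' where D: "polygonal_domain U D E \<Gamma>'" "K \<subseteq> D" using exists_polygonal_domain'[OF compact_K U] by blast
  have finE: "finite E" using D(1) unfolding polygonal_domain_def by blast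
  have supp: "chain_support E \<subseteq> S" using polygonal_domain_frontier[OF D(1)] D(2) unfolding S_def by auto
  have seg: "closed_segment (fst e) (snd e) \<subseteq> S" if "e \<in> E" for e using supp that unfolding chain_support_def by blast
  have const: "F z = F (fst e)" if e: "e \<in> E" "z \<in> closed_segment (fst e) (snd e)" for e z
  proof -
    have "\<exists>k. \<forall>x\<in>closed_segment (fst e) (snd e). F x = k"
      by (rule has_field_derivative_zero_constant, rule convex_closed_segment, rule has_field_derivative_at_within,
          rule F, rule SK(2), rule subsetD[OF seg[OF e(1)]])
    then show ?thesis using e(2) ends_in_segment(1) by metis
  qed
  show "slice_integral e1 F h2 \<Gamma> = 0"
    unfolding s.eq_iff_functional
  proof (intro allI impI)
    fix \<phi> :: "('a qmod \<Rightarrow>\<^sub>L 'a qmod) \<Rightarrow> complex" assume \<phi>: "s.functional \<phi>"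
    interpret \<phi>: bounded_linear \<phi> using \<phi> by (simp add: s.functional_def)
    have hy: "(\<lambda>z. \<phi> (s.y z)) holomorphic_on S"
      using s.cholo_subset[OF s.cholo_y, of S] \<phi> SK(1) unfolding s.cholo_def by blast
    have hH2: "(\<lambda>z. \<phi> (s.H2 z)) holomorphic_on S"
      using s.cholo_subset[OF s.cholo_H(2), of S] \<phi> SK(1) unfolding s.cholo_def by blast
    have hFS: "F holomorphic_on S" by (rule holomorphic_on_subset[OF hF]) (auto simp: S_def)
    have d: "((\<lambda>z. \<i> / 2 * (F z * \<phi> (s.X z))) has_field_derivative - \<i> * F z * \<phi> (s.H2 z) + \<i> / 2 * (F z * \<phi> (s.y z))) (at z)"
      if "z \<in> S" for z
      by (rule derivative_eq_intros F[OF SK(2)[OF that]] s.DERIV_X[OF \<phi> SK(1)[OF that]] refl)+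
        (simp add: \<phi>.scaleR \<phi>.diff scaleR_conv_of_real algebra_simps)
    have "contour_integral \<gamma> (\<lambda>z. - \<i> * F z * \<phi> (s.H2 z)) = - \<i> / 2 * contour_integral \<gamma> (\<lambda>z. F z * \<phi> (s.y z))"
      if \<gamma>: "\<gamma> \<in> \<Gamma>" for \<gamma>
    proof -
      have i: "g contour_integrable_on \<gamma>" if "g holomorphic_on S" for g
        by (rule contour_integrable_holomorphic_simple[OF that S c(2,4)[OF \<gamma>]])
      have i1: "(\<lambda>z. - \<i> * F z * \<phi> (s.H2 z)) contour_integrable_on \<gamma>" by (intro i holomorphic_intros hFS hH2)
      have i2: "(\<lambda>z. F z * \<phi> (s.y z)) contour_integrable_on \<gamma>" by (intro i holomorphic_intros hFS hy)
      have "contour_integral \<gamma> (\<lambda>z. - \<i> * F z * \<phi> (s.H2 z) + \<i> / 2 * (F z * \<phi> (s.y z))) = 0"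
        by (rule prim[OF \<gamma> d])
      also have "contour_integral \<gamma> (\<lambda>z. - \<i> * F z * \<phi> (s.H2 z) + \<i> / 2 * (F z * \<phi> (s.y z))) =
        contour_integral \<gamma> (\<lambda>z. - \<i> * F z * \<phi> (s.H2 z)) + \<i> / 2 * contour_integral \<gamma> (\<lambda>z. F z * \<phi> (s.y z))"
        unfolding contour_integral_add[OF i1 contour_integrable_lmul[OF i2]] contour_integral_lmul[OF i2] ..
      finally show ?thesis by (simp add: eq_neg_iff_add_eq_0)
    qed
    then have "\<phi> (slice_integral e1 F h2 \<Gamma>) = - \<i> / 2 * (\<Sum>\<gamma>\<in>\<Gamma>. contour_integral \<gamma> (\<lambda>z. F z * \<phi> (s.y z)))"
      unfolding s.functional_slice_integral[OF slice_kernel_h(2) hF U(1) \<Gamma> \<phi>] h2 sum_distrib_left by (intro sum.cong refl)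
    also have "(\<Sum>\<gamma>\<in>\<Gamma>. contour_integral \<gamma> (\<lambda>z. F z * \<phi> (s.y z))) = (\<Sum>\<gamma>\<in>\<Gamma>'. contour_integral \<gamma> (\<lambda>z. F z * \<phi> (s.y z)))"
      by (rule contour_integral_unique_contour[OF U _ \<Gamma> polygonal_domain_contour[OF D]])
        (unfold S_def[symmetric], intro holomorphic_intros hFS hy)
    also have "\<dots> = chain_integral E (\<lambda>z. F z * \<phi> (s.y z))"
    proof -
      have "frontier D = chain_support E" using D(1) unfolding polygonal_domain_def by simp
      then have "continuous_on (frontier D) (\<lambda>z. F z * \<phi> (s.y z))"
        using supp by (intro continuous_on_subset[OF holomorphic_on_imp_continuous_on[of _ S]] holomorphic_intros hFS hy) auto
      then show ?thesis using D(1) unfolding polygonal_domain_def by blast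
    qed
    also have "\<dots> = 0"
    proof -
      define I where "I e = contour_integral (linepath (fst e) (snd e)) (\<lambda>z. \<phi> (s.y z))" for e
      have iy: "(\<lambda>z. \<phi> (s.y z)) contour_integrable_on linepath (fst e) (snd e)" if "e \<in> E" for e
        by (rule contour_integrable_holomorphic_simple[OF hy S]) (use seg[OF that] in auto)
      have const_int: "contour_integral (linepath (fst e) (snd e)) (\<lambda>z. G z * \<phi> (s.y z)) = k * I e"
        if "e \<in> E" "\<And>z. z \<in> closed_segment (fst e) (snd e) \<Longrightarrow> G z = k" for e G k
      proof -
        have "contour_integral (linepath (fst e) (snd e)) (\<lambda>z. G z * \<phi> (s.y z)) = contour_integral (linepath (fst e) (snd e)) (\<lambda>z. k * \<phi> (s.y z))"
          by (rule contour_integral_cong[OF refl]) (use that in auto)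
        then show ?thesis unfolding I_def contour_integral_lmul[OF iy[OF that(1)]] .
      qed
      \<comment> \<open>The indicator \<eta> of a level set is holomorphic because \<open>F\<close>
        is locally constant, and even because \<open>F\<close> is, so
        \<open>eint_resolvent_zero\<close> applies to each level separately.\<close>
      have level: "(\<Sum>e\<in>E. (if F (fst e) = v then 1 else 0) * I e) = 0" for v
      proof -
        define \<eta> :: "complex \<Rightarrow> complex" where "\<eta> z = (if F z = v then 1 else 0)" for z
        have h\<eta>: "\<eta> holomorphic_on U"
        proof (unfold holomorphic_on_open[OF U(1)], intro ballI exI)
          fix z assume z: "z \<in> U"
          obtain r where r: "r > 0" "ball z r \<subseteq> U" using U(1) z open_contains_ball by blast
          have "\<exists>k. \<forall>x\<in>ball z r. F x = k"
            by (rule has_field_derivative_zero_constant[OF convex_ball has_field_derivative_at_within[OF F]]) (rule subsetD[OF r(2)])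
          then obtain k where k: "F x = k" if "x \<in> ball z r" for x by auto
          have loc: "\<eta> z = \<eta> x" if "x \<in> ball z r" for x
            unfolding \<eta>_def k[OF that] k[of z, unfolded centre_in_ball, OF r(1)] ..
          show "(\<eta> has_field_derivative 0) (at z)"
          proof (rule has_field_derivative_transform_within_open[where f = "\<lambda>_. \<eta> z" and S = "ball z r"])
            show "((\<lambda>_. \<eta> z) has_field_derivative 0) (at z)" by (rule DERIV_const)
            show "z \<in> ball z r" using r(1) by simp
          qed (rule open_ball, erule loc)
        qed
        have "chain_integral E (\<lambda>z. \<phi> (s.cscale (\<eta> z) (s.y z))) = \<phi> (s.eint E (\<lambda>z. s.cscale (\<eta> z) (s.y z)))"
        proof (rule s.functional_eint[OF S _ supp \<phi>, symmetric])
          show "s.cholo (\<lambda>z. s.cscale (\<eta> z) (s.y z)) S"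
            by (intro s.cholo_cscale holomorphic_on_subset[OF h\<eta>] s.cholo_subset[OF s.cholo_y]) (auto simp: S_def)
        qed
        also have "s.eint E (\<lambda>z. s.cscale (\<eta> z) (s.y z)) = 0"
          by (rule s.eint_resolvent_zero[OF refl real U(1) h\<eta> _ _ D]) (auto simp: \<eta>_def cF)
        finally have "chain_integral E (\<lambda>z. \<eta> z * \<phi> (s.y z)) = 0" unfolding s.functional_cscale[OF \<phi>] \<phi>.zero .
        also have "chain_integral E (\<lambda>z. \<eta> z * \<phi> (s.y z)) = (\<Sum>e\<in>E. \<eta> (fst e) * I e)"
          unfolding chain_integral_def
        proof (rule sum.cong[OF refl])
          fix e assume e: "e \<in> E"
          have "\<eta> z = \<eta> (fst e)" if "z \<in> closed_segment (fst e) (snd e)" for z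
            unfolding \<eta>_def const[OF e that] ..
          then show "contour_integral (linepath (fst e) (snd e)) (\<lambda>z. \<eta> z * \<phi> (s.y z)) = \<eta> (fst e) * I e"
            by (rule const_int[OF e])
        qed
        finally show ?thesis unfolding \<eta>_def .
      qed
      have "chain_integral E (\<lambda>z. F z * \<phi> (s.y z)) = (\<Sum>e\<in>E. F (fst e) * I e)"
        unfolding chain_integral_def
      proof (rule sum.cong[OF refl])
        fix e assume e: "e \<in> E"
        show "contour_integral (linepath (fst e) (snd e)) (\<lambda>z. F z * \<phi> (s.y z)) = F (fst e) * I e"
          by (rule const_int[OF e const[OF e]])
      qed
      also have "\<dots> = (\<Sum>e\<in>E. \<Sum>v\<in>(\<lambda>e. F (fst e)) ` E. v * ((if F (fst e) = v then 1 else 0) * I e))"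
      proof (intro sum.cong refl)
        fix e assume e: "e \<in> E"
        have "(\<Sum>v\<in>(\<lambda>e. F (fst e)) ` E. v * ((if F (fst e) = v then 1 else 0) * I e)) =
          (\<Sum>v\<in>(\<lambda>e. F (fst e)) ` E. if F (fst e) = v then v * I e else 0)"
          by (intro sum.cong refl) simp
        also have "\<dots> = F (fst e) * I e" using e finE by (subst sum.delta') auto
        finally show "F (fst e) * I e = (\<Sum>v\<in>(\<lambda>e. F (fst e)) ` E. v * ((if F (fst e) = v then 1 else 0) * I e))" by simp
      qed
      also have "\<dots> = (\<Sum>v\<in>(\<lambda>e. F (fst e)) ` E. v * (\<Sum>e\<in>E. (if F (fst e) = v then 1 else 0) * I e))"
        by (subst sum.swap) (simp only: sum_distrib_left)
      also have "\<dots> = 0" by (simp only: level mult_zero_right sum.neutral_const)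
      finally show ?thesis .
    qed
    finally show "\<phi> (slice_integral e1 F h2 \<Gamma>) = \<phi> 0" by (simp add: \<phi>.zero)
  qed
qed

section \<open>Intrinsic components, partial derivatives, and a differential equation for stem
  functions\<close>

section \<open>Stem functions and the conjugate Cauchy-Fueter operator\<close>

text \<open>The coordinates of both stem functions along \<open>b\<close>, combined into one complex
  function. The Cauchy-Riemann equations make it holomorphic and parity makes it intrinsic; for
  \<open>b\<close> in {1, e1, e2, e3} these four functions recover the slice function.\<close>

definition stem_comp :: "quat \<Rightarrow> (complex \<Rightarrow> quat) \<Rightarrow> (complex \<Rightarrow> quat) \<Rightarrow> complex \<Rightarrow> complex" where
  "stem_comp b \<alpha> \<beta> z = Complex (inner (\<alpha> z) b) (inner (\<beta> z) b)"

lemma stem_comp_cnj: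
  "stem_pair U \<alpha> \<beta> \<Longrightarrow> z \<in> U \<Longrightarrow> stem_comp b \<alpha> \<beta> (cnj z) = cnj (stem_comp b \<alpha> \<beta> z)"
  unfolding stem_pair_def stem_comp_def by (simp add: complex_eq_iff)

lemma has_derivative_Complex:
  assumes "(f has_derivative f') F" "(g has_derivative g') F"
  shows "((\<lambda>z. Complex (f z) (g z)) has_derivative (\<lambda>v. Complex (f' v) (g' v))) F"
  unfolding Complex_eq using assms by (auto intro!: derivative_eq_intros)

lemma stem_comp_derivative:
  assumes s: "stem_pair U \<alpha> \<beta>" and z: "z \<in> U"
  shows "(stem_comp b \<alpha> \<beta> has_field_derivative
    Complex (inner (frechet_derivative \<alpha> (at z) 1) b) (inner (frechet_derivative \<beta> (at z) 1) b)) (at z)"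
proof -
  let ?a = "frechet_derivative \<alpha> (at z)" and ?b = "frechet_derivative \<beta> (at z)"
  have d: "(\<alpha> has_derivative ?a) (at z)" "(\<beta> has_derivative ?b) (at z)"
    and CR: "?a 1 = ?b \<i>" "?a \<i> = - ?b 1"
    using s z unfolding stem_pair_def by (auto simp: frechet_derivative_works)
  interpret a: bounded_linear ?a by (rule has_derivative_bounded_linear[OF d(1)])
  interpret b: bounded_linear ?b by (rule has_derivative_bounded_linear[OF d(2)])
  have main: "(stem_comp b \<alpha> \<beta> has_derivative (\<lambda>v. Complex (inner (?a v) b) (inner (?b v) b))) (at z)"
    unfolding stem_comp_def[abs_def]
    by (intro has_derivative_Complex bounded_linear.has_derivative[OF bounded_linear_inner_left] d)
  have "Complex (inner (?a v) b) (inner (?b v) b) = Complex (inner (?a 1) b) (inner (?b 1) b) * v" for v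
  proof -
    have v: "v = Re v *\<^sub>R 1 + Im v *\<^sub>R \<i>" by (simp add: complex_eq_iff)
    have A: "?a v = Re v *\<^sub>R ?a 1 + Im v *\<^sub>R ?a \<i>" and B: "?b v = Re v *\<^sub>R ?b 1 + Im v *\<^sub>R ?b \<i>"
      by (subst v, simp only: a.add a.scaleR b.add b.scaleR)+
    show ?thesis
      unfolding A B CR(2) CR(1)[symmetric] by (simp add: complex_eq_iff inner_add_left algebra_simps)
  qed
  then have eq: "(\<lambda>v. Complex (inner (?a v) b) (inner (?b v) b)) =
      (*) (Complex (inner (?a 1) b) (inner (?b 1) b))" by (rule ext)
  show ?thesis unfolding has_field_derivative_def using main unfolding eq .
qed

lemma stem_comp_holomorphic:
  assumes "open U" "stem_pair U \<alpha> \<beta>"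
  shows "stem_comp b \<alpha> \<beta> holomorphic_on U"
  unfolding holomorphic_on_open[OF assms(1)] by (intro ballI exI) (rule stem_comp_derivative[OF assms(2)])

text \<open>The derivative in every direction \<open>w\<close> is w D and must be real; the
  directions 1 and \<i> together leave only 0.\<close>

lemma real_valued_holomorphic_derivative:
  assumes g: "(g has_field_derivative D) (at z)" and S: "open S" "z \<in> S" "\<And>w. w \<in> S \<Longrightarrow> Im (g w) = 0"
  shows "D = 0"
proof -
  have "Im (w * D) = 0" for w
  proof -
    have "((\<lambda>t. z + of_real t * w) has_vector_derivative w) (at (0::real))"
      by (auto intro!: derivative_eq_intros)
    then have "((g \<circ> (\<lambda>t. z + of_real t * w)) has_vector_derivative (w * D)) (at (0::real))"
      using g by (intro field_vector_diff_chain_at) auto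
    then have "((\<lambda>t. Im (g (z + of_real t * w))) has_vector_derivative Im (w * D)) (at (0::real))"
      using bounded_linear.has_vector_derivative[OF bounded_linear_Im] by (fastforce simp: o_def)
    moreover have "((\<lambda>t. Im (g (z + of_real t * w))) has_vector_derivative 0) (at (0::real))"
    proof (rule has_vector_derivative_transform_within_open[of "\<lambda>_. 0"])
      show "open ((\<lambda>t::real. z + of_real t * w) -` S)"
        by (intro open_vimage S continuous_intros)
    qed (use S in auto)
    ultimately show ?thesis by (rule vector_derivative_unique_at)
  qed
  from this[of 1] this[of \<i>] show ?thesis by (simp add: complex_eq_iff)
qed

lemma partial_deriv_slice:
  assumes M: "bounded_bilinear M"
    and f: "\<And>t. t \<in> A \<Longrightarrow> f (q + t *\<^sub>R e) = \<alpha> (c t) + M (K t) (\<beta> (c t))" and A: "open A" "0 \<in> A"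
    and c: "(c has_vector_derivative c') (at 0)" and K: "(K has_vector_derivative K') (at 0)"
    and d: "(\<alpha> has_derivative \<alpha>') (at (c 0))" "(\<beta> has_derivative \<beta>') (at (c 0))"
  shows "partial_deriv e f q = \<alpha>' c' + (M (K 0) (\<beta>' c') + M K' (\<beta> (c 0)))"
  unfolding partial_deriv_def
proof (rule vector_derivative_at, rule has_vector_derivative_transform_within_open[of "\<lambda>t. \<alpha> (c t) + M (K t) (\<beta> (c t))"])
  have 1: "((\<lambda>t. \<alpha> (c t)) has_vector_derivative \<alpha>' c') (at 0)" "((\<lambda>t. \<beta> (c t)) has_vector_derivative \<beta>' c') (at 0)"
    using vector_derivative_diff_chain_within[OF c has_derivative_at_withinI[OF d(1)]]
      vector_derivative_diff_chain_within[OF c has_derivative_at_withinI[OF d(2)]] by (simp_all add: o_def)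
  show "((\<lambda>t. \<alpha> (c t) + M (K t) (\<beta> (c t))) has_vector_derivative \<alpha>' c' + (M (K 0) (\<beta>' c') + M K' (\<beta> (c 0)))) (at 0)"
    by (intro has_vector_derivative_add 1 bounded_bilinear.has_vector_derivative[OF M] K)
qed (use A f in auto)

text \<open>The directions 1 and \<open>e1\<close> stay in the slice. Along \<open>e2\<close> and
  \<open>e3\<close> the modulus of the imaginary part changes only to second order, so to first
  order only the imaginary unit turns, at rate 1 / Im z.\<close>

lemma partial_derivs_at_slice_point:
  assumes M: "bounded_bilinear M"
    and f: "\<And>J z. J \<in> imag_units \<Longrightarrow> z \<in> U \<Longrightarrow> f (slice_pt J z) = \<alpha> z + M J (\<beta> z)"
    and U: "open U" "z \<in> U" and s: "stem_pair U \<alpha> \<beta>" and v: "Im z \<noteq> 0"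
  defines "a1 \<equiv> frechet_derivative \<alpha> (at z) 1" and "b1 \<equiv> frechet_derivative \<beta> (at z) 1"
  shows "partial_deriv 1 f (slice_pt e1 z) = a1 + M e1 b1"
    "partial_deriv e1 f (slice_pt e1 z) = - b1 + M e1 a1"
    "e \<in> {e2, e3} \<Longrightarrow> partial_deriv e f (slice_pt e1 z) = (1 / Im z) *\<^sub>R M e (\<beta> z)"
proof -
  interpret M: bounded_bilinear M by (rule M)
  let ?a = "frechet_derivative \<alpha> (at z)" and ?b = "frechet_derivative \<beta> (at z)"
  have d: "(\<alpha> has_derivative ?a) (at z)" "(\<beta> has_derivative ?b) (at z)"
    and CR: "?a 1 = ?b \<i>" "?a \<i> = - ?b 1"
    using s U(2) unfolding stem_pair_def by (auto simp: frechet_derivative_works)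
  have line: "partial_deriv (slice_pt e1 w) f (slice_pt e1 z) = ?a w + M e1 (?b w)" for w
  proof -
    let ?c = "\<lambda>t::real. z + of_real t * w"
    have "partial_deriv (slice_pt e1 w) f (slice_pt e1 z) = ?a w + (M e1 (?b w) + M 0 (\<beta> (?c 0)))"
    proof (rule partial_deriv_slice[OF M, where A = "?c -` U" and c = ?c and K = "\<lambda>_. e1"])
      have "slice_pt e1 z + t *\<^sub>R slice_pt e1 w = slice_pt e1 (?c t)" for t
        by (simp add: slice_pt_def of_real_def algebra_simps)
      then show "f (slice_pt e1 z + t *\<^sub>R slice_pt e1 w) = \<alpha> (?c t) + M e1 (\<beta> (?c t))" if "t \<in> ?c -` U" for t
        using f[of e1 "?c t"] that by simp
      show "open (?c -` U)" by (intro open_vimage U continuous_intros)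
      show "(?c has_vector_derivative w) (at 0)" by (auto intro!: derivative_eq_intros)
    qed (use U d in \<open>auto intro!: derivative_eq_intros\<close>)
    then show ?thesis by (simp add: M.zero_left)
  qed
  from line[of 1] show "partial_deriv 1 f (slice_pt e1 z) = a1 + M e1 b1" by (simp add: a1_def b1_def)
  from line[of \<i>] show "partial_deriv e1 f (slice_pt e1 z) = - b1 + M e1 a1" by (simp add: a1_def b1_def CR)
  show "partial_deriv e f (slice_pt e1 z) = (1 / Im z) *\<^sub>R M e (\<beta> z)" if e: "e \<in> {e2, e3}"
  proof -
    define v where "v = Im z"
    \<comment> \<open>The imaginary coordinate along the curve. The sign keeps it on the side of
      \<open>z\<close>, which may lie in the lower half plane.\<close>
    define w where "w t = sgn v * sqrt (v\<^sup>2 + t\<^sup>2)" for t :: real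
    have v0: "v \<noteq> 0" using \<open>Im z \<noteq> 0\<close> by (simp add: v_def)
    then have pos: "v\<^sup>2 + t\<^sup>2 > 0" for t :: real by (simp add: add_pos_nonneg)
    have w0: "w 0 = v" by (simp add: w_def sgn_if)
    have wn: "w t \<noteq> 0" for t using pos[of t] v0 by (simp add: w_def sgn_zero_iff)
    have w2: "(w t)\<^sup>2 = v\<^sup>2 + t\<^sup>2" for t using pos[of t] v0 by (simp add: w_def power_mult_distrib sgn_if)
    have dw: "(w has_real_derivative 0) (at 0)"
      unfolding w_def using v0 by (auto intro!: derivative_eq_intros simp: power2_eq_square)
    let ?c = "\<lambda>t. Complex (Re z) (w t)"
    let ?K = "\<lambda>t. (v / w t) *\<^sub>R e1 + (t / w t) *\<^sub>R e"
    have dc: "(?c has_vector_derivative 0) (at 0)"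
    proof -
      have "(?c has_derivative (\<lambda>h. Complex 0 (0 * h))) (at 0)"
        by (rule has_derivative_Complex[OF has_derivative_const dw[unfolded has_field_derivative_def]])
      moreover have "(\<lambda>h. Complex 0 (0 * h)) = (\<lambda>h. h *\<^sub>R 0)" by (simp add: fun_eq_iff complex_eq_iff)
      ultimately show ?thesis unfolding has_vector_derivative_def by simp
    qed
    have dK: "(?K has_vector_derivative (1 / v) *\<^sub>R e) (at 0)"
    proof -
      have D: "((\<lambda>t. v / w t) has_real_derivative 0) (at 0)" "((\<lambda>t. t / w t) has_real_derivative 1 / v) (at 0)"
        using wn[of 0] v0 by (auto intro!: derivative_eq_intros dw simp: w0 power2_eq_square)
      note L = bounded_linear.has_vector_derivative[OF bounded_linear_scaleR_left]
      from has_vector_derivative_add[OF L[OF D(1)[unfolded has_real_derivative_iff_has_vector_derivative], of e1]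
        L[OF D(2)[unfolded has_real_derivative_iff_has_vector_derivative], of e]]
      show ?thesis by simp
    qed
    have KI: "?K t \<in> imag_units" for t
    proof -
      have "(v / w t)\<^sup>2 + (t / w t)\<^sup>2 = 1"
        proof -
        have "w t \<noteq> 0" using wn[of t] by auto
        then show ?thesis unfolding power_divide add_divide_distrib[symmetric] w2[of t, symmetric] by simp
      qed
      then show ?thesis using e unfolding imag_units_iff
        by (auto simp: e1_def e2_def e3_def plus_quat_def scaleR_quat_def)
    qed
    have pt: "slice_pt e1 z + t *\<^sub>R e = slice_pt (?K t) (?c t)" for t
      using wn[of t] by (simp add: slice_pt_def v_def[symmetric] scaleR_add_right)
    have c0: "?c 0 = z" by (simp add: w0 v_def)
    have "partial_deriv e f (slice_pt e1 z) = ?a 0 + (M (?K 0) (?b 0) + M ((1 / v) *\<^sub>R e) (\<beta> (?c 0)))"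
    proof (rule partial_deriv_slice[OF M, where A = "?c -` U" and c = ?c and K = ?K])
      show "f (slice_pt e1 z + t *\<^sub>R e) = \<alpha> (?c t) + M (?K t) (\<beta> (?c t))" if "t \<in> ?c -` U" for t
        unfolding pt using f[OF KI, of "?c t"] that by simp
      show "open (?c -` U)"
        unfolding w_def Complex_eq by (intro open_vimage U continuous_intros)
    qed (use U d dc dK c0 in auto)
    moreover have "?a 0 = 0" "?b 0 = 0"
      using d[THEN has_derivative_bounded_linear] linear_simps(3) by (auto dest: bounded_linear.linear linear_0)
    ultimately show ?thesis unfolding c0 by (simp add: M.zero_right M.scaleR_left v_def)
  qed
qed

text \<open>The derivatives in \<open>Dbar\<close> can be added only where they exist, and they are
  needed at all points of the domain. At a real point the line in the direction \<open>e\<close>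
  stays in the slice of \<open>e\<close>; elsewhere the unit and the modulus move
  differentiably.\<close>

lemma slice_function_directional:
  assumes M: "bounded_bilinear M"
    and f: "\<And>J z. J \<in> imag_units \<Longrightarrow> z \<in> U \<Longrightarrow> f (slice_pt J z) = \<alpha> z + M J (\<beta> z)"
    and U: "open U" "cnj ` U \<subseteq> U" and s: "stem_pair U \<alpha> \<beta>"
    and J: "J \<in> imag_units" "z \<in> U" and e: "e = 1 \<or> e \<in> imag_units"
  shows "(\<lambda>t. f (slice_pt J z + t *\<^sub>R e)) differentiable (at (0::real))"
proof -
  interpret M: bounded_bilinear M by (rule M)
  have main: ?thesis
    if c: "c differentiable (at 0)" "continuous_on UNIV c" "c 0 \<in> U" and K: "K differentiable (at 0)"
      and pt: "open A" "0 \<in> A" "\<And>t. t \<in> A \<Longrightarrow> K t \<in> imag_units \<and> slice_pt J z + t *\<^sub>R e = slice_pt (K t) (c t)"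
    for c :: "real \<Rightarrow> complex" and K A
  proof -
    have d: "\<alpha> differentiable (at (c 0))" "\<beta> differentiable (at (c 0))" using s c(3) unfolding stem_pair_def by auto
    have "(\<lambda>t. \<alpha> (c t)) differentiable (at 0)" "(\<lambda>t. \<beta> (c t)) differentiable (at 0)"
      using differentiable_chain_at[OF c(1) d(1)] differentiable_chain_at[OF c(1) d(2)] by (simp_all add: o_def)
    then obtain a b k where "((\<lambda>t. \<alpha> (c t)) has_derivative a) (at 0)" "((\<lambda>t. \<beta> (c t)) has_derivative b) (at 0)"
      "(K has_derivative k) (at 0)" using K unfolding differentiable_def by blast
    from has_derivative_add[OF this(1) M.FDERIV[OF this(3,2)]]
    have "((\<lambda>t. \<alpha> (c t) + M (K t) (\<beta> (c t))) has_derivative (\<lambda>h. a h + (M (K 0) (b h) + M (k h) (\<beta> (c 0))))) (at 0)" .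
    then have "((\<lambda>t. f (slice_pt J z + t *\<^sub>R e)) has_derivative (\<lambda>h. a h + (M (K 0) (b h) + M (k h) (\<beta> (c 0))))) (at 0)"
    proof (rule has_derivative_transform_within_open)
      show "open (A \<inter> c -` U)" by (intro open_Int pt open_vimage U c)
      show "0 \<in> A \<inter> c -` U" using pt c by auto
      show "\<alpha> (c t) + M (K t) (\<beta> (c t)) = f (slice_pt J z + t *\<^sub>R e)" if "t \<in> A \<inter> c -` U" for t
        using pt(3)[of t] f[of "K t" "c t"] that by simp
    qed
    then show ?thesis unfolding differentiable_def by blast
  qed
  consider "e = 1" | "e \<in> imag_units" "Im z = 0" | "e \<in> imag_units" "Im z \<noteq> 0" using e by blast
  then show ?thesis
  proof cases
    case 1
    have "(\<lambda>t::real. z + of_real t) differentiable (at 0)"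
      by (rule differentiable_add) (auto intro: bounded_linear_imp_differentiable bounded_linear_of_real)
    moreover have "continuous_on UNIV (\<lambda>t::real. z + of_real t)" by (intro continuous_intros)
    ultimately show ?thesis
      by (rule main[of _ "\<lambda>_. J" UNIV]) (use J 1 in \<open>auto simp: slice_pt_def of_real_def algebra_simps\<close>)
  next
    case 2
    have "(\<lambda>t::real. z + \<i> * of_real t) differentiable (at 0)"
      by (intro differentiable_add differentiable_mult) (auto intro: bounded_linear_imp_differentiable bounded_linear_of_real)
    moreover have "continuous_on UNIV (\<lambda>t::real. z + \<i> * of_real t)" by (intro continuous_intros)
    ultimately show ?thesis
      by (rule main[of _ "\<lambda>_. e" UNIV]) (use J 2 in \<open>auto simp: slice_pt_def of_real_def algebra_simps\<close>)
  next
    case 3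
    define w where "w t = norm (Im z *\<^sub>R J + t *\<^sub>R e)" for t :: real
    have nJ: "norm J = 1" using norm_slice_pt[OF J(1), of \<i>] by simp
    have lin: "(\<lambda>t::real. Im z *\<^sub>R J + t *\<^sub>R e) differentiable (at 0)"
      by (rule differentiable_add) (auto intro: bounded_linear_imp_differentiable bounded_linear_scaleR_left)
    have w0: "w 0 = \<bar>Im z\<bar>" by (simp add: w_def nJ)
    have "norm differentiable (at (Im z *\<^sub>R J + 0 *\<^sub>R e))" by (rule differentiable_norm_at) (use 3 nJ in auto)
    from differentiable_chain_at[OF lin this] have dw: "w differentiable (at 0)" by (simp add: w_def[abs_def] o_def)
    have cw: "continuous_on UNIV w" unfolding w_def by (intro continuous_intros)
    have dc: "(\<lambda>t. Complex (Re z) (w t)) differentiable (at 0)"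
      using dw has_derivative_Complex[OF has_derivative_const] unfolding differentiable_def by blast
    have cc: "continuous_on UNIV (\<lambda>t. Complex (Re z) (w t))" unfolding Complex_eq by (intro continuous_intros cw)
    \<comment> \<open>The modulus is taken nonnegative here, so for negative imaginary part the
      curve starts at the conjugate point; this is where the symmetry of \<open>U\<close>
      enters.\<close>
    have c0: "Complex (Re z) (w 0) \<in> U"
    proof (cases "Im z > 0")
      case True
      then have "Complex (Re z) (w 0) = z" by (simp add: w0 complex_eq_iff)
      then show ?thesis using J(2) by simp
    next
      case False
      then have "Complex (Re z) (w 0) = cnj z" by (simp add: w0 complex_eq_iff)
      then show ?thesis using J(2) U(2) by auto
    qed
    have "(\<lambda>t. inverse (w t)) differentiable (at 0)" by (rule differentiable_inverse[OF dw]) (use 3 w0 in auto)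
    then obtain k l where "((\<lambda>t. inverse (w t)) has_derivative k) (at 0)" "((\<lambda>t::real. Im z *\<^sub>R J + t *\<^sub>R e) has_derivative l) (at 0)"
      using lin unfolding differentiable_def by blast
    from has_derivative_scaleR[OF this] have dK: "(\<lambda>t. inverse (w t) *\<^sub>R (Im z *\<^sub>R J + t *\<^sub>R e)) differentiable (at 0)"
      unfolding differentiable_def by blast
    have iu: "inverse (norm x) *\<^sub>R x \<in> imag_units" if "qRe x = 0" "norm x \<noteq> 0" for x
    proof -
      have "qIm1 x * qIm1 x + qIm2 x * qIm2 x + qIm3 x * qIm3 x = norm x * norm x"
        using that(1) unfolding norm_quat_def inner_quat_def by simp
      then have "(qIm1 x)\<^sup>2 + (qIm2 x)\<^sup>2 + (qIm3 x)\<^sup>2 = (norm x)\<^sup>2" by (simp add: power2_eq_square)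
      then show ?thesis using that unfolding imag_units_iff
        by (simp add: scaleR_quat_def power_mult_distrib distrib_left[symmetric] power_inverse)
    qed
    have re: "qRe (Im z *\<^sub>R J + t *\<^sub>R e) = 0" for t
      using J(1) 3(1) unfolding imag_units_iff by (simp add: plus_quat_def scaleR_quat_def)
    show ?thesis
    proof (rule main[OF dc cc c0 dK, of "w -` (- {0})"])
      show "open (w -` (- {0}))" by (intro open_vimage cw) auto
      show "0 \<in> w -` (- {0})" using 3 w0 by auto
      fix t assume "t \<in> w -` (- {0})"
      then have "w t \<noteq> 0" by simp
      then show "inverse (w t) *\<^sub>R (Im z *\<^sub>R J + t *\<^sub>R e) \<in> imag_units \<and>
        slice_pt J z + t *\<^sub>R e = slice_pt (inverse (w t) *\<^sub>R (Im z *\<^sub>R J + t *\<^sub>R e)) (Complex (Re z) (w t))"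
        using iu[OF re] by (simp add: w_def slice_pt_def)
    qed
  qed
qed

text \<open>Off the real axis F' is real-valued, hence has derivative 0. Then F + z F' has
  derivative 2 F' and imaginary part Im F + Im z F' = 0, so F' = 0 there as well, and at real points
  by continuity. Now Im F = 0 off the axis, so the intrinsic symmetry becomes evenness.\<close>

lemma holomorphic_zero_derivative:
  assumes U: "open U" and F: "F holomorphic_on U" and cF: "\<And>z. z \<in> U \<Longrightarrow> F (cnj z) = cnj (F z)"
    and d: "\<And>z. z \<in> U \<Longrightarrow> Im z \<noteq> 0 \<Longrightarrow> (F has_field_derivative Complex (- Im (F z) / Im z) 0) (at z)"
  shows "z \<in> U \<Longrightarrow> (F has_field_derivative 0) (at z)" "z \<in> U \<Longrightarrow> F (cnj z) = F z"
proof -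
  let ?G = "deriv F"
  define U0 where "U0 = U \<inter> Im -` (- {0})"
  have U0: "open U0" unfolding U0_def by (intro open_Int U open_vimage continuous_intros)
  have G: "?G holomorphic_on U" by (rule holomorphic_deriv[OF F U])
  have Gz: "?G z = Complex (- Im (F z) / Im z) 0" if "z \<in> U0" for z
    using DERIV_imp_deriv[OF d] that by (auto simp: U0_def)
  have FU: "(F has_field_derivative ?G z) (at z)" and GU: "(?G has_field_derivative deriv ?G z) (at z)" if "z \<in> U" for z
    using holomorphic_derivI[OF F U that] holomorphic_derivI[OF G U that] by auto
  have G0: "?G z = 0" if z: "z \<in> U0" for z
  proof -
    have zU: "z \<in> U" using z by (simp add: U0_def)
    have "deriv ?G z = 0" by (rule real_valued_holomorphic_derivative[OF GU[OF zU] U0 z]) (simp add: Gz)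
    then have "((\<lambda>w. F w + w * ?G w) has_field_derivative 2 * ?G z) (at z)"
      using FU[OF zU] GU[OF zU] by (auto intro!: derivative_eq_intros)
    then have "2 * ?G z = 0"
      by (rule real_valued_holomorphic_derivative[OF _ U0 z]) (auto simp: Gz U0_def)
    then show ?thesis by simp
  qed
  have G1: "?G z = 0" if z: "z \<in> U" for z
  proof (cases "Im z = 0")
    case False
    then show ?thesis using G0 z by (simp add: U0_def)
  next
    case True
    \<comment> \<open>Real points are approached vertically from the upper half plane.\<close>
    let ?x = "\<lambda>n. z + \<i> * of_real (inverse (real (Suc n)))"
    have "(\<lambda>n. inverse (real (Suc n))) \<longlonglongrightarrow> 0" by (rule LIMSEQ_inverse_real_of_nat)
    then have "?x \<longlonglongrightarrow> z + \<i> * of_real 0" by (intro tendsto_intros)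
    then have x: "?x \<longlonglongrightarrow> z" by simp
    then have ev: "eventually (\<lambda>n. ?x n \<in> U) sequentially" using U z by (rule topological_tendstoD)
    have "eventually (\<lambda>n. ?G (?x n) = 0) sequentially"
      using ev
    proof eventually_elim
      fix n assume n: "?x n \<in> U"
      have "Im (?x n) \<noteq> 0" unfolding plus_complex.sel True by (simp del: of_nat_Suc)
      with n show "?G (?x n) = 0" by (intro G0) (simp add: U0_def del: of_nat_Suc)
    qed
    moreover have "(\<lambda>n. ?G (?x n)) \<longlonglongrightarrow> ?G z"
    proof (rule isCont_tendsto_compose[OF _ x])
      have "\<forall>z\<in>U. isCont ?G z"
        using holomorphic_on_imp_continuous_on[OF G] unfolding continuous_on_eq_continuous_at[OF U] .
      then show "isCont ?G z" using z by (rule bspec)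
    qed
    ultimately have "(\<lambda>n. 0) \<longlonglongrightarrow> ?G z" by (rule Lim_transform_eventually[rotated])
    then show ?thesis by (simp add: LIMSEQ_const_iff)
  qed
  show "(F has_field_derivative 0) (at z)" if "z \<in> U" using FU[OF that] G1[OF that] by simp
  show "F (cnj z) = F z" if z: "z \<in> U"
  proof (cases "Im z = 0")
    case True
    then have "cnj z = z" by (simp add: complex_eq_iff)
    then show ?thesis by simp
  next
    case False
    then have "z \<in> U0" using z by (simp add: U0_def)
    then have "Im (F z) = 0" using Gz[of z] G0[of z] False by (simp add: complex_eq_iff)
    then show ?thesis using cF[OF z] by (simp add: complex_eq_iff)
  qed
qed

text \<open>At the conjugate point the derivative of \<alpha> and the quotient \<beta> z / Im z are
  unchanged while the derivative of \<beta> changes sign. Comparing the two equations kills the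
  latter, and what remains is the equation of \<open>holomorphic_zero_derivative\<close> for every
  component.\<close>

lemma stem_locally_constant:
  assumes M: "bounded_bilinear M" "\<And>x. M e1 x = 0 \<Longrightarrow> x = 0"
    and U: "open U" "cnj ` U \<subseteq> U" and s: "stem_pair U \<alpha> \<beta>"
    and eq: "\<And>z. z \<in> U \<Longrightarrow> Im z \<noteq> 0 \<Longrightarrow>
      frechet_derivative \<alpha> (at z) 1 + M e1 (frechet_derivative \<beta> (at z) 1) + (1 / Im z) *\<^sub>R \<beta> z = 0"
  shows "z \<in> U \<Longrightarrow> (stem_comp b \<alpha> \<beta> has_field_derivative 0) (at z)"
    "z \<in> U \<Longrightarrow> stem_comp b \<alpha> \<beta> (cnj z) = stem_comp b \<alpha> \<beta> z"
proof -
  interpret M: bounded_bilinear M by (rule M(1))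
  have sd: "\<alpha> (cnj z) = \<alpha> z" "\<beta> (cnj z) = - \<beta> z" "(\<alpha> has_derivative frechet_derivative \<alpha> (at z)) (at z)"
    "(\<beta> has_derivative frechet_derivative \<beta> (at z)) (at z)" if "z \<in> U" for z
    using s that unfolding stem_pair_def by (auto simp: frechet_derivative_works)
  have cU: "cnj z \<in> U" if "z \<in> U" for z using that U(2) by blast
  have cnjd: "(cnj has_derivative cnj) (at z)" for z by (rule bounded_linear_imp_has_derivative[OF bounded_linear_cnj])
  have d: "(stem_comp b \<alpha> \<beta> has_field_derivative Complex (- Im (stem_comp b \<alpha> \<beta> z) / Im z) 0) (at z)"
    if z: "z \<in> U" "Im z \<noteq> 0" for z
  proof -
    let ?a = "\<lambda>z. frechet_derivative \<alpha> (at z) 1" and ?b = "\<lambda>z. frechet_derivative \<beta> (at z) 1"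
    have "((\<lambda>w. \<alpha> (cnj w)) has_derivative (\<lambda>v. frechet_derivative \<alpha> (at (cnj z)) (cnj v))) (at z)"
      using has_derivative_compose[OF cnjd sd(3)[OF cU[OF z(1)]]] .
    then have "(\<alpha> has_derivative (\<lambda>v. frechet_derivative \<alpha> (at (cnj z)) (cnj v))) (at z)"
      by (rule has_derivative_transform_within_open[OF _ U(1) z(1)]) (rule sd(1))
    from has_derivative_unique[OF this sd(3)[OF z(1)]] have a: "?a (cnj z) = ?a z"
      by (metis complex_cnj_one)
    have "((\<lambda>w. - \<beta> (cnj w)) has_derivative (\<lambda>v. - frechet_derivative \<beta> (at (cnj z)) (cnj v))) (at z)"
      by (rule has_derivative_minus[OF has_derivative_compose[OF cnjd sd(4)[OF cU[OF z(1)]]]])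
    then have "(\<beta> has_derivative (\<lambda>v. - frechet_derivative \<beta> (at (cnj z)) (cnj v))) (at z)"
      by (rule has_derivative_transform_within_open[OF _ U(1) z(1)]) (simp add: sd(2))
    from has_derivative_unique[OF this sd(4)[OF z(1)]] have b: "?b (cnj z) = - ?b z"
      by (metis complex_cnj_one minus_minus)
    have 1: "?a z + M e1 (?b z) + (1 / Im z) *\<^sub>R \<beta> z = 0" by (rule eq[OF z])
    have 2: "?a z - M e1 (?b z) + (1 / Im z) *\<^sub>R \<beta> z = 0"
      using eq[OF cU[OF z(1)]] z unfolding a b sd(2)[OF z(1)] by (simp add: M.minus_right)
    have "2 *\<^sub>R M e1 (?b z) = (?a z + M e1 (?b z) + (1 / Im z) *\<^sub>R \<beta> z) - (?a z - M e1 (?b z) + (1 / Im z) *\<^sub>R \<beta> z)"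
      by (simp add: scaleR_2)
    then have "M e1 (?b z) = 0" unfolding 1 2 by simp
    then have b0: "?b z = 0" by (rule M(2))
    then have a0: "?a z = - ((1 / Im z) *\<^sub>R \<beta> z)" using 1 by (simp add: M.zero_right eq_neg_iff_add_eq_0)
    show ?thesis using stem_comp_derivative[OF s z(1), of b] unfolding a0 b0 by (simp add: stem_comp_def)
  qed
  note hol = stem_comp_holomorphic[OF U(1) s, of b] and cj = stem_comp_cnj[OF s, of _ b]
  show "z \<in> U \<Longrightarrow> (stem_comp b \<alpha> \<beta> has_field_derivative 0) (at z)"
    by (rule holomorphic_zero_derivative(1)[OF U(1) hol cj d])
  show "z \<in> U \<Longrightarrow> stem_comp b \<alpha> \<beta> (cnj z) = stem_comp b \<alpha> \<beta> z"
    by (rule holomorphic_zero_derivative(2)[OF U(1) hol cj d])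
qed

section \<open>Linearity and kernel of the conjugate Cauchy-Fueter operator on slice
  functions\<close>

section \<open>Slice functions with values on either side\<close>

text \<open>\<open>M\<close> is left or right multiplication, \<open>M J x = J x\<close> or \<open>M J x = x J\<close>; this treats left and right
  slice hyperholomorphic functions simultaneously.\<close>

definition slice_rep :: "(quat \<Rightarrow> quat \<Rightarrow> quat) \<Rightarrow> complex set \<Rightarrow> (quat \<Rightarrow> quat) \<Rightarrow> (complex \<Rightarrow> quat) \<Rightarrow> (complex \<Rightarrow> quat) \<Rightarrow> bool" where
  "slice_rep M U f \<alpha> \<beta> \<longleftrightarrow> stem_pair U \<alpha> \<beta> \<and> (\<forall>J\<in>imag_units. \<forall>z\<in>U. f (slice_pt J z) = \<alpha> z + M J (\<beta> z))"

definition Dbar :: "(quat \<Rightarrow> quat \<Rightarrow> quat) \<Rightarrow> (quat \<Rightarrow> quat) \<Rightarrow> quat \<Rightarrow> quat" where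
  "Dbar M f q = partial_deriv 1 f q
     - (M e1 (partial_deriv e1 f q) + M e2 (partial_deriv e2 f q) + M e3 (partial_deriv e3 f q))"

lemma Dbar_left_eq: "Dbar_left f q = Dbar (*) f q" and Dbar_right_eq: "Dbar_right f q = Dbar (\<lambda>a b. b * a) f q"
  unfolding Dbar_left_def Dbar_right_def Dbar_def by (rule refl)+

lemma slice_repD:
  assumes "slice_rep M U f \<alpha> \<beta>"
  shows "stem_pair U \<alpha> \<beta>" "\<And>J z. J \<in> imag_units \<Longrightarrow> z \<in> U \<Longrightarrow> f (slice_pt J z) = \<alpha> z + M J (\<beta> z)"
  using assms unfolding slice_rep_def by simp_all

lemma slice_rep_mono: "slice_rep M U f \<alpha> \<beta> \<Longrightarrow> U' \<subseteq> U \<Longrightarrow> slice_rep M U' f \<alpha> \<beta>"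
  unfolding slice_rep_def stem_pair_def by blast

text \<open>\<open>L\<close> will be multiplication by the constant \<open>a\<close> on the side
  opposite to the imaginary unit. It commutes with \<open>M J\<close> and therefore acts on the stem
  functions.\<close>

lemma slice_rep_combination:
  assumes f: "slice_rep M U f \<alpha> \<beta>" and g: "slice_rep M U g \<gamma> \<delta>" and L: "bounded_linear L"
    and LM: "\<And>J x. L (M J x) = M J (L x)" and M: "bounded_bilinear M"
  shows "slice_rep M U (\<lambda>q. L (f q) + g q) (\<lambda>z. L (\<alpha> z) + \<gamma> z) (\<lambda>z. L (\<beta> z) + \<delta> z)"
proof -
  interpret L: bounded_linear L by (rule L)
  interpret M: bounded_bilinear M by (rule M)
  have "stem_pair U (\<lambda>z. L (\<alpha> z) + \<gamma> z) (\<lambda>z. L (\<beta> z) + \<delta> z)"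
    unfolding stem_pair_def
  proof
    fix z assume z: "z \<in> U"
    let ?a = "frechet_derivative \<alpha> (at z)" and ?b = "frechet_derivative \<beta> (at z)"
      and ?c = "frechet_derivative \<gamma> (at z)" and ?d = "frechet_derivative \<delta> (at z)"
    have a: "\<alpha> (cnj z) = \<alpha> z" "\<beta> (cnj z) = - \<beta> z" "?a 1 = ?b \<i>" "?a \<i> = - ?b 1"
      and da: "\<alpha> differentiable (at z)" "\<beta> differentiable (at z)"
      using slice_repD(1)[OF f] z unfolding stem_pair_def by simp_all
    have c: "\<gamma> (cnj z) = \<gamma> z" "\<delta> (cnj z) = - \<delta> z" "?c 1 = ?d \<i>" "?c \<i> = - ?d 1"
      and dc: "\<gamma> differentiable (at z)" "\<delta> differentiable (at z)"
      using slice_repD(1)[OF g] z unfolding stem_pair_def by simp_all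
    note A = has_derivative_add[OF L.has_derivative[OF da(1)[unfolded frechet_derivative_works]] dc(1)[unfolded frechet_derivative_works]]
      and B = has_derivative_add[OF L.has_derivative[OF da(2)[unfolded frechet_derivative_works]] dc(2)[unfolded frechet_derivative_works]]
    have fa: "frechet_derivative (\<lambda>z. L (\<alpha> z) + \<gamma> z) (at z) = (\<lambda>v. L (?a v) + ?c v)"
      and fb: "frechet_derivative (\<lambda>z. L (\<beta> z) + \<delta> z) (at z) = (\<lambda>v. L (?b v) + ?d v)"
      using frechet_derivative_at[OF A] frechet_derivative_at[OF B] by simp_all
    show "L (\<alpha> (cnj z)) + \<gamma> (cnj z) = L (\<alpha> z) + \<gamma> z \<and> L (\<beta> (cnj z)) + \<delta> (cnj z) = - (L (\<beta> z) + \<delta> z) \<and>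
      (\<lambda>z. L (\<alpha> z) + \<gamma> z) differentiable (at z) \<and> (\<lambda>z. L (\<beta> z) + \<delta> z) differentiable (at z) \<and>
      frechet_derivative (\<lambda>z. L (\<alpha> z) + \<gamma> z) (at z) 1 = frechet_derivative (\<lambda>z. L (\<beta> z) + \<delta> z) (at z) \<i> \<and>
      frechet_derivative (\<lambda>z. L (\<alpha> z) + \<gamma> z) (at z) \<i> = - frechet_derivative (\<lambda>z. L (\<beta> z) + \<delta> z) (at z) 1"
    proof (intro conjI)
      show "(\<lambda>z. L (\<alpha> z) + \<gamma> z) differentiable (at z)" unfolding differentiable_def by (rule exI, rule A)
      show "(\<lambda>z. L (\<beta> z) + \<delta> z) differentiable (at z)" unfolding differentiable_def by (rule exI, rule B)
    qed (simp_all only: fa fb a c L.neg minus_add_distrib)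
  qed
  moreover have "L (f (slice_pt J z)) + g (slice_pt J z) = L (\<alpha> z) + \<gamma> z + M J (L (\<beta> z) + \<delta> z)"
    if "J \<in> imag_units" "z \<in> U" for J z
    unfolding slice_repD(2)[OF f that] slice_repD(2)[OF g that] by (simp add: L.add LM M.add_right)
  ultimately show ?thesis unfolding slice_rep_def by simp
qed

lemma Dbar_combination:
  assumes f: "slice_rep M U f \<alpha> \<beta>" and g: "slice_rep M U g \<gamma> \<delta>" and L: "bounded_linear L"
    and LM: "\<And>J x. L (M J x) = M J (L x)" and M: "bounded_bilinear M"
    and U: "open U" "cnj ` U \<subseteq> U" and J: "J \<in> imag_units" "z \<in> U"
  shows "Dbar M (\<lambda>q. L (f q) + g q) (slice_pt J z) = L (Dbar M f (slice_pt J z)) + Dbar M g (slice_pt J z)"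
proof -
  interpret L: bounded_linear L by (rule L)
  interpret M: bounded_bilinear M by (rule M)
  have pd: "partial_deriv e (\<lambda>q. L (f q) + g q) (slice_pt J z) =
      L (partial_deriv e f (slice_pt J z)) + partial_deriv e g (slice_pt J z)" if e: "e = 1 \<or> e \<in> imag_units" for e
  proof -
    have "((\<lambda>t. f (slice_pt J z + t *\<^sub>R e)) has_vector_derivative partial_deriv e f (slice_pt J z)) (at 0)"
      using slice_function_directional[OF M slice_repD(2)[OF f] U slice_repD(1)[OF f] J e]
      unfolding partial_deriv_def vector_derivative_works .
    moreover have "((\<lambda>t. g (slice_pt J z + t *\<^sub>R e)) has_vector_derivative partial_deriv e g (slice_pt J z)) (at 0)"
      using slice_function_directional[OF M slice_repD(2)[OF g] U slice_repD(1)[OF g] J e]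
      unfolding partial_deriv_def vector_derivative_works .
    ultimately have "((\<lambda>t. L (f (slice_pt J z + t *\<^sub>R e)) + g (slice_pt J z + t *\<^sub>R e)) has_vector_derivative
        L (partial_deriv e f (slice_pt J z)) + partial_deriv e g (slice_pt J z)) (at 0)"
      by (intro has_vector_derivative_add L.has_vector_derivative)
    then show ?thesis unfolding partial_deriv_def[of e "\<lambda>q. L (f q) + g q"] by (rule vector_derivative_at)
  qed
  have pd': "partial_deriv 1 (\<lambda>q. L (f q) + g q) (slice_pt J z) =
      L (partial_deriv 1 f (slice_pt J z)) + partial_deriv 1 g (slice_pt J z)"
    "partial_deriv e1 (\<lambda>q. L (f q) + g q) (slice_pt J z) =
      L (partial_deriv e1 f (slice_pt J z)) + partial_deriv e1 g (slice_pt J z)"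
    "partial_deriv e2 (\<lambda>q. L (f q) + g q) (slice_pt J z) =
      L (partial_deriv e2 f (slice_pt J z)) + partial_deriv e2 g (slice_pt J z)"
    "partial_deriv e3 (\<lambda>q. L (f q) + g q) (slice_pt J z) =
      L (partial_deriv e3 f (slice_pt J z)) + partial_deriv e3 g (slice_pt J z)"
    by (rule pd, simp)+
  show ?thesis unfolding Dbar_def pd' by (simp add: L.diff L.add LM M.add_right)
qed

lemma slice_rep_locally_constant:
  assumes M: "bounded_bilinear M" and sq: "\<And>J x. J \<in> imag_units \<Longrightarrow> M J (M J x) = - x"
    and U: "open U" "cnj ` U \<subseteq> U" and f: "slice_rep M U f \<alpha> \<beta>"
    and zero: "\<And>z. z \<in> U \<Longrightarrow> Dbar M f (slice_pt e1 z) = 0"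
  shows "z \<in> U \<Longrightarrow> (stem_comp b \<alpha> \<beta> has_field_derivative 0) (at z)"
    "z \<in> U \<Longrightarrow> stem_comp b \<alpha> \<beta> (cnj z) = stem_comp b \<alpha> \<beta> z"
proof -
  interpret M: bounded_bilinear M by (rule M)
  have inj: "x = 0" if "M e1 x = 0" for x
    using sq[of e1 x] unfolding that M.zero_right by simp
  have eq: "frechet_derivative \<alpha> (at z) 1 + M e1 (frechet_derivative \<beta> (at z) 1) + (1 / Im z) *\<^sub>R \<beta> z = 0"
    (is "?a + M e1 ?b + ?c = 0") if z: "z \<in> U" "Im z \<noteq> 0" for z
  proof -
    note pd = partial_derivs_at_slice_point[OF M slice_repD(2)[OF f] U(1) z(1) slice_repD(1)[OF f] z(2)]
    have pd1: "partial_deriv 1 f (slice_pt e1 z) = ?a + M e1 ?b" by (rule pd(1))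
    have pd2: "partial_deriv e1 f (slice_pt e1 z) = - ?b + M e1 ?a" by (rule pd(2))
    have pd3: "partial_deriv e f (slice_pt e1 z) = (1 / Im z) *\<^sub>R M e (\<beta> z)" if "e \<in> {e2, e3}" for e
      by (rule pd(3); (assumption | rule that))
    note pd23 = pd3[of e2, OF insertI1] pd3[of e3, OF insertI2[OF singletonI]]
    have "0 = Dbar M f (slice_pt e1 z)" by (rule zero[OF z(1), symmetric])
    \<comment> \<open>Each \<open>M e\<close> squares to - 1. The directions 1 and \<open>e1\<close>
      produce the first two terms twice, and \<open>e2\<close> and \<open>e3\<close> produce the
      third one each.\<close>
    also have "\<dots> = 2 *\<^sub>R (?a + M e1 ?b + ?c)"
      unfolding Dbar_def pd1 pd2 pd23 M.add_right M.minus_right M.scaleR_right sq[OF e_imag_units(1)] sq[OF e_imag_units(2)] sq[OF e_imag_units(3)]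
      by (simp add: scaleR_2)
    finally show ?thesis by simp
  qed
  show "z \<in> U \<Longrightarrow> (stem_comp b \<alpha> \<beta> has_field_derivative 0) (at z)"
    by (rule stem_locally_constant(1)[OF M inj U slice_repD(1)[OF f] eq])
  show "z \<in> U \<Longrightarrow> stem_comp b \<alpha> \<beta> (cnj z) = stem_comp b \<alpha> \<beta> z"
    by (rule stem_locally_constant(2)[OF M inj U slice_repD(1)[OF f] eq])
qed

lemma quat_expand: "(\<Sum>b\<in>{1, e1, e2, e3}. inner q b *\<^sub>R b) = q"
proof -
  have "distinct [1, e1, e2, e3]" by (simp add: one_quat_def e1_def e2_def e3_def)
  then have "(\<Sum>b\<in>{1, e1, e2, e3}. inner q b *\<^sub>R b) = inner q 1 *\<^sub>R 1 + inner q e1 *\<^sub>R e1 + inner q e2 *\<^sub>R e2 + inner q e3 *\<^sub>R e3"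
    by (simp add: add.assoc)
  also have "\<dots> = q"
    by (simp add: quat_eq_iff plus_quat_def scaleR_quat_def inner_quat_def one_quat_def e1_def e2_def e3_def)
  finally show ?thesis .
qed

lemma stem_expand:
  "(\<Sum>b\<in>{1, e1, e2, e3}. slice_pt J (stem_comp b \<alpha> \<beta> z) * b) = \<alpha> z + J * \<beta> z"
  "(\<Sum>b\<in>{1, e1, e2, e3}. b * slice_pt J (stem_comp b \<alpha> \<beta> z)) = \<alpha> z + \<beta> z * J"
proof -
  have "slice_pt J (stem_comp b \<alpha> \<beta> z) * b = inner (\<alpha> z) b *\<^sub>R b + J * (inner (\<beta> z) b *\<^sub>R b)"
    "b * slice_pt J (stem_comp b \<alpha> \<beta> z) = inner (\<alpha> z) b *\<^sub>R b + (inner (\<beta> z) b *\<^sub>R b) * J" for b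
    by (simp_all add: slice_pt_def stem_comp_def of_real_def distrib_left distrib_right)
  then show "(\<Sum>b\<in>{1, e1, e2, e3}. slice_pt J (stem_comp b \<alpha> \<beta> z) * b) = \<alpha> z + J * \<beta> z"
    "(\<Sum>b\<in>{1, e1, e2, e3}. b * slice_pt J (stem_comp b \<alpha> \<beta> z)) = \<alpha> z + \<beta> z * J"
    by (simp_all only: sum.distrib sum_distrib_left[symmetric] sum_distrib_right[symmetric] quat_expand)
qed

lemma open_slice: "open W \<Longrightarrow> open (slice J W)"
proof -
  assume "open W"
  then have "open (slice_pt J -` W)"
    unfolding slice_pt_def[abs_def] of_real_def by (intro open_vimage continuous_intros)
  then show ?thesis by (simp add: slice_def vimage_def)
qed

lemma closure_slice_subset: "closure (slice J W) \<subseteq> slice J (closure W)"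
proof (rule closure_minimal)
  have "closed (slice_pt J -` closure W)"
    unfolding slice_pt_def[abs_def] of_real_def by (intro closed_vimage continuous_intros closed_closure)
  then show "closed (slice J (closure W))" by (simp add: slice_def vimage_def)
  show "slice J W \<subseteq> slice J (closure W)" using closure_subset by (auto simp: slice_def)
qed

lemma cnj_slice: 
  assumes "axially_symmetric W" "J \<in> imag_units"
  shows "cnj ` slice J W \<subseteq> slice J W"
proof -
  have "slice (- J) W = slice J W" using assms by (intro axially_symmetric_slice) simp_all
  then have eq: "z \<in> slice (- J) W" if "z \<in> slice J W" for z using that by (simp only:)
  show ?thesis
  proof (rule image_subsetI)
    fix z assume "z \<in> slice J W"
    then show "cnj z \<in> slice J W" using eq[of z] unfolding slice_def mem_Collect_eq slice_pt_cnj by blast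
  qed
qed

text \<open>\<open>G\<close> and \<open>H\<close> will be the integrands with the kernels
  \<open>h1\<close> and \<open>h2\<close>, and \<open>P b\<close>, \<open>Q b\<close> the
  compositions with \<open>V\<close> and \<open>Lm b\<close> that are constant along the
  contour.\<close>

lemma sum_integral_combination:
  fixes k :: "'c \<Rightarrow> real \<Rightarrow> 'b::banach"
  assumes fin: "finite B" 
    and G: "\<And>b \<gamma>. \<gamma> \<in> \<Gamma> \<Longrightarrow> G b \<gamma> integrable_on {0..1}" "\<And>b \<gamma>. \<gamma> \<in> \<Gamma> \<Longrightarrow> H b \<gamma> integrable_on {0..1}"
    and lin: "\<And>b. bounded_linear (P b)" "\<And>b. bounded_linear (Q b)"
    and eq: "\<And>\<gamma> t. \<gamma> \<in> \<Gamma> \<Longrightarrow> t \<in> {0..1} \<Longrightarrow> (\<Sum>b\<in>B. P b (G b \<gamma> t) + Q b (H b \<gamma> t)) = k \<gamma> t"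
  shows "\<gamma> \<in> \<Gamma> \<Longrightarrow> k \<gamma> integrable_on {0..1}"
    "(\<Sum>\<gamma>\<in>\<Gamma>. integral {0..1} (k \<gamma>)) =
      (\<Sum>b\<in>B. P b (\<Sum>\<gamma>\<in>\<Gamma>. integral {0..1} (G b \<gamma>)) + Q b (\<Sum>\<gamma>\<in>\<Gamma>. integral {0..1} (H b \<gamma>)))"
proof -
  have k: "(k \<gamma> has_integral (\<Sum>b\<in>B. P b (integral {0..1} (G b \<gamma>)) + Q b (integral {0..1} (H b \<gamma>)))) {0..1}"
    if \<gamma>: "\<gamma> \<in> \<Gamma>" for \<gamma>
  proof (rule has_integral_eq[OF eq[OF \<gamma>]])
    show "((\<lambda>t. \<Sum>b\<in>B. P b (G b \<gamma> t) + Q b (H b \<gamma> t)) has_integral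
        (\<Sum>b\<in>B. P b (integral {0..1} (G b \<gamma>)) + Q b (integral {0..1} (H b \<gamma>)))) {0..1}"
      by (intro has_integral_sum[OF fin] has_integral_add
        has_integral_linear[OF integrable_integral[OF G(1)[OF \<gamma>]] lin(1), unfolded o_def]
        has_integral_linear[OF integrable_integral[OF G(2)[OF \<gamma>]] lin(2), unfolded o_def])
  qed
  show "\<gamma> \<in> \<Gamma> \<Longrightarrow> k \<gamma> integrable_on {0..1}" using k by (rule has_integral_integrable)
  have "(\<Sum>\<gamma>\<in>\<Gamma>. integral {0..1} (k \<gamma>)) =
      (\<Sum>\<gamma>\<in>\<Gamma>. \<Sum>b\<in>B. P b (integral {0..1} (G b \<gamma>)) + Q b (integral {0..1} (H b \<gamma>)))"
    by (rule sum.cong[OF refl], rule integral_unique, rule k)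
  also have "\<dots> = (\<Sum>b\<in>B. \<Sum>\<gamma>\<in>\<Gamma>. P b (integral {0..1} (G b \<gamma>)) + Q b (integral {0..1} (H b \<gamma>)))" by (rule sum.swap)
  also have "\<dots> = (\<Sum>b\<in>B. P b (\<Sum>\<gamma>\<in>\<Gamma>. integral {0..1} (G b \<gamma>)) + Q b (\<Sum>\<gamma>\<in>\<Gamma>. integral {0..1} (H b \<gamma>)))"
    unfolding sum.distrib linear_sum[OF bounded_linear.linear[OF lin(1)]] linear_sum[OF bounded_linear.linear[OF lin(2)]] ..
  finally show "(\<Sum>\<gamma>\<in>\<Gamma>. integral {0..1} (k \<gamma>)) =
      (\<Sum>b\<in>B. P b (\<Sum>\<gamma>\<in>\<Gamma>. integral {0..1} (G b \<gamma>)) + Q b (\<Sum>\<gamma>\<in>\<Gamma>. integral {0..1} (H b \<gamma>)))" .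
qed

section \<open>Reduction of both calculi to slice integrals of intrinsic functions\<close>

section \<open>The kernels of the functional calculus\<close>

lemma Lm_sum: "Lm (sum g B) = (\<Sum>b\<in>B. Lm (g b) :: 'a::real_normed_vector qmod \<Rightarrow>\<^sub>L 'a qmod)"
  by (rule linear_sum[OF bounded_linear.linear[OF bounded_linear_Lm]])

lemma ds_J_eq: "J \<in> imag_units \<Longrightarrow> ds_J J \<gamma> t = slice_pt J (- \<i> * vector_derivative \<gamma> (at t within {0..1}))"
proof -
  assume J: "J \<in> imag_units"
  have "- \<i> * w = - (w * \<i>)" for w :: complex by (simp add: mult.commute)
  then show ?thesis unfolding ds_J_def by (simp only: slice_pt_minus slice_pt_mult[OF J] slice_pt_i mult_minus_right)
qed

context slice_triple
begin

text \<open>The squared inverse of \<open>Qc\<close> commutes with s and t0, so multiplying by - s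
  and adding the product with t0 amounts to a factor t0 - s, whose sign cancels that of - 4. The
  vector part \<open>V\<close> does not commute with s and stays outside, on the left or on the
  right of \<open>h1\<close> according to the side of the kernel.\<close>

lemma P2_kernels:
  assumes z: "z \<notin> K"
  shows "P2_kernel_L (slice_pt J z) T = 4 *\<^sub>R (h2 (slice_pt J z) + (V o\<^sub>L h1 (slice_pt J z)))"
    "P2_kernel_R (slice_pt J z) T = 4 *\<^sub>R (h2 (slice_pt J z) + (h1 (slice_pt J z) o\<^sub>L V))"
proof -
  define S where "S = sop z"
  define P where "P = y z o\<^sub>L y z"
  have c0: "lift_op (comp0 T) = t0" unfolding T_def comp_quat_op t0_def ..
  have PS: "P o\<^sub>L S = S o\<^sub>L P" and Pt: "P o\<^sub>L t0 = t0 o\<^sub>L P"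
    unfolding P_def S_def by (simp_all only: oL_assoc y_comm(1)[OF z, symmetric] y_comm(1)[OF z, THEN comm_left, symmetric]
      y_comm(3)[OF z, symmetric] y_comm(3)[OF z, THEN comm_left, symmetric])
  have tS: "t0 o\<^sub>L S = S o\<^sub>L t0" unfolding S_def by (rule t_Lm)
  have FL: "F_L (slice_pt J z) T = (-4) *\<^sub>R ((S - (t0 - V)) o\<^sub>L P)"
    and FR: "F_R (slice_pt J z) T = (-4) *\<^sub>R (P o\<^sub>L (S - (t0 - V)))"
    unfolding F_L_def F_R_def conj_T S_def P_def Y_def by (rule refl)+
  have H: "h1 (slice_pt J z) = (S - t0) o\<^sub>L P" "h2 (slice_pt J z) = (S - t0) o\<^sub>L ((S - t0) o\<^sub>L P)"
    unfolding h2_def h1_def S_def P_def by (rule refl)+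
  note rules = oL_ring PS PS[THEN comm_left] Pt Pt[THEN comm_left] tS tS[THEN comm_left] V_t0 V_t0[THEN comm_left]
  have L: "(((S - (t0 - V)) o\<^sub>L P) o\<^sub>L S) - (t0 o\<^sub>L ((S - (t0 - V)) o\<^sub>L P)) =
      ((S - t0) o\<^sub>L ((S - t0) o\<^sub>L P)) + (V o\<^sub>L ((S - t0) o\<^sub>L P))"
    by (simp add: rules)
  have R: "(S o\<^sub>L (P o\<^sub>L (S - (t0 - V)))) - (t0 o\<^sub>L (P o\<^sub>L (S - (t0 - V)))) =
      ((S - t0) o\<^sub>L ((S - t0) o\<^sub>L P)) + (((S - t0) o\<^sub>L P) o\<^sub>L V)"
    by (simp add: rules)
  show "P2_kernel_L (slice_pt J z) T = 4 *\<^sub>R (h2 (slice_pt J z) + (V o\<^sub>L h1 (slice_pt J z)))"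
    unfolding P2_kernel_L_def c0 FL H L[symmetric] S_def[symmetric] by (simp add: oL.scaleR_left oL.scaleR_right oL.minus_left oL.minus_right scaleR_diff_right)
  show "P2_kernel_R (slice_pt J z) T = 4 *\<^sub>R (h2 (slice_pt J z) + (h1 (slice_pt J z) o\<^sub>L V))"
    unfolding P2_kernel_R_def c0 FR H R[symmetric] S_def[symmetric] by (simp add: oL.scaleR_left oL.scaleR_right oL.minus_left oL.minus_right scaleR_diff_right)
qed

lemma slice_kernel_commute:
  assumes h: "slice_kernel h" and z: "z \<notin> K"
  shows "h (slice_pt J z) o\<^sub>L Lm (slice_pt J c) = Lm (slice_pt J c) o\<^sub>L h (slice_pt J z)"
proof -
  have "slice_pt J c * slice_pt J z = slice_pt J z * slice_pt J c"
    unfolding slice_pt_mult[OF J, symmetric] by (simp only: mult.commute)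
  then show ?thesis using h J z unfolding slice_kernel_def by simp
qed

text \<open>The intrinsic components of \<open>f\<close> lie in the slice of \<open>J\<close>; they
  commute with \<open>ds_J\<close> and with \<open>h1\<close> and \<open>h2\<close> and can be moved
  in front of the kernel, while the constants \<open>b\<close> remain on the right.\<close>

lemma P2_integral_L_formula:
  assumes U: "open U" and f: "slice_rep (*) U f \<alpha> \<beta>" and \<Gamma>: "contour U \<Gamma>"
  shows "\<gamma> \<in> \<Gamma> \<Longrightarrow> (\<lambda>t. P2_kernel_L (slice_pt J (\<gamma> t)) T o\<^sub>L Lm (ds_J J \<gamma> t) o\<^sub>L Lm (f (slice_pt J (\<gamma> t)))) integrable_on {0..1}"
    "P2_integral_L T f J \<Gamma> = (1 / (2 * pi)) *\<^sub>R (\<Sum>b\<in>{1, e1, e2, e3}.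
      4 *\<^sub>R ((V o\<^sub>L slice_integral J (stem_comp b \<alpha> \<beta>) h1 \<Gamma>) o\<^sub>L Lm b) +
      4 *\<^sub>R (slice_integral J (stem_comp b \<alpha> \<beta>) h2 \<Gamma> o\<^sub>L Lm b))"
proof -
  define G where "G h b \<gamma> t = Lm (slice_pt J (- \<i> * stem_comp b \<alpha> \<beta> (\<gamma> t) * vector_derivative \<gamma> (at t within {0..1})))
    o\<^sub>L (h (slice_pt J (\<gamma> t)) :: 'a qmod \<Rightarrow>\<^sub>L 'a qmod)" for h b \<gamma> t
  have int: "G h b \<gamma> integrable_on {0..1}" if "slice_kernel h" "\<gamma> \<in> \<Gamma>" for h b \<gamma>
    unfolding G_def by (rule slice_integrand_integrable[OF that(1) stem_comp_holomorphic[OF U slice_repD(1)[OF f]] U \<Gamma> that(2)])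
  let ?k = "\<lambda>\<gamma> t. P2_kernel_L (slice_pt J (\<gamma> t)) T o\<^sub>L Lm (ds_J J \<gamma> t) o\<^sub>L Lm (f (slice_pt J (\<gamma> t)))"
  have eq: "(\<Sum>b\<in>{1, e1, e2, e3}. 4 *\<^sub>R ((V o\<^sub>L G h1 b \<gamma> t) o\<^sub>L Lm b) + 4 *\<^sub>R (G h2 b \<gamma> t o\<^sub>L Lm b)) = ?k \<gamma> t"
    if g: "\<gamma> \<in> \<Gamma>" "t \<in> {0..1}" for \<gamma> t
  proof -
    define z d where "z = \<gamma> t" and "d = vector_derivative \<gamma> (at t within {0..1})"
    have "z \<in> path_image \<gamma>" unfolding path_image_def z_def using g(2) by (rule imageI)
    then have "z \<in> U - K" by (rule subsetD[OF contourD(4)[OF \<Gamma> g(1)]])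
    then have z: "z \<in> U" "z \<notin> K" by simp_all
    define c where "c b = slice_pt J (- \<i> * stem_comp b \<alpha> \<beta> z * d)" for b
    have "slice_pt J (- \<i> * d) * (slice_pt J (stem_comp b \<alpha> \<beta> z) * b) = c b * b" for b
      unfolding c_def mult.assoc[symmetric] slice_pt_mult[OF J, symmetric] by (simp add: mult_ac)
    then have e: "ds_J J \<gamma> t * f (slice_pt J z) = (\<Sum>b\<in>{1, e1, e2, e3}. c b * b)"
      unfolding ds_J_eq[OF J] d_def[symmetric] slice_repD(2)[OF f J z(1)] stem_expand(1)[symmetric] sum_distrib_left by simp
    have "?k \<gamma> t = (\<Sum>b\<in>{1, e1, e2, e3}. P2_kernel_L (slice_pt J z) T o\<^sub>L (Lm (c b) o\<^sub>L Lm b))"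
      unfolding z_def[symmetric] oL_assoc Lm_mult[symmetric] e Lm_sum oL.sum_right ..
    also have "\<dots> = (\<Sum>b\<in>{1, e1, e2, e3}. 4 *\<^sub>R ((V o\<^sub>L G h1 b \<gamma> t) o\<^sub>L Lm b) + 4 *\<^sub>R (G h2 b \<gamma> t o\<^sub>L Lm b))"
    proof (rule sum.cong[OF refl])
      fix b
      have cm: "h (slice_pt J z) o\<^sub>L (Lm (c b) o\<^sub>L Lm b) = Lm (c b) o\<^sub>L (h (slice_pt J z) o\<^sub>L Lm b)" if "slice_kernel h" for h
        unfolding c_def oL_assoc[symmetric] slice_kernel_commute[OF that z(2)] ..
      show "P2_kernel_L (slice_pt J z) T o\<^sub>L (Lm (c b) o\<^sub>L Lm b) =
          4 *\<^sub>R ((V o\<^sub>L G h1 b \<gamma> t) o\<^sub>L Lm b) + 4 *\<^sub>R (G h2 b \<gamma> t o\<^sub>L Lm b)"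
        unfolding G_def z_def[symmetric] d_def[symmetric] c_def[symmetric] P2_kernels(1)[OF z(2)]
          oL.scaleR_left oL.add_left oL_assoc cm[OF slice_kernel_h(1)] cm[OF slice_kernel_h(2)] scaleR_add_right
        by (rule add.commute)
    qed
    finally show ?thesis ..
  qed
  have lin: "bounded_linear (\<lambda>A. 4 *\<^sub>R ((V o\<^sub>L A) o\<^sub>L Lm b))" "bounded_linear (\<lambda>A. 4 *\<^sub>R ((A :: 'a qmod \<Rightarrow>\<^sub>L 'a qmod) o\<^sub>L Lm b))" for b
    by (rule bounded_linear_const_scaleR, rule bounded_linear_compose[OF oL.bounded_linear_left oL.bounded_linear_right],
      rule bounded_linear_const_scaleR, rule oL.bounded_linear_left)
  note c = sum_integral_combination[of "{1, e1, e2, e3}" \<Gamma> "G h1" "G h2" "\<lambda>b A. 4 *\<^sub>R ((V o\<^sub>L A) o\<^sub>L Lm b)" "\<lambda>b A. 4 *\<^sub>R (A o\<^sub>L Lm b)" ?k,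
    OF _ int[OF slice_kernel_h(1)] int[OF slice_kernel_h(2)] lin eq]
  show "\<gamma> \<in> \<Gamma> \<Longrightarrow> ?k \<gamma> integrable_on {0..1}" by (rule c(1)) simp
  have S: "slice_integral J (stem_comp b \<alpha> \<beta>) h \<Gamma> = (\<Sum>\<gamma>\<in>\<Gamma>. integral {0..1} (G h b \<gamma>))" for h b
    unfolding slice_integral_def G_def ..
  have C: "(\<Sum>\<gamma>\<in>\<Gamma>. integral {0..1} (?k \<gamma>)) = (\<Sum>b\<in>{1, e1, e2, e3}. 4 *\<^sub>R ((V o\<^sub>L slice_integral J (stem_comp b \<alpha> \<beta>) h1 \<Gamma>) o\<^sub>L Lm b) +
      4 *\<^sub>R (slice_integral J (stem_comp b \<alpha> \<beta>) h2 \<Gamma> o\<^sub>L Lm b))"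
    unfolding S by (rule c(2)) simp
  show "P2_integral_L T f J \<Gamma> = (1 / (2 * pi)) *\<^sub>R (\<Sum>b\<in>{1, e1, e2, e3}.
      4 *\<^sub>R ((V o\<^sub>L slice_integral J (stem_comp b \<alpha> \<beta>) h1 \<Gamma>) o\<^sub>L Lm b) +
      4 *\<^sub>R (slice_integral J (stem_comp b \<alpha> \<beta>) h2 \<Gamma> o\<^sub>L Lm b))"
    unfolding P2_integral_L_def C ..
qed

text \<open>Here the constants \<open>b\<close> stand on the left and \<open>V\<close> on the right,
  so the components are already in front of the kernel and only have to be exchanged with
  \<open>ds_J\<close>.\<close>

lemma P2_integral_R_formula:
  assumes U: "open U" and f: "slice_rep (\<lambda>a b. b * a) U f \<alpha> \<beta>" and \<Gamma>: "contour U \<Gamma>"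
  shows "\<gamma> \<in> \<Gamma> \<Longrightarrow> (\<lambda>t. Lm (f (slice_pt J (\<gamma> t))) o\<^sub>L Lm (ds_J J \<gamma> t) o\<^sub>L P2_kernel_R (slice_pt J (\<gamma> t)) T) integrable_on {0..1}"
    "P2_integral_R T f J \<Gamma> = (1 / (2 * pi)) *\<^sub>R (\<Sum>b\<in>{1, e1, e2, e3}.
      4 *\<^sub>R (Lm b o\<^sub>L (slice_integral J (stem_comp b \<alpha> \<beta>) h1 \<Gamma> o\<^sub>L V)) +
      4 *\<^sub>R (Lm b o\<^sub>L slice_integral J (stem_comp b \<alpha> \<beta>) h2 \<Gamma>))"
proof -
  define G where "G h b \<gamma> t = Lm (slice_pt J (- \<i> * stem_comp b \<alpha> \<beta> (\<gamma> t) * vector_derivative \<gamma> (at t within {0..1})))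
    o\<^sub>L (h (slice_pt J (\<gamma> t)) :: 'a qmod \<Rightarrow>\<^sub>L 'a qmod)" for h b \<gamma> t
  have int: "G h b \<gamma> integrable_on {0..1}" if "slice_kernel h" "\<gamma> \<in> \<Gamma>" for h b \<gamma>
    unfolding G_def by (rule slice_integrand_integrable[OF that(1) stem_comp_holomorphic[OF U slice_repD(1)[OF f]] U \<Gamma> that(2)])
  let ?k = "\<lambda>\<gamma> t. Lm (f (slice_pt J (\<gamma> t))) o\<^sub>L Lm (ds_J J \<gamma> t) o\<^sub>L P2_kernel_R (slice_pt J (\<gamma> t)) T"
  have eq: "(\<Sum>b\<in>{1, e1, e2, e3}. 4 *\<^sub>R (Lm b o\<^sub>L (G h1 b \<gamma> t o\<^sub>L V)) + 4 *\<^sub>R (Lm b o\<^sub>L G h2 b \<gamma> t)) = ?k \<gamma> t"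
    if g: "\<gamma> \<in> \<Gamma>" "t \<in> {0..1}" for \<gamma> t
  proof -
    define z d where "z = \<gamma> t" and "d = vector_derivative \<gamma> (at t within {0..1})"
    have "z \<in> path_image \<gamma>" unfolding path_image_def z_def using g(2) by (rule imageI)
    then have "z \<in> U - K" by (rule subsetD[OF contourD(4)[OF \<Gamma> g(1)]])
    then have z: "z \<in> U" "z \<notin> K" by simp_all
    define c where "c b = slice_pt J (- \<i> * stem_comp b \<alpha> \<beta> z * d)" for b
    have "(b * slice_pt J (stem_comp b \<alpha> \<beta> z)) * slice_pt J (- \<i> * d) = b * c b" for b
      unfolding c_def mult.assoc slice_pt_mult[OF J, symmetric] by (simp add: mult_ac)
    then have e: "f (slice_pt J z) * ds_J J \<gamma> t = (\<Sum>b\<in>{1, e1, e2, e3}. b * c b)"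
      unfolding ds_J_eq[OF J] d_def[symmetric] slice_repD(2)[OF f J z(1)] stem_expand(2)[symmetric] sum_distrib_right by simp
    have "?k \<gamma> t = (\<Sum>b\<in>{1, e1, e2, e3}. (Lm b o\<^sub>L Lm (c b)) o\<^sub>L P2_kernel_R (slice_pt J z) T)"
      unfolding z_def[symmetric] Lm_mult[symmetric] e Lm_sum oL.sum_left ..
    also have "\<dots> = (\<Sum>b\<in>{1, e1, e2, e3}. 4 *\<^sub>R (Lm b o\<^sub>L (G h1 b \<gamma> t o\<^sub>L V)) + 4 *\<^sub>R (Lm b o\<^sub>L G h2 b \<gamma> t))"
    proof (rule sum.cong[OF refl])
      fix b
      show "(Lm b o\<^sub>L Lm (c b)) o\<^sub>L P2_kernel_R (slice_pt J z) T =
          4 *\<^sub>R (Lm b o\<^sub>L (G h1 b \<gamma> t o\<^sub>L V)) + 4 *\<^sub>R (Lm b o\<^sub>L G h2 b \<gamma> t)"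
        unfolding G_def z_def[symmetric] d_def[symmetric] c_def[symmetric] P2_kernels(2)[OF z(2)]
          oL.scaleR_right oL.add_right oL_assoc scaleR_add_right
        by (rule add.commute)
    qed
    finally show ?thesis ..
  qed
  have lin: "bounded_linear (\<lambda>A. 4 *\<^sub>R (Lm b o\<^sub>L (A o\<^sub>L V)))" "bounded_linear (\<lambda>A :: 'a qmod \<Rightarrow>\<^sub>L 'a qmod. 4 *\<^sub>R (Lm b o\<^sub>L A))" for b
    by (rule bounded_linear_const_scaleR, rule bounded_linear_compose[OF oL.bounded_linear_right oL.bounded_linear_left],
      rule bounded_linear_const_scaleR, rule oL.bounded_linear_right)
  note c = sum_integral_combination[of "{1, e1, e2, e3}" \<Gamma> "G h1" "G h2" "\<lambda>b A. 4 *\<^sub>R (Lm b o\<^sub>L (A o\<^sub>L V))" "\<lambda>b A. 4 *\<^sub>R (Lm b o\<^sub>L A)" ?k,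
    OF _ int[OF slice_kernel_h(1)] int[OF slice_kernel_h(2)] lin eq]
  show "\<gamma> \<in> \<Gamma> \<Longrightarrow> ?k \<gamma> integrable_on {0..1}" by (rule c(1)) simp
  have S: "slice_integral J (stem_comp b \<alpha> \<beta>) h \<Gamma> = (\<Sum>\<gamma>\<in>\<Gamma>. integral {0..1} (G h b \<gamma>))" for h b
    unfolding slice_integral_def G_def ..
  have C: "(\<Sum>\<gamma>\<in>\<Gamma>. integral {0..1} (?k \<gamma>)) = (\<Sum>b\<in>{1, e1, e2, e3}. 4 *\<^sub>R (Lm b o\<^sub>L (slice_integral J (stem_comp b \<alpha> \<beta>) h1 \<Gamma> o\<^sub>L V)) +
      4 *\<^sub>R (Lm b o\<^sub>L slice_integral J (stem_comp b \<alpha> \<beta>) h2 \<Gamma>))"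
    unfolding S by (rule c(2)) simp
  show "P2_integral_R T f J \<Gamma> = (1 / (2 * pi)) *\<^sub>R (\<Sum>b\<in>{1, e1, e2, e3}.
      4 *\<^sub>R (Lm b o\<^sub>L (slice_integral J (stem_comp b \<alpha> \<beta>) h1 \<Gamma> o\<^sub>L V)) +
      4 *\<^sub>R (Lm b o\<^sub>L slice_integral J (stem_comp b \<alpha> \<beta>) h2 \<Gamma>))"
    unfolding P2_integral_R_def C ..
qed

end

section \<open>Existence of admissible domains and their traces in the slices\<close>

section \<open>Admissible domains\<close>

context commuting_triple
begin

lemma K_subset_slice: "S_spectrum T \<subseteq> W \<Longrightarrow> K \<subseteq> slice e1 W"
  unfolding K_def slice_def by auto

text \<open>By axial symmetry the plane trace of \<open>W\<close> is the same in every unit, so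
  boundaries taken in any slice become contours in a single plane set.\<close>

lemma admissible_contour:
  assumes a: "admissible T W Ud" and W: "axially_symmetric W" and J: "J \<in> imag_units" and o: "oriented_boundary (slice J Ud) \<Gamma>"
  shows "contour (slice e1 W) \<Gamma>"
proof -
  have u: "open Ud" "S_spectrum T \<subseteq> Ud" "closure Ud \<subseteq> W" using a unfolding admissible_def slice_cauchy_domain_def by simp_all
  have "K \<subseteq> slice J Ud" unfolding slice_spectrum_eq_K[OF J, symmetric] slice_def using u(2) by auto
  moreover have "closure (slice J Ud) \<subseteq> slice e1 W"
  proof -
    have "slice J (closure Ud) \<subseteq> slice J W" using u(3) unfolding slice_def by auto
    also have "slice J W = slice e1 W" by (rule axially_symmetric_slice[OF W J e_imag_units(1)])
    finally show ?thesis using closure_slice_subset[of J Ud] by (rule subset_trans[rotated])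
  qed
  ultimately show ?thesis unfolding contour_def using open_slice[OF u(1), of J] o by (intro exI[of _ "slice J Ud"] conjI)
qed

text \<open>A plane domain symmetric under conjugation is rotated about the real axis. This shows
  that the description in the functional calculus ranges over a nonempty set of choices, and it
  provides a contour inside the intersection of two domains.\<close>

lemma exists_admissible:
  assumes W: "open W" "axially_symmetric W" "S_spectrum T \<subseteq> W"
  shows "\<exists>Ud \<Gamma>. admissible T W Ud \<and> oriented_boundary (slice e1 Ud) \<Gamma>"
proof -
  obtain D E \<Gamma> where pd: "polygonal_domain (slice e1 W) D E \<Gamma>" and KD: "K \<subseteq> D" and "cnj ` K \<subseteq> K \<longrightarrow> cnj ` D \<subseteq> D"
    using exists_polygonal_domain'[OF compact_K open_slice[OF W(1), of e1] K_subset_slice[OF W(3)]] by (elim exE conjE)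
  then have cD: "cnj ` D \<subseteq> D" using cnj_K by simp
  have D: "open D" "bounded D" "closure D \<subseteq> slice e1 W" "oriented_boundary D \<Gamma>"
    using pd unfolding polygonal_domain_def by simp_all
  have cnj_iff: "cnj z \<in> D \<longleftrightarrow> z \<in> D" for z
  proof
    assume "cnj z \<in> D"
    then have "cnj (cnj z) \<in> cnj ` D" by (rule imageI)
    then show "z \<in> D" using cD by auto
  qed (use cD in auto)
  \<comment> \<open>The slice coordinate of \<open>q\<close> in the closed upper half plane. It is
    continuous, and the rotated domain is the preimage of \<open>D\<close> under it.\<close>
  define c where "c q = Complex (inner q 1) (norm (q - inner q 1 *\<^sub>R 1))" for q :: quat
  have cc: "continuous_on UNIV c" unfolding c_def Complex_eq by (intro continuous_intros)
  have c_slice: "c (slice_pt J z) = z \<or> c (slice_pt J z) = cnj z" if J: "J \<in> imag_units" for J z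
  proof -
    have i: "inner q 1 = qRe q" for q by (simp add: inner_quat_def one_quat_def)
    have nJ: "norm J = 1" using norm_slice_pt[OF J, of \<i>] by simp
    have "c (slice_pt J z) = Complex (Re z) \<bar>Im z\<bar>"
      unfolding c_def i qRe_slice_pt[OF J] by (simp add: slice_pt_def of_real_def nJ)
    then show ?thesis by (auto simp: complex_eq_iff abs_if)
  qed
  define Ud where "Ud = c -` D"
  have mem: "slice_pt J z \<in> Ud \<longleftrightarrow> z \<in> D" if "J \<in> imag_units" for J z
    using c_slice[OF that, of z] cnj_iff[of z] unfolding Ud_def by auto
  have slice_Ud: "slice J Ud = D" if "J \<in> imag_units" for J
    unfolding slice_def mem[OF that] by simp
  have "open Ud" unfolding Ud_def by (rule open_vimage[OF D(1) cc])
  moreover have "axially_symmetric Ud" unfolding axially_symmetric_def by (simp add: mem)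
  moreover have "bounded Ud"
  proof -
    obtain r where r: "\<And>z. z \<in> D \<Longrightarrow> cmod z \<le> r" using D(2) unfolding bounded_iff by auto
    have "norm q \<le> r" if "q \<in> Ud" for q
    proof -
      obtain J z where q: "J \<in> imag_units" "q = slice_pt J z" by (rule quat_slice_cases)
      then have "z \<in> D" using that mem by simp
      then show ?thesis unfolding q(2) norm_slice_pt[OF q(1)] by (rule r)
    qed
    then show ?thesis unfolding bounded_iff by auto
  qed
  moreover have "S_spectrum T \<subseteq> Ud"
  proof
    fix q assume s: "q \<in> S_spectrum T"
    obtain J z where q: "J \<in> imag_units" "q = slice_pt J z" by (rule quat_slice_cases)
    have "z \<in> slice J (S_spectrum T)" using s unfolding q(2) slice_def by simp
    then have "z \<in> D" using KD unfolding slice_spectrum_eq_K[OF q(1)] by auto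
    then show "q \<in> Ud" unfolding q(2) mem[OF q(1)] .
  qed
  moreover have "closure Ud \<subseteq> W"
  proof
    fix q assume s: "q \<in> closure Ud"
    obtain J z where q: "J \<in> imag_units" "q = slice_pt J z" by (rule quat_slice_cases)
    have "closure Ud \<subseteq> c -` closure D"
      using closure_subset[of D] unfolding Ud_def by (intro closure_minimal closed_vimage[OF closed_closure cc]) auto
    then have w: "c q \<in> slice e1 W" using s D(3) by auto
    have "z \<in> slice e1 W"
    proof (cases "c q = z")
      case False
      then have "z = cnj (c q)" using c_slice[OF q(1), of z] unfolding q(2) by auto
      then show ?thesis using cnj_slice[OF W(2) e_imag_units(1)] w by auto
    qed (use w in simp)
    then have "z \<in> slice J W" unfolding axially_symmetric_slice[OF W(2) e_imag_units(1) q(1)] .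
    then show "q \<in> W" unfolding q(2) slice_def by simp
  qed
  moreover have "\<exists>\<Gamma>. jordan_boundary (slice J Ud) \<Gamma>" if "J \<in> imag_units" for J
    using D(4) unfolding slice_Ud[OF that] oriented_boundary_def by auto
  ultimately have "admissible T W Ud" unfolding admissible_def slice_cauchy_domain_def by simp
  moreover have "oriented_boundary (slice e1 Ud) \<Gamma>" unfolding slice_Ud[OF e_imag_units(1)] by (rule D(4))
  ultimately show ?thesis by (intro exI conjI)
qed

end

section \<open>The left calculus: independence of the primitive, domain, unit and contour\<close>

section \<open>Independence of the choices and linearity\<close>

lemma SH_L_rep:
  assumes "(f, W) \<in> SH_L S"
  shows "open W" "axially_symmetric W" "S \<subseteq> W" "\<exists>\<alpha> \<beta>. slice_rep (*) (slice e1 W) f \<alpha> \<beta>"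
proof -
  show W: "open W" "axially_symmetric W" "S \<subseteq> W" using assms unfolding SH_L_def by simp_all
  have "left_slice_hyperholomorphic f W" using assms unfolding SH_L_def by simp
  then obtain \<alpha> \<beta> where "\<forall>J\<in>imag_units. stem_pair (slice J W) \<alpha> \<beta> \<and> (\<forall>z\<in>slice J W. f (slice_pt J z) = \<alpha> z + J * \<beta> z)"
    unfolding left_slice_hyperholomorphic_def by (elim exE)
  note ab = bspec[OF this]
  have sl: "slice J W = slice e1 W" if "J \<in> imag_units" for J
    by (rule axially_symmetric_slice[OF W(2) that e_imag_units(1)])
  have "slice_rep (*) (slice e1 W) f \<alpha> \<beta>"
    unfolding slice_rep_def
  proof (intro conjI ballI)
    show "stem_pair (slice e1 W) \<alpha> \<beta>" using ab[OF e_imag_units(1)] by (rule conjunct1)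
    show "f (slice_pt J z) = \<alpha> z + J * \<beta> z" if "J \<in> imag_units" "z \<in> slice e1 W" for J z
      using ab[OF that(1)] that(2) unfolding sl[OF that(1)] by simp
  qed
  then show "\<exists>\<alpha> \<beta>. slice_rep (*) (slice e1 W) f \<alpha> \<beta>" by (intro exI)
qed

lemma SH_L_I:
  assumes W: "open W" "axially_symmetric W" "S \<subseteq> W" and f: "slice_rep (*) (slice e1 W) f \<alpha> \<beta>"
  shows "(f, W) \<in> SH_L S"
proof -
  have "stem_pair (slice J W) \<alpha> \<beta> \<and> (\<forall>z\<in>slice J W. f (slice_pt J z) = \<alpha> z + J * \<beta> z)" if J: "J \<in> imag_units" for J
    unfolding axially_symmetric_slice[OF W(2) J e_imag_units(1)] using slice_repD[OF f] J by simp
  then have "left_slice_hyperholomorphic f W" unfolding left_slice_hyperholomorphic_def by (intro exI ballI)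
  then show ?thesis unfolding SH_L_def using W by simp
qed

lemma SH_L_combination:
  assumes f: "(f, Wf) \<in> SH_L S" and g: "(g, Wg) \<in> SH_L S"
  shows "(\<lambda>q. f q * a + g q, Wf \<inter> Wg) \<in> SH_L S"
    "q \<in> Wf \<inter> Wg \<Longrightarrow> Dbar_left (\<lambda>q. f q * a + g q) q = Dbar_left f q * a + Dbar_left g q"
proof -
  note F = SH_L_rep[OF f] and G = SH_L_rep[OF g]
  have W: "open (Wf \<inter> Wg)" "axially_symmetric (Wf \<inter> Wg)" "S \<subseteq> Wf \<inter> Wg"
    using F(1-3) G(1-3) unfolding axially_symmetric_def by auto
  have sub: "slice e1 (Wf \<inter> Wg) \<subseteq> slice e1 Wf" "slice e1 (Wf \<inter> Wg) \<subseteq> slice e1 Wg" unfolding slice_def by auto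
  obtain \<alpha> \<beta> \<gamma> \<delta> where "slice_rep (*) (slice e1 Wf) f \<alpha> \<beta>" "slice_rep (*) (slice e1 Wg) g \<gamma> \<delta>"
    using F(4) G(4) by (elim exE)
  note r = this(1)[THEN slice_rep_mono, OF sub(1)] this(2)[THEN slice_rep_mono, OF sub(2)]
  have LM: "(J * x) * a = J * (x * a)" for J x :: quat by (simp add: mult.assoc)
  show "(\<lambda>q. f q * a + g q, Wf \<inter> Wg) \<in> SH_L S"
    by (rule SH_L_I[OF W slice_rep_combination[OF r bounded_linear_mult_left LM bounded_bilinear_mult]])
  show "Dbar_left (\<lambda>q. f q * a + g q) q = Dbar_left f q * a + Dbar_left g q" if q: "q \<in> Wf \<inter> Wg"
  proof -
    obtain J z where J: "J \<in> imag_units" "q = slice_pt J z" by (rule quat_slice_cases)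
    have "z \<in> slice J (Wf \<inter> Wg)" using q unfolding J(2) slice_def by simp
    then have z: "z \<in> slice e1 (Wf \<inter> Wg)" unfolding axially_symmetric_slice[OF W(2) J(1) e_imag_units(1)] .
    show ?thesis unfolding Dbar_left_eq J(2)
      by (rule Dbar_combination[OF r bounded_linear_mult_left LM bounded_bilinear_mult open_slice[OF W(1)] cnj_slice[OF W(2) e_imag_units(1)] J(1) z])
  qed
qed

context commuting_triple
begin

lemma P2_integral_L_independent:
  assumes U: "open U" "K \<subseteq> U" "cnj ` U \<subseteq> U" and f: "slice_rep (*) U f \<alpha> \<beta>"
    and \<Gamma>: "contour U \<Gamma>" "contour U \<Gamma>'" and J: "J \<in> imag_units"
  shows "P2_integral_L T f J \<Gamma> = P2_integral_L T f e1 \<Gamma>'"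
proof -
  interpret e: slice_triple T0 T1 T2 e1 by unfold_locales simp
  interpret s: slice_triple T0 T1 T2 J by unfold_locales fact
  note stem = slice_repD(1)[OF f]
  have ind: "slice_integral J (stem_comp b \<alpha> \<beta>) h \<Gamma> = slice_integral e1 (stem_comp b \<alpha> \<beta>) h \<Gamma>'" if "slice_kernel h" for b h
    by (rule slice_integral_independent[OF that stem_comp_holomorphic[OF U(1) stem] stem_comp_cnj[OF stem] U \<Gamma> J])
  show ?thesis
    unfolding s.P2_integral_L_formula(2)[OF U(1) f \<Gamma>(1)] e.P2_integral_L_formula(2)[OF U(1) f \<Gamma>(2)]
      ind[OF slice_kernel_h(1)] ind[OF slice_kernel_h(2)] ..
qed

lemma P2_integral_L_zero:
  assumes real: "real_spectrum T0" "real_spectrum T1" "real_spectrum T2"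
    and U: "open U" "K \<subseteq> U" "cnj ` U \<subseteq> U" and f: "slice_rep (*) U f \<alpha> \<beta>" and \<Gamma>: "contour U \<Gamma>"
    and zero: "\<And>z. z \<in> U \<Longrightarrow> Dbar (*) f (slice_pt e1 z) = 0"
  shows "P2_integral_L T f e1 \<Gamma> = 0"
proof -
  interpret e: slice_triple T0 T1 T2 e1 by unfold_locales simp
  have sq: "J * (J * x) = - x" if "J \<in> imag_units" for J x :: quat
    using imag_unitsD[OF that] by (simp add: mult.assoc[symmetric])
  have lc1: "(stem_comp b \<alpha> \<beta> has_field_derivative 0) (at z)" if z: "z \<in> U" for b z
    by (rule slice_rep_locally_constant(1)[OF bounded_bilinear_mult sq U(1,3) f zero z])
  have lc2: "stem_comp b \<alpha> \<beta> (cnj z) = stem_comp b \<alpha> \<beta> z" if z: "z \<in> U" for b z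
    by (rule slice_rep_locally_constant(2)[OF bounded_bilinear_mult sq U(1,3) f zero z])
  have z1: "slice_integral e1 (stem_comp b \<alpha> \<beta>) h1 \<Gamma> = 0" for b
    by (rule slice_integral_locally_constant(1)[OF real U(1,2) \<Gamma> lc1 lc2])
  have z2: "slice_integral e1 (stem_comp b \<alpha> \<beta>) h2 \<Gamma> = 0" for b
    by (rule slice_integral_locally_constant(2)[OF real U(1,2) \<Gamma> lc1 lc2])
  show ?thesis unfolding e.P2_integral_L_formula(2)[OF U(1) f \<Gamma>] z1 z2
    by (simp add: oL.zero_left oL.zero_right)
qed

lemma P2_integral_L_combination:
  assumes U: "open U" and f: "slice_rep (*) U f \<alpha> \<beta>" and g: "slice_rep (*) U g \<gamma>' \<delta>"
    and \<Gamma>: "contour U \<Gamma>" and J: "J \<in> imag_units"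
  shows "P2_integral_L T (\<lambda>q. f q * a + g q) J \<Gamma> = (P2_integral_L T f J \<Gamma> o\<^sub>L Lm a) + P2_integral_L T g J \<Gamma>"
proof -
  interpret s: slice_triple T0 T1 T2 J by unfold_locales fact
  define k where "k f \<gamma> t = P2_kernel_L (slice_pt J (\<gamma> t)) T o\<^sub>L Lm (ds_J J \<gamma> t) o\<^sub>L Lm (f (slice_pt J (\<gamma> t)))" for f :: "quat \<Rightarrow> quat" and \<gamma> t
  have P: "P2_integral_L T f J \<Gamma> = (1 / (2 * pi)) *\<^sub>R (\<Sum>\<gamma>\<in>\<Gamma>. integral {0..1} (k f \<gamma>))" for f
    unfolding P2_integral_L_def k_def ..
  have "integral {0..1} (k (\<lambda>q. f q * a + g q) \<gamma>) = (integral {0..1} (k f \<gamma>) o\<^sub>L Lm a) + integral {0..1} (k g \<gamma>)" if \<gamma>: "\<gamma> \<in> \<Gamma>" for \<gamma>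
  proof -
    \<comment> \<open>Integrability is required before splitting, since the integral of a function
      that is not integrable is 0 by convention.\<close>
    have i: "k f \<gamma> integrable_on {0..1}" "k g \<gamma> integrable_on {0..1}"
      unfolding k_def by (rule s.P2_integral_L_formula(1)[OF U f \<Gamma> \<gamma>], rule s.P2_integral_L_formula(1)[OF U g \<Gamma> \<gamma>])
    have "k (\<lambda>q. f q * a + g q) \<gamma> = (\<lambda>t. (k f \<gamma> t o\<^sub>L Lm a) + k g \<gamma> t)"
      unfolding k_def Lm_add Lm_mult oL.add_left oL.add_right oL_assoc ..
    then show ?thesis
      using has_integral_add[OF has_integral_linear[OF integrable_integral[OF i(1)] oL.bounded_linear_left, unfolded o_def] integrable_integral[OF i(2)], of "Lm a"]
      by (simp add: integral_unique)
  qed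
  then have "(\<Sum>\<gamma>\<in>\<Gamma>. integral {0..1} (k (\<lambda>q. f q * a + g q) \<gamma>)) = (\<Sum>\<gamma>\<in>\<Gamma>. (integral {0..1} (k f \<gamma>) o\<^sub>L Lm a) + integral {0..1} (k g \<gamma>))"
    by (rule sum.cong[OF refl])
  then show ?thesis unfolding P by (simp only: sum.distrib oL.sum_left oL.scaleR_left oL.scaleR_right scaleR_add_right)
qed

text \<open>Two primitives differ by a slice hyperholomorphic function with vanishing conjugate
  Cauchy-Fueter derivative, whose integral is 0; for a single primitive every contour and unit give
  the same integral. So the description operator picks the only value there is.\<close>

lemma P2_calc_L_eq:
  assumes real: "real_spectrum T0" "real_spectrum T1" "real_spectrum T2"
    and f: "(f, W) \<in> SH_L (S_spectrum T)" and h: "\<forall>q\<in>W. h q = Dbar_left f q"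
    and a: "admissible T W Ud" and J: "J \<in> imag_units" and o: "oriented_boundary (slice J Ud) \<Gamma>"
  shows "P2_calc_L T W h = P2_integral_L T f J \<Gamma>"
  unfolding P2_calc_L_def
proof (rule the_equality)
  show "\<exists>f' U J' \<Gamma>'. (f', W) \<in> SH_L (S_spectrum T) \<and> (\<forall>q\<in>W. h q = Dbar_left f' q) \<and>
     admissible T W U \<and> J' \<in> imag_units \<and> oriented_boundary (slice J' U) \<Gamma>' \<and> P2_integral_L T f J \<Gamma> = P2_integral_L T f' J' \<Gamma>'"
    by (intro exI conjI, rule f, rule h, rule a, rule J, rule o, rule refl)
next
  fix A assume "\<exists>f' U J' \<Gamma>'. (f', W) \<in> SH_L (S_spectrum T) \<and> (\<forall>q\<in>W. h q = Dbar_left f' q) \<and>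
     admissible T W U \<and> J' \<in> imag_units \<and> oriented_boundary (slice J' U) \<Gamma>' \<and> A = P2_integral_L T f' J' \<Gamma>'"
  then obtain f' U' J' \<Gamma>' where f': "(f', W) \<in> SH_L (S_spectrum T)" and h': "\<forall>q\<in>W. h q = Dbar_left f' q"
    and a': "admissible T W U'" and J': "J' \<in> imag_units" and o': "oriented_boundary (slice J' U') \<Gamma>'"
    and A: "A = P2_integral_L T f' J' \<Gamma>'" by (elim exE conjE)
  note W = SH_L_rep(1-3)[OF f]
  define U where "U = slice e1 W"
  have U: "open U" "K \<subseteq> U" "cnj ` U \<subseteq> U"
    unfolding U_def by (rule open_slice[OF W(1)], rule K_subset_slice[OF W(3)], rule cnj_slice[OF W(2) e_imag_units(1)])
  note c = admissible_contour[OF a W(2) J o, folded U_def] and c' = admissible_contour[OF a' W(2) J' o', folded U_def]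
  obtain \<alpha> \<beta> \<gamma> \<delta> where r: "slice_rep (*) U f \<alpha> \<beta>" and r': "slice_rep (*) U f' \<gamma> \<delta>"
    using SH_L_rep(4)[OF f] SH_L_rep(4)[OF f'] unfolding U_def by (elim exE)
  \<comment> \<open>The difference of the primitives, written with the coefficient - 1 so that the
    lemmas on combinations apply.\<close>
  let ?d = "\<lambda>q. f q * - 1 + f' q"
  note comb = SH_L_combination[OF f f', where a = "- 1", unfolded Int_absorb]
  obtain \<epsilon> \<zeta> where rd: "slice_rep (*) U ?d \<epsilon> \<zeta>"
    using SH_L_rep(4)[OF comb(1)] unfolding U_def by (elim exE)
  have "Dbar (*) ?d (slice_pt e1 z) = 0" if "z \<in> U" for z
  proof -
    have q: "slice_pt e1 z \<in> W" using that unfolding U_def slice_def by simp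
    have "Dbar_left f (slice_pt e1 z) = h (slice_pt e1 z)" "Dbar_left f' (slice_pt e1 z) = h (slice_pt e1 z)"
      using h h' q by simp_all
    then show ?thesis using comb(2)[OF q] unfolding Dbar_left_eq by simp
  qed
  note zero = this
  have "P2_integral_L T ?d e1 \<Gamma> = 0" by (rule P2_integral_L_zero[OF real U rd c zero])
  then have e: "P2_integral_L T f' e1 \<Gamma> = P2_integral_L T f e1 \<Gamma>"
    unfolding P2_integral_L_combination[OF U(1) r r' c e_imag_units(1)] by (simp add: Lm_minus oL.minus_left oL.minus_right Lm_one)
  show "A = P2_integral_L T f J \<Gamma>"
    unfolding A P2_integral_L_independent[OF U r' c' c J'] P2_integral_L_independent[OF U r c c J] by (rule e)
qed

text \<open>A domain admissible for the intersection is admissible for both larger domains, so one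
  contour evaluates all three values of the calculus.\<close>

lemma P2_calc_L_combination:
  assumes real: "real_spectrum T0" "real_spectrum T1" "real_spectrum T2"
    and f: "(f, Wf) \<in> SH_L (S_spectrum T)" and g: "(g, Wg) \<in> SH_L (S_spectrum T)"
    and h: "\<forall>q\<in>Wf. f0 q = Dbar_left f q" "\<forall>q\<in>Wg. g0 q = Dbar_left g q"
  shows "P2_calc_L T (Wf \<inter> Wg) (\<lambda>q. f0 q * a + g0 q) = (P2_calc_L T Wf f0 o\<^sub>L Lm a) + P2_calc_L T Wg g0"
proof -
  note comb = SH_L_combination[OF f g, where a = a]
  note W = SH_L_rep(1-3)[OF comb(1)]
  obtain Ud \<Gamma> where a: "admissible T (Wf \<inter> Wg) Ud" and o: "oriented_boundary (slice e1 Ud) \<Gamma>"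
    using exists_admissible[OF W] by (elim exE conjE)
  have af: "admissible T Wf Ud" "admissible T Wg Ud" using a unfolding admissible_def by simp_all
  have hc: "\<forall>q\<in>Wf \<inter> Wg. f0 q * a + g0 q = Dbar_left (\<lambda>q. f q * a + g q) q"
  proof
    fix q assume q: "q \<in> Wf \<inter> Wg"
    then have "f0 q = Dbar_left f q" "g0 q = Dbar_left g q" using h by simp_all
    then show "f0 q * a + g0 q = Dbar_left (\<lambda>q. f q * a + g q) q" unfolding comb(2)[OF q] by simp
  qed
  define U where "U = slice e1 (Wf \<inter> Wg)"
  have sub: "U \<subseteq> slice e1 Wf" "U \<subseteq> slice e1 Wg" unfolding U_def slice_def by auto
  obtain \<alpha> \<beta> \<gamma> \<delta> where "slice_rep (*) (slice e1 Wf) f \<alpha> \<beta>" "slice_rep (*) (slice e1 Wg) g \<gamma> \<delta>"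
    using SH_L_rep(4)[OF f] SH_L_rep(4)[OF g] by (elim exE)
  note r = this(1)[THEN slice_rep_mono, OF sub(1)] this(2)[THEN slice_rep_mono, OF sub(2)]
  have U: "open U" unfolding U_def by (rule open_slice[OF W(1)])
  show ?thesis
    unfolding P2_calc_L_eq[OF real comb(1) hc a e_imag_units(1) o] P2_calc_L_eq[OF real f h(1) af(1) e_imag_units(1) o]
      P2_calc_L_eq[OF real g h(2) af(2) e_imag_units(1) o]
    by (rule P2_integral_L_combination[OF U r admissible_contour[OF a W(2) e_imag_units(1) o, folded U_def] e_imag_units(1)])
qed

end

section \<open>The right calculus, with the imaginary unit acting from the right and constants from
  the left\<close>

lemma SH_R_rep:
  assumes "(f, W) \<in> SH_R S"
  shows "open W" "axially_symmetric W" "S \<subseteq> W" "\<exists>\<alpha> \<beta>. slice_rep (\<lambda>a b. b * a) (slice e1 W) f \<alpha> \<beta>"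
proof -
  show W: "open W" "axially_symmetric W" "S \<subseteq> W" using assms unfolding SH_R_def by simp_all
  have "right_slice_hyperholomorphic f W" using assms unfolding SH_R_def by simp
  then obtain \<alpha> \<beta> where "\<forall>J\<in>imag_units. stem_pair (slice J W) \<alpha> \<beta> \<and> (\<forall>z\<in>slice J W. f (slice_pt J z) = \<alpha> z + \<beta> z * J)"
    unfolding right_slice_hyperholomorphic_def by (elim exE)
  note ab = bspec[OF this]
  have sl: "slice J W = slice e1 W" if "J \<in> imag_units" for J
    by (rule axially_symmetric_slice[OF W(2) that e_imag_units(1)])
  have "slice_rep (\<lambda>a b. b * a) (slice e1 W) f \<alpha> \<beta>"
    unfolding slice_rep_def
  proof (intro conjI ballI)
    show "stem_pair (slice e1 W) \<alpha> \<beta>" using ab[OF e_imag_units(1)] by (rule conjunct1)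
    show "f (slice_pt J z) = \<alpha> z + \<beta> z * J" if "J \<in> imag_units" "z \<in> slice e1 W" for J z
      using ab[OF that(1)] that(2) unfolding sl[OF that(1)] by simp
  qed
  then show "\<exists>\<alpha> \<beta>. slice_rep (\<lambda>a b. b * a) (slice e1 W) f \<alpha> \<beta>" by (intro exI)
qed

lemma SH_R_I:
  assumes W: "open W" "axially_symmetric W" "S \<subseteq> W" and f: "slice_rep (\<lambda>a b. b * a) (slice e1 W) f \<alpha> \<beta>"
  shows "(f, W) \<in> SH_R S"
proof -
  have "stem_pair (slice J W) \<alpha> \<beta> \<and> (\<forall>z\<in>slice J W. f (slice_pt J z) = \<alpha> z + \<beta> z * J)" if J: "J \<in> imag_units" for J
    unfolding axially_symmetric_slice[OF W(2) J e_imag_units(1)] using slice_repD[OF f] J by simp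
  then have "right_slice_hyperholomorphic f W" unfolding right_slice_hyperholomorphic_def by (intro exI ballI)
  then show ?thesis unfolding SH_R_def using W by simp
qed

lemma SH_R_combination:
  assumes f: "(f, Wf) \<in> SH_R S" and g: "(g, Wg) \<in> SH_R S"
  shows "(\<lambda>q. a * f q + g q, Wf \<inter> Wg) \<in> SH_R S"
    "q \<in> Wf \<inter> Wg \<Longrightarrow> Dbar_right (\<lambda>q. a * f q + g q) q = a * Dbar_right f q + Dbar_right g q"
proof -
  note F = SH_R_rep[OF f] and G = SH_R_rep[OF g]
  have W: "open (Wf \<inter> Wg)" "axially_symmetric (Wf \<inter> Wg)" "S \<subseteq> Wf \<inter> Wg"
    using F(1-3) G(1-3) unfolding axially_symmetric_def by auto
  have sub: "slice e1 (Wf \<inter> Wg) \<subseteq> slice e1 Wf" "slice e1 (Wf \<inter> Wg) \<subseteq> slice e1 Wg" unfolding slice_def by auto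
  obtain \<alpha> \<beta> \<gamma> \<delta> where "slice_rep (\<lambda>a b. b * a) (slice e1 Wf) f \<alpha> \<beta>" "slice_rep (\<lambda>a b. b * a) (slice e1 Wg) g \<gamma> \<delta>"
    using F(4) G(4) by (elim exE)
  note r = this(1)[THEN slice_rep_mono, OF sub(1)] this(2)[THEN slice_rep_mono, OF sub(2)]
  have LM: "a * (x * J) = (a * x) * J" for J x :: quat by (simp add: mult.assoc)
  show "(\<lambda>q. a * f q + g q, Wf \<inter> Wg) \<in> SH_R S"
    by (rule SH_R_I[OF W slice_rep_combination[OF r bounded_linear_mult_right LM bounded_bilinear.flip[OF bounded_bilinear_mult]]])
  show "Dbar_right (\<lambda>q. a * f q + g q) q = a * Dbar_right f q + Dbar_right g q" if q: "q \<in> Wf \<inter> Wg"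
  proof -
    obtain J z where J: "J \<in> imag_units" "q = slice_pt J z" by (rule quat_slice_cases)
    have "z \<in> slice J (Wf \<inter> Wg)" using q unfolding J(2) slice_def by simp
    then have z: "z \<in> slice e1 (Wf \<inter> Wg)" unfolding axially_symmetric_slice[OF W(2) J(1) e_imag_units(1)] .
    show ?thesis unfolding Dbar_right_eq J(2)
      by (rule Dbar_combination[OF r bounded_linear_mult_right LM bounded_bilinear.flip[OF bounded_bilinear_mult] open_slice[OF W(1)] cnj_slice[OF W(2) e_imag_units(1)] J(1) z])
  qed
qed

context commuting_triple
begin

lemma P2_integral_R_independent:
  assumes U: "open U" "K \<subseteq> U" "cnj ` U \<subseteq> U" and f: "slice_rep (\<lambda>a b. b * a) U f \<alpha> \<beta>"
    and \<Gamma>: "contour U \<Gamma>" "contour U \<Gamma>'" and J: "J \<in> imag_units"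
  shows "P2_integral_R T f J \<Gamma> = P2_integral_R T f e1 \<Gamma>'"
proof -
  interpret e: slice_triple T0 T1 T2 e1 by unfold_locales simp
  interpret s: slice_triple T0 T1 T2 J by unfold_locales fact
  note stem = slice_repD(1)[OF f]
  have ind: "slice_integral J (stem_comp b \<alpha> \<beta>) h \<Gamma> = slice_integral e1 (stem_comp b \<alpha> \<beta>) h \<Gamma>'" if "slice_kernel h" for b h
    by (rule slice_integral_independent[OF that stem_comp_holomorphic[OF U(1) stem] stem_comp_cnj[OF stem] U \<Gamma> J])
  show ?thesis
    unfolding s.P2_integral_R_formula(2)[OF U(1) f \<Gamma>(1)] e.P2_integral_R_formula(2)[OF U(1) f \<Gamma>(2)]
      ind[OF slice_kernel_h(1)] ind[OF slice_kernel_h(2)] ..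
qed

lemma P2_integral_R_zero:
  assumes real: "real_spectrum T0" "real_spectrum T1" "real_spectrum T2"
    and U: "open U" "K \<subseteq> U" "cnj ` U \<subseteq> U" and f: "slice_rep (\<lambda>a b. b * a) U f \<alpha> \<beta>" and \<Gamma>: "contour U \<Gamma>"
    and zero: "\<And>z. z \<in> U \<Longrightarrow> Dbar (\<lambda>a b. b * a) f (slice_pt e1 z) = 0"
  shows "P2_integral_R T f e1 \<Gamma> = 0"
proof -
  interpret e: slice_triple T0 T1 T2 e1 by unfold_locales simp
  have sq: "(x * J) * J = - x" if "J \<in> imag_units" for J x :: quat
    using imag_unitsD[OF that] by (simp add: mult.assoc)
  have lc1: "(stem_comp b \<alpha> \<beta> has_field_derivative 0) (at z)" if z: "z \<in> U" for b z
    by (rule slice_rep_locally_constant(1)[OF bounded_bilinear.flip[OF bounded_bilinear_mult] sq U(1,3) f zero z])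
  have lc2: "stem_comp b \<alpha> \<beta> (cnj z) = stem_comp b \<alpha> \<beta> z" if z: "z \<in> U" for b z
    by (rule slice_rep_locally_constant(2)[OF bounded_bilinear.flip[OF bounded_bilinear_mult] sq U(1,3) f zero z])
  have z1: "slice_integral e1 (stem_comp b \<alpha> \<beta>) h1 \<Gamma> = 0" for b
    by (rule slice_integral_locally_constant(1)[OF real U(1,2) \<Gamma> lc1 lc2])
  have z2: "slice_integral e1 (stem_comp b \<alpha> \<beta>) h2 \<Gamma> = 0" for b
    by (rule slice_integral_locally_constant(2)[OF real U(1,2) \<Gamma> lc1 lc2])
  show ?thesis unfolding e.P2_integral_R_formula(2)[OF U(1) f \<Gamma>] z1 z2
    by (simp add: oL.zero_left oL.zero_right)
qed

lemma P2_integral_R_combination: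
  assumes U: "open U" and f: "slice_rep (\<lambda>a b. b * a) U f \<alpha> \<beta>" and g: "slice_rep (\<lambda>a b. b * a) U g \<gamma>' \<delta>"
    and \<Gamma>: "contour U \<Gamma>" and J: "J \<in> imag_units"
  shows "P2_integral_R T (\<lambda>q. a * f q + g q) J \<Gamma> = (Lm a o\<^sub>L P2_integral_R T f J \<Gamma>) + P2_integral_R T g J \<Gamma>"
proof -
  interpret s: slice_triple T0 T1 T2 J by unfold_locales fact
  define k where "k f \<gamma> t = Lm (f (slice_pt J (\<gamma> t))) o\<^sub>L Lm (ds_J J \<gamma> t) o\<^sub>L P2_kernel_R (slice_pt J (\<gamma> t)) T" for f :: "quat \<Rightarrow> quat" and \<gamma> t
  have P: "P2_integral_R T f J \<Gamma> = (1 / (2 * pi)) *\<^sub>R (\<Sum>\<gamma>\<in>\<Gamma>. integral {0..1} (k f \<gamma>))" for f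
    unfolding P2_integral_R_def k_def ..
  have "integral {0..1} (k (\<lambda>q. a * f q + g q) \<gamma>) = (Lm a o\<^sub>L integral {0..1} (k f \<gamma>)) + integral {0..1} (k g \<gamma>)" if \<gamma>: "\<gamma> \<in> \<Gamma>" for \<gamma>
  proof -
    have i: "k f \<gamma> integrable_on {0..1}" "k g \<gamma> integrable_on {0..1}"
      unfolding k_def by (rule s.P2_integral_R_formula(1)[OF U f \<Gamma> \<gamma>], rule s.P2_integral_R_formula(1)[OF U g \<Gamma> \<gamma>])
    have "k (\<lambda>q. a * f q + g q) \<gamma> = (\<lambda>t. (Lm a o\<^sub>L k f \<gamma> t) + k g \<gamma> t)"
      unfolding k_def Lm_add Lm_mult oL.add_left oL.add_right oL_assoc ..
    then show ?thesis
      using has_integral_add[OF has_integral_linear[OF integrable_integral[OF i(1)] oL.bounded_linear_right, unfolded o_def] integrable_integral[OF i(2)], of "Lm a"]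
      by (simp add: integral_unique)
  qed
  then have "(\<Sum>\<gamma>\<in>\<Gamma>. integral {0..1} (k (\<lambda>q. a * f q + g q) \<gamma>)) = (\<Sum>\<gamma>\<in>\<Gamma>. (Lm a o\<^sub>L integral {0..1} (k f \<gamma>)) + integral {0..1} (k g \<gamma>))"
    by (rule sum.cong[OF refl])
  then show ?thesis unfolding P by (simp only: sum.distrib oL.sum_right oL.scaleR_left oL.scaleR_right scaleR_add_right)
qed

lemma P2_calc_R_eq:
  assumes real: "real_spectrum T0" "real_spectrum T1" "real_spectrum T2"
    and f: "(f, W) \<in> SH_R (S_spectrum T)" and h: "\<forall>q\<in>W. h q = Dbar_right f q"
    and a: "admissible T W Ud" and J: "J \<in> imag_units" and o: "oriented_boundary (slice J Ud) \<Gamma>"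
  shows "P2_calc_R T W h = P2_integral_R T f J \<Gamma>"
  unfolding P2_calc_R_def
proof (rule the_equality)
  show "\<exists>f' U J' \<Gamma>'. (f', W) \<in> SH_R (S_spectrum T) \<and> (\<forall>q\<in>W. h q = Dbar_right f' q) \<and>
     admissible T W U \<and> J' \<in> imag_units \<and> oriented_boundary (slice J' U) \<Gamma>' \<and> P2_integral_R T f J \<Gamma> = P2_integral_R T f' J' \<Gamma>'"
    by (intro exI conjI, rule f, rule h, rule a, rule J, rule o, rule refl)
next
  fix A assume "\<exists>f' U J' \<Gamma>'. (f', W) \<in> SH_R (S_spectrum T) \<and> (\<forall>q\<in>W. h q = Dbar_right f' q) \<and>
     admissible T W U \<and> J' \<in> imag_units \<and> oriented_boundary (slice J' U) \<Gamma>' \<and> A = P2_integral_R T f' J' \<Gamma>'"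
  then obtain f' U' J' \<Gamma>' where f': "(f', W) \<in> SH_R (S_spectrum T)" and h': "\<forall>q\<in>W. h q = Dbar_right f' q"
    and a': "admissible T W U'" and J': "J' \<in> imag_units" and o': "oriented_boundary (slice J' U') \<Gamma>'"
    and A: "A = P2_integral_R T f' J' \<Gamma>'" by (elim exE conjE)
  note W = SH_R_rep(1-3)[OF f]
  define U where "U = slice e1 W"
  have U: "open U" "K \<subseteq> U" "cnj ` U \<subseteq> U"
    unfolding U_def by (rule open_slice[OF W(1)], rule K_subset_slice[OF W(3)], rule cnj_slice[OF W(2) e_imag_units(1)])
  note c = admissible_contour[OF a W(2) J o, folded U_def] and c' = admissible_contour[OF a' W(2) J' o', folded U_def]
  obtain \<alpha> \<beta> \<gamma> \<delta> where r: "slice_rep (\<lambda>a b. b * a) U f \<alpha> \<beta>" and r': "slice_rep (\<lambda>a b. b * a) U f' \<gamma> \<delta>"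
    using SH_R_rep(4)[OF f] SH_R_rep(4)[OF f'] unfolding U_def by (elim exE)
  let ?d = "\<lambda>q. - 1 * f q + f' q"
  note comb = SH_R_combination[OF f f', where a = "- 1", unfolded Int_absorb]
  obtain \<epsilon> \<zeta> where rd: "slice_rep (\<lambda>a b. b * a) U ?d \<epsilon> \<zeta>"
    using SH_R_rep(4)[OF comb(1)] unfolding U_def by (elim exE)
  have "Dbar (\<lambda>a b. b * a) ?d (slice_pt e1 z) = 0" if "z \<in> U" for z
  proof -
    have q: "slice_pt e1 z \<in> W" using that unfolding U_def slice_def by simp
    have "Dbar_right f (slice_pt e1 z) = h (slice_pt e1 z)" "Dbar_right f' (slice_pt e1 z) = h (slice_pt e1 z)"
      using h h' q by simp_all
    then show ?thesis using comb(2)[OF q] unfolding Dbar_right_eq by simp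
  qed
  note zero = this
  have "P2_integral_R T ?d e1 \<Gamma> = 0" by (rule P2_integral_R_zero[OF real U rd c zero])
  then have e: "P2_integral_R T f' e1 \<Gamma> = P2_integral_R T f e1 \<Gamma>"
    unfolding P2_integral_R_combination[OF U(1) r r' c e_imag_units(1)] by (simp add: Lm_minus oL.minus_left oL.minus_right Lm_one)
  show "A = P2_integral_R T f J \<Gamma>"
    unfolding A P2_integral_R_independent[OF U r' c' c J'] P2_integral_R_independent[OF U r c c J] by (rule e)
qed

lemma P2_calc_R_combination:
  assumes real: "real_spectrum T0" "real_spectrum T1" "real_spectrum T2"
    and f: "(f, Wf) \<in> SH_R (S_spectrum T)" and g: "(g, Wg) \<in> SH_R (S_spectrum T)"
    and h: "\<forall>q\<in>Wf. f0 q = Dbar_right f q" "\<forall>q\<in>Wg. g0 q = Dbar_right g q"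
  shows "P2_calc_R T (Wf \<inter> Wg) (\<lambda>q. a * f0 q + g0 q) = (Lm a o\<^sub>L P2_calc_R T Wf f0) + P2_calc_R T Wg g0"
proof -
  note comb = SH_R_combination[OF f g, where a = a]
  note W = SH_R_rep(1-3)[OF comb(1)]
  obtain Ud \<Gamma> where a: "admissible T (Wf \<inter> Wg) Ud" and o: "oriented_boundary (slice e1 Ud) \<Gamma>"
    using exists_admissible[OF W] by (elim exE conjE)
  have af: "admissible T Wf Ud" "admissible T Wg Ud" using a unfolding admissible_def by simp_all
  have hc: "\<forall>q\<in>Wf \<inter> Wg. a * f0 q + g0 q = Dbar_right (\<lambda>q. a * f q + g q) q"
  proof
    fix q assume q: "q \<in> Wf \<inter> Wg"
    then have "f0 q = Dbar_right f q" "g0 q = Dbar_right g q" using h by simp_all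
    then show "a * f0 q + g0 q = Dbar_right (\<lambda>q. a * f q + g q) q" unfolding comb(2)[OF q] by simp
  qed
  define U where "U = slice e1 (Wf \<inter> Wg)"
  have sub: "U \<subseteq> slice e1 Wf" "U \<subseteq> slice e1 Wg" unfolding U_def slice_def by auto
  obtain \<alpha> \<beta> \<gamma> \<delta> where "slice_rep (\<lambda>a b. b * a) (slice e1 Wf) f \<alpha> \<beta>" "slice_rep (\<lambda>a b. b * a) (slice e1 Wg) g \<gamma> \<delta>"
    using SH_R_rep(4)[OF f] SH_R_rep(4)[OF g] by (elim exE)
  note r = this(1)[THEN slice_rep_mono, OF sub(1)] this(2)[THEN slice_rep_mono, OF sub(2)]
  have U: "open U" unfolding U_def by (rule open_slice[OF W(1)])
  show ?thesis
    unfolding P2_calc_R_eq[OF real comb(1) hc a e_imag_units(1) o] P2_calc_R_eq[OF real f h(1) af(1) e_imag_units(1) o]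
      P2_calc_R_eq[OF real g h(2) af(2) e_imag_units(1) o]
    by (rule P2_integral_R_combination[OF U r admissible_contour[OF a W(2) e_imag_units(1) o, folded U_def] e_imag_units(1)])
qed

end

theorem proposition3p17:
  fixes T :: "'a::banach qmod \<Rightarrow>\<^sub>L 'a qmod"
    and T0 T1 T2 :: "'a \<Rightarrow>\<^sub>L 'a"
  assumes "T \<in> BC"
    and "T = quat_op T0 T1 T2 0"
    and "real_spectrum T0" "real_spectrum T1" "real_spectrum T2"
  shows "(\<forall>f g f\<^sub>0 g\<^sub>0 W\<^sub>f W\<^sub>g a.
            (f, W\<^sub>f) \<in> SH_L (S_spectrum T) \<longrightarrow> (g, W\<^sub>g) \<in> SH_L (S_spectrum T) \<longrightarrow>
            (\<forall>q\<in>W\<^sub>f. f\<^sub>0 q = Dbar_left f q) \<longrightarrow> (\<forall>q\<in>W\<^sub>g. g\<^sub>0 q = Dbar_left g q) \<longrightarrow>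
            P2_calc_L T (W\<^sub>f \<inter> W\<^sub>g) (\<lambda>q. f\<^sub>0 q * a + g\<^sub>0 q) =
              (P2_calc_L T W\<^sub>f f\<^sub>0 o\<^sub>L Lm a) + P2_calc_L T W\<^sub>g g\<^sub>0)
       \<and> (\<forall>f g f\<^sub>0 g\<^sub>0 W\<^sub>f W\<^sub>g a.
            (f, W\<^sub>f) \<in> SH_R (S_spectrum T) \<longrightarrow> (g, W\<^sub>g) \<in> SH_R (S_spectrum T) \<longrightarrow>
            (\<forall>q\<in>W\<^sub>f. f\<^sub>0 q = Dbar_right f q) \<longrightarrow> (\<forall>q\<in>W\<^sub>g. g\<^sub>0 q = Dbar_right g q) \<longrightarrow>
            P2_calc_R T (W\<^sub>f \<inter> W\<^sub>g) (\<lambda>q. a * f\<^sub>0 q + g\<^sub>0 q) =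
              (Lm a o\<^sub>L P2_calc_R T W\<^sub>f f\<^sub>0) + P2_calc_R T W\<^sub>g g\<^sub>0)"
proof -
  obtain A0 A1 A2 A3 where A: "T = quat_op A0 A1 A2 A3" "commute_op A0 A1" "commute_op A0 A2" "commute_op A1 A2"
    using assms(1) unfolding BC_def by blast
  \<comment> \<open>Components of an operator are unique, so the commuting components supplied by
    \<open>BC\<close> are the given ones.\<close>
  have "A0 = T0" "A1 = T1" "A2 = T2"
    using comp_quat_op[of A0 A1 A2 A3] comp_quat_op[of T0 T1 T2 0] unfolding A(1)[symmetric] assms(2)[symmetric] by simp_all
  with A have "T0 o\<^sub>L T1 = T1 o\<^sub>L T0" "T0 o\<^sub>L T2 = T2 o\<^sub>L T0" "T1 o\<^sub>L T2 = T2 o\<^sub>L T1" unfolding commute_op_def by simp_all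
  then interpret c: commuting_triple T0 T1 T2 by unfold_locales
  have T: "T = c.T" unfolding c.T_def by (rule assms(2))
  show ?thesis
    unfolding T
  proof (intro conjI allI impI)
    show "P2_calc_L c.T (Wf \<inter> Wg) (\<lambda>q. f0 q * a + g0 q) = (P2_calc_L c.T Wf f0 o\<^sub>L Lm a) + P2_calc_L c.T Wg g0"
      if "(f, Wf) \<in> SH_L (S_spectrum c.T)" "(g, Wg) \<in> SH_L (S_spectrum c.T)"
        "\<forall>q\<in>Wf. f0 q = Dbar_left f q" "\<forall>q\<in>Wg. g0 q = Dbar_left g q" for f g f0 g0 Wf Wg a
      by (rule c.P2_calc_L_combination[OF assms(3-5) that])
    show "P2_calc_R c.T (Wf \<inter> Wg) (\<lambda>q. a * f0 q + g0 q) = (Lm a o\<^sub>L P2_calc_R c.T Wf f0) + P2_calc_R c.T Wg g0"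
      if "(f, Wf) \<in> SH_R (S_spectrum c.T)" "(g, Wg) \<in> SH_R (S_spectrum c.T)"
        "\<forall>q\<in>Wf. f0 q = Dbar_right f q" "\<forall>q\<in>Wg. g0 q = Dbar_right g q" for f g f0 g0 Wf Wg a
      by (rule c.P2_calc_R_combination[OF assms(3-5) that])
  qed
qed

end
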